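(* Let $n\ge 1$, $s\in(0,1)$, $\mathbf v\in \mathbf H^s(\mathbb R^n)$ and $u\in H^s(\mathbb R^n)$. Take the uniform measure $M(d\boldsymbol\theta)=d\boldsymbol\theta$ on the unit sphere in the definition of the directional operators $\operatorname{Grad}^s$, $\operatorname{Div}^s$. Then the directional and Cartesian definitions of the fractional gradient and divergence agree up to a constant: $$\operatorname{Grad}^s u(\mathbf x)=G_s\,\operatorname{grad}^s u(\mathbf x),\qquad \operatorname{Div}^s\mathbf v(\mathbf x)=G_s\,\operatorname{div}^s\mathbf v(\mathbf x),$$ where $G_s=\dfrac{s}{\Gamma(1-s)}$.
   Context: $H^s(\mathbb R^n)$ is the usual Sobolev space; $\mathbf v\in\mathbf H^s(\mathbb R^n)$ means each component of $\mathbf v:\mathbb R^n\to\mathbb R^n$ is in $H^s(\mathbb R^n)$. Singular integrals are understood in the principal value sense; identities between functions hold almost everywhere. Directional operators: for a unit vector $\boldsymbol\theta$, the directional derivative $D^s_{\boldsymbol\theta}u(\mathbf x)$ is the one-dimensional positive Riemann–Liouville derivative of $w(t)=u(\mathbf x+t\boldsymbol\theta)$ evaluated at $t=0$, where $$\frac{d^sw}{dt^s}=\frac1{\Gamma(1-s)}\frac{d}{dt}\int_0^\infty w(t-t')(t')^{-s}\,dt'.$$ It has Fourier transform $(i\boldsymbol\xi\cdot\boldsymbol\theta)^s\hat u(\boldsymbol\xi)$ in $\mathbf x$, with $(iy)^s=|y|^se^{i\,\mathrm{sgn}(y)\pi s/2}$. $D^s_{\boldsymbol\theta}$ acts on vector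 fields componentwise. Then, with $M(d\boldsymbol\theta)=d\boldsymbol\theta$ surface measure, $$\operatorname{Grad}^su(\mathbf x)=\int_{|\boldsymbol\theta|=1}\boldsymbol\theta\,D^s_{\boldsymbol\theta}u(\mathbf x)\,d\boldsymbol\theta,\qquad \operatorname{Div}^s\mathbf v(\mathbf x)=\int_{|\boldsymbol\theta|=1}\boldsymbol\theta\cdot D^s_{\boldsymbol\theta}\mathbf v(\mathbf x)\,d\boldsymbol\theta .$$ Cartesian operators: $$\operatorname{grad}^su(\mathbf x)=\int_{\mathbb R^n}[u(\mathbf x)-u(\mathbf y)]\frac{\mathbf x-\mathbf y}{|\mathbf x-\mathbf y|}\frac{d\mathbf y}{|\mathbf x-\mathbf y|^{n+s}},\qquad \operatorname{div}^s\mathbf v(\mathbf x)=\int_{\mathbb R^n}[\mathbf v(\mathbf x)-\mathbf v(\mathbf y)]\cdot\frac{\mathbf x-\mathbf y}{|\mathbf x-\mathbf y|}\frac{d\mathbf y}{|\mathbf x-\mathbf y|^{n+s}}.$$ *)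

theory Defs
  imports "HOL-Analysis.Analysis"
begin

text \<open>Square-integrable functions and the Sobolev space \<open>H^s\<close>, \<open>0 < s < 1\<close>, with the
  Gagliardo--Slobodeckij norm (squared, and possibly infinite).\<close>

definition L2_norm_sq :: "(real^'n \<Rightarrow> real) \<Rightarrow> ennreal" where
  "L2_norm_sq u = (\<integral>\<^sup>+ x. ennreal ((u x)\<^sup>2) \<partial>lebesgue)"

definition L2_functions :: "(real^'n \<Rightarrow> real) set" where
  "L2_functions = {u \<in> borel_measurable lebesgue. L2_norm_sq u < \<infinity>}"

definition gagliardo_sq :: "real \<Rightarrow> (real^'n \<Rightarrow> real) \<Rightarrow> ennreal" where
  "gagliardo_sq s u =
     (\<integral>\<^sup>+ x. (\<integral>\<^sup>+ y. ennreal ((u x - u y)\<^sup>2 / norm (x - y) powr (real CARD('n) + 2 * s))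
        \<partial>lebesgue) \<partial>lebesgue)"

definition Sobolev_norm_sq :: "real \<Rightarrow> (real^'n \<Rightarrow> real) \<Rightarrow> ennreal" where
  "Sobolev_norm_sq s u = L2_norm_sq u + gagliardo_sq s u"

definition Sobolev :: "real \<Rightarrow> (real^'n \<Rightarrow> real) set" where
  "Sobolev s = {u \<in> borel_measurable lebesgue. Sobolev_norm_sq s u < \<infinity>}"

definition Sobolev_vec :: "real \<Rightarrow> (real^'n \<Rightarrow> real^'n) set" where
  "Sobolev_vec s = {v. \<forall>i. (\<lambda>x. v x $ i) \<in> Sobolev s}"

primrec continuously_differentiable :: "nat \<Rightarrow> (real^'n \<Rightarrow> real) \<Rightarrow> bool" where
  "continuously_differentiable 0 f \<longleftrightarrow> continuous_on UNIV f"
| "continuously_differentiable (Suc k) f \<longleftrightarrow>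
     (\<forall>x. f differentiable (at x)) \<and>
     (\<forall>i. continuously_differentiable k (\<lambda>x. frechet_derivative f (at x) (axis i 1)))"

definition test_functions :: "(real^'n \<Rightarrow> real) set" where
  "test_functions =
     {f. (\<forall>k. continuously_differentiable k f) \<and> compact (closure {x. f x \<noteq> 0})}"

definition RL_deriv :: "real \<Rightarrow> (real \<Rightarrow> real) \<Rightarrow> real \<Rightarrow> real" where
  "RL_deriv s w t =
     1 / Gamma (1 - s) *
     deriv (\<lambda>t. LINT t':{0<..}|lebesgue. w (t - t') * t' powr (- s)) t"

definition RL_dir_deriv :: "real \<Rightarrow> real^'n \<Rightarrow> (real^'n \<Rightarrow> real) \<Rightarrow> real^'n \<Rightarrow> real" where
  "RL_dir_deriv s \<theta> u x = RL_deriv s (\<lambda>t. u (x + t *\<^sub>R \<theta>)) 0"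

text \<open>For \<open>u \<in> H^s\<close> the Riemann--Liouville integral of \<open>t \<mapsto> u (x + t \<theta>)\<close> need not converge
  at infinity: for \<open>n = 1\<close> and \<open>s \<le> 1/2\<close>, a smooth function equal to
  \<open>|t| powr (-1/2) / ln |t|\<close> for large \<open>|t|\<close> is a counterexample.  On \<open>H^s\<close> the operator
  is therefore the continuous extension \<open>H^s \<rightarrow> L^2\<close> of the Riemann--Liouville formula on
  \<open>C_c^\<infinity>\<close>; it is the operator with Fourier symbol \<open>(i \<xi> \<bullet> \<theta>)^s\<close>.  Its values are
  determined up to null sets only, hence a relation.\<close>

definition is_dir_deriv ::
    "real \<Rightarrow> real^'n \<Rightarrow> (real^'n \<Rightarrow> real) \<Rightarrow> (real^'n \<Rightarrow> real) \<Rightarrow> bool" where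
  "is_dir_deriv s \<theta> u g \<longleftrightarrow>
     g \<in> L2_functions \<and>
     (\<exists>\<phi>. (\<forall>k. \<phi> k \<in> test_functions) \<and>
          (\<lambda>k::nat. Sobolev_norm_sq s (\<lambda>x. \<phi> k x - u x)) \<longlonglongrightarrow> 0 \<and>
          (\<lambda>k. L2_norm_sq (\<lambda>x. RL_dir_deriv s \<theta> (\<phi> k) x - g x)) \<longlonglongrightarrow> 0)"

text \<open>Surface measure on the unit sphere, via polar coordinates: \<open>n\<close> times the volume of the cone
  in the unit ball over a Borel set.  For \<open>n = 1\<close> it is the counting measure on \<open>{-1, 1}\<close>.\<close>

definition surface_measure :: "(real^'n) measure" where
  "surface_measure =
     scale_measure (of_nat CARD('n))
       (distr (restrict_space lborel (ball 0 1 - {0})) (restrict_space borel (sphere 0 1))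
          (\<lambda>x. x /\<^sub>R norm x))"

lemma emeasure_surface_measure:
  fixes A :: "(real^'n) set"
  assumes "A \<in> sets borel" "A \<subseteq> sphere 0 1"
  shows "emeasure surface_measure A =
    of_nat CARD('n) * emeasure lborel {x \<in> ball 0 1. x \<noteq> 0 \<and> x /\<^sub>R norm x \<in> A}"
proof -
  let ?N = "restrict_space lborel (ball 0 1 - {0}) :: (real^'n) measure"
  have A: "A \<in> sets (restrict_space borel (sphere 0 1))"
    using assms by (auto simp: sets_restrict_space_iff)
  have m: "(\<lambda>x. x /\<^sub>R norm x) \<in> measurable ?N (restrict_space borel (sphere 0 1))"
    by (rule measurable_restrict_space2) (auto simp: space_restrict_space intro!: measurable_restrict_space1)
  have "(\<lambda>x. x /\<^sub>R norm x) -` A \<inter> space ?N = {x \<in> ball 0 1. x \<noteq> 0 \<and> x /\<^sub>R norm x \<in> A}"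
    by (auto simp: space_restrict_space)
  then have "emeasure surface_measure A =
      of_nat CARD('n) * emeasure ?N {x \<in> ball 0 1. x \<noteq> 0 \<and> x /\<^sub>R norm x \<in> A}"
    using A m by (simp only: surface_measure_def emeasure_scale_measure emeasure_distr)
  also have "emeasure ?N {x \<in> ball 0 1. x \<noteq> 0 \<and> x /\<^sub>R norm x \<in> A} =
      emeasure lborel {x \<in> ball 0 1. x \<noteq> 0 \<and> x /\<^sub>R norm x \<in> A}"
    by (rule emeasure_restrict_space) auto
  finally show ?thesis .
qed

text \<open>\<open>\<theta> \<mapsto> D \<theta>\<close> is a jointly measurable choice of representatives of the directional
  derivatives, so that the integral over the sphere makes sense for almost every \<open>x\<close>.\<close>

definition is_Grad :: "real \<Rightarrow> (real^'n \<Rightarrow> real) \<Rightarrow> (real^'n \<Rightarrow> real^'n) \<Rightarrow> bool" where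
  "is_Grad s u G \<longleftrightarrow>
     (\<exists>D. (\<lambda>(\<theta>, x). D \<theta> x) \<in> borel_measurable (surface_measure \<Otimes>\<^sub>M lebesgue) \<and>
          (\<forall>\<theta> \<in> sphere 0 1. is_dir_deriv s \<theta> u (D \<theta>)) \<and>
          (AE x in lebesgue.
             has_bochner_integral surface_measure (\<lambda>\<theta>. D \<theta> x *\<^sub>R \<theta>) (G x)))"

definition is_Div :: "real \<Rightarrow> (real^'n \<Rightarrow> real^'n) \<Rightarrow> (real^'n \<Rightarrow> real) \<Rightarrow> bool" where
  "is_Div s v d \<longleftrightarrow>
     (\<exists>D :: real^'n \<Rightarrow> real^'n \<Rightarrow> real^'n.
          (\<lambda>(\<theta>, x). D \<theta> x) \<in> borel_measurable (surface_measure \<Otimes>\<^sub>M lebesgue) \<and>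
          (\<forall>\<theta> \<in> sphere 0 1. \<forall>i. is_dir_deriv s \<theta> (\<lambda>x. v x $ i) (\<lambda>x. D \<theta> x $ i)) \<and>
          (AE x in lebesgue.
             has_bochner_integral surface_measure (\<lambda>\<theta>. \<theta> \<bullet> D \<theta> x) (d x)))"

text \<open>Principal value of the integral of \<open>f\<close> over the whole space, with singularity at \<open>x\<close>.\<close>

definition has_pv_integral ::
    "(real^'n \<Rightarrow> 'b::{banach, second_countable_topology}) \<Rightarrow> real^'n \<Rightarrow> 'b \<Rightarrow> bool" where
  "has_pv_integral f x I \<longleftrightarrow>
     (\<forall>\<epsilon>>0. set_integrable lebesgue (- ball x \<epsilon>) f) \<and>
     ((\<lambda>\<epsilon>. LINT y:- ball x \<epsilon>|lebesgue. f y) \<longlongrightarrow> I) (at_right 0)"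

definition is_grad :: "real \<Rightarrow> (real^'n \<Rightarrow> real) \<Rightarrow> (real^'n \<Rightarrow> real^'n) \<Rightarrow> bool" where
  "is_grad s u g \<longleftrightarrow>
     (AE x in lebesgue.
        has_pv_integral
          (\<lambda>y. ((u x - u y) / norm (x - y) powr (real CARD('n) + s)) *\<^sub>R
               ((x - y) /\<^sub>R norm (x - y))) x (g x))"

definition is_div :: "real \<Rightarrow> (real^'n \<Rightarrow> real^'n) \<Rightarrow> (real^'n \<Rightarrow> real) \<Rightarrow> bool" where
  "is_div s v d \<longleftrightarrow>
     (AE x in lebesgue.
        has_pv_integral
          (\<lambda>y. ((v x - v y) \<bullet> ((x - y) /\<^sub>R norm (x - y))) /
               norm (x - y) powr (real CARD('n) + s)) x (d x))"

end

theory Submission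
  imports Defs
begin

text \<open>
  No Fourier transform is needed.  Put \<open>A(h) = \<integral> (u x - u (x - h))\<^sup>2 dx\<close>.  Since
  \<open>A(h + k) \<le> 2 A(h) + 2 A(k)\<close>, the Gagliardo seminorm bounds \<open>\<integral>\<^sub>0\<^sup>\<infinity> A(t \<theta>) t\<^bsup>-1-2s\<^esup> dt\<close> for every
  single direction \<open>\<theta>\<close>, uniformly.  The identity
  \<open>(\<integral> a d\<mu>)\<^sup>2 + 1/2 \<integral>\<integral> (a t - a t')\<^sup>2 d\<mu> d\<mu> = \<mu>(UNIV) \<integral> a\<^sup>2 d\<mu>\<close> for \<open>\<mu> = t\<^bsup>-1-s\<^esup> dt\<close> on \<open>[\<epsilon>, \<infinity>)\<close> turns this
  into an \<open>L\<^sup>2\<close> bound for the Marchaud derivative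
  \<open>\<integral>\<^sub>0\<^sup>\<infinity> (u x - u (x - t \<theta>)) t\<^bsup>-1-s\<^esup> dt\<close>, which on test functions is \<open>\<Gamma>(1 - s) / s\<close> times the
  Riemann--Liouville derivative (integrate by parts).  Hence the directional derivatives extend to
  \<open>H\<^sup>s\<close> with bounds uniform in \<open>\<theta>\<close>.

  For a test function the Cartesian gradient is the spherical average of the Marchaud derivatives, by
  polar coordinates, and by density it remains to prove that the principal value defining
  \<open>grad\<^sup>s u\<close> exists almost everywhere and equals the \<open>L\<^sup>2\<close> limit \<open>V\<close>.  The integral truncated at radius \<open>r\<close>
  differs from the mollification \<open>\<rho>\<^sub>r * V\<close> by at most a multiple of
  \<open>\<integral> |u x - u (x - y)| min (r\<^bsup>-n-s\<^esup>) (r |y|\<^bsup>-n-s-1\<^esup>) dy\<close>, which tends to \<open>0\<close> wherever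
  \<open>\<integral> (u x - u (x - y))\<^sup>2 |y|\<^bsup>-n-2s\<^esup> dy\<close> is finite; and \<open>\<rho>\<^sub>r * V\<close> converges to \<open>V\<close> almost everywhere
  by the weak maximal inequality.  The divergence is the trace of the gradients of the components.
\<close>

text \<open>Two obstacles shape the argument. A directional derivative of \<open>u\<close> is known
  only up to a null set depending on the direction, while the spherical average uses all directions
  at one point. Hence one fast approximating sequence serves all directions, the representative is
  its pointwise limit, jointly measurable in direction and point, and Tonelli exchanges "almost
  every point for each direction" with "almost every direction for almost every point". Secondly,
  L^2 convergence of the gradients of the approximants does not by itself give the principal value
  of \<open>u\<close> at a point: two limits, in the radius and in the approximation, would have to
  be exchanged. At a fixed radius, however, all kernels are bounded and integrable, so the
  approximation is removed there first. Oddness of the kernel makes the comparison possible: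
  constants integrate to zero outside any ball, so all increments can be centred at the same point.
  In the final constant, 1 / \<Gamma>(1 - s) stands in the Riemann--Liouville formula,
  \<open>s\<close> comes from differentiating t^(-s), and polar coordinates contribute
  nothing.\<close>

lemma nn_integral_powr_tail:
  fixes a c :: real
  assumes "0 < a" "0 < c"
  shows "(\<integral>\<^sup>+t. ennreal (t powr (- 1 - a)) * indicator {c..} t \<partial>lborel) = ennreal (c powr (- a) / a)"
proof -
  have "(\<integral>\<^sup>+t. ennreal (t powr (- 1 - a)) * indicator {c..} t \<partial>lborel)
      = 0 - (- (c powr (- a) / a))"
  proof (rule nn_integral_FTC_atLeast[where F = "\<lambda>t. - (t powr (- a) / a)"])
    show "(\<lambda>t. t powr (- 1 - a)) \<in> borel_measurable borel" by measurable
    fix x :: real assume "c \<le> x"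
    then have "0 < x" using assms by auto
    then show "((\<lambda>t. - (t powr (- a) / a)) has_real_derivative x powr (- 1 - a)) (at x)"
      using assms by (auto intro!: derivative_eq_intros simp: powr_diff powr_minus field_simps)
    show "0 \<le> x powr (- 1 - a)" by simp
  next
    have "((\<lambda>t. t powr (- a)) \<longlongrightarrow> 0) at_top"
      using assms by (intro tendsto_neg_powr filterlim_ident) auto
    then have "((\<lambda>t. - (t powr (- a) / a)) \<longlongrightarrow> - (0 / a)) at_top"
      using assms by (intro tendsto_intros) auto
    then show "((\<lambda>t. - (t powr (- a) / a)) \<longlongrightarrow> 0) at_top" by simp
  qed
  then show ?thesis by simp
qed

lemma nn_integral_powr_head:
  fixes b c :: real
  assumes "- 1 < b" "0 \<le> c"
  shows "(\<integral>\<^sup>+t. ennreal (t powr b) * indicator {0..c} t \<partial>lborel) = ennreal (c powr (b + 1) / (b + 1))"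
  by (rule nn_integral_has_integral_lebesgue') (use has_integral_powr_from_0[of b c] assms in auto)

section \<open>Translations, reflections and dilations of Lebesgue measure\<close>

lemma nn_integral_shift:
  fixes f :: "'a::euclidean_space \<Rightarrow> ennreal"
  assumes [measurable]: "f \<in> borel_measurable borel"
  shows "(\<integral>\<^sup>+x. f (a + x) \<partial>lborel) = (\<integral>\<^sup>+x. f x \<partial>lborel)"
    and "(\<integral>\<^sup>+x. f (x + a) \<partial>lborel) = (\<integral>\<^sup>+x. f x \<partial>lborel)"
    and "(\<integral>\<^sup>+x. f (x - a) \<partial>lborel) = (\<integral>\<^sup>+x. f x \<partial>lborel)"
proof -
  have *: "(\<integral>\<^sup>+x. f (a + x) \<partial>lborel) = (\<integral>\<^sup>+x. f x \<partial>lborel)" for a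
    using nn_integral_distr[of "(+) a" lborel borel f] by (simp add: lborel_distr_plus)
  show "(\<integral>\<^sup>+x. f (a + x) \<partial>lborel) = (\<integral>\<^sup>+x. f x \<partial>lborel)"
    and "(\<integral>\<^sup>+x. f (x + a) \<partial>lborel) = (\<integral>\<^sup>+x. f x \<partial>lborel)"
    and "(\<integral>\<^sup>+x. f (x - a) \<partial>lborel) = (\<integral>\<^sup>+x. f x \<partial>lborel)"
    using *[of a] *[of "- a"] by (simp_all add: add.commute)
qed

lemma nn_integral_reflect:
  fixes f :: "'a::euclidean_space \<Rightarrow> ennreal"
  assumes [measurable]: "f \<in> borel_measurable borel"
  shows "(\<integral>\<^sup>+x. f (a - x) \<partial>lborel) = (\<integral>\<^sup>+x. f x \<partial>lborel)"
  by (subst (2) lborel_affine[of "-1" a]) (simp_all add: nn_integral_density nn_integral_distr)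

lemma nn_integral_scale:
  fixes f :: "'a::euclidean_space \<Rightarrow> ennreal"
  assumes [measurable]: "f \<in> borel_measurable borel" and "0 < c"
  shows "(\<integral>\<^sup>+x. f x \<partial>lborel) = ennreal (c ^ DIM('a)) * (\<integral>\<^sup>+x. f (c *\<^sub>R x) \<partial>lborel)"
  using assms(2)
  by (subst lborel_affine[of c 0]) (simp_all add: nn_integral_density nn_integral_distr nn_integral_cmult)

lemma integral_shift:
  fixes f :: "'a::euclidean_space \<Rightarrow> 'b::{banach, second_countable_topology}"
  assumes [measurable]: "f \<in> borel_measurable borel"
  shows "(LINT x|lborel. f (a + x)) = (LINT x|lborel. f x)"
    and "(LINT x|lborel. f (x - a)) = (LINT x|lborel. f x)"
    and "(LINT x|lborel. f (a - x)) = (LINT x|lborel. f x)"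
proof -
  have *: "(LINT x|lborel. f (a + x)) = (LINT x|lborel. f x)" for a
    using integral_distr[of "(+) a" lborel borel f] by (simp add: lborel_distr_plus)
  show "(LINT x|lborel. f (a + x)) = (LINT x|lborel. f x)"
    and "(LINT x|lborel. f (x - a)) = (LINT x|lborel. f x)"
    using *[of a] *[of "- a"] by (simp_all add: add.commute)
  have "integral\<^sup>L (density (distr lborel borel ((-) a)) (\<lambda>x. ennreal 1)) f = (LINT x|lborel. f (a - x))"
    by (subst integral_density) (simp_all add: integral_distr)
  then show "(LINT x|lborel. f (a - x)) = (LINT x|lborel. f x)"
    by (subst (2) lborel_affine[of "-1" a]) simp_all
qed

subsection \<open>Polar coordinates\<close>

lemma space_surface_measure [simp]: "space surface_measure = (sphere 0 1 :: (real^'n) set)"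
  by (simp add: surface_measure_def space_scale_measure space_restrict_space)

lemma sets_surface_measure [measurable_cong]:
  "sets surface_measure = sets (restrict_space borel (sphere 0 1 :: (real^'n) set))"
  by (simp add: surface_measure_def)

lemma nn_integral_scale_measure':
  assumes [measurable]: "f \<in> borel_measurable M"
  shows "(\<integral>\<^sup>+x. f x \<partial>scale_measure r M) = r * (\<integral>\<^sup>+x. f x \<partial>M)"
  by (rule nn_integral_scale_measure) fact

lemma nn_integral_surface_measure:
  fixes f :: "real^'n \<Rightarrow> ennreal"
  assumes f[measurable]: "f \<in> borel_measurable borel"
  shows "(\<integral>\<^sup>+\<theta>. f \<theta> \<partial>surface_measure) =
    of_nat CARD('n) * (\<integral>\<^sup>+x. f (x /\<^sub>R norm x) * indicator (ball 0 1 - {0}) x \<partial>lborel)"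
proof -
  have m: "(\<lambda>x. x /\<^sub>R norm x) \<in> measurable (restrict_space lborel (ball 0 1 - {0}))
       (restrict_space borel (sphere 0 1 :: (real^'n) set))"
    by (rule measurable_restrict_space2) (auto simp: space_restrict_space intro!: measurable_restrict_space1)
  have f': "f \<in> borel_measurable (restrict_space borel (sphere 0 1))"
    by (intro measurable_restrict_space1) fact
  have "(\<integral>\<^sup>+\<theta>. f \<theta> \<partial>surface_measure) = of_nat CARD('n) *
     (\<integral>\<^sup>+x. f (x /\<^sub>R norm x) \<partial>restrict_space lborel (ball 0 1 - {0}))"
    unfolding surface_measure_def using m f'
    by (subst nn_integral_scale_measure') (simp_all add: nn_integral_distr)
  also have "\<dots> = of_nat CARD('n) * (\<integral>\<^sup>+x. f (x /\<^sub>R norm x) * indicator (ball 0 1 - {0}) x \<partial>lborel)"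
    by (subst nn_integral_restrict_space) simp_all
  finally show ?thesis .
qed

text \<open>No Jacobian of a spherical chart is computed. By its definition through cones, an
  integral over the sphere is \<open>CARD('n)\<close> times an integral over the punctured unit
  ball. Rescaling the radius by \<open>norm x\<close> removes the normalisation of x, and for fixed
  r the dilation y = r x turns the unit ball into the ball of radius r. Tonelli then leaves the
  integral of r^(-1-n) over r > |y|, which is |y|^(-n) / n and cancels the factors |y|^n and
  n.\<close>

lemma nn_integral_polar:
  fixes f :: "real^'n \<Rightarrow> ennreal"
  assumes f[measurable]: "f \<in> borel_measurable borel"
  shows "(\<integral>\<^sup>+x. f x \<partial>lborel) =
    (\<integral>\<^sup>+\<theta>. (\<integral>\<^sup>+r. f (r *\<^sub>R \<theta>) * ennreal (r ^ (CARD('n) - 1)) * indicator {0<..} r \<partial>lborel) \<partial>surface_measure)"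
proof -
  let ?n = "CARD('n)"
  have n: "0 < ?n" by simp
  define B where "B = ball 0 1 - {0 :: real^'n}"
  have [measurable]: "B \<in> sets borel" by (simp add: B_def)
  have "(\<integral>\<^sup>+\<theta>. (\<integral>\<^sup>+r. f (r *\<^sub>R \<theta>) * ennreal (r ^ (?n - 1)) * indicator {0<..} r \<partial>lborel) \<partial>surface_measure)
     = of_nat ?n * (\<integral>\<^sup>+x. (\<integral>\<^sup>+r. f (r *\<^sub>R x /\<^sub>R norm x) * ennreal (r ^ (?n - 1)) * indicator {0<..} r \<partial>lborel)
          * indicator B x \<partial>lborel)"
    unfolding B_def by (subst nn_integral_surface_measure) (simp_all add: mult.assoc mult.commute[of "inverse (norm _)"])
  also have "(\<integral>\<^sup>+x. (\<integral>\<^sup>+r. f (r *\<^sub>R x /\<^sub>R norm x) * ennreal (r ^ (?n - 1)) * indicator {0<..} r \<partial>lborel)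
          * indicator B x \<partial>lborel)
     = (\<integral>\<^sup>+x. (\<integral>\<^sup>+r. f (r *\<^sub>R x) * (ennreal (r ^ (?n - 1)) * ennreal (norm x ^ ?n)) * indicator {0<..} r * indicator B x \<partial>lborel)
          \<partial>lborel)"
  proof (intro nn_integral_cong)
    fix x :: "real^'n"
    show "(\<integral>\<^sup>+r. f (r *\<^sub>R x /\<^sub>R norm x) * ennreal (r ^ (?n - 1)) * indicator {0<..} r \<partial>lborel) * indicator B x
       = (\<integral>\<^sup>+r. f (r *\<^sub>R x) * (ennreal (r ^ (?n - 1)) * ennreal (norm x ^ ?n)) * indicator {0<..} r * indicator B x \<partial>lborel)"
    proof (cases "x \<in> B")
      case True
      then have x: "0 < norm x" by (auto simp: B_def)
      have "(\<integral>\<^sup>+r. f (r *\<^sub>R x /\<^sub>R norm x) * ennreal (r ^ (?n - 1)) * indicator {0<..} r \<partial>lborel)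
        = ennreal (norm x) * (\<integral>\<^sup>+r. f ((norm x * r) *\<^sub>R x /\<^sub>R norm x) * ennreal ((norm x * r) ^ (?n - 1)) * indicator {0<..} (norm x * r) \<partial>lborel)"
        using x nn_integral_scale[of "\<lambda>r. f (r *\<^sub>R x /\<^sub>R norm x) * ennreal (r ^ (?n - 1)) * indicator {0<..} r" "norm x"]
        by simp
      also have "\<dots> = (\<integral>\<^sup>+r. ennreal (norm x) * (f ((norm x * r) *\<^sub>R x /\<^sub>R norm x) * ennreal ((norm x * r) ^ (?n - 1)) * indicator {0<..} (norm x * r)) \<partial>lborel)"
        by (subst nn_integral_cmult) simp_all
      also have "\<dots> = (\<integral>\<^sup>+r. f (r *\<^sub>R x) * (ennreal (r ^ (?n - 1)) * ennreal (norm x ^ ?n)) * indicator {0<..} r \<partial>lborel)"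
      proof (intro nn_integral_cong)
        fix r :: real
        have "ennreal (norm x) * ennreal ((norm x * r) ^ (?n - 1)) = ennreal (r ^ (?n - 1)) * ennreal (norm x ^ ?n)"
          if "0 < r"
          using that x by (subst (1 2) ennreal_mult[symmetric])
             (auto simp: power_mult_distrib power_eq_if[of _ ?n])
        then have h: "ennreal (norm x) * (ennreal ((norm x * r) ^ (?n - 1)) * indicator {0<..} r)
            = ennreal (r ^ (?n - 1)) * ennreal (norm x ^ ?n) * indicator {0<..} r"
          by (cases "0 < r") simp_all
        have e: "(norm x * r) *\<^sub>R x /\<^sub>R norm x = r *\<^sub>R x"
          "indicator {0<..} (norm x * r) = (indicator {0<..} r :: ennreal)"
          using x by (auto simp: indicator_def zero_less_mult_iff)
        show "ennreal (norm x) * (f ((norm x * r) *\<^sub>R x /\<^sub>R norm x) * ennreal ((norm x * r) ^ (?n - 1)) * indicator {0<..} (norm x * r))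
          = f (r *\<^sub>R x) * (ennreal (r ^ (?n - 1)) * ennreal (norm x ^ ?n)) * indicator {0<..} r"
          unfolding e mult.assoc mult.left_commute[of "ennreal (norm x)" "f _"] h by (simp only: mult.assoc)
      qed
      finally show ?thesis using True by simp
    qed simp
  qed
  also have "\<dots> = (\<integral>\<^sup>+r. (\<integral>\<^sup>+x. f (r *\<^sub>R x) * (ennreal (r ^ (?n - 1)) * ennreal (norm x ^ ?n)) * indicator {0<..} r * indicator B x \<partial>lborel)
          \<partial>lborel)"
    by (rule lborel_pair.Fubini') measurable
  also have "\<dots> = (\<integral>\<^sup>+r. (\<integral>\<^sup>+y. f y * ennreal (norm y ^ ?n) * (ennreal (r powr (- 1 - real ?n)) * indicator {0<..} r * (if norm y < r then 1 else 0) * indicator (-{0}) y) \<partial>lborel)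
          \<partial>lborel)"
  proof (rule nn_integral_cong)
    fix r :: real
    show "(\<integral>\<^sup>+x. f (r *\<^sub>R x) * (ennreal (r ^ (?n - 1)) * ennreal (norm x ^ ?n)) * indicator {0<..} r * indicator B x \<partial>lborel)
       = (\<integral>\<^sup>+y. f y * ennreal (norm y ^ ?n) * (ennreal (r powr (- 1 - real ?n)) * indicator {0<..} r * (if norm y < r then 1 else 0) * indicator (-{0}) y) \<partial>lborel)"
    proof (cases "0 < r")
      case True
      have mF: "(\<lambda>y. f y * ennreal (norm y ^ ?n) * (ennreal (r powr (- 1 - real ?n)) * indicator {0<..} r * (if norm y < r then 1 else 0) * indicator (-{0}) y))
         \<in> borel_measurable borel" by measurable
      \<comment> \<open>One factor \<open>r ^ ?n\<close> is the Jacobian of the dilation, the other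
        comes from \<open>norm (r *\<^sub>R x) ^ ?n\<close>.\<close>
      have pw: "r powr (- 1 - real ?n) * r ^ ?n * r ^ ?n = r ^ (?n - 1)"
      proof -
        have "r powr (- 1 - real ?n) * r ^ ?n * r ^ ?n = r powr (- 1 - real ?n + real ?n + real ?n)"
          using True by (simp only: powr_add powr_realpow)
        also have "\<dots> = r powr (real (?n - 1))"
          by (simp add: of_nat_diff Suc_leI)
        also have "\<dots> = r ^ (?n - 1)" using True by (rule powr_realpow)
        finally show ?thesis .
      qed
      have "(\<integral>\<^sup>+y. f y * ennreal (norm y ^ ?n) * (ennreal (r powr (- 1 - real ?n)) * indicator {0<..} r * (if norm y < r then 1 else 0) * indicator (-{0}) y) \<partial>lborel)
       = (\<integral>\<^sup>+y. ennreal (r ^ ?n) * (f (r *\<^sub>R y) * ennreal (norm (r *\<^sub>R y) ^ ?n) * (ennreal (r powr (- 1 - real ?n)) * indicator {0<..} r * (if norm (r *\<^sub>R y) < r then 1 else 0) * indicator (-{0}) (r *\<^sub>R y))) \<partial>lborel)"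
        unfolding nn_integral_scale[OF mF True] DIM_cart DIM_real mult_1_right by (rule nn_integral_cmult[symmetric]) measurable
      also have "\<dots> = (\<integral>\<^sup>+x. f (r *\<^sub>R x) * (ennreal (r ^ (?n - 1)) * ennreal (norm x ^ ?n)) * indicator {0<..} r * indicator B x \<partial>lborel)"
      proof (intro nn_integral_cong)
        fix x :: "real^'n"
        have 1: "ennreal (r ^ ?n) * ennreal (norm (r *\<^sub>R x) ^ ?n) * ennreal (r powr (- 1 - real ?n))
           = ennreal (r ^ (?n - 1)) * ennreal (norm x ^ ?n)"
        proof -
          have "ennreal (r ^ ?n) * ennreal (norm (r *\<^sub>R x) ^ ?n) * ennreal (r powr (- 1 - real ?n))
             = ennreal (r ^ ?n * norm (r *\<^sub>R x) ^ ?n * r powr (- 1 - real ?n))"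
            using True by (simp add: ennreal_mult)
          also have "r ^ ?n * norm (r *\<^sub>R x) ^ ?n * r powr (- 1 - real ?n)
             = r powr (- 1 - real ?n) * r ^ ?n * r ^ ?n * norm x ^ ?n"
            using True by (simp add: power_mult_distrib)
          also have "\<dots> = r ^ (?n - 1) * norm x ^ ?n" by (simp only: pw)
          also have "ennreal \<dots> = ennreal (r ^ (?n - 1)) * ennreal (norm x ^ ?n)"
            using True by (simp add: ennreal_mult)
          finally show ?thesis .
        qed
        have 2: "(if norm (r *\<^sub>R x) < r then 1 else 0) * indicator (-{0}) (r *\<^sub>R x) = (indicator B x :: ennreal)"
          using True by (auto simp: B_def indicator_def)
        show "ennreal (r ^ ?n) * (f (r *\<^sub>R x) * ennreal (norm (r *\<^sub>R x) ^ ?n) * (ennreal (r powr (- 1 - real ?n)) * indicator {0<..} r * (if norm (r *\<^sub>R x) < r then 1 else 0) * indicator (-{0}) (r *\<^sub>R x)))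
          = f (r *\<^sub>R x) * (ennreal (r ^ (?n - 1)) * ennreal (norm x ^ ?n)) * indicator {0<..} r * indicator B x"
          unfolding 1[symmetric] 2[symmetric] by (simp only: mult_ac)
      qed
      finally show ?thesis by (rule sym)
    next
      case False
      then show ?thesis by simp
    qed
  qed
  also have "\<dots> = (\<integral>\<^sup>+y. (\<integral>\<^sup>+r. f y * ennreal (norm y ^ ?n) * (ennreal (r powr (- 1 - real ?n)) * indicator {0<..} r * (if norm y < r then 1 else 0) * indicator (-{0}) y) \<partial>lborel)
          \<partial>lborel)"
    by (rule lborel_pair.Fubini') measurable
  also have "\<dots> = (\<integral>\<^sup>+y. f y / of_nat ?n \<partial>lborel)"
  proof (rule nn_integral_cong_AE)
    have "AE y in lborel. y \<noteq> (0 :: real^'n)" by (rule AE_lborel_singleton)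
    then show "AE y in lborel. (\<integral>\<^sup>+r. f y * ennreal (norm y ^ ?n) * (ennreal (r powr (- 1 - real ?n)) * indicator {0<..} r * (if norm y < r then 1 else 0) * indicator (-{0}) y) \<partial>lborel)
       = f y / of_nat ?n"
    proof eventually_elim
      fix y :: "real^'n" assume y: "y \<noteq> 0"
      have "(\<integral>\<^sup>+r. f y * ennreal (norm y ^ ?n) * (ennreal (r powr (- 1 - real ?n)) * indicator {0<..} r * (if norm y < r then 1 else 0) * indicator (-{0}) y) \<partial>lborel)
        = (\<integral>\<^sup>+r. f y * ennreal (norm y ^ ?n) * (ennreal (r powr (- 1 - real ?n)) * indicator {norm y..} r) \<partial>lborel)"
      \<comment> \<open>The single radius r = |y| is discarded to pass from the open half-line to
        the closed one of \<open>nn_integral_powr_tail\<close>; y \<noteq> 0 makes its left end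
        positive.\<close>
      proof (rule nn_integral_cong_AE)
        have "AE r in lborel. r \<noteq> norm y" by (rule AE_lborel_singleton)
        then show "AE r in lborel. f y * ennreal (norm y ^ ?n) * (ennreal (r powr (- 1 - real ?n)) * indicator {0<..} r * (if norm y < r then 1 else 0) * indicator (-{0}) y)
          = f y * ennreal (norm y ^ ?n) * (ennreal (r powr (- 1 - real ?n)) * indicator {norm y..} r)"
        proof eventually_elim
          fix r :: real assume "r \<noteq> norm y"
          moreover have "0 < r" if "norm y \<le> r" using y that by (smt (verit) zero_less_norm_iff)
          ultimately show "f y * ennreal (norm y ^ ?n) * (ennreal (r powr (- 1 - real ?n)) * indicator {0<..} r * (if norm y < r then 1 else 0) * indicator (-{0}) y)
          = f y * ennreal (norm y ^ ?n) * (ennreal (r powr (- 1 - real ?n)) * indicator {norm y..} r)"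
            using y by (auto simp: indicator_def)
        qed
      qed
      also have "\<dots> = f y * ennreal (norm y ^ ?n) * ennreal (norm y powr (- real ?n) / ?n)"
        using y by (subst nn_integral_cmult) (simp_all add: nn_integral_powr_tail)
      also have "\<dots> = f y * (ennreal (norm y ^ ?n) * ennreal (norm y powr (- real ?n) / real ?n))"
        by (rule mult.assoc)
      also have "ennreal (norm y ^ ?n) * ennreal (norm y powr (- real ?n) / real ?n)
          = ennreal (norm y ^ ?n * (norm y powr (- real ?n) / real ?n))"
        by (rule ennreal_mult[symmetric]) auto
      also have "norm y ^ ?n * (norm y powr (- real ?n) / ?n) = 1 / ?n"
        using y by (simp add: powr_minus powr_realpow field_simps)
      also have "f y * ennreal (1 / ?n) = f y / of_nat ?n"
        by (simp add: divide_ennreal_def ennreal_of_nat_eq_real_of_nat inverse_ennreal divide_inverse)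
      finally show "(\<integral>\<^sup>+r. f y * ennreal (norm y ^ ?n) * (ennreal (r powr (- 1 - real ?n)) * indicator {0<..} r * (if norm y < r then 1 else 0) * indicator (-{0}) y) \<partial>lborel)
       = f y / of_nat ?n" .
    qed
  qed
  also have "\<dots> = (\<integral>\<^sup>+y. f y \<partial>lborel) / of_nat ?n"
    by (rule nn_integral_divide) simp
  also have "of_nat ?n * ((\<integral>\<^sup>+y. f y \<partial>lborel) / of_nat ?n) = (\<integral>\<^sup>+y. f y \<partial>lborel)"
    unfolding ennreal_times_divide
    by (subst mult.commute, rule ennreal_mult_divide_eq) (auto simp: ennreal_of_nat_eq_real_of_nat)
  finally show ?thesis ..
qed

lemma finite_measure_surface_measure [simp, intro]: "finite_measure (surface_measure :: (real^'n) measure)"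
proof (rule finite_measureI)
  have "emeasure surface_measure (space surface_measure :: (real^'n) set) =
     of_nat CARD('n) * emeasure lborel {x :: real^'n. x \<in> ball 0 1 \<and> x \<noteq> 0 \<and> x /\<^sub>R norm x \<in> sphere 0 1}"
    by (subst emeasure_surface_measure[symmetric]) simp_all
  also have "emeasure lborel {x :: real^'n. x \<in> ball 0 1 \<and> x \<noteq> 0 \<and> x /\<^sub>R norm x \<in> sphere 0 1}
     \<le> emeasure lborel (ball 0 1 :: (real^'n) set)"
    by (rule emeasure_mono) auto
  also have "of_nat CARD('n) * emeasure lborel (ball 0 1 :: (real^'n) set) < \<infinity>"
    using emeasure_lborel_ball_finite[of "0 :: real^'n" 1]
    by (auto simp: ennreal_mult_less_top ennreal_of_nat_eq_real_of_nat)
  finally show "emeasure surface_measure (space surface_measure :: (real^'n) set) \<noteq> \<infinity>"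
    by (auto simp: mult_left_mono)
qed

interpretation surface: finite_measure "surface_measure :: (real^'n) measure"
  by simp

lemma measurable_surface_measure:
  assumes "f \<in> borel \<rightarrow>\<^sub>M N"
  shows "f \<in> surface_measure \<rightarrow>\<^sub>M N"
  unfolding measurable_cong_sets[OF sets_surface_measure refl]
  using assms by (rule measurable_restrict_space1)

text \<open>The radial factor is made a measure of its own so that polar coordinates become the
  image of a product measure and the Fubini theorems for pairs apply.\<close>

definition radial_measure :: "nat \<Rightarrow> real measure" where
  "radial_measure n = density lborel (\<lambda>r. ennreal (r ^ (n - 1)) * indicator {0<..} r)"

lemma sets_radial_measure [measurable_cong, simp]: "sets (radial_measure n) = sets borel"
  by (simp add: radial_measure_def)

lemma sigma_finite_radial_measure [simp, intro]: "sigma_finite_measure (radial_measure n)"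
  unfolding radial_measure_def
  by (subst sigma_finite_measure.sigma_finite_iff_density_finite[OF sigma_finite_lborel]) (auto simp: indicator_def)

text \<open>\<open>nn_integral_polar\<close> for indicators, read as an equality of measures. In
  this form it transports Bochner integrals of vector-valued functions as well.\<close>

lemma lborel_polar:
  "lborel = distr (surface_measure \<Otimes>\<^sub>M radial_measure CARD('n)) borel (\<lambda>(\<theta>, r). r *\<^sub>R (\<theta> :: real^'n))"
proof (rule measure_eqI)
  interpret radial: sigma_finite_measure "radial_measure CARD('n)" by simp
  fix X :: "(real^'n) set" assume "X \<in> sets lborel"
  then have [measurable]: "X \<in> sets borel" by simp
  have sm[measurable]: "(\<lambda>\<theta>. \<theta>) \<in> surface_measure \<rightarrow>\<^sub>M (borel :: (real^'n) measure)"
    by (rule measurable_surface_measure) simp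
  have [measurable]: "fst \<in> surface_measure \<Otimes>\<^sub>M radial_measure CARD('n) \<rightarrow>\<^sub>M (borel :: (real^'n) measure)"
    using measurable_compose[OF measurable_fst[of surface_measure "radial_measure CARD('n)"] sm] by simp
  have [measurable]: "(\<lambda>(\<theta>, r). r *\<^sub>R (\<theta> :: real^'n)) \<in> surface_measure \<Otimes>\<^sub>M radial_measure CARD('n) \<rightarrow>\<^sub>M borel"
    unfolding split_beta by (intro borel_measurable_scaleR) (simp_all add: radial_measure_def)
  have "emeasure (distr (surface_measure \<Otimes>\<^sub>M radial_measure CARD('n)) borel (\<lambda>(\<theta>, r). r *\<^sub>R \<theta>)) X
     = (\<integral>\<^sup>+z. indicator X ((\<lambda>(\<theta>, r). r *\<^sub>R \<theta>) z) \<partial>(surface_measure \<Otimes>\<^sub>M radial_measure CARD('n)))"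
    by (subst nn_integral_indicator[symmetric], simp, subst nn_integral_distr) simp_all
  also have "\<dots> = (\<integral>\<^sup>+\<theta>. (\<integral>\<^sup>+r. indicator X (r *\<^sub>R \<theta>) \<partial>radial_measure CARD('n)) \<partial>surface_measure)"
    by (subst radial.nn_integral_fst[symmetric]) (simp_all add: split_beta)
  also have "\<dots> = (\<integral>\<^sup>+\<theta>. (\<integral>\<^sup>+r. indicator X (r *\<^sub>R \<theta>) * ennreal (r ^ (CARD('n) - 1)) * indicator {0<..} r \<partial>lborel) \<partial>surface_measure)"
    unfolding radial_measure_def by (subst nn_integral_density) (simp_all add: mult_ac)
  also have "\<dots> = (\<integral>\<^sup>+x. indicator X x \<partial>lborel)"
    by (rule nn_integral_polar[symmetric]) simp
  finally show "emeasure lborel X = emeasure (distr (surface_measure \<Otimes>\<^sub>M radial_measure CARD('n)) borel (\<lambda>(\<theta>, r). r *\<^sub>R \<theta>)) X"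
    by simp
qed simp

lemma integral_polar:
  fixes f :: "real^'n \<Rightarrow> 'b::{banach, second_countable_topology}"
  assumes "integrable lborel f"
  shows "(LINT x|lborel. f x) = (LINT \<theta>|surface_measure. (LINT r:{0<..}|lborel. r ^ (CARD('n) - 1) *\<^sub>R f (r *\<^sub>R \<theta>)))"
    and "integrable surface_measure (\<lambda>\<theta>. LINT r:{0<..}|lborel. r ^ (CARD('n) - 1) *\<^sub>R f (r *\<^sub>R \<theta>))"
proof -
  interpret radial: sigma_finite_measure "radial_measure CARD('n)" by simp
  have [measurable]: "f \<in> borel_measurable borel" using assms by auto
  have sm[measurable]: "(\<lambda>\<theta>. \<theta>) \<in> surface_measure \<rightarrow>\<^sub>M (borel :: (real^'n) measure)"
    by (rule measurable_surface_measure) simp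
  have [measurable]: "fst \<in> surface_measure \<Otimes>\<^sub>M radial_measure CARD('n) \<rightarrow>\<^sub>M (borel :: (real^'n) measure)"
    using measurable_compose[OF measurable_fst[of surface_measure "radial_measure CARD('n)"] sm] by simp
  have m[measurable]: "(\<lambda>(\<theta>, r). r *\<^sub>R (\<theta> :: real^'n)) \<in> surface_measure \<Otimes>\<^sub>M radial_measure CARD('n) \<rightarrow>\<^sub>M borel"
    unfolding split_beta by (intro borel_measurable_scaleR) (simp_all add: radial_measure_def)
  have eq: "(LINT r:{0<..}|lborel. r ^ (CARD('n) - 1) *\<^sub>R f (r *\<^sub>R \<theta>)) = (LINT r|radial_measure CARD('n). f (r *\<^sub>R \<theta>))" for \<theta>
  proof -
    have "radial_measure CARD('n) = density lborel (\<lambda>r. ennreal (indicator {0<..} r * r ^ (CARD('n) - 1)))"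
      unfolding radial_measure_def by (intro density_cong) (auto simp: indicator_def)
    then show ?thesis
      by (simp add: integral_density set_lebesgue_integral_def indicator_def)
  qed
  have "integrable (distr (surface_measure \<Otimes>\<^sub>M radial_measure CARD('n)) borel (\<lambda>(\<theta>, r). r *\<^sub>R \<theta>)) f"
    using assms by (subst lborel_polar[symmetric])
  then have i: "integrable (surface_measure \<Otimes>\<^sub>M radial_measure CARD('n)) (\<lambda>z. f ((\<lambda>(\<theta>, r). r *\<^sub>R \<theta>) z))"
    by (rule integrable_distr[OF m])
  interpret pair_sigma_finite "surface_measure :: (real^'n) measure" "radial_measure CARD('n)" ..
  have "(LINT x|lborel. f x) = (LINT z|(surface_measure \<Otimes>\<^sub>M radial_measure CARD('n)). f ((\<lambda>(\<theta>, r). r *\<^sub>R \<theta>) z))"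
    by (subst lborel_polar, subst integral_distr) simp_all
  also have "\<dots> = (LINT \<theta>|surface_measure. LINT r|radial_measure CARD('n). f (r *\<^sub>R \<theta>))"
    using integral_fst'[OF i] by simp
  finally show "(LINT x|lborel. f x) = (LINT \<theta>|surface_measure. (LINT r:{0<..}|lborel. r ^ (CARD('n) - 1) *\<^sub>R f (r *\<^sub>R \<theta>)))"
    unfolding eq .
  show "integrable surface_measure (\<lambda>\<theta>. LINT r:{0<..}|lborel. r ^ (CARD('n) - 1) *\<^sub>R f (r *\<^sub>R \<theta>))"
    unfolding eq using integrable_fst'[OF i] by simp
qed

subsection \<open>The Gagliardo energy on lines\<close>

text \<open>The function A of the overview. With values in \<open>ennreal\<close> all estimates make
  sense before anything is known to be finite.\<close>

definition diff_sq :: "(real^'n \<Rightarrow> real) \<Rightarrow> real^'n \<Rightarrow> ennreal" where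
  "diff_sq u h = (\<integral>\<^sup>+x. ennreal ((u x - u (x - h))\<^sup>2) \<partial>lborel)"

text \<open>The Gagliardo double integral after y = x - h and Tonelli: u enters only through
  \<open>diff_sq u\<close>.\<close>

definition gag :: "real \<Rightarrow> (real^'n \<Rightarrow> real) \<Rightarrow> ennreal" where
  "gag s u = (\<integral>\<^sup>+h. diff_sq u h * ennreal (norm h powr - (real CARD('n) + 2 * s)) \<partial>lborel)"

lemma measurable_diff_sq [measurable]:
  assumes [measurable]: "u \<in> borel_measurable borel"
  shows "diff_sq u \<in> borel_measurable borel"
  unfolding diff_sq_def[abs_def] by measurable

lemma gagliardo_sq_eq_gag:
  assumes [measurable]: "u \<in> borel_measurable borel"
  shows "gagliardo_sq s u = gag s (u :: real^'n \<Rightarrow> real)"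
proof -
  have "gagliardo_sq s u = (\<integral>\<^sup>+x. (\<integral>\<^sup>+y. ennreal ((u x - u y)\<^sup>2 / norm (x - y) powr (real CARD('n) + 2 * s)) \<partial>lborel) \<partial>lborel)"
    by (simp add: gagliardo_sq_def nn_integral_completion)
  also have "\<dots> = (\<integral>\<^sup>+x. (\<integral>\<^sup>+h. ennreal ((u x - u (x - h))\<^sup>2 / norm h powr (real CARD('n) + 2 * s)) \<partial>lborel) \<partial>lborel)"
  proof (rule nn_integral_cong)
    fix x :: "real^'n"
    show "(\<integral>\<^sup>+y. ennreal ((u x - u y)\<^sup>2 / norm (x - y) powr (real CARD('n) + 2 * s)) \<partial>lborel)
       = (\<integral>\<^sup>+h. ennreal ((u x - u (x - h))\<^sup>2 / norm h powr (real CARD('n) + 2 * s)) \<partial>lborel)"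
      using nn_integral_reflect[of "\<lambda>y. ennreal ((u x - u y)\<^sup>2 / norm (x - y) powr (real CARD('n) + 2 * s))" x]
      by simp
  qed
  also have "\<dots> = (\<integral>\<^sup>+h. (\<integral>\<^sup>+x. ennreal ((u x - u (x - h))\<^sup>2 / norm h powr (real CARD('n) + 2 * s)) \<partial>lborel) \<partial>lborel)"
    by (rule lborel_pair.Fubini') measurable
  also have "\<dots> = gag s u"
    unfolding gag_def diff_sq_def powr_minus
    by (subst nn_integral_multc[symmetric]) (simp_all add: ennreal_mult[symmetric] divide_inverse)
  finally show ?thesis .
qed

lemma diff_sq_add:
  assumes [measurable]: "u \<in> borel_measurable borel"
  shows "diff_sq u (h + k) \<le> 2 * diff_sq u h + 2 * diff_sq u k"
proof -
  have "diff_sq u (h + k) \<le> (\<integral>\<^sup>+x. (2 * ennreal ((u x - u (x - h))\<^sup>2) + 2 * ennreal ((u (x - h) - u (x - h - k))\<^sup>2)) \<partial>lborel)"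
    unfolding diff_sq_def
  proof (rule nn_integral_mono)
    fix x
    let ?a = "u x - u (x - h)" and ?b = "u (x - h) - u (x - h - k)"
    have "(u x - u (x - (h + k)))\<^sup>2 = (?a + ?b)\<^sup>2" by (simp add: diff_diff_add)
    also have "(a + b)\<^sup>2 \<le> 2 * a\<^sup>2 + 2 * b\<^sup>2" for a b :: real
      using sum_squares_bound[of a b] by (simp add: power2_sum)
    finally show "ennreal ((u x - u (x - (h + k)))\<^sup>2) \<le> 2 * ennreal (?a\<^sup>2) + 2 * ennreal (?b\<^sup>2)"
      by (subst (1 2) ennreal_numeral[symmetric])
         (simp add: ennreal_mult'[symmetric] ennreal_plus[symmetric] ennreal_leI del: ennreal_plus ennreal_numeral)
  qed
  also have "\<dots> = 2 * diff_sq u h + 2 * (\<integral>\<^sup>+x. ennreal ((u (x - h) - u (x - h - k))\<^sup>2) \<partial>lborel)"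
    unfolding diff_sq_def by (simp add: nn_integral_add nn_integral_cmult)
  also have "(\<integral>\<^sup>+x. ennreal ((u (x - h) - u (x - h - k))\<^sup>2) \<partial>lborel) = diff_sq u k"
    unfolding diff_sq_def by (rule nn_integral_shift(3)[of "\<lambda>x. ennreal ((u x - u (x - k))\<^sup>2)"]) simp
  finally show ?thesis .
qed

lemma diff_sq_uminus:
  assumes [measurable]: "u \<in> borel_measurable borel"
  shows "diff_sq u (- h) = diff_sq u h"
proof -
  have "diff_sq u (- h) = (\<integral>\<^sup>+x. ennreal ((u (x - h) - u x)\<^sup>2) \<partial>lborel)"
    unfolding diff_sq_def
    using nn_integral_shift(3)[of "\<lambda>x. ennreal ((u x - u (x + h))\<^sup>2)" h] by simp
  then show ?thesis by (simp add: diff_sq_def power2_commute)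
qed

lemma diff_sq_0 [simp]: "diff_sq u 0 = 0"
  by (simp add: diff_sq_def)

text \<open>A shift by \<open>h\<close> is a shift by \<open>k\<close> followed by one by \<open>h - k\<close>; averaging over \<open>k\<close> in the ball
  with diameter \<open>[0, h]\<close>, which \<open>k \<mapsto> h - k\<close> preserves, controls a single direction by all of them.\<close>

lemma diff_sq_average:
  fixes u :: "real^'n \<Rightarrow> real"
  assumes [measurable]: "u \<in> borel_measurable borel"
  shows "ennreal (unit_ball_vol (real CARD('n)) * norm h ^ CARD('n)) * diff_sq u h
    \<le> ennreal (4 * 2 ^ CARD('n)) * (\<integral>\<^sup>+k. diff_sq u k * (if norm k \<le> norm h then 1 else 0) \<partial>lborel)"
proof -
  let ?B = "ball (h /\<^sub>R 2) (norm h / 2)"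
  have hB: "h - k \<in> ?B \<longleftrightarrow> k \<in> ?B" for k
  proof -
    have "h /\<^sub>R 2 - (h - k) = - (h /\<^sub>R 2 - k)"
      using scaleR_half_double[of h] by (simp add: scaleR_2[symmetric] algebra_simps)
    then show ?thesis by (simp only: mem_ball dist_norm norm_minus_cancel)
  qed
  have B: "norm k \<le> norm h" if "k \<in> ?B" for k
  proof -
    have "norm k \<le> norm (k - h /\<^sub>R 2) + norm (h /\<^sub>R 2)" by norm
    also have "\<dots> \<le> norm h" using that by (simp add: dist_norm norm_minus_commute)
    finally show ?thesis .
  qed
  have "diff_sq u h * emeasure lborel ?B = (\<integral>\<^sup>+k. diff_sq u h * indicator ?B k \<partial>lborel)"
    by (simp add: nn_integral_cmult_indicator)
  also have "\<dots> \<le> (\<integral>\<^sup>+k. (2 * (diff_sq u k * indicator ?B k) + 2 * (diff_sq u (h - k) * indicator ?B (h - k))) \<partial>lborel)"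
  proof (rule nn_integral_mono)
    fix k
    show "diff_sq u h * indicator ?B k \<le> 2 * (diff_sq u k * indicator ?B k) + 2 * (diff_sq u (h - k) * indicator ?B (h - k))"
      using diff_sq_add[OF assms, of k "h - k"] hB[of k] by (auto simp: indicator_def)
  qed
  also have "\<dots> = 2 * (\<integral>\<^sup>+k. diff_sq u k * indicator ?B k \<partial>lborel) + 2 * (\<integral>\<^sup>+k. diff_sq u (h - k) * indicator ?B (h - k) \<partial>lborel)"
  proof -
    have [measurable]: "?B \<in> sets borel" by simp
    define F where "F k = diff_sq u k * indicator ?B k" for k
    have [measurable]: "F \<in> borel_measurable borel" unfolding F_def by measurable
    show ?thesis unfolding F_def[symmetric] by (simp add: nn_integral_add nn_integral_cmult)
  qed
  also have "(\<integral>\<^sup>+k. diff_sq u (h - k) * indicator ?B (h - k) \<partial>lborel) = (\<integral>\<^sup>+k. diff_sq u k * indicator ?B k \<partial>lborel)"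
  proof -
    have [measurable]: "?B \<in> sets borel" by simp
    show ?thesis by (rule nn_integral_reflect[of "\<lambda>k. diff_sq u k * indicator ?B k"]) measurable
  qed
  also have "2 * (\<integral>\<^sup>+k. diff_sq u k * indicator ?B k \<partial>lborel) + 2 * (\<integral>\<^sup>+k. diff_sq u k * indicator ?B k \<partial>lborel)
     = 4 * (\<integral>\<^sup>+k. diff_sq u k * indicator ?B k \<partial>lborel)"
    by (simp add: distrib_right[symmetric])
  also have "\<dots> \<le> 4 * (\<integral>\<^sup>+k. diff_sq u k * (if norm k \<le> norm h then 1 else 0) \<partial>lborel)"
    by (intro mult_left_mono nn_integral_mono) (use B in \<open>auto simp: indicator_def\<close>)
  finally have *: "diff_sq u h * emeasure lborel ?B \<le> 4 * (\<integral>\<^sup>+k. diff_sq u k * (if norm k \<le> norm h then 1 else 0) \<partial>lborel)" .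
  \<comment> \<open>The ball has radius \<open>norm h / 2\<close>, which costs the factor
    \<open>2 ^ CARD('n)\<close>. The 4 collects the two terms of \<open>diff_sq_add\<close>, which
    are equal after the reflection.\<close>
  have "unit_ball_vol (real CARD('n)) * norm h ^ CARD('n)
     = 2 ^ CARD('n) * (unit_ball_vol (real CARD('n)) * (norm h / 2) ^ CARD('n))"
    by (simp add: power_divide)
  moreover have "emeasure lborel ?B = ennreal (unit_ball_vol (real CARD('n)) * (norm h / 2) ^ CARD('n))"
    by (subst emeasure_ball) simp_all
  ultimately have "ennreal (unit_ball_vol (real CARD('n)) * norm h ^ CARD('n)) = ennreal (2 ^ CARD('n)) * emeasure lborel ?B"
    by (simp only: ennreal_mult' zero_le_power zero_le_numeral)
  then have "ennreal (unit_ball_vol (real CARD('n)) * norm h ^ CARD('n)) * diff_sq u h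
      = ennreal (2 ^ CARD('n)) * (diff_sq u h * emeasure lborel ?B)" by (simp add: mult_ac)
  also have "\<dots> \<le> ennreal (2 ^ CARD('n)) * (4 * (\<integral>\<^sup>+k. diff_sq u k * (if norm k \<le> norm h then 1 else 0) \<partial>lborel))"
    using * by (rule mult_left_mono) simp
  also have "\<dots> = ennreal (4 * 2 ^ CARD('n)) * (\<integral>\<^sup>+k. diff_sq u k * (if norm k \<le> norm h then 1 else 0) \<partial>lborel)"
    by (subst ennreal_mult) (simp_all add: mult_ac)
  finally show ?thesis .
qed

text \<open>The constant C in A(h) \<le> C |h|^(-n) times the integral of A over |k| \<le>
  |h|.\<close>

definition line_const :: "'n itself \<Rightarrow> real" where
  "line_const _ = 4 * 2 ^ CARD('n) / unit_ball_vol (real CARD('n))"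

lemma line_const_nonneg: "0 \<le> line_const TYPE('n::finite)"
  by (simp add: line_const_def)

lemma diff_sq_average':
  fixes u :: "real^'n \<Rightarrow> real"
  assumes [measurable]: "u \<in> borel_measurable borel" and "h \<noteq> 0"
  shows "diff_sq u h \<le> ennreal (line_const TYPE('n) * norm h powr (- real CARD('n)))
     * (\<integral>\<^sup>+k. diff_sq u k * (if norm k \<le> norm h then 1 else 0) \<partial>lborel)" (is "_ \<le> _ * ?I")
proof -
  let ?a = "unit_ball_vol (real CARD('n)) * norm h ^ CARD('n)"
  have a: "0 < ?a" using assms(2) by simp
  have "diff_sq u h = ennreal (1 / ?a) * (ennreal ?a * diff_sq u h)"
    using a by (subst mult.assoc[symmetric], subst ennreal_mult[symmetric]) auto
  also have "\<dots> \<le> ennreal (1 / ?a) * (ennreal (4 * 2 ^ CARD('n)) * ?I)"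
    by (intro mult_left_mono diff_sq_average) simp_all
  also have "\<dots> = ennreal (1 / ?a * (4 * 2 ^ CARD('n))) * ?I"
    using a by (subst ennreal_mult) (simp_all add: mult.assoc)
  also have "1 / ?a * (4 * 2 ^ CARD('n)) = line_const TYPE('n) * norm h powr (- real CARD('n))"
    using assms(2) by (simp add: line_const_def powr_minus powr_realpow divide_inverse mult_ac)
  finally show ?thesis .
qed

text \<open>The averaged bound is inserted and t exchanged with k: the integral of t^(-1-n-2s) over
  t \<ge> |k| is |k|^(-n-2s) / (n + 2s), which is the Gagliardo weight again. The direction enters
  only through \<open>norm (t *\<^sub>R \<theta>) = t\<close>, so the constant does not depend on
  it.\<close>

lemma diff_sq_line:
  fixes u :: "real^'n \<Rightarrow> real"
  assumes [measurable]: "u \<in> borel_measurable borel" and s: "0 < s" and \<theta>: "norm \<theta> = 1"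
  shows "(\<integral>\<^sup>+t. diff_sq u (t *\<^sub>R \<theta>) * ennreal (t powr (- 1 - 2 * s)) * indicator {0<..} t \<partial>lborel)
    \<le> ennreal (line_const TYPE('n) / (real CARD('n) + 2 * s)) * gag s u"
proof -
  let ?n = "real CARD('n)" and ?C = "line_const TYPE('n)"
  have "(\<integral>\<^sup>+t. diff_sq u (t *\<^sub>R \<theta>) * ennreal (t powr (- 1 - 2 * s)) * indicator {0<..} t \<partial>lborel)
    \<le> (\<integral>\<^sup>+t. (\<integral>\<^sup>+k. diff_sq u k * (if norm k \<le> t then 1 else 0) * ennreal (?C * t powr (- 1 - (?n + 2 * s))) * indicator {0<..} t \<partial>lborel) \<partial>lborel)"
  proof (rule nn_integral_mono)
    fix t :: real
    show "diff_sq u (t *\<^sub>R \<theta>) * ennreal (t powr (- 1 - 2 * s)) * indicator {0<..} t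
      \<le> (\<integral>\<^sup>+k. diff_sq u k * (if norm k \<le> t then 1 else 0) * ennreal (?C * t powr (- 1 - (?n + 2 * s))) * indicator {0<..} t \<partial>lborel)"
    proof (cases "0 < t")
      case True
      have "\<theta> \<noteq> 0" using \<theta> by auto
      have "diff_sq u (t *\<^sub>R \<theta>) * ennreal (t powr (- 1 - 2 * s))
        \<le> (ennreal (?C * t powr (- ?n)) * (\<integral>\<^sup>+k. diff_sq u k * (if norm k \<le> t then 1 else 0) \<partial>lborel)) * ennreal (t powr (- 1 - 2 * s))"
        using diff_sq_average'[OF assms(1), of "t *\<^sub>R \<theta>"] True \<theta> \<open>\<theta> \<noteq> 0\<close>
        by (intro mult_right_mono) (auto)
      also have "\<dots> = (\<integral>\<^sup>+k. diff_sq u k * (if norm k \<le> t then 1 else 0) \<partial>lborel) * (ennreal (?C * t powr (- ?n)) * ennreal (t powr (- 1 - 2 * s)))"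
        by (simp only: mult_ac)
      also have "ennreal (?C * t powr (- ?n)) * ennreal (t powr (- 1 - 2 * s)) = ennreal (?C * t powr (- ?n) * t powr (- 1 - 2 * s))"
        by (rule ennreal_mult[symmetric]) (simp_all add: line_const_nonneg)
      also have "?C * t powr (- ?n) * t powr (- 1 - 2 * s) = ?C * t powr (- 1 - (?n + 2 * s))"
        by (simp add: mult.assoc powr_add[symmetric] algebra_simps)
      also have "(\<integral>\<^sup>+k. diff_sq u k * (if norm k \<le> t then 1 else 0) \<partial>lborel) * ennreal (?C * t powr (- 1 - (?n + 2 * s)))
        = (\<integral>\<^sup>+k. diff_sq u k * (if norm k \<le> t then 1 else 0) * ennreal (?C * t powr (- 1 - (?n + 2 * s))) \<partial>lborel)"
        by (rule nn_integral_multc[symmetric]) measurable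
      finally show ?thesis using True by simp
    qed simp
  qed
  also have "\<dots> = (\<integral>\<^sup>+k. (\<integral>\<^sup>+t. diff_sq u k * (if norm k \<le> t then 1 else 0) * ennreal (?C * t powr (- 1 - (?n + 2 * s))) * indicator {0<..} t \<partial>lborel) \<partial>lborel)"
    by (rule lborel_pair.Fubini') measurable
  also have "\<dots> = (\<integral>\<^sup>+k. ennreal (?C / (?n + 2 * s)) * (diff_sq u k * ennreal (norm k powr - (?n + 2 * s))) \<partial>lborel)"
  proof (rule nn_integral_cong)
    fix k :: "real^'n"
    show "(\<integral>\<^sup>+t. diff_sq u k * (if norm k \<le> t then 1 else 0) * ennreal (?C * t powr (- 1 - (?n + 2 * s))) * indicator {0<..} t \<partial>lborel)
      = ennreal (?C / (?n + 2 * s)) * (diff_sq u k * ennreal (norm k powr - (?n + 2 * s)))"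
    proof (cases "k = 0")
      case False
      have "(\<integral>\<^sup>+t. diff_sq u k * (if norm k \<le> t then 1 else 0) * ennreal (?C * t powr (- 1 - (?n + 2 * s))) * indicator {0<..} t \<partial>lborel)
        = (\<integral>\<^sup>+t. (diff_sq u k * ennreal ?C) * (ennreal (t powr (- 1 - (?n + 2 * s))) * indicator {norm k..} t) \<partial>lborel)"
      proof (rule nn_integral_cong)
        fix t :: real
        have "0 < t" if "norm k \<le> t" using that False by (smt (verit) zero_less_norm_iff)
        then show "diff_sq u k * (if norm k \<le> t then 1 else 0) * ennreal (?C * t powr (- 1 - (?n + 2 * s))) * indicator {0<..} t
          = (diff_sq u k * ennreal ?C) * (ennreal (t powr (- 1 - (?n + 2 * s))) * indicator {norm k..} t)"
          by (auto simp: indicator_def ennreal_mult line_const_nonneg mult.assoc)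
      qed
      also have "\<dots> = (diff_sq u k * ennreal ?C) * ennreal (norm k powr (- (?n + 2 * s)) / (?n + 2 * s))"
        using False s by (subst nn_integral_cmult) (simp_all add: nn_integral_powr_tail add_pos_pos)
      also have "\<dots> = diff_sq u k * ennreal (?C * (norm k powr (- (?n + 2 * s)) / (?n + 2 * s)))"
        using s by (simp only: mult.assoc) (subst ennreal_mult, simp_all add: line_const_nonneg add_nonneg_nonneg)
      also have "?C * (norm k powr (- (?n + 2 * s)) / (?n + 2 * s)) = (?C / (?n + 2 * s)) * norm k powr (- (?n + 2 * s))"
        by simp
      also have "diff_sq u k * ennreal \<dots> = ennreal (?C / (?n + 2 * s)) * (diff_sq u k * ennreal (norm k powr - (?n + 2 * s)))"
        using s by (subst ennreal_mult) (simp_all add: line_const_nonneg mult_ac)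
      finally show ?thesis .
    qed simp
  qed
  also have "\<dots> = ennreal (?C / (?n + 2 * s)) * gag s u"
    unfolding gag_def by (rule nn_integral_cmult) measurable
  finally show ?thesis .
qed

text \<open>In the averaged bound the weight |k|^(-n-2s) is at least |h|^(-n-2s) on |k| \<le> |h|.
  The resulting L^2 modulus of continuity of order |h|^s later fixes the scale of
  mollification.\<close>

lemma diff_sq_le_gag:
  fixes u :: "real^'n \<Rightarrow> real"
  assumes [measurable]: "u \<in> borel_measurable borel" and s: "0 < s"
  shows "diff_sq u h \<le> ennreal (line_const TYPE('n) * norm h powr (2 * s)) * gag s u"
proof (cases "h = 0")
  case False
  let ?n = "real CARD('n)" and ?C = "line_const TYPE('n)"
  have "(\<integral>\<^sup>+k. diff_sq u k * (if norm k \<le> norm h then 1 else 0) \<partial>lborel)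
     \<le> (\<integral>\<^sup>+k. ennreal (norm h powr (?n + 2 * s)) * (diff_sq u k * ennreal (norm k powr - (?n + 2 * s))) \<partial>lborel)"
  proof (rule nn_integral_mono)
    fix k :: "real^'n"
    have "1 \<le> norm h powr (?n + 2 * s) * norm k powr - (?n + 2 * s)" if "norm k \<le> norm h" "k \<noteq> 0"
      unfolding powr_minus using that s powr_mono2[of "?n + 2 * s" "norm k" "norm h"]
      by (simp add: divide_inverse[symmetric])
    then have "1 \<le> ennreal (norm h powr (?n + 2 * s)) * ennreal (norm k powr - (?n + 2 * s))" if "norm k \<le> norm h" "k \<noteq> 0"
      using that by (simp add: ennreal_mult'[symmetric])
    from mult_left_mono[OF this, of "diff_sq u k"]
    show "diff_sq u k * (if norm k \<le> norm h then 1 else 0) \<le> ennreal (norm h powr (?n + 2 * s)) * (diff_sq u k * ennreal (norm k powr - (?n + 2 * s)))"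
      by (cases "k = 0") (auto simp: mult_ac)
  qed
  also have "\<dots> = ennreal (norm h powr (?n + 2 * s)) * gag s u"
    unfolding gag_def by (rule nn_integral_cmult) measurable
  finally have "diff_sq u h \<le> ennreal (?C * norm h powr (- ?n)) * (ennreal (norm h powr (?n + 2 * s)) * gag s u)"
    using diff_sq_average'[OF assms(1) False] by (meson mult_left_mono order_trans zero_le)
  also have "\<dots> = ennreal (?C * norm h powr (- ?n) * norm h powr (?n + 2 * s)) * gag s u"
    by (subst mult.assoc[symmetric], subst ennreal_mult[symmetric]) (auto simp: line_const_nonneg)
  also have "?C * norm h powr (- ?n) * norm h powr (?n + 2 * s) = ?C * norm h powr (2 * s)"
    by (simp add: mult.assoc powr_add[symmetric])
  finally show ?thesis .
qed simp

subsection \<open>Truncated Marchaud integrals\<close>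

text \<open>Expanding the square, the cross term integrates to the square of the mean. Stated as a
  doubled sum, since a difference of extended numbers could not be rearranged later; boundedness of
  \<open>a\<close> and finiteness of the measure allow the computation in the reals.\<close>

lemma (in finite_measure) variance_identity:
  fixes a :: "'a \<Rightarrow> real"
  assumes [measurable]: "a \<in> borel_measurable M" and B: "\<And>x. \<bar>a x\<bar> \<le> B"
  shows "2 * ennreal ((LINT x|M. a x)\<^sup>2) + (\<integral>\<^sup>+x. (\<integral>\<^sup>+y. ennreal ((a x - a y)\<^sup>2) \<partial>M) \<partial>M)
     = 2 * emeasure M (space M) * (\<integral>\<^sup>+x. ennreal ((a x)\<^sup>2) \<partial>M)"
proof -
  let ?m = "measure M (space M)"
  define J where "J = (LINT x|M. a x)"
  define Q where "Q = (LINT x|M. (a x)\<^sup>2)"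
  have i1[simp]: "integrable M a"
    by (rule integrable_const_bound[where B=B]) (use B in auto)
  have "(a x)\<^sup>2 \<le> B\<^sup>2" for x using B[of x] by (metis abs_ge_zero power2_abs power_mono)
  then have i2[simp]: "integrable M (\<lambda>x. (a x)\<^sup>2)"
    by (intro integrable_const_bound[where B="B\<^sup>2"]) auto
  have sq: "(a x - a y)\<^sup>2 = (a x)\<^sup>2 - 2 * a x * a y + (a y)\<^sup>2" for x y
    by (simp add: power2_diff)
  have in1: "integrable M (\<lambda>y. (a x - a y)\<^sup>2)" for x
    unfolding sq by (intro Bochner_Integration.integrable_add Bochner_Integration.integrable_diff) auto
  have e1: "(LINT y|M. (a x - a y)\<^sup>2) = (a x)\<^sup>2 * ?m - 2 * a x * J + Q" for x
    unfolding sq J_def Q_def by (subst Bochner_Integration.integral_add) (auto simp: mult.commute)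
  have n1: "(\<integral>\<^sup>+y. ennreal ((a x - a y)\<^sup>2) \<partial>M) = ennreal ((a x)\<^sup>2 * ?m - 2 * a x * J + Q)" for x
    using nn_integral_eq_integral[OF in1, of x] by (simp add: e1)
  have nn: "0 \<le> (a x)\<^sup>2 * ?m - 2 * a x * J + Q" for x
    unfolding e1[symmetric] by simp
  have i3: "integrable M (\<lambda>x. (a x)\<^sup>2 * ?m - 2 * a x * J + Q)" by auto
  have e2: "(LINT x|M. (a x)\<^sup>2 * ?m - 2 * a x * J + Q) = 2 * ?m * Q - 2 * J\<^sup>2"
  proof -
    have "(LINT x|M. (a x)\<^sup>2 * ?m - 2 * a x * J + Q) = Q * ?m - 2 * J * J + ?m * Q"
      by (subst Bochner_Integration.integral_add) (auto simp: J_def Q_def)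
    then show ?thesis by (simp add: power2_eq_square)
  qed
  have n2: "(\<integral>\<^sup>+x. (\<integral>\<^sup>+y. ennreal ((a x - a y)\<^sup>2) \<partial>M) \<partial>M) = ennreal (2 * ?m * Q - 2 * J\<^sup>2)"
    unfolding n1 using nn_integral_eq_integral[OF i3] nn by (simp add: e2)
  have nn2: "0 \<le> 2 * ?m * Q - 2 * J\<^sup>2" unfolding e2[symmetric] by (rule Bochner_Integration.integral_nonneg) (rule nn)
  have n3: "(\<integral>\<^sup>+x. ennreal ((a x)\<^sup>2) \<partial>M) = ennreal Q"
    using nn_integral_eq_integral[OF i2] by (simp add: Q_def)
  have Q: "0 \<le> Q" by (simp add: Q_def)
  have "2 * ennreal (J\<^sup>2) + ennreal (2 * ?m * Q - 2 * J\<^sup>2) = ennreal (2 * J\<^sup>2) + ennreal (2 * ?m * Q - 2 * J\<^sup>2)"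
    by (simp add: ennreal_mult)
  also have "\<dots> = ennreal (2 * ?m * Q)"
    using nn2 by (subst ennreal_plus[symmetric]) auto
  also have "\<dots> = 2 * emeasure M (space M) * ennreal Q"
    using Q by (simp add: ennreal_mult emeasure_eq_measure)
  finally show ?thesis unfolding n2 n3 J_def .
qed

text \<open>Truncation at \<epsilon> makes t^(-1-s) dt a finite measure, as
  \<open>variance_identity\<close> requires. Its mass, of order \<epsilon>^(-s), is what has to
  cancel.\<close>

definition tail_measure :: "real \<Rightarrow> real \<Rightarrow> real measure" where
  "tail_measure s \<epsilon> = density lborel (\<lambda>t. ennreal (t powr (- 1 - s)) * indicator {\<epsilon>..} t)"

lemma sets_tail_measure [measurable_cong, simp]: "sets (tail_measure s \<epsilon>) = sets borel"
  by (simp add: tail_measure_def)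

lemma space_tail_measure [simp]: "space (tail_measure s \<epsilon>) = UNIV"
  by (simp add: tail_measure_def)

lemma finite_tail_measure:
  assumes "0 < s" "0 < \<epsilon>"
  shows "finite_measure (tail_measure s \<epsilon>)"
proof (rule finite_measureI)
  have "emeasure (tail_measure s \<epsilon>) (space (tail_measure s \<epsilon>)) = ennreal (\<epsilon> powr (- s) / s)"
    using assms by (simp add: tail_measure_def emeasure_density nn_integral_powr_tail)
  then show "emeasure (tail_measure s \<epsilon>) (space (tail_measure s \<epsilon>)) \<noteq> \<infinity>" by simp
qed

lemma nn_integral_tail_measure:
  assumes [measurable]: "f \<in> borel_measurable borel"
  shows "(\<integral>\<^sup>+t. f t \<partial>tail_measure s \<epsilon>) = (\<integral>\<^sup>+t. f t * ennreal (t powr (- 1 - s)) * indicator {\<epsilon>..} t \<partial>lborel)"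
  unfolding tail_measure_def by (subst nn_integral_density) (simp_all add: mult_ac)

text \<open>Mean value theorem; the derivative of x^(-1-s) is largest in modulus at the left end of
  the interval.\<close>

lemma powr_diff_le:
  fixes s t \<sigma> :: real
  assumes "0 < s" "0 < t" "0 < \<sigma>"
  shows "t powr (- 1 - s) - (t + \<sigma>) powr (- 1 - s) \<le> (1 + s) * \<sigma> * t powr (- 2 - s)"
proof -
  have "\<exists>z>t. z < t + \<sigma> \<and> (t + \<sigma>) powr (- 1 - s) - t powr (- 1 - s) = (t + \<sigma> - t) * ((- 1 - s) * z powr (- 2 - s))"
  proof (rule MVT2)
    have exponent: "- 1 - s - 1 = - 2 - s" by simp
    fix x assume "t \<le> x" "x \<le> t + \<sigma>"
    then have "0 < x" using assms by auto
    then show "((\<lambda>x. x powr (- 1 - s)) has_real_derivative (- 1 - s) * x powr (- 2 - s)) (at x)"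
      using has_real_derivative_powr[of x "- 1 - s"] unfolding exponent by simp
  qed (use assms in auto)
  then obtain z where z: "t < z" "(t + \<sigma>) powr (- 1 - s) - t powr (- 1 - s) = \<sigma> * ((- 1 - s) * z powr (- 2 - s))"
    by auto
  have "z powr (- 2 - s) \<le> t powr (- 2 - s)"
    using z(1) assms by (intro powr_mono2') auto
  then have "(1 + s) * \<sigma> * z powr (- 2 - s) \<le> (1 + s) * \<sigma> * t powr (- 2 - s)"
    using assms by (intro mult_left_mono) auto
  with z(2) show ?thesis by (simp add: algebra_simps)
qed

text \<open>The first summand comes from increments \<sigma> \<le> t, the second from \<sigma> \<ge>
  t, in \<open>tail_measure_kernel\<close>.\<close>

definition marchaud_const :: "real \<Rightarrow> real" where
  "marchaud_const s = (1 + s) / (1 - s) + 1 / s"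

text \<open>The integral of t^(-1-s) - (t + \<sigma>)^(-1-s) against \<sigma>^(-1-s) d\<sigma> is
  split at \<sigma> = t. Below, the mean value bound leaves \<sigma>^(-s), integrable at 0 because s
  < 1; above, the difference is at most t^(-1-s). Both parts are multiples of t^(-1-2s), and neither
  depends on \<epsilon>.\<close>

lemma tail_measure_kernel:
  assumes s: "0 < s" "s < 1" and "0 < \<epsilon>" "\<epsilon> \<le> t"
  shows "emeasure (tail_measure s \<epsilon>) UNIV * ennreal (t powr (- 1 - s))
    \<le> (\<integral>\<^sup>+\<sigma>. ennreal ((t + \<sigma>) powr (- 1 - s)) \<partial>tail_measure s \<epsilon>) + ennreal (marchaud_const s * t powr (- 1 - 2 * s))"
proof -
  have t: "0 < t" using assms by simp
  have "emeasure (tail_measure s \<epsilon>) UNIV * ennreal (t powr (- 1 - s)) = (\<integral>\<^sup>+\<sigma>. ennreal (t powr (- 1 - s)) \<partial>tail_measure s \<epsilon>)"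
    by (simp add: mult.commute)
  also have "\<dots> = (\<integral>\<^sup>+\<sigma>. ennreal (t powr (- 1 - s)) * ennreal (\<sigma> powr (- 1 - s)) * indicator {\<epsilon>..} \<sigma> \<partial>lborel)"
    by (rule nn_integral_tail_measure) simp
  also have "\<dots> \<le> (\<integral>\<^sup>+\<sigma>. ennreal ((t + \<sigma>) powr (- 1 - s)) * ennreal (\<sigma> powr (- 1 - s)) * indicator {\<epsilon>..} \<sigma>
      + (ennreal ((1 + s) * t powr (- 2 - s)) * (ennreal (\<sigma> powr (- s)) * indicator {0..t} \<sigma>)
      + ennreal (t powr (- 1 - s)) * (ennreal (\<sigma> powr (- 1 - s)) * indicator {t..} \<sigma>)) \<partial>lborel)"
  proof (rule nn_integral_mono)
    fix \<sigma> :: real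
    show "ennreal (t powr (- 1 - s)) * ennreal (\<sigma> powr (- 1 - s)) * indicator {\<epsilon>..} \<sigma>
      \<le> ennreal ((t + \<sigma>) powr (- 1 - s)) * ennreal (\<sigma> powr (- 1 - s)) * indicator {\<epsilon>..} \<sigma>
      + (ennreal ((1 + s) * t powr (- 2 - s)) * (ennreal (\<sigma> powr (- s)) * indicator {0..t} \<sigma>)
      + ennreal (t powr (- 1 - s)) * (ennreal (\<sigma> powr (- 1 - s)) * indicator {t..} \<sigma>))"
    proof (cases "\<epsilon> \<le> \<sigma>")
      case True
      then have sg: "0 < \<sigma>" using assms by simp
      show ?thesis
      proof (cases "\<sigma> \<le> t")
        case le: True
        have "t powr (- 1 - s) * \<sigma> powr (- 1 - s)
          \<le> ((t + \<sigma>) powr (- 1 - s) + (1 + s) * \<sigma> * t powr (- 2 - s)) * \<sigma> powr (- 1 - s)"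
          using powr_diff_le[OF s(1) t sg] by (intro mult_right_mono) auto
        also have "\<dots> = (t + \<sigma>) powr (- 1 - s) * \<sigma> powr (- 1 - s) + (1 + s) * t powr (- 2 - s) * (\<sigma> * \<sigma> powr (- 1 - s))"
          by (simp add: algebra_simps)
        also have "\<sigma> * \<sigma> powr (- 1 - s) = \<sigma> powr (- s)"
          using sg by (simp add: powr_mult_base)
        finally have "ennreal (t powr (- 1 - s) * \<sigma> powr (- 1 - s))
           \<le> ennreal ((t + \<sigma>) powr (- 1 - s) * \<sigma> powr (- 1 - s)) + ennreal ((1 + s) * t powr (- 2 - s) * \<sigma> powr (- s))"
          using s by (subst ennreal_plus[symmetric]) (auto intro!: ennreal_leI simp del: ennreal_plus)
        then have "ennreal (t powr (- 1 - s)) * ennreal (\<sigma> powr (- 1 - s))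
           \<le> ennreal ((t + \<sigma>) powr (- 1 - s)) * ennreal (\<sigma> powr (- 1 - s)) + ennreal ((1 + s) * t powr (- 2 - s)) * ennreal (\<sigma> powr (- s))"
          using s by (simp add: ennreal_mult)
        then show ?thesis using True sg le by (auto simp: indicator_def intro: order_trans add_mono)
      next
        case False
        then show ?thesis using True sg by (auto simp: indicator_def)
      qed
    qed (simp add: indicator_def)
  qed
  also have "\<dots> = (\<integral>\<^sup>+\<sigma>. ennreal ((t + \<sigma>) powr (- 1 - s)) * ennreal (\<sigma> powr (- 1 - s)) * indicator {\<epsilon>..} \<sigma> \<partial>lborel)
      + (ennreal ((1 + s) * t powr (- 2 - s)) * (\<integral>\<^sup>+\<sigma>. ennreal (\<sigma> powr (- s)) * indicator {0..t} \<sigma> \<partial>lborel)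
      + ennreal (t powr (- 1 - s)) * (\<integral>\<^sup>+\<sigma>. ennreal (\<sigma> powr (- 1 - s)) * indicator {t..} \<sigma> \<partial>lborel))"
    by (subst nn_integral_add, simp, simp, subst nn_integral_add) (simp_all add: nn_integral_cmult)
  also have "(\<integral>\<^sup>+\<sigma>. ennreal ((t + \<sigma>) powr (- 1 - s)) * ennreal (\<sigma> powr (- 1 - s)) * indicator {\<epsilon>..} \<sigma> \<partial>lborel)
      = (\<integral>\<^sup>+\<sigma>. ennreal ((t + \<sigma>) powr (- 1 - s)) \<partial>tail_measure s \<epsilon>)"
    by (rule nn_integral_tail_measure[symmetric]) simp
  also have "(\<integral>\<^sup>+\<sigma>. ennreal (\<sigma> powr (- s)) * indicator {0..t} \<sigma> \<partial>lborel) = ennreal (t powr (- s + 1) / (- s + 1))"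
    using s t by (intro nn_integral_powr_head) auto
  also have "(\<integral>\<^sup>+\<sigma>. ennreal (\<sigma> powr (- 1 - s)) * indicator {t..} \<sigma> \<partial>lborel) = ennreal (t powr (- s) / s)"
    using s t by (intro nn_integral_powr_tail) auto
  also have "ennreal ((1 + s) * t powr (- 2 - s)) * ennreal (t powr (- s + 1) / (- s + 1)) + ennreal (t powr (- 1 - s)) * ennreal (t powr (- s) / s)
     = ennreal ((1 + s) * t powr (- 2 - s) * (t powr (- s + 1) / (- s + 1)) + t powr (- 1 - s) * (t powr (- s) / s))"
    using s by (subst ennreal_plus) (auto simp: ennreal_mult[symmetric])
  also have "(1 + s) * t powr (- 2 - s) * (t powr (- s + 1) / (- s + 1)) + t powr (- 1 - s) * (t powr (- s) / s)
     = (1 + s) / (1 - s) * (t powr (- 2 - s) * t powr (- s + 1)) + 1 / s * (t powr (- 1 - s) * t powr (- s))"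
    by (simp add: algebra_simps add_divide_distrib)
  also have "\<dots> = marchaud_const s * t powr (- 1 - 2 * s)"
    by (simp add: powr_add[symmetric] marchaud_const_def algebra_simps)
  finally show ?thesis .
qed

text \<open>The variance identity is applied to \<open>t \<mapsto> \<phi> (x - t \<theta>)\<close>: after integration in \<open>x\<close> both sides depend
  on \<open>diff_sq \<phi>\<close> only, and the divergent factor \<open>\<mu>[\<epsilon>, \<infinity>)\<close> on the right cancels against the variance
  by \<open>tail_measure_kernel\<close>.\<close>

lemma truncated_Marchaud_bound:
  fixes \<phi> :: "real^'n \<Rightarrow> real"
  assumes m[measurable]: "\<phi> \<in> borel_measurable borel" and B: "\<And>x. \<bar>\<phi> x\<bar> \<le> B"
    and D: "\<And>h. diff_sq \<phi> h \<le> ennreal D"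
    and s: "0 < s" "s < 1" and \<epsilon>: "0 < \<epsilon>"
  shows "(\<integral>\<^sup>+x. ennreal ((LINT t|tail_measure s \<epsilon>. \<phi> x - \<phi> (x - t *\<^sub>R \<theta>))\<^sup>2) \<partial>lborel)
    \<le> ennreal (marchaud_const s) * (\<integral>\<^sup>+t. diff_sq \<phi> (t *\<^sub>R \<theta>) * ennreal (t powr (- 1 - 2 * s)) * indicator {0<..} t \<partial>lborel)"
proof -
  let ?M = "tail_measure s \<epsilon>"
  interpret M: finite_measure ?M using s \<epsilon> by (intro finite_tail_measure)
  interpret MM: pair_sigma_finite ?M ?M ..
  interpret LM: pair_sigma_finite lborel ?M ..
  define b where "b t = diff_sq \<phi> (t *\<^sub>R \<theta>)" for t
  have [measurable]: "b \<in> borel_measurable borel" unfolding b_def by measurable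
  define m where "m = emeasure ?M UNIV"
  have m_fin: "m < \<infinity>" unfolding m_def using M.emeasure_finite[of UNIV] by (simp only: less_top infinity_ennreal_def)
  define X where "X = (\<integral>\<^sup>+x. ennreal ((LINT t|?M. \<phi> x - \<phi> (x - t *\<^sub>R \<theta>))\<^sup>2) \<partial>lborel)"
  have b_minus: "b (- t) = b t" for t unfolding b_def using diff_sq_uminus[OF m, of "t *\<^sub>R \<theta>"] by simp
  have shift: "(\<integral>\<^sup>+x. ennreal ((\<phi> (x - \<sigma> *\<^sub>R \<theta>) - \<phi> (x - \<tau> *\<^sub>R \<theta>))\<^sup>2) \<partial>lborel) = b (\<tau> - \<sigma>)" for \<tau> \<sigma>
    unfolding b_def diff_sq_def
    using nn_integral_shift(3)[of "\<lambda>x. ennreal ((\<phi> x - \<phi> (x - (\<tau> - \<sigma>) *\<^sub>R \<theta>))\<^sup>2)" "\<sigma> *\<^sub>R \<theta>"]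
    by (simp add: algebra_simps)
  \<comment> \<open>Half of the variance term: b(\<tau> - \<sigma>) is symmetric because
    \<open>b\<close> is even, and it vanishes on the diagonal because b(0) = 0.\<close>
  define P where "P = (\<integral>\<^sup>+\<tau>. (\<integral>\<^sup>+\<sigma>. b (\<tau> - \<sigma>) * (if \<sigma> < \<tau> then 1 else 0) \<partial>?M) \<partial>?M)"
  have total: "2 * X + 2 * P = 2 * m * (\<integral>\<^sup>+\<tau>. b \<tau> \<partial>?M)"
  proof -
    have v: "2 * ennreal ((LINT t|?M. \<phi> x - \<phi> (x - t *\<^sub>R \<theta>))\<^sup>2)
        + (\<integral>\<^sup>+\<tau>. (\<integral>\<^sup>+\<sigma>. ennreal ((\<phi> (x - \<sigma> *\<^sub>R \<theta>) - \<phi> (x - \<tau> *\<^sub>R \<theta>))\<^sup>2) \<partial>?M) \<partial>?M)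
      = 2 * m * (\<integral>\<^sup>+\<tau>. ennreal ((\<phi> x - \<phi> (x - \<tau> *\<^sub>R \<theta>))\<^sup>2) \<partial>?M)" for x
    proof -
      have "\<bar>\<phi> x - \<phi> (x - t *\<^sub>R \<theta>)\<bar> \<le> 2 * B" for t
        using B[of x] B[of "x - t *\<^sub>R \<theta>"] by linarith
      from M.variance_identity[OF _ this] show ?thesis
        by (simp add: m_def algebra_simps)
    qed
    have "(\<integral>\<^sup>+x. (2 * ennreal ((LINT t|?M. \<phi> x - \<phi> (x - t *\<^sub>R \<theta>))\<^sup>2)
        + (\<integral>\<^sup>+\<tau>. (\<integral>\<^sup>+\<sigma>. ennreal ((\<phi> (x - \<sigma> *\<^sub>R \<theta>) - \<phi> (x - \<tau> *\<^sub>R \<theta>))\<^sup>2) \<partial>?M) \<partial>?M)) \<partial>lborel)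
      = 2 * X + (\<integral>\<^sup>+x. (\<integral>\<^sup>+\<tau>. (\<integral>\<^sup>+\<sigma>. ennreal ((\<phi> (x - \<sigma> *\<^sub>R \<theta>) - \<phi> (x - \<tau> *\<^sub>R \<theta>))\<^sup>2) \<partial>?M) \<partial>?M) \<partial>lborel)"
      unfolding X_def by (subst nn_integral_add) (simp_all add: nn_integral_cmult)
    also have "(\<integral>\<^sup>+x. (\<integral>\<^sup>+\<tau>. (\<integral>\<^sup>+\<sigma>. ennreal ((\<phi> (x - \<sigma> *\<^sub>R \<theta>) - \<phi> (x - \<tau> *\<^sub>R \<theta>))\<^sup>2) \<partial>?M) \<partial>?M) \<partial>lborel)
      = (\<integral>\<^sup>+\<tau>. (\<integral>\<^sup>+x. (\<integral>\<^sup>+\<sigma>. ennreal ((\<phi> (x - \<sigma> *\<^sub>R \<theta>) - \<phi> (x - \<tau> *\<^sub>R \<theta>))\<^sup>2) \<partial>?M) \<partial>lborel) \<partial>?M)"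
      by (rule LM.Fubini'[symmetric]) measurable
    also have "\<dots> = (\<integral>\<^sup>+\<tau>. (\<integral>\<^sup>+\<sigma>. (\<integral>\<^sup>+x. ennreal ((\<phi> (x - \<sigma> *\<^sub>R \<theta>) - \<phi> (x - \<tau> *\<^sub>R \<theta>))\<^sup>2) \<partial>lborel) \<partial>?M) \<partial>?M)"
      by (intro nn_integral_cong LM.Fubini'[symmetric]) measurable
    also have "\<dots> = (\<integral>\<^sup>+\<tau>. (\<integral>\<^sup>+\<sigma>. b (\<tau> - \<sigma>) \<partial>?M) \<partial>?M)"
      unfolding shift ..
    also have "\<dots> = (\<integral>\<^sup>+\<tau>. (\<integral>\<^sup>+\<sigma>. (b (\<tau> - \<sigma>) * (if \<sigma> < \<tau> then 1 else 0) + b (\<sigma> - \<tau>) * (if \<tau> < \<sigma> then 1 else 0)) \<partial>?M) \<partial>?M)"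
    proof (intro nn_integral_cong)
      fix \<tau> \<sigma> :: real
      show "b (\<tau> - \<sigma>) = b (\<tau> - \<sigma>) * (if \<sigma> < \<tau> then 1 else 0) + b (\<sigma> - \<tau>) * (if \<tau> < \<sigma> then 1 else 0)"
        using b_minus[of "\<tau> - \<sigma>"] by (cases \<sigma> \<tau> rule: linorder_cases) (auto simp: b_def)
    qed
    also have "\<dots> = P + (\<integral>\<^sup>+\<tau>. (\<integral>\<^sup>+\<sigma>. b (\<sigma> - \<tau>) * (if \<tau> < \<sigma> then 1 else 0) \<partial>?M) \<partial>?M)"
      unfolding P_def by (subst nn_integral_add[symmetric]) (simp_all add: nn_integral_add)
    also have "(\<integral>\<^sup>+\<tau>. (\<integral>\<^sup>+\<sigma>. b (\<sigma> - \<tau>) * (if \<tau> < \<sigma> then 1 else 0) \<partial>?M) \<partial>?M) = P"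
      unfolding P_def by (rule MM.Fubini') measurable
    finally have "2 * X + (P + P) = (\<integral>\<^sup>+x. 2 * m * (\<integral>\<^sup>+\<tau>. ennreal ((\<phi> x - \<phi> (x - \<tau> *\<^sub>R \<theta>))\<^sup>2) \<partial>?M) \<partial>lborel)"
      unfolding v by simp
    also have "\<dots> = 2 * m * (\<integral>\<^sup>+x. (\<integral>\<^sup>+\<tau>. ennreal ((\<phi> x - \<phi> (x - \<tau> *\<^sub>R \<theta>))\<^sup>2) \<partial>?M) \<partial>lborel)"
      by (rule nn_integral_cmult) measurable
    also have "(\<integral>\<^sup>+x. (\<integral>\<^sup>+\<tau>. ennreal ((\<phi> x - \<phi> (x - \<tau> *\<^sub>R \<theta>))\<^sup>2) \<partial>?M) \<partial>lborel)
      = (\<integral>\<^sup>+\<tau>. (\<integral>\<^sup>+x. ennreal ((\<phi> x - \<phi> (x - \<tau> *\<^sub>R \<theta>))\<^sup>2) \<partial>lborel) \<partial>?M)"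
      by (rule LM.Fubini'[symmetric]) measurable
    also have "\<dots> = (\<integral>\<^sup>+\<tau>. b \<tau> \<partial>?M)" by (simp add: b_def diff_sq_def)
    finally show ?thesis by (simp add: mult_2[of P])
  qed
  then have "2 * (X + P) = 2 * (m * (\<integral>\<^sup>+\<tau>. b \<tau> \<partial>?M))"
    by (simp add: distrib_left mult.assoc)
  then have total': "X + P = m * (\<integral>\<^sup>+\<tau>. b \<tau> \<partial>?M)"
    by (subst (asm) ennreal_mult_cancel_left) auto
  \<comment> \<open>The bound \<open>D\<close> serves to make \<open>P\<close> finite, so that it
    can be cancelled in \<open>ennreal\<close> at the end; it does not enter the final
    constant.\<close>
  have "P \<le> (\<integral>\<^sup>+\<tau>. (\<integral>\<^sup>+\<sigma>. ennreal D \<partial>?M) \<partial>?M)"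
    unfolding P_def b_def by (intro nn_integral_mono) (auto simp: D)
  also have "\<dots> = ennreal D * m * m" by (simp add: m_def)
  also have "\<dots> < \<infinity>" using m_fin by (simp add: ennreal_mult_less_top)
  finally have P_fin: "P \<noteq> \<infinity>" by simp
  \<comment> \<open>The substitution t = \<tau> - \<sigma> turns the density at \<tau> into the
    kernel (t + \<sigma>)^(-1-s) of \<open>tail_measure_kernel\<close>.\<close>
  have P_eq: "P = (\<integral>\<^sup>+t. b t * indicator {0<..} t * (\<integral>\<^sup>+\<sigma>. ennreal ((t + \<sigma>) powr (- 1 - s)) * indicator {\<epsilon>..} (t + \<sigma>) \<partial>?M) \<partial>lborel)"
  proof -
    have "P = (\<integral>\<^sup>+\<sigma>. (\<integral>\<^sup>+\<tau>. b (\<tau> - \<sigma>) * (if \<sigma> < \<tau> then 1 else 0) \<partial>?M) \<partial>?M)"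
      unfolding P_def by (rule MM.Fubini') measurable
    also have "\<dots> = (\<integral>\<^sup>+\<sigma>. (\<integral>\<^sup>+t. b t * indicator {0<..} t * (ennreal ((t + \<sigma>) powr (- 1 - s)) * indicator {\<epsilon>..} (t + \<sigma>)) \<partial>lborel) \<partial>?M)"
    proof (rule nn_integral_cong)
      fix \<sigma> :: real
      have "(\<integral>\<^sup>+\<tau>. b (\<tau> - \<sigma>) * (if \<sigma> < \<tau> then 1 else 0) \<partial>?M)
        = (\<integral>\<^sup>+\<tau>. b (\<tau> - \<sigma>) * (if \<sigma> < \<tau> then 1 else 0) * ennreal (\<tau> powr (- 1 - s)) * indicator {\<epsilon>..} \<tau> \<partial>lborel)"
        by (rule nn_integral_tail_measure) measurable
      also have "\<dots> = (\<integral>\<^sup>+t. b (t + \<sigma> - \<sigma>) * (if \<sigma> < t + \<sigma> then 1 else 0) * ennreal ((t + \<sigma>) powr (- 1 - s)) * indicator {\<epsilon>..} (t + \<sigma>) \<partial>lborel)"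
        by (rule nn_integral_shift(2)[symmetric]) measurable
      also have "\<dots> = (\<integral>\<^sup>+t. b t * indicator {0<..} t * (ennreal ((t + \<sigma>) powr (- 1 - s)) * indicator {\<epsilon>..} (t + \<sigma>)) \<partial>lborel)"
        by (intro nn_integral_cong) (auto simp: indicator_def)
      finally show "(\<integral>\<^sup>+\<tau>. b (\<tau> - \<sigma>) * (if \<sigma> < \<tau> then 1 else 0) \<partial>?M) = \<dots>" .
    qed
    also have "\<dots> = (\<integral>\<^sup>+t. (\<integral>\<^sup>+\<sigma>. b t * indicator {0<..} t * (ennreal ((t + \<sigma>) powr (- 1 - s)) * indicator {\<epsilon>..} (t + \<sigma>)) \<partial>?M) \<partial>lborel)"
      by (rule LM.Fubini') measurable
    also have "\<dots> = (\<integral>\<^sup>+t. b t * indicator {0<..} t * (\<integral>\<^sup>+\<sigma>. ennreal ((t + \<sigma>) powr (- 1 - s)) * indicator {\<epsilon>..} (t + \<sigma>) \<partial>?M) \<partial>lborel)"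
      by (intro nn_integral_cong nn_integral_cmult) measurable
    finally show ?thesis .
  qed
  have "m * (\<integral>\<^sup>+\<tau>. b \<tau> \<partial>?M) = m * (\<integral>\<^sup>+t. b t * ennreal (t powr (- 1 - s)) * indicator {\<epsilon>..} t \<partial>lborel)"
    by (subst nn_integral_tail_measure) simp_all
  also have "\<dots> = (\<integral>\<^sup>+t. m * (b t * ennreal (t powr (- 1 - s)) * indicator {\<epsilon>..} t) \<partial>lborel)"
    by (rule nn_integral_cmult[symmetric]) measurable
  also have "\<dots> \<le> (\<integral>\<^sup>+t. (b t * indicator {0<..} t * (\<integral>\<^sup>+\<sigma>. ennreal ((t + \<sigma>) powr (- 1 - s)) * indicator {\<epsilon>..} (t + \<sigma>) \<partial>?M)
      + ennreal (marchaud_const s) * (b t * ennreal (t powr (- 1 - 2 * s)) * indicator {0<..} t)) \<partial>lborel)"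
  proof (rule nn_integral_mono)
    fix t :: real
    show "m * (b t * ennreal (t powr (- 1 - s)) * indicator {\<epsilon>..} t)
      \<le> b t * indicator {0<..} t * (\<integral>\<^sup>+\<sigma>. ennreal ((t + \<sigma>) powr (- 1 - s)) * indicator {\<epsilon>..} (t + \<sigma>) \<partial>?M)
      + ennreal (marchaud_const s) * (b t * ennreal (t powr (- 1 - 2 * s)) * indicator {0<..} t)"
    proof (cases "\<epsilon> \<le> t")
      case True
      have "(\<integral>\<^sup>+\<sigma>. ennreal ((t + \<sigma>) powr (- 1 - s)) \<partial>?M) = (\<integral>\<^sup>+\<sigma>. ennreal ((t + \<sigma>) powr (- 1 - s)) * indicator {\<epsilon>..} (t + \<sigma>) \<partial>?M)"
      proof (subst (1 2) nn_integral_tail_measure)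
        show "(\<integral>\<^sup>+ \<sigma>. ennreal ((t + \<sigma>) powr (- 1 - s)) * ennreal (\<sigma> powr (- 1 - s)) * indicator {\<epsilon>..} \<sigma> \<partial>lborel)
          = (\<integral>\<^sup>+ \<sigma>. ennreal ((t + \<sigma>) powr (- 1 - s)) * indicator {\<epsilon>..} (t + \<sigma>) * ennreal (\<sigma> powr (- 1 - s)) * indicator {\<epsilon>..} \<sigma> \<partial>lborel)"
          using True \<epsilon> by (intro nn_integral_cong) (auto simp: indicator_def)
      qed measurable
      then have ineq: "m * ennreal (t powr (- 1 - s)) \<le> (\<integral>\<^sup>+\<sigma>. ennreal ((t + \<sigma>) powr (- 1 - s)) * indicator {\<epsilon>..} (t + \<sigma>) \<partial>?M)
         + ennreal (marchaud_const s * t powr (- 1 - 2 * s))"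
        using tail_measure_kernel[OF s \<epsilon> True] unfolding m_def by simp
      have "0 \<le> marchaud_const s" using s by (simp add: marchaud_const_def)
      then show ?thesis
        using mult_left_mono[OF ineq, of "b t"] True \<epsilon>
        by (simp add: distrib_left ennreal_mult mult_ac)
    qed simp
  qed
  also have "\<dots> = P + ennreal (marchaud_const s) * (\<integral>\<^sup>+t. b t * ennreal (t powr (- 1 - 2 * s)) * indicator {0<..} t \<partial>lborel)"
    unfolding P_eq by (subst nn_integral_add) (simp_all add: nn_integral_cmult)
  finally have "P + X \<le> P + ennreal (marchaud_const s) * (\<integral>\<^sup>+t. b t * ennreal (t powr (- 1 - 2 * s)) * indicator {0<..} t \<partial>lborel)"
    unfolding total'[symmetric] by (simp add: add.commute)
  then show ?thesis
    using P_fin by (simp add: ennreal_add_left_cancel_le X_def b_def)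
qed

subsection \<open>Test functions\<close>

definition partial_deriv :: "'n \<Rightarrow> (real^'n \<Rightarrow> real) \<Rightarrow> real^'n \<Rightarrow> real" where
  "partial_deriv i f x = frechet_derivative f (at x) (axis i 1)"

lemma continuously_differentiable_continuous:
  assumes "continuously_differentiable k f"
  shows "continuous_on UNIV f"
  using assms
  by (cases k) (auto intro!: continuous_at_imp_continuous_on differentiable_imp_continuous_within)

lemma continuously_differentiable_Suc:
  "continuously_differentiable (Suc k) f \<longleftrightarrow>
     (\<forall>x. f differentiable (at x)) \<and> (\<forall>i. continuously_differentiable k (partial_deriv i f))"
  by (simp add: partial_deriv_def[abs_def])

lemma test_function_continuous: "f \<in> test_functions \<Longrightarrow> continuous_on UNIV f"
  by (auto simp: test_functions_def dest: continuously_differentiable_continuous)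

lemma test_function_measurable: "f \<in> test_functions \<Longrightarrow> f \<in> borel_measurable borel"
  by (intro borel_measurable_continuous_onI test_function_continuous)

lemma test_function_differentiable:
  assumes "f \<in> test_functions" shows "f differentiable (at x)"
proof -
  have "continuously_differentiable (Suc 0) f" using assms unfolding test_functions_def by blast
  then show ?thesis by simp
qed

lemma test_function_has_derivative:
  assumes "f \<in> test_functions"
  shows "(f has_derivative (\<lambda>h. \<Sum>i\<in>UNIV. h $ i * partial_deriv i f x)) (at x)"
proof -
  have D: "(f has_derivative frechet_derivative f (at x)) (at x)"
    using test_function_differentiable[OF assms] by (simp add: frechet_derivative_works)
  interpret linear "frechet_derivative f (at x)"
    using D by (rule has_derivative_linear)
  have eq: "frechet_derivative f (at x) h = (\<Sum>i\<in>UNIV. h $ i * partial_deriv i f x)" for h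
  proof -
    have "h = (\<Sum>i\<in>UNIV. h $ i *\<^sub>R axis i 1)"
      by (simp add: vec_eq_iff axis_def if_distrib[where f="\<lambda>x. _ * x"] cong: if_cong)
    then have "frechet_derivative f (at x) h = frechet_derivative f (at x) (\<Sum>i\<in>UNIV. h $ i *\<^sub>R axis i 1)"
      by simp
    then show ?thesis by (simp add: sum scale partial_deriv_def)
  qed
  show ?thesis using D unfolding eq[abs_def] .
qed

text \<open>Off the closed support the function vanishes on a neighbourhood, so its derivative is
  zero there too: differentiation does not enlarge the support.\<close>

lemma test_function_partial_deriv:
  assumes f: "f \<in> test_functions"
  shows "partial_deriv i f \<in> test_functions"
proof -
  have "continuously_differentiable k (partial_deriv i f)" for k
  proof -
    have "continuously_differentiable (Suc k) f" using f unfolding test_functions_def by blast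
    then show ?thesis unfolding continuously_differentiable_Suc by blast
  qed
  moreover have "{x. partial_deriv i f x \<noteq> 0} \<subseteq> closure {x. f x \<noteq> 0}"
  proof (rule subsetI, rule ccontr)
    fix x assume x: "x \<in> {x. partial_deriv i f x \<noteq> 0}" "x \<notin> closure {x. f x \<noteq> 0}"
    have "(f has_derivative (\<lambda>_. 0)) (at x)"
    proof (rule has_derivative_transform_within_open)
      show "((\<lambda>_. 0) has_derivative (\<lambda>_. 0)) (at x)" by simp
      show "open (- closure {x. f x \<noteq> 0})" "x \<in> - closure {x. f x \<noteq> 0}" using x by auto
      show "0 = f y" if "y \<in> - closure {x. f x \<noteq> 0}" for y
        using that closure_subset[of "{x. f x \<noteq> 0}"] by auto
    qed
    then have "frechet_derivative f (at x) = (\<lambda>_. 0)" by (rule frechet_derivative_at[symmetric])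
    with x show False by (simp add: partial_deriv_def)
  qed
  then have "closure {x. partial_deriv i f x \<noteq> 0} \<subseteq> closure {x. f x \<noteq> 0}"
    by (rule closure_minimal) simp
  then have "compact (closure {x. partial_deriv i f x \<noteq> 0})"
    using f unfolding test_functions_def compact_eq_bounded_closed by (auto intro: bounded_subset)
  ultimately show ?thesis by (simp add: test_functions_def)
qed

lemma continuously_differentiable_diff:
  "continuously_differentiable k f \<Longrightarrow> continuously_differentiable k g \<Longrightarrow>
    continuously_differentiable k (\<lambda>x. f x - g x)"
proof (induction k arbitrary: f g)
  case 0
  then show ?case by (auto intro: continuous_on_diff)
next
  case (Suc k)
  have d: "\<And>x. f differentiable (at x)" "\<And>x. g differentiable (at x)"
    using Suc.prems unfolding continuously_differentiable_Suc by auto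
  have "partial_deriv i (\<lambda>x. f x - g x) = (\<lambda>x. partial_deriv i f x - partial_deriv i g x)" for i
  proof
    fix x
    have "((\<lambda>x. f x - g x) has_derivative (\<lambda>h. frechet_derivative f (at x) h - frechet_derivative g (at x) h)) (at x)"
      using d by (intro has_derivative_diff) (simp_all add: frechet_derivative_works)
    from frechet_derivative_at[OF this, symmetric]
    show "partial_deriv i (\<lambda>x. f x - g x) x = partial_deriv i f x - partial_deriv i g x"
      by (simp add: partial_deriv_def)
  qed
  then show ?case
    using Suc d unfolding continuously_differentiable_Suc by (auto intro: differentiable_diff)
qed

lemma test_function_support:
  assumes "f \<in> test_functions"
  obtains R where "0 < R" "\<And>x. R \<le> norm x \<Longrightarrow> f x = 0"
proof -
  have "bounded (closure {x. f x \<noteq> 0})" using assms by (auto simp: test_functions_def compact_imp_bounded)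
  then obtain R where "0 < R" and R: "\<forall>x\<in>closure {x. f x \<noteq> 0}. norm x \<le> R" by (auto simp: bounded_pos)
  have "f x = 0" if "R + 1 \<le> norm x" for x
  proof (rule ccontr)
    assume "f x \<noteq> 0"
    then have "x \<in> closure {x. f x \<noteq> 0}" using closure_subset[of "{x. f x \<noteq> 0}"] by blast
    with R that show False by force
  qed
  with \<open>0 < R\<close> show thesis by (intro that[of "R + 1"]) auto
qed

lemma test_functionI:
  assumes "\<And>k. continuously_differentiable k f" and "\<And>x. R \<le> norm x \<Longrightarrow> f x = 0"
  shows "f \<in> test_functions"
proof -
  have "{x. f x \<noteq> 0} \<subseteq> cball 0 R" using assms(2) by (force simp: not_le)
  then have "bounded {x. f x \<noteq> 0}" by (rule bounded_subset[OF bounded_cball])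
  then show ?thesis using assms(1) by (simp add: test_functions_def)
qed

lemma test_function_diff:
  assumes "f \<in> test_functions" "g \<in> test_functions"
  shows "(\<lambda>x. f x - g x) \<in> test_functions"
proof -
  obtain R where R: "\<And>x. R \<le> norm x \<Longrightarrow> f x = 0" using test_function_support[OF assms(1)] by blast
  obtain R' where R': "\<And>x. R' \<le> norm x \<Longrightarrow> g x = 0" using test_function_support[OF assms(2)] by blast
  show ?thesis
    by (rule test_functionI[where R="max R R'"])
       (use assms R R' in \<open>auto simp: test_functions_def intro: continuously_differentiable_diff\<close>)
qed

lemma test_function_bounded:
  assumes "f \<in> test_functions"
  obtains B where "0 \<le> B" "\<And>x. \<bar>f x\<bar> \<le> B"
proof -
  obtain R where R: "0 < R" "\<And>x. R \<le> norm x \<Longrightarrow> f x = 0" using test_function_support[OF assms] by blast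
  have "continuous_on (cball 0 R) f" using test_function_continuous[OF assms] continuous_on_subset by blast
  then have "bounded (f ` cball 0 R)" by (intro compact_imp_bounded compact_continuous_image) auto
  then obtain B where "0 < B" and B: "\<forall>y\<in>f ` cball 0 R. norm y \<le> B" by (auto simp: bounded_pos)
  have "\<bar>f x\<bar> \<le> B" for x
    using B R(2)[of x] \<open>0 < B\<close> by (cases "R \<le> norm x") auto
  with \<open>0 < B\<close> show thesis by (intro that[of B]) auto
qed

lemma test_function_deriv_bounded:
  assumes f: "f \<in> test_functions"
  obtains L where "0 \<le> L" "\<And>x h. \<bar>\<Sum>i\<in>UNIV. h $ i * partial_deriv i f x\<bar> \<le> L * norm h"
proof -
  have "\<exists>B\<ge>0. \<forall>x. \<bar>partial_deriv i f x\<bar> \<le> B" for i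
    using test_function_bounded[OF test_function_partial_deriv[OF f, of i]] by metis
  then obtain B where B: "\<And>i. 0 \<le> B i" "\<And>i x. \<bar>partial_deriv i f x\<bar> \<le> B i" by metis
  show thesis
  proof (rule that[of "\<Sum>i\<in>UNIV. B i"])
    show "0 \<le> (\<Sum>i\<in>UNIV. B i)" using B by (simp add: sum_nonneg)
    fix x h
    have "\<bar>\<Sum>i\<in>UNIV. h $ i * partial_deriv i f x\<bar> \<le> (\<Sum>i\<in>UNIV. \<bar>h $ i * partial_deriv i f x\<bar>)"
      by (rule sum_abs)
    also have "\<dots> \<le> (\<Sum>i\<in>UNIV. norm h * B i)"
      using B component_le_norm_cart[of h] by (intro sum_mono) (auto simp: abs_mult intro!: mult_mono)
    finally show "\<bar>\<Sum>i\<in>UNIV. h $ i * partial_deriv i f x\<bar> \<le> (\<Sum>i\<in>UNIV. B i) * norm h"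
      by (simp add: sum_distrib_left mult.commute)
  qed
qed

lemma test_function_Lipschitz:
  assumes f: "f \<in> test_functions"
  obtains L where "0 \<le> L" "\<And>x y. \<bar>f x - f y\<bar> \<le> L * norm (x - y)"
proof -
  obtain L where L: "0 \<le> L" "\<And>x h. \<bar>\<Sum>i\<in>UNIV. h $ i * partial_deriv i f x\<bar> \<le> L * norm h"
    using test_function_deriv_bounded[OF f] by blast
  have "norm (f x - f y) \<le> L * norm (x - y)" for x y
  proof (rule differentiable_bound[where S=UNIV])
    show "onorm (\<lambda>h. \<Sum>i\<in>UNIV. h $ i * partial_deriv i f x) \<le> L" for x
      using L by (intro onorm_le) simp
  qed (auto intro: test_function_has_derivative[OF f])
  with L show thesis by (intro that[of L]) auto
qed

lemma test_function_line_derivative: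
  assumes f: "f \<in> test_functions"
  shows "((\<lambda>t. f (x + t *\<^sub>R \<theta>)) has_real_derivative (\<Sum>i\<in>UNIV. \<theta> $ i * partial_deriv i f (x + t *\<^sub>R \<theta>))) (at t)"
proof -
  have "((\<lambda>t. x + t *\<^sub>R \<theta>) has_derivative (\<lambda>h. h *\<^sub>R \<theta>)) (at t)"
    by (auto intro!: derivative_eq_intros)
  from has_derivative_compose[OF this test_function_has_derivative[OF f]]
  show ?thesis
    unfolding has_field_derivative_def
    by (rule has_derivative_eq_rhs) (auto simp: sum_distrib_left fun_eq_iff mult_ac)
qed

subsection \<open>Bump functions\<close>

text \<open>Smoothness is encoded by a whole tower of derivatives, so that the derivative of a
  smooth function is smooth by a shift of the index.\<close>

definition smooth_real :: "(real \<Rightarrow> real) \<Rightarrow> bool" where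
  "smooth_real b \<longleftrightarrow> (\<exists>F. F (0::nat) = b \<and> (\<forall>k t. (F k has_real_derivative F (Suc k) t) (at t)))"

lemma smooth_real_derivative:
  assumes "smooth_real b"
  obtains b' where "smooth_real b'" "\<And>t. (b has_real_derivative b' t) (at t)"
proof -
  obtain F where F: "F (0::nat) = b" "\<And>k t. (F k has_real_derivative F (Suc k) t) (at t)"
    using assms by (auto simp: smooth_real_def)
  have "smooth_real (F 1)" unfolding smooth_real_def
    by (rule exI[of _ "\<lambda>k. F (Suc k)"]) (use F in auto)
  with F(1) F(2)[of 0] show thesis by (intro that[of "F 1"]) auto
qed

text \<open>A different factor is allowed in each coordinate because the j-th partial derivative
  just replaces \<open>b j\<close> by its derivative: the class is closed under differentiation and
  the induction runs inside it.\<close>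

lemma continuously_differentiable_prod:
  fixes b :: "'n::finite \<Rightarrow> real \<Rightarrow> real"
  assumes "\<And>i. smooth_real (b i)"
  shows "continuously_differentiable k (\<lambda>x. \<Prod>i\<in>UNIV. b i (x $ i))"
  using assms
proof (induction k arbitrary: b)
  case 0
  have "continuous_on UNIV (b i)" for i
    using smooth_real_derivative[OF 0[of i]]
    by (metis DERIV_isCont continuous_at_imp_continuous_on)
  then have "continuous_on UNIV (\<lambda>x. b i (x $ i))" for i
    by (rule continuous_on_compose2) (auto intro!: continuous_intros)
  then show ?case by (auto intro!: continuous_on_prod)
next
  case (Suc k)
  have "\<exists>b'. smooth_real b' \<and> (\<forall>t. (b i has_real_derivative b' t) (at t))" for i
    using smooth_real_derivative[OF Suc.prems[of i]] by metis
  then obtain b' where b': "\<And>i. smooth_real (b' i)" "\<And>i t. (b i has_real_derivative b' i t) (at t)"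
    by metis
  have comp: "((\<lambda>x. b i (x $ i)) has_derivative (\<lambda>h. b' i (x $ i) * h $ i)) (at x)" for i and x :: "real^'n"
  proof -
    have "((\<lambda>x. x $ i) has_derivative (\<lambda>h. h $ i)) (at x)"
      by (rule bounded_linear_imp_has_derivative) (rule bounded_linear_vec_nth)
    from has_derivative_compose[OF this b'(2)[unfolded has_field_derivative_def]] show ?thesis by simp
  qed
  have D: "((\<lambda>x. \<Prod>i\<in>UNIV. b i (x $ i)) has_derivative
     (\<lambda>h. \<Sum>i\<in>UNIV. (b' i (x $ i) * h $ i) * (\<Prod>j\<in>UNIV - {i}. b j (x $ j)))) (at x)" for x :: "real^'n"
    by (rule has_derivative_prod) (rule comp)
  have "partial_deriv j (\<lambda>x. \<Prod>i\<in>UNIV. b i (x $ i)) = (\<lambda>x. \<Prod>i\<in>UNIV. (b(j := b' j)) i (x $ i))" for j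
  proof
    fix x :: "real^'n"
    have "partial_deriv j (\<lambda>x. \<Prod>i\<in>UNIV. b i (x $ i)) x
       = (\<Sum>i\<in>UNIV. (b' i (x $ i) * axis j 1 $ i) * (\<Prod>j\<in>UNIV - {i}. b j (x $ j)))"
      unfolding partial_deriv_def frechet_derivative_at[OF D, symmetric] ..
    also have "\<dots> = (\<Sum>i\<in>UNIV. if i = j then b' j (x $ j) * (\<Prod>i\<in>UNIV - {j}. b i (x $ i)) else 0)"
      by (intro sum.cong) (auto simp: axis_def)
    also have "\<dots> = b' j (x $ j) * (\<Prod>i\<in>UNIV - {j}. b i (x $ i))" by simp
    also have "(\<Prod>i\<in>UNIV - {j}. b i (x $ i)) = (\<Prod>i\<in>UNIV - {j}. (b(j := b' j)) i (x $ i))"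
      by (intro prod.cong) auto
    also have "b' j (x $ j) * \<dots> = (\<Prod>i\<in>UNIV. (b(j := b' j)) i (x $ i))"
      by (subst prod.remove[of UNIV j]) auto
    finally show "partial_deriv j (\<lambda>x. \<Prod>i\<in>UNIV. b i (x $ i)) x = \<dots>" .
  qed
  moreover have "smooth_real ((b(j := b' j)) i)" for i j
    using b' Suc.prems by simp
  ultimately show ?case
    unfolding continuously_differentiable_Suc using differentiableI[OF D] Suc.IH
    by (auto simp del: fun_upd_apply)
qed

definition bump_term :: "real poly \<Rightarrow> nat \<Rightarrow> real \<Rightarrow> real" where
  "bump_term p m t = (if \<bar>t\<bar> < 1 then poly p t / (1 - t\<^sup>2) ^ m * exp (- (1 / (1 - t\<^sup>2))) else 0)"

text \<open>Derivatives of \<open>exp (- 1 / (1 - t\<^sup>2))\<close> are of the form \<open>bump_term p m\<close>;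
  differentiation turns \<open>(p, m)\<close> into \<open>(bump_poly p m, m + 2)\<close>.\<close>

definition bump_poly :: "real poly \<Rightarrow> nat \<Rightarrow> real poly" where
  "bump_poly p m = pderiv p * [:1, 0, -1:] ^ 2 + smult (2 * real m) ([:0, 1:] * p * [:1, 0, -1:]) - smult 2 ([:0, 1:] * p)"

text \<open>Meant for the gluing points t = 1 and t = -1 of the bump, where no single formula
  describes it on a neighbourhood.\<close>

lemma DERIV_zero_quadratic:
  fixes f :: "real \<Rightarrow> real"
  assumes "\<And>y. \<bar>f y - f t\<bar> \<le> C * (y - t)\<^sup>2"
  shows "(f has_real_derivative 0) (at t)"
proof -
  have "((\<lambda>h. (f (t + h) - f t) / h) \<longlongrightarrow> 0) (at 0)"
  proof (rule Lim_null_comparison)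
    show "eventually (\<lambda>h. norm ((f (t + h) - f t) / h) \<le> C * \<bar>h\<bar>) (at 0)"
    proof (rule eventually_at_filter[THEN iffD2], rule always_eventually, intro allI impI)
      fix h :: real assume "h \<noteq> 0"
      then show "norm ((f (t + h) - f t) / h) \<le> C * \<bar>h\<bar>"
        using assms[of "t + h"] by (simp add: field_simps power2_eq_square abs_mult_self_eq)
    qed
    show "((\<lambda>h. C * \<bar>h\<bar>) \<longlongrightarrow> 0) (at 0)"
      by (auto intro!: tendsto_eq_intros)
  qed
  then show ?thesis by (simp add: DERIV_def)
qed

text \<open>With w = 1 - t^2, one term of the exponential series gives exp(1/w) \<ge> w^(-(m+2)) /
  (m+2)!, hence exp(-1/w) / w^m \<le> (m+2)! w^2. The order m + 2 is taken to leave the two powers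
  of w that \<open>DERIV_zero_quadratic\<close> consumes.\<close>

lemma bump_term_bound:
  obtains C where "\<And>t. \<bar>bump_term p m t\<bar> \<le> C * (1 - t\<^sup>2)\<^sup>2" "0 \<le> C"
proof -
  have "bounded (poly p ` {-1..1})"
    by (intro compact_imp_bounded compact_continuous_image continuous_intros) auto
  then obtain B where "0 < B" and B: "\<forall>y\<in>poly p ` {-1..1}. norm y \<le> B" by (auto simp: bounded_pos)
  have "\<bar>bump_term p m t\<bar> \<le> B * fact (m + 2) * (1 - t\<^sup>2)\<^sup>2" for t
  proof (cases "\<bar>t\<bar> < 1")
    case True
    define w where "w = 1 - t\<^sup>2"
    have w: "0 < w" using True by (simp add: w_def abs_square_less_1)
    have "(1 / w) ^ (m + 2) / fact (m + 2) \<le> exp (1 / w)"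
    proof -
      have "(1 / w) ^ (m + 2) /\<^sub>R fact (m + 2) \<le> (\<Sum>n. (1 / w) ^ n /\<^sub>R fact n)"
        using w sum_le_suminf[OF summable_exp_generic[of "1 / w"], of "{m + 2}"] by simp
      then show ?thesis by (simp add: exp_def divide_inverse mult.commute)
    qed
    moreover have "exp (- (1 / w)) / w ^ m \<le> K * w\<^sup>2" if "(1 / w) ^ (m + 2) / K \<le> exp (1 / w)" "0 < K" for K
      using w that by (simp add: exp_minus field_simps power_add power2_eq_square)
    ultimately have "exp (- (1 / w)) / w ^ m \<le> fact (m + 2) * w\<^sup>2" by (simp del: fact_Suc)
    moreover have "\<bar>poly p t\<bar> \<le> B" using B True by force
    ultimately have "\<bar>poly p t\<bar> * (exp (- (1 / w)) / w ^ m) \<le> B * (fact (m + 2) * w\<^sup>2)"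
      using w by (intro mult_mono) auto
    moreover have "\<bar>bump_term p m t\<bar> = \<bar>poly p t\<bar> * (exp (- (1 / w)) / w ^ m)"
      using True w by (simp add: bump_term_def w_def[symmetric] abs_mult)
    ultimately show ?thesis by (simp add: w_def mult.assoc)
  next
    case False
    then show ?thesis using \<open>0 < B\<close> by (simp add: bump_term_def)
  qed
  with \<open>0 < B\<close> show thesis by (intro that[of "B * fact (m + 2)"]) auto
qed

lemma bump_term_derivative:
  "(bump_term p m has_real_derivative bump_term (bump_poly p m) (m + 2) t) (at t)"
proof (cases "\<bar>t\<bar> < 1")
  case True
  define w where "w = 1 - t\<^sup>2"
  have w: "0 < w" using True by (simp add: w_def abs_square_less_1)
  have poly: "poly (bump_poly p m) t = poly (pderiv p) t * w\<^sup>2 + 2 * real m * (t * poly p t * w) - 2 * (t * poly p t)"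
    by (simp add: bump_poly_def w_def power2_eq_square algebra_simps)
  have "((\<lambda>t. poly p t / (1 - t\<^sup>2) ^ m * exp (- (1 / (1 - t\<^sup>2)))) has_real_derivative
     (poly (pderiv p) t * w ^ m - poly p t * (real m * w ^ (m - Suc 0) * (- 2 * t))) / (w ^ m * w ^ m) * exp (- (1 / w))
     + exp (- (1 / w)) * (- (2 * t) / (w * w)) * (poly p t / w ^ m)) (at t)"
    using w by (auto intro!: derivative_eq_intros poly_DERIV simp: w_def[symmetric]) (simp add: field_simps)
  also have "(poly (pderiv p) t * w ^ m - poly p t * (real m * w ^ (m - Suc 0) * (- 2 * t))) / (w ^ m * w ^ m) * exp (- (1 / w))
     + exp (- (1 / w)) * (- (2 * t) / (w * w)) * (poly p t / w ^ m) = bump_term (bump_poly p m) (m + 2) t"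
  proof -
    have "(poly (pderiv p) t * w ^ m - poly p t * (real m * w ^ (m - Suc 0) * (- 2 * t))) / (w ^ m * w ^ m)
      = (poly (pderiv p) t * w + 2 * real m * (t * poly p t)) / (w * w ^ m)"
    proof -
      have "(poly (pderiv p) t * w ^ m - poly p t * (real m * w ^ (m - Suc 0) * (- 2 * t))) * w
        = w ^ m * (poly (pderiv p) t * w + 2 * real m * (t * poly p t))"
        by (cases m) (auto simp: algebra_simps)
      then show ?thesis using w by (simp add: field_simps)
    qed
    moreover have "bump_term (bump_poly p m) (m + 2) t
       = (poly (pderiv p) t * w\<^sup>2 + 2 * real m * (t * poly p t * w) - 2 * (t * poly p t)) / (w ^ m * w\<^sup>2) * exp (- (1 / w))"
      using True unfolding bump_term_def poly power_add w_def[symmetric] by simp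
    moreover have "(P * w + 2 * M * (t * q)) / (w * W) * e + e * (- (2 * t) / (w * w)) * (q / W)
       = (P * w\<^sup>2 + 2 * M * (t * q * w) - 2 * (t * q)) / (W * w\<^sup>2) * e" if "0 < W" for P M q W e
      using w that by (simp add: field_simps power2_eq_square)
    ultimately show ?thesis using w by simp
  qed
  finally show ?thesis
  proof (rule has_field_derivative_transform_within_open[where S="{-1<..<1}"])
    show "t \<in> {-1<..<1}" using True by auto
  qed (auto simp: bump_term_def)
next
  case False
  obtain C where C: "\<And>t. \<bar>bump_term p m t\<bar> \<le> C * (1 - t\<^sup>2)\<^sup>2" "0 \<le> C"
    using bump_term_bound[of p m] by blast
  have z: "bump_term q k t = 0" for q k using False by (simp add: bump_term_def)
  have "\<bar>bump_term p m y - bump_term p m t\<bar> \<le> (4 * C) * (y - t)\<^sup>2" for y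
  proof (cases "\<bar>y\<bar> < 1")
    case True
    \<comment> \<open>As |y| < 1 \<le> |t|, the factor 1 - |y| of 1 - y^2 is at most |y - t| and the
      factor 1 + |y| at most 2.\<close>
    have "(1 - y\<^sup>2)\<^sup>2 \<le> (2 * (y - t))\<^sup>2"
    proof (rule abs_le_square_iff[THEN iffD1])
      have "\<bar>1 - y\<^sup>2\<bar> = 1 - y\<^sup>2" using True by (simp add: abs_square_le_1)
      moreover have "1 - y\<^sup>2 = (1 - \<bar>y\<bar>) * (1 + \<bar>y\<bar>)" by (simp add: algebra_simps power2_eq_square)
      moreover have "(1 - \<bar>y\<bar>) * (1 + \<bar>y\<bar>) \<le> \<bar>y - t\<bar> * 2"
        using True False by (intro mult_mono) auto
      moreover have "\<bar>2 * (y - t)\<bar> = \<bar>y - t\<bar> * 2" by (simp only: abs_mult)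
      ultimately show "\<bar>1 - y\<^sup>2\<bar> \<le> \<bar>2 * (y - t)\<bar>" by linarith
    qed
    then have "C * (1 - y\<^sup>2)\<^sup>2 \<le> C * (2 * (y - t))\<^sup>2" using C(2) by (rule mult_left_mono)
    moreover have "C * (2 * (y - t))\<^sup>2 = (4 * C) * (y - t)\<^sup>2" by (simp only: power_mult_distrib) simp
    ultimately show ?thesis using C(1)[of y] unfolding z by linarith
  next
    case False
    then have "bump_term p m y = 0" by (simp add: bump_term_def)
    then show ?thesis using C(2) by (simp add: z)
  qed
  from DERIV_zero_quadratic[OF this] show ?thesis by (simp only: z)
qed

lemma smooth_real_bump: "smooth_real (bump_term p m)"
proof -
  define F where "F k = (case ((\<lambda>(p, m). (bump_poly p m, m + 2)) ^^ k) (p, m) of (p, m) \<Rightarrow> bump_term p m)" for k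
  have "(F k has_real_derivative F (Suc k) t) (at t)" for k t
    unfolding F_def by (cases "((\<lambda>(p, m). (bump_poly p m, m + 2)) ^^ k) (p, m)") (use bump_term_derivative in simp)
  moreover have "F 0 = bump_term p m" by (simp add: F_def)
  ultimately show ?thesis unfolding smooth_real_def by blast
qed

lemma smooth_real_scale:
  assumes "smooth_real b"
  shows "smooth_real (\<lambda>t. b (c * t))"
proof -
  obtain F where F: "F (0::nat) = b" "\<And>k t. (F k has_real_derivative F (Suc k) t) (at t)"
    using assms by (auto simp: smooth_real_def)
  have "((\<lambda>t. c ^ k * F k (c * t)) has_real_derivative c ^ Suc k * F (Suc k) (c * t)) (at t)" for k t
  proof -
    have "((\<lambda>t. F k (c * t)) has_real_derivative F (Suc k) (c * t) * c) (at t)"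
      by (rule DERIV_chain2[OF F(2)]) (auto intro!: derivative_eq_intros)
    from DERIV_cmult[OF this, of "c ^ k"] show ?thesis by (simp add: mult_ac)
  qed
  then show ?thesis unfolding smooth_real_def
    by (intro exI[of _ "\<lambda>k t. c ^ k * F k (c * t)"]) (use F in auto)
qed

lemma test_function_cmult:
  assumes "f \<in> test_functions"
  shows "(\<lambda>x. c * f x) \<in> test_functions"
proof -
  have "continuously_differentiable k f \<Longrightarrow> continuously_differentiable k (\<lambda>x. c * f x)" for k and f :: "real^'n \<Rightarrow> real"
  proof (induction k arbitrary: f)
    case 0
    then show ?case by (auto intro: continuous_on_mult_left)
  next
    case (Suc k)
    have d: "\<And>x. f differentiable (at x)" using Suc.prems unfolding continuously_differentiable_Suc by auto
    have D: "((\<lambda>x. c * f x) has_derivative (\<lambda>h. c * frechet_derivative f (at x) h)) (at x)" for x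
      using d by (intro has_derivative_mult_right) (simp add: frechet_derivative_works)
    have "partial_deriv i (\<lambda>x. c * f x) = (\<lambda>x. c * partial_deriv i f x)" for i
      unfolding partial_deriv_def frechet_derivative_at[OF D, symmetric] ..
    with D show ?case
      using Suc unfolding continuously_differentiable_Suc by (auto simp: differentiable_def)
  qed
  moreover obtain R where "\<And>x. R \<le> norm x \<Longrightarrow> f x = 0" using test_function_support[OF assms] by blast
  ultimately show ?thesis
    using assms by (intro test_functionI[where R=R]) (auto simp: test_functions_def)
qed

text \<open>A product of one-dimensional bumps in the coordinates, rescaled by c = n / \<delta>: if
  all |x_i| were below 1 / c, the l^1 norm would force |x| < \<delta>, so a point with |x| \<ge>
  \<delta> kills some factor. On the ball of radius 1 / c no factor vanishes, so the mass is
  positive and can be normalised.\<close>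

lemma mollifier_exists:
  assumes "0 < \<delta>"
  obtains \<eta> :: "real^'n \<Rightarrow> real" where "\<eta> \<in> test_functions" "\<And>x. 0 \<le> \<eta> x"
    "\<And>x. \<delta> \<le> norm x \<Longrightarrow> \<eta> x = 0" "(\<integral>\<^sup>+x. ennreal (\<eta> x) \<partial>lborel) = 1"
proof -
  define c where "c = real CARD('n) / \<delta>"
  have c: "0 < c" using assms by (simp add: c_def)
  define B :: "real^'n \<Rightarrow> real" where "B x = (\<Prod>i\<in>UNIV. bump_term 1 0 (c * x $ i))" for x
  have Bz: "B x = 0" if "\<delta> \<le> norm x" for x
  proof -
    have "\<exists>i. 1 \<le> \<bar>c * x $ i\<bar>"
    proof (rule ccontr)
      assume "\<not> (\<exists>i. 1 \<le> \<bar>c * x $ i\<bar>)"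
      then have "\<And>i. \<bar>x $ i\<bar> < 1 / c" using c by (auto simp: abs_mult field_simps not_le)
      then have "(\<Sum>i\<in>UNIV. \<bar>x $ i\<bar>) < (\<Sum>i\<in>(UNIV::'n set). 1 / c)" by (intro sum_strict_mono) auto
      with norm_le_l1_cart[of x] have "norm x < real CARD('n) * (1 / c)" by simp
      with that assms show False by (simp add: c_def)
    qed
    then obtain i where "1 \<le> \<bar>c * x $ i\<bar>" ..
    then have "bump_term 1 0 (c * x $ i) = 0" by (simp add: bump_term_def)
    then show ?thesis unfolding B_def by (intro prod_zero) auto
  qed
  have Bt: "B \<in> test_functions"
    unfolding B_def[abs_def]
    by (rule test_functionI[where R=\<delta>])
       (use Bz in \<open>auto simp: B_def[abs_def] intro!: continuously_differentiable_prod smooth_real_scale smooth_real_bump\<close>)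
  have Bn: "0 \<le> B x" for x unfolding B_def by (intro prod_nonneg) (auto simp: bump_term_def)
  have [measurable]: "B \<in> borel_measurable borel" by (rule test_function_measurable[OF Bt])
  obtain K where K: "0 \<le> K" "\<And>x. \<bar>B x\<bar> \<le> K" using test_function_bounded[OF Bt] by blast
  define I where "I = (\<integral>\<^sup>+x. ennreal (B x) \<partial>lborel)"
  have "I \<le> (\<integral>\<^sup>+x. ennreal K * indicator (cball (0 :: real^'n) \<delta>) x \<partial>lborel)"
    unfolding I_def
  proof (rule nn_integral_mono)
    fix x show "ennreal (B x) \<le> ennreal K * indicator (cball 0 \<delta>) x"
      using K(2)[of x] Bz[of x] by (cases "\<delta> \<le> norm x") (auto simp: indicator_def intro!: ennreal_leI)
  qed
  also have "\<dots> = ennreal K * emeasure lborel (cball 0 \<delta> :: (real^'n) set)"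
    by (simp add: nn_integral_cmult_indicator)
  also have "\<dots> < \<infinity>"
    using emeasure_lborel_cball_finite[of "0 :: real^'n" \<delta>] by (simp add: ennreal_mult_less_top)
  finally have "I < \<infinity>" .
  have "I \<noteq> 0"
  proof
    assume "I = 0"
    then have ae: "AE x in lborel. B x = 0"
      unfolding I_def using Bn by (subst (asm) nn_integral_0_iff_AE) (auto simp: ennreal_eq_0_iff dest: antisym)
    define U where "U = ball (0 :: real^'n) (1 / c)"
    have "B x \<noteq> 0" if "x \<in> U" for x
    proof -
      have "\<bar>c * x $ i\<bar> < 1" for i
      proof -
        have "\<bar>c * x $ i\<bar> \<le> c * norm x"
          using c component_le_norm_cart[of x i] by (simp add: abs_mult)
        also have "\<dots> < 1" using that c by (simp add: U_def pos_less_divide_eq mult.commute)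
        finally show ?thesis .
      qed
      then have "bump_term 1 0 (c * x $ i) \<noteq> 0" for i by (simp add: bump_term_def)
      then show ?thesis unfolding B_def by (simp add: prod_zero_iff)
    qed
    with ae have "AE x in lborel. x \<notin> U" by (auto elim!: eventually_mono)
    then have "emeasure lborel U = 0" by (subst (asm) AE_iff_measurable[where N=U]) (auto simp: U_def)
    moreover have "0 < unit_ball_vol (real CARD('n)) * (1 / c) ^ CARD('n)" using c by simp
    ultimately show False using c by (simp add: U_def emeasure_ball ennreal_eq_0_iff)
  qed
  obtain J where J: "I = ennreal J" "0 < J"
    using \<open>I \<noteq> 0\<close> \<open>I < \<infinity>\<close> by (cases I) (auto simp: ennreal_eq_0_iff less_le)
  show thesis
  proof (rule that[of "\<lambda>x. 1 / J * B x"])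
    show "(\<lambda>x. 1 / J * B x) \<in> test_functions" by (rule test_function_cmult[OF Bt])
    have "(\<integral>\<^sup>+x. ennreal (1 / J * B x) \<partial>lborel) = ennreal (1 / J) * I"
      unfolding I_def using J Bn by (simp add: ennreal_mult nn_integral_cmult del: times_divide_eq_left)
    also have "\<dots> = 1" unfolding J(1) using J(2) by (subst ennreal_mult[symmetric]) auto
    finally show "(\<integral>\<^sup>+x. ennreal (1 / J * B x) \<partial>lborel) = 1" .
  qed (use J Bn Bz in auto)
qed

subsection \<open>Convolution with a test function\<close>

text \<open>All derivatives fall on \<eta>, while f is merely integrable. The remainder quotient
  \<open>q\<close> is bounded by \<open>L + L'\<close> uniformly in h and y and tends to 0
  pointwise, so dominated convergence with majorant (L + L') |f| applies.\<close>

lemma convolution_has_derivative: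
  fixes f :: "real^'n \<Rightarrow> real"
  assumes f: "integrable lborel f" and \<eta>: "\<eta> \<in> test_functions"
  shows "((\<lambda>x. LINT y|lborel. f y * \<eta> (x - y)) has_derivative
    (\<lambda>h. \<Sum>i\<in>UNIV. h $ i * (LINT y|lborel. f y * partial_deriv i \<eta> (x - y)))) (at x)"
proof -
  have int: "integrable lborel (\<lambda>y. f y * g (x - y))" if g: "g \<in> test_functions" for g x
  proof -
    obtain B where B: "\<And>x. \<bar>g x\<bar> \<le> B" using test_function_bounded[OF g] by blast
    have [measurable]: "g \<in> borel_measurable borel" using g by (rule test_function_measurable)
    have [measurable]: "f \<in> borel_measurable borel" using f by auto
    have "norm (f y * g (x - y)) \<le> norm (B * f y)" for y
    proof -
      have "\<bar>f y\<bar> * \<bar>g (x - y)\<bar> \<le> \<bar>f y\<bar> * B" using B by (intro mult_left_mono) auto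
      then show ?thesis using order_trans[OF abs_ge_zero B] by (simp add: abs_mult mult.commute)
    qed
    then have "AE y in lborel. norm (f y * g (x - y)) \<le> norm (B * f y)" by simp
    from Bochner_Integration.integrable_bound[OF _ _ this] show ?thesis using f by simp
  qed
  obtain L where L: "0 \<le> L" "\<And>x y. \<bar>\<eta> x - \<eta> y\<bar> \<le> L * norm (x - y)"
    using test_function_Lipschitz[OF \<eta>] by blast
  obtain L' where L': "0 \<le> L'" "\<And>x h. \<bar>\<Sum>i\<in>UNIV. h $ i * partial_deriv i \<eta> x\<bar> \<le> L' * norm h"
    using test_function_deriv_bounded[OF \<eta>] by blast
  define q where "q h y = (\<eta> (x - y + h) - \<eta> (x - y) - (\<Sum>i\<in>UNIV. h $ i * partial_deriv i \<eta> (x - y))) / norm h" for h y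
  have [measurable]: "\<eta> \<in> borel_measurable borel" "\<And>i. partial_deriv i \<eta> \<in> borel_measurable borel"
    using \<eta> by (auto intro: test_function_measurable test_function_partial_deriv)
  have [measurable]: "f \<in> borel_measurable borel" using f by auto
  have qb: "\<bar>q h y\<bar> \<le> L + L'" if "h \<noteq> 0" for h y
  proof -
    have "\<bar>\<eta> (x - y + h) - \<eta> (x - y) - (\<Sum>i\<in>UNIV. h $ i * partial_deriv i \<eta> (x - y))\<bar> \<le> L * norm h + L' * norm h"
      using L(2)[of "x - y + h" "x - y"] L'(2)[of h "x - y"] by simp
    then show ?thesis using that by (simp add: q_def field_simps)
  qed
  have q0: "((\<lambda>h. q h y) \<longlongrightarrow> 0) (at 0)" for y
  proof -
    have "((\<lambda>h. norm (q h y)) \<longlongrightarrow> 0) (at 0)"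
      using test_function_has_derivative[OF \<eta>, of "x - y"] unfolding has_derivative_at q_def by simp
    then show ?thesis by (simp only: tendsto_norm_zero_iff)
  qed
  have "bounded_linear (\<lambda>h. \<Sum>i\<in>UNIV. h $ i * (LINT y|lborel. f y * partial_deriv i \<eta> (x - y)))"
    by (intro bounded_linear_sum bounded_linear_mult_const bounded_linear_vec_nth)
  moreover have "((\<lambda>h. norm ((LINT y|lborel. f y * \<eta> (x + h - y)) - (LINT y|lborel. f y * \<eta> (x - y)) -
      (\<Sum>i\<in>UNIV. h $ i * (LINT y|lborel. f y * partial_deriv i \<eta> (x - y)))) / norm h) \<longlongrightarrow> 0) (at 0)"
    unfolding tendsto_at_iff_sequentially
  proof (intro allI impI)
    fix X :: "nat \<Rightarrow> real^'n" assume X: "\<forall>i. X i \<in> UNIV - {0}" "X \<longlonglongrightarrow> 0"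
    have eq: "norm ((LINT y|lborel. f y * \<eta> (x + h - y)) - (LINT y|lborel. f y * \<eta> (x - y)) -
      (\<Sum>i\<in>UNIV. h $ i * (LINT y|lborel. f y * partial_deriv i \<eta> (x - y)))) / norm h
      = norm (LINT y|lborel. f y * q h y)" for h
    proof -
      have "(LINT y|lborel. f y * q h y) = (LINT y|lborel. (f y * \<eta> (x + h - y) - f y * \<eta> (x - y)
          - (\<Sum>i\<in>UNIV. h $ i * (f y * partial_deriv i \<eta> (x - y)))) / norm h)"
        by (intro Bochner_Integration.integral_cong)
           (auto simp: q_def algebra_simps sum_distrib_left diff_divide_distrib add_divide_distrib)
      also have "\<dots> = ((LINT y|lborel. f y * \<eta> (x + h - y)) - (LINT y|lborel. f y * \<eta> (x - y)) -
        (\<Sum>i\<in>UNIV. h $ i * (LINT y|lborel. f y * partial_deriv i \<eta> (x - y)))) / norm h"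
        using int[OF \<eta>] int[OF test_function_partial_deriv[OF \<eta>]]
        by (simp add: Bochner_Integration.integral_diff Bochner_Integration.integral_sum)
      finally show ?thesis by simp
    qed
    have "(\<lambda>k. LINT y|lborel. f y * q (X k) y) \<longlonglongrightarrow> (LINT y|(lborel :: (real^'n) measure). (0 :: real))"
    proof (rule integral_dominated_convergence[where w="\<lambda>y. (L + L') * \<bar>f y\<bar>"])
      show "integrable lborel (\<lambda>y. (L + L') * \<bar>f y\<bar>)" using f by auto
      show "AE y in lborel. (\<lambda>k. f y * q (X k) y) \<longlonglongrightarrow> 0"
      proof (rule AE_I2)
        fix y
        have "(\<lambda>k. q (X k) y) \<longlonglongrightarrow> 0"
          using q0[of y] X unfolding tendsto_at_iff_sequentially by (auto simp: comp_def)
        from tendsto_mult_right_zero[OF this] show "(\<lambda>k. f y * q (X k) y) \<longlonglongrightarrow> 0" .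
      qed
      show "AE y in lborel. norm (f y * q (X k) y) \<le> (L + L') * \<bar>f y\<bar>" for k
        using X qb[of "X k"] by (intro AE_I2) (auto simp: abs_mult mult.commute[of "L + L'"] intro!: mult_left_mono)
    qed (simp_all add: q_def)
    then have "(\<lambda>k. norm (LINT y|lborel. f y * q (X k) y)) \<longlonglongrightarrow> 0"
      by (intro tendsto_norm_zero) simp
    then show "((\<lambda>h. norm ((LINT y|lborel. f y * \<eta> (x + h - y)) - (LINT y|lborel. f y * \<eta> (x - y)) -
      (\<Sum>i\<in>UNIV. h $ i * (LINT y|lborel. f y * partial_deriv i \<eta> (x - y)))) / norm h) \<circ> X) \<longlonglongrightarrow> 0"
      unfolding eq comp_def .
  qed
  ultimately show ?thesis unfolding has_derivative_at by simp
qed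

lemma convolution_test_function:
  fixes f :: "real^'n \<Rightarrow> real"
  assumes f: "integrable lborel f" "\<And>x. R \<le> norm x \<Longrightarrow> f x = 0" and \<eta>: "\<eta> \<in> test_functions"
  shows "(\<lambda>x. LINT y|lborel. f y * \<eta> (x - y)) \<in> test_functions"
proof -
  have "\<eta> \<in> test_functions \<Longrightarrow> continuously_differentiable k (\<lambda>x. LINT y|lborel. f y * \<eta> (x - y))" for k \<eta>
  proof (induction k arbitrary: \<eta>)
    case 0
    then show ?case
      by (auto intro!: continuous_at_imp_continuous_on has_derivative_continuous[OF convolution_has_derivative[OF f(1)]])
  next
    case (Suc k)
    note D = convolution_has_derivative[OF f(1) Suc.prems]
    have "partial_deriv i (\<lambda>x. LINT y|lborel. f y * \<eta> (x - y)) = (\<lambda>x. LINT y|lborel. f y * partial_deriv i \<eta> (x - y))" for i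
      unfolding partial_deriv_def[of i "\<lambda>x. LINT y|lborel. f y * \<eta> (x - y)", abs_def] frechet_derivative_at[OF D, symmetric]
      by (simp add: axis_def if_distrib[where f="\<lambda>x. x * _"] cong: if_cong)
    then show ?case
      using Suc.IH[OF test_function_partial_deriv[OF Suc.prems]] differentiableI[OF D]
      unfolding continuously_differentiable_Suc by simp
  qed
  moreover obtain R' where R': "\<And>x. R' \<le> norm x \<Longrightarrow> \<eta> x = 0" using test_function_support[OF \<eta>] by blast
  moreover have "(LINT y|lborel. f y * \<eta> (x - y)) = 0" if "R + R' \<le> norm x" for x
  proof -
    have "f y * \<eta> (x - y) = 0" for y
    proof (cases "R \<le> norm y")
      case False
      then have "R' \<le> norm (x - y)" using that norm_triangle_ineq[of "x - y" y] by simp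
      then show ?thesis using R' by simp
    qed (simp add: f(2))
    then show ?thesis by (simp only: lebesgue_integral_const scaleR_zero_right mult_zero_right)
  qed
  ultimately show ?thesis using \<eta> by (intro test_functionI[where R="R + R'"]) auto
qed

section \<open>Cauchy--Schwarz with a weight\<close>

lemma nn_integral_weighted_Cauchy_Schwarz:
  fixes w g :: "'a \<Rightarrow> real"
  assumes [measurable]: "w \<in> borel_measurable M" "g \<in> borel_measurable M" and w: "\<And>x. 0 \<le> w x"
  shows "(\<integral>\<^sup>+x. ennreal (w x * \<bar>g x\<bar>) \<partial>M)\<^sup>2 \<le> (\<integral>\<^sup>+x. ennreal (w x) \<partial>M) * (\<integral>\<^sup>+x. ennreal (w x * (g x)\<^sup>2) \<partial>M)"
proof -
  have "(\<integral>\<^sup>+x. ennreal (sqrt (w x)) * ennreal (sqrt (w x) * \<bar>g x\<bar>) \<partial>M)\<^sup>2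
    \<le> (\<integral>\<^sup>+x. (ennreal (sqrt (w x)))\<^sup>2 \<partial>M) * (\<integral>\<^sup>+x. (ennreal (sqrt (w x) * \<bar>g x\<bar>))\<^sup>2 \<partial>M)"
    by (rule Cauchy_Schwarz_nn_integral) measurable
  also have "(\<integral>\<^sup>+x. ennreal (sqrt (w x)) * ennreal (sqrt (w x) * \<bar>g x\<bar>) \<partial>M) = (\<integral>\<^sup>+x. ennreal (w x * \<bar>g x\<bar>) \<partial>M)"
    using w by (intro nn_integral_cong) (simp add: ennreal_mult[symmetric] mult.assoc[symmetric])
  also have "(\<integral>\<^sup>+x. (ennreal (sqrt (w x)))\<^sup>2 \<partial>M) = (\<integral>\<^sup>+x. ennreal (w x) \<partial>M)"
    using w by (intro nn_integral_cong) (simp add: ennreal_power)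
  also have "(\<integral>\<^sup>+x. (ennreal (sqrt (w x) * \<bar>g x\<bar>))\<^sup>2 \<partial>M) = (\<integral>\<^sup>+x. ennreal (w x * (g x)\<^sup>2) \<partial>M)"
    using w by (intro nn_integral_cong) (simp add: ennreal_power power_mult_distrib)
  finally show ?thesis .
qed

text \<open>The non-integrable case is included: the Bochner integral is then 0 by convention. With
  a weight of mass 1 this is Jensen's inequality for the square.\<close>

lemma integral_weighted_Cauchy_Schwarz:
  fixes w g :: "'a \<Rightarrow> real"
  assumes [measurable]: "w \<in> borel_measurable M" "g \<in> borel_measurable M" and w: "\<And>x. 0 \<le> w x"
  shows "ennreal ((LINT x|M. w x * g x)\<^sup>2) \<le> (\<integral>\<^sup>+x. ennreal (w x) \<partial>M) * (\<integral>\<^sup>+x. ennreal (w x * (g x)\<^sup>2) \<partial>M)"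
proof (cases "integrable M (\<lambda>x. w x * g x)")
  case True
  have "ennreal \<bar>LINT x|M. w x * g x\<bar> \<le> (\<integral>\<^sup>+x. ennreal (w x * \<bar>g x\<bar>) \<partial>M)"
    using integral_norm_bound_ennreal[OF True] w by (simp add: abs_mult)
  then have "(ennreal \<bar>LINT x|M. w x * g x\<bar>)\<^sup>2 \<le> (\<integral>\<^sup>+x. ennreal (w x * \<bar>g x\<bar>) \<partial>M)\<^sup>2"
    by (rule power_mono) simp
  also have "\<dots> \<le> (\<integral>\<^sup>+x. ennreal (w x) \<partial>M) * (\<integral>\<^sup>+x. ennreal (w x * (g x)\<^sup>2) \<partial>M)"
    by (rule nn_integral_weighted_Cauchy_Schwarz) (use w in auto)
  finally show ?thesis by (simp add: ennreal_power)
qed (simp add: not_integrable_integral_eq)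

subsection \<open>The Sobolev norm\<close>

definition sq_int :: "('a::euclidean_space \<Rightarrow> real) \<Rightarrow> ennreal" where
  "sq_int u = (\<integral>\<^sup>+x. ennreal ((u x)\<^sup>2) \<partial>lborel)"

lemma ennreal_square_add_le: "ennreal ((a + b)\<^sup>2) \<le> 2 * ennreal (a\<^sup>2) + 2 * ennreal (b\<^sup>2)"
proof -
  have "(a + b)\<^sup>2 \<le> 2 * a\<^sup>2 + 2 * b\<^sup>2"
    using sum_squares_bound[of a b] by (simp add: power2_sum)
  then have "ennreal ((a + b)\<^sup>2) \<le> ennreal (2 * a\<^sup>2 + 2 * b\<^sup>2)" by (rule ennreal_leI)
  also have "\<dots> = 2 * ennreal (a\<^sup>2) + 2 * ennreal (b\<^sup>2)" by (simp add: ennreal_mult)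
  finally show ?thesis .
qed

lemma sq_int_add:
  assumes [measurable]: "u \<in> borel_measurable borel" "v \<in> borel_measurable borel"
  shows "sq_int (\<lambda>x. u x + v x) \<le> 2 * sq_int u + 2 * sq_int v"
proof -
  have "sq_int (\<lambda>x. u x + v x) \<le> (\<integral>\<^sup>+x. (2 * ennreal ((u x)\<^sup>2) + 2 * ennreal ((v x)\<^sup>2)) \<partial>lborel)"
    unfolding sq_int_def by (intro nn_integral_mono ennreal_square_add_le)
  then show ?thesis by (simp add: sq_int_def nn_integral_add nn_integral_cmult)
qed

lemma diff_sq_eq_sq_int: "diff_sq u h = sq_int (\<lambda>x. u x - u (x - h))"
  by (simp add: diff_sq_def sq_int_def)

lemma sq_int_shift:
  assumes [measurable]: "u \<in> borel_measurable borel"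
  shows "sq_int (\<lambda>x. u (x - h)) = sq_int u"
  unfolding sq_int_def by (rule nn_integral_shift(3)[of "\<lambda>x. ennreal ((u x)\<^sup>2)"]) simp

lemma sq_int_uminus: "sq_int (\<lambda>x. - u x) = sq_int u"
  by (simp add: sq_int_def)

lemma diff_sq_le_sq_int:
  assumes [measurable]: "u \<in> borel_measurable borel"
  shows "diff_sq u h \<le> 4 * sq_int u"
proof -
  have "diff_sq u h \<le> 2 * sq_int u + 2 * sq_int (\<lambda>x. - u (x - h))"
    unfolding diff_sq_eq_sq_int using sq_int_add[of u "\<lambda>x. - u (x - h)"] by simp
  also have "\<dots> = 4 * sq_int u"
    by (simp add: sq_int_uminus sq_int_shift distrib_right[symmetric])
  finally show ?thesis .
qed

lemma diff_sq_add_fun: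
  assumes [measurable]: "u \<in> borel_measurable borel" "v \<in> borel_measurable borel"
  shows "diff_sq (\<lambda>x. u x + v x) h \<le> 2 * diff_sq u h + 2 * diff_sq v h"
proof -
  have "diff_sq (\<lambda>x. u x + v x) h = sq_int (\<lambda>x. (u x - u (x - h)) + (v x - v (x - h)))"
    unfolding diff_sq_eq_sq_int by (simp add: algebra_simps)
  also have "\<dots> \<le> 2 * diff_sq u h + 2 * diff_sq v h"
    unfolding diff_sq_eq_sq_int by (rule sq_int_add) measurable
  finally show ?thesis .
qed

lemma gag_add:
  fixes u v :: "real^'n \<Rightarrow> real"
  assumes [measurable]: "u \<in> borel_measurable borel" "v \<in> borel_measurable borel"
  shows "gag s (\<lambda>x. u x + v x) \<le> 2 * gag s u + 2 * gag s v"
proof -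
  have "gag s (\<lambda>x. u x + v x) \<le> (\<integral>\<^sup>+h. (2 * (diff_sq u h * ennreal (norm h powr - (real CARD('n) + 2 * s)))
      + 2 * (diff_sq v h * ennreal (norm h powr - (real CARD('n) + 2 * s)))) \<partial>lborel)"
    unfolding gag_def
  proof (rule nn_integral_mono)
    fix h :: "real^'n"
    show "diff_sq (\<lambda>x. u x + v x) h * ennreal (norm h powr - (real CARD('n) + 2 * s))
      \<le> 2 * (diff_sq u h * ennreal (norm h powr - (real CARD('n) + 2 * s)))
      + 2 * (diff_sq v h * ennreal (norm h powr - (real CARD('n) + 2 * s)))"
      using mult_right_mono[OF diff_sq_add_fun[OF assms, of h], of "ennreal (norm h powr - (real CARD('n) + 2 * s))"]
      by (simp add: distrib_right mult.assoc)
  qed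
  also have "\<dots> = 2 * gag s u + 2 * gag s v"
    unfolding gag_def by (subst nn_integral_add) (simp_all add: nn_integral_cmult)
  finally show ?thesis .
qed

text \<open>The squared norm over \<open>lborel\<close>. Borel representatives keep Tonelli and
  translations at hand; \<open>Sobolev_norm_sq_eq_sob\<close> and
  \<open>Sobolev_norm_sq_cong\<close> lead back to Lebesgue measurable functions.\<close>

definition sob :: "real \<Rightarrow> (real^'n \<Rightarrow> real) \<Rightarrow> ennreal" where
  "sob s u = sq_int u + gag s u"

lemma sob_add:
  fixes u v :: "real^'n \<Rightarrow> real"
  assumes "u \<in> borel_measurable borel" "v \<in> borel_measurable borel"
  shows "sob s (\<lambda>x. u x + v x) \<le> 2 * sob s u + 2 * sob s v"
  using add_mono[OF sq_int_add[OF assms] gag_add[OF assms, of s]]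
  by (simp add: sob_def algebra_simps)

lemma sob_minus_commute: "sob s (\<lambda>x. u x - v x) = sob s (\<lambda>x. v x - u x)"
proof -
  have e: "(v x - u x - (v y - u y))\<^sup>2 = (u x - v x - (u y - v y))\<^sup>2" for x y
    by (simp add: power2_eq_square algebra_simps)
  show ?thesis
    unfolding sob_def sq_int_def gag_def diff_sq_def e power2_commute[of "v _"] ..
qed

section \<open>Integrals of powers of the norm\<close>

lemma nn_integral_radial:
  fixes F :: "real \<Rightarrow> ennreal"
  assumes [measurable]: "F \<in> borel_measurable borel"
  shows "(\<integral>\<^sup>+x. F (norm (x :: real^'n)) \<partial>lborel) = emeasure (surface_measure :: (real^'n) measure) (sphere 0 1)
    * (\<integral>\<^sup>+r. F r * ennreal (r ^ (CARD('n) - 1)) * indicator {0<..} r \<partial>lborel)"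
proof -
  have "(\<integral>\<^sup>+x. F (norm (x :: real^'n)) \<partial>lborel) = (\<integral>\<^sup>+\<theta>. (\<integral>\<^sup>+r. F (norm (r *\<^sub>R (\<theta> :: real^'n))) * ennreal (r ^ (CARD('n) - 1)) * indicator {0<..} r \<partial>lborel) \<partial>surface_measure)"
    by (rule nn_integral_polar) measurable
  also have "\<dots> = (\<integral>\<^sup>+\<theta>. (\<integral>\<^sup>+r. F r * ennreal (r ^ (CARD('n) - 1)) * indicator {0<..} r \<partial>lborel) \<partial>(surface_measure :: (real^'n) measure))"
    by (intro nn_integral_cong) (auto simp: indicator_def)
  finally show ?thesis by (simp add: mult.commute)
qed

definition sphere_area :: "'n::finite itself \<Rightarrow> real" where
  "sphere_area _ = measure (surface_measure :: (real^'n) measure) (sphere 0 1)"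

lemma sphere_area_nonneg [simp]: "0 \<le> sphere_area TYPE('n::finite)"
  by (simp add: sphere_area_def)

lemma emeasure_sphere_area: "emeasure (surface_measure :: (real^'n) measure) (sphere 0 1) = ennreal (sphere_area TYPE('n))"
  unfolding sphere_area_def by (rule surface.emeasure_eq_measure)

lemma powr_times_radius:
  assumes "0 < r"
  shows "r powr a * r ^ (CARD('n::finite) - 1) = r powr (a + real CARD('n) - 1)"
proof -
  have "r ^ (CARD('n) - 1) = r powr real (CARD('n) - 1)" by (rule powr_realpow[OF assms, symmetric])
  then show ?thesis by (simp add: powr_add[symmetric] of_nat_diff Suc_leI add_diff_eq)
qed

lemma nn_integral_norm_powr_tail:
  assumes "0 < a" "0 < c"
  shows "(\<integral>\<^sup>+x. ennreal (norm (x :: real^'n) powr (- real CARD('n) - a)) * indicator (- ball 0 c) x \<partial>lborel)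
    = ennreal (sphere_area TYPE('n) * (c powr (- a) / a))"
proof -
  have "(\<integral>\<^sup>+x. ennreal (norm (x :: real^'n) powr (- real CARD('n) - a)) * indicator (- ball 0 c) x \<partial>lborel)
    = (\<integral>\<^sup>+x. ennreal (norm (x :: real^'n) powr (- real CARD('n) - a)) * indicator {c..} (norm x) \<partial>lborel)"
    by (intro nn_integral_cong) (auto simp: indicator_def)
  also have "\<dots> = ennreal (sphere_area TYPE('n)) * (\<integral>\<^sup>+r. ennreal (r powr (- real CARD('n) - a)) * indicator {c..} r * ennreal (r ^ (CARD('n) - 1)) * indicator {0<..} r \<partial>lborel)"
    by (subst nn_integral_radial) (simp_all add: emeasure_sphere_area)
  also have "(\<integral>\<^sup>+r. ennreal (r powr (- real CARD('n) - a)) * indicator {c..} r * ennreal (r ^ (CARD('n) - 1)) * indicator {0<..} r \<partial>lborel)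
    = (\<integral>\<^sup>+r. ennreal (r powr (- 1 - a)) * indicator {c..} r \<partial>lborel)"
  proof (rule nn_integral_cong)
    fix r :: real
    show "ennreal (r powr (- real CARD('n) - a)) * indicator {c..} r * ennreal (r ^ (CARD('n) - 1)) * indicator {0<..} r
      = ennreal (r powr (- 1 - a)) * indicator {c..} r"
    proof (cases "c \<le> r")
      case True
      then have r: "0 < r" using assms by simp
      have "r powr (- real CARD('n) - a) * r ^ (CARD('n) - 1) = r powr (- 1 - a)"
        unfolding powr_times_radius[OF r] by (rule arg_cong[where f="\<lambda>x. r powr x"]) simp
      then show ?thesis using True r by (simp add: ennreal_mult[symmetric])
    qed simp
  qed
  also have "\<dots> = ennreal (c powr (- a) / a)" by (rule nn_integral_powr_tail) fact+
  finally show ?thesis using assms by (simp add: ennreal_mult[symmetric])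
qed

lemma nn_integral_norm_powr_head:
  assumes "0 < a" "0 \<le> c"
  shows "(\<integral>\<^sup>+x. ennreal (norm (x :: real^'n) powr (a - real CARD('n))) * indicator (cball 0 c) x \<partial>lborel)
    = ennreal (sphere_area TYPE('n) * (c powr a / a))"
proof -
  have "(\<integral>\<^sup>+x. ennreal (norm (x :: real^'n) powr (a - real CARD('n))) * indicator (cball 0 c) x \<partial>lborel)
    = (\<integral>\<^sup>+x. ennreal (norm (x :: real^'n) powr (a - real CARD('n))) * indicator {0..c} (norm x) \<partial>lborel)"
    by (intro nn_integral_cong) (auto simp: indicator_def)
  also have "\<dots> = ennreal (sphere_area TYPE('n)) * (\<integral>\<^sup>+r. ennreal (r powr (a - real CARD('n))) * indicator {0..c} r * ennreal (r ^ (CARD('n) - 1)) * indicator {0<..} r \<partial>lborel)"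
    by (subst nn_integral_radial) (simp_all add: emeasure_sphere_area)
  also have "(\<integral>\<^sup>+r. ennreal (r powr (a - real CARD('n))) * indicator {0..c} r * ennreal (r ^ (CARD('n) - 1)) * indicator {0<..} r \<partial>lborel)
    = (\<integral>\<^sup>+r. ennreal (r powr (a - 1)) * indicator {0..c} r \<partial>lborel)"
  proof (rule nn_integral_cong)
    fix r :: real
    show "ennreal (r powr (a - real CARD('n))) * indicator {0..c} r * ennreal (r ^ (CARD('n) - 1)) * indicator {0<..} r
      = ennreal (r powr (a - 1)) * indicator {0..c} r"
    proof (cases "0 < r \<and> r \<le> c")
      case True
      then have r: "0 < r" by simp
      have "r powr (a - real CARD('n)) * r ^ (CARD('n) - 1) = r powr (a - 1)"
        unfolding powr_times_radius[OF r] by (rule arg_cong[where f="\<lambda>x. r powr x"]) simp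
      then show ?thesis using True r by (simp add: ennreal_mult[symmetric])
    next
      case False
      then show ?thesis by (cases "r = 0") auto
    qed
  qed
  also have "\<dots> = ennreal (c powr (a - 1 + 1) / (a - 1 + 1))" by (rule nn_integral_powr_head) (use assms in auto)
  finally show ?thesis using assms by (simp add: ennreal_mult[symmetric])
qed

subsection \<open>Cutoff\<close>

text \<open>Lipschitz with constant 1 / R is enough here: smoothness is supplied afterwards by
  mollification.\<close>

definition cutoff :: "real \<Rightarrow> real^'n \<Rightarrow> real" where
  "cutoff R x = max 0 (min 1 (2 - norm x / R))"

lemma cutoff_bounds: "0 \<le> cutoff R x" "cutoff R x \<le> 1"
  by (auto simp: cutoff_def)

lemma cutoff_eq_1: "norm x \<le> R \<Longrightarrow> 0 < R \<Longrightarrow> cutoff R x = 1"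
  by (simp add: cutoff_def field_simps)

lemma cutoff_eq_0: "2 * R \<le> norm x \<Longrightarrow> 0 < R \<Longrightarrow> cutoff R x = 0"
  by (simp add: cutoff_def field_simps)

lemma measurable_cutoff [measurable]: "cutoff R \<in> borel_measurable borel"
  unfolding cutoff_def[abs_def] by measurable

lemma cutoff_diff:
  assumes "0 < R"
  shows "\<bar>cutoff R x - cutoff R y\<bar> \<le> min 1 (norm (x - y) / R)"
proof -
  have "\<bar>cutoff R x - cutoff R y\<bar> \<le> \<bar>norm x / R - norm y / R\<bar>" by (simp add: cutoff_def)
  also have "\<dots> = \<bar>norm x - norm y\<bar> / R" using assms by (simp add: diff_divide_distrib[symmetric])
  also have "\<dots> \<le> norm (x - y) / R" using assms norm_triangle_ineq3[of x y] by (intro divide_right_mono) auto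
  finally show ?thesis using cutoff_bounds[of R x] cutoff_bounds[of R y] by linarith
qed

lemma cutoff_tendsto:
  "(\<lambda>k. cutoff (real (Suc k)) x) \<longlonglongrightarrow> 1"
proof (rule tendsto_eventually)
  show "eventually (\<lambda>k. cutoff (real (Suc k)) x = 1) sequentially"
    using eventually_ge_at_top[of "nat \<lceil>norm x\<rceil>"]
  proof eventually_elim
    case (elim k)
    then have "norm x \<le> real (Suc k)" using real_nat_ceiling_ge[of "norm x"] by linarith
    then show ?case by (rule cutoff_eq_1) simp
  qed
qed

text \<open>Near the origin the integrand is |h|^(2-2s-n), integrable because s < 1; at infinity it
  is |h|^(-n-2s), integrable because s > 0.\<close>

lemma nn_integral_min_norm_finite:
  assumes s: "0 < s" "s < 1"
  shows "(\<integral>\<^sup>+h. ennreal ((min 1 (norm (h :: real^'n)))\<^sup>2 * norm h powr - (real CARD('n) + 2 * s)) \<partial>lborel) < \<infinity>"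
proof -
  let ?n = "real CARD('n)"
  have "(\<integral>\<^sup>+h. ennreal ((min 1 (norm (h :: real^'n)))\<^sup>2 * norm h powr - (?n + 2 * s)) \<partial>lborel)
    \<le> (\<integral>\<^sup>+h. (ennreal (norm (h :: real^'n) powr ((2 - 2 * s) - ?n)) * indicator (cball 0 1) h
       + ennreal (norm h powr (- ?n - 2 * s)) * indicator (- ball 0 1) h) \<partial>lborel)"
  proof (rule nn_integral_mono)
    fix h :: "real^'n"
    have "norm h ^ 2 * norm h powr - (?n + 2 * s) = norm h powr ((2 - 2 * s) - ?n)" if "h \<noteq> 0"
    proof -
      have "norm h ^ 2 = norm h powr 2" using that by simp
      then have "norm h ^ 2 * norm h powr - (?n + 2 * s) = norm h powr (2 + - (?n + 2 * s))"
        by (simp only: powr_add)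
      also have "2 + - (?n + 2 * s) = (2 - 2 * s) - ?n" by simp
      finally show ?thesis .
    qed
    moreover have "- (?n + 2 * s) = - ?n - 2 * s" by simp
    ultimately show "ennreal ((min 1 (norm h))\<^sup>2 * norm h powr - (?n + 2 * s))
      \<le> ennreal (norm h powr ((2 - 2 * s) - ?n)) * indicator (cball 0 1) h
       + ennreal (norm h powr (- ?n - 2 * s)) * indicator (- ball 0 1) h"
      by (cases "h = 0"; cases "norm h \<le> 1") (auto simp: indicator_def min_def)
  qed
  also have "\<dots> = ennreal (sphere_area TYPE('n) * (1 powr (2 - 2 * s) / (2 - 2 * s))) + ennreal (sphere_area TYPE('n) * (1 powr (- (2 * s)) / (2 * s)))"
  proof (subst nn_integral_add)
    show "(\<integral>\<^sup>+h. ennreal (norm (h :: real^'n) powr ((2 - 2 * s) - ?n)) * indicator (cball 0 1) h \<partial>lborel)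
      + (\<integral>\<^sup>+h. ennreal (norm (h :: real^'n) powr (- ?n - 2 * s)) * indicator (- ball 0 1) h \<partial>lborel)
      = ennreal (sphere_area TYPE('n) * (1 powr (2 - 2 * s) / (2 - 2 * s))) + ennreal (sphere_area TYPE('n) * (1 powr (- (2 * s)) / (2 * s)))"
      using s by (intro arg_cong2[where f="(+)"] nn_integral_norm_powr_head nn_integral_norm_powr_tail) auto
    have [measurable]: "cball (0 :: real^'n) 1 \<in> sets borel" "- ball (0 :: real^'n) 1 \<in> sets borel" by auto
    show "(\<lambda>h. ennreal (norm (h :: real^'n) powr ((2 - 2 * s) - ?n)) * indicator (cball 0 1) h) \<in> borel_measurable lborel"
      "(\<lambda>h. ennreal (norm (h :: real^'n) powr (- ?n - 2 * s)) * indicator (- ball 0 1) h) \<in> borel_measurable lborel"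
      by measurable
  qed
  also have "\<dots> < \<infinity>" by simp
  finally show ?thesis .
qed

text \<open>With c = 1 - cutoff, the discrete product rule splits c(x) u(x) - c(x-h) u(x-h) into
  c(x) (u(x) - u(x-h)) and (c(x) - c(x-h)) u(x-h). The first part is dominated by the Gagliardo
  integrand of u, the second by its L^2 norm times the integral of the squared increment bound of
  the cutoff against the singular weight; both tend to 0.\<close>

lemma sob_cutoff_tendsto:
  fixes u :: "real^'n \<Rightarrow> real"
  assumes u[measurable]: "u \<in> borel_measurable borel" and fin: "sob s u < \<infinity>" and s: "0 < s" "s < 1"
  shows "(\<lambda>k. sob s (\<lambda>x. (1 - cutoff (real (Suc k)) x) * u x)) \<longlonglongrightarrow> 0"
proof -
  let ?n = "real CARD('n)"
  define c :: "nat \<Rightarrow> real^'n \<Rightarrow> real" where "c k x = 1 - cutoff (real (Suc k)) x" for k x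
  have cb: "0 \<le> c k x" "c k x \<le> 1" for k x using cutoff_bounds[of "real (Suc k)" x] by (auto simp: c_def)
  have c0: "(\<lambda>k. c k x) \<longlonglongrightarrow> 0" for x
    using tendsto_diff[OF tendsto_const[of 1] cutoff_tendsto[of x]] by (simp add: c_def)
  have [measurable]: "c k \<in> borel_measurable borel" for k unfolding c_def[abs_def] by measurable
  have sq_fin: "sq_int u < \<infinity>" and gag_fin: "gag s u < \<infinity>"
    using fin by (auto simp: sob_def ennreal_add_less_top)
  have mult_le: "ennreal ((c k x * a)\<^sup>2) \<le> ennreal (a\<^sup>2)" for k x a
  proof -
    have "(c k x)\<^sup>2 \<le> 1" using cb[of k x] by (simp add: power_le_one)
    then have "(c k x)\<^sup>2 * a\<^sup>2 \<le> 1 * a\<^sup>2" by (intro mult_right_mono) auto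
    then show ?thesis by (simp add: power_mult_distrib ennreal_leI)
  qed
  have lim: "(\<lambda>k. ennreal ((c k x * a)\<^sup>2)) \<longlonglongrightarrow> 0" for x a
  proof -
    have "(\<lambda>k. ennreal ((c k x * a)\<^sup>2)) \<longlonglongrightarrow> ennreal ((0 * a)\<^sup>2)"
      by (intro tendsto_ennrealI tendsto_power tendsto_mult c0 tendsto_const)
    then show ?thesis by simp
  qed
  have 1: "(\<lambda>k. sq_int (\<lambda>x. c k x * u x)) \<longlonglongrightarrow> 0"
  proof -
    have "(\<lambda>k. \<integral>\<^sup>+x. ennreal ((c k x * u x)\<^sup>2) \<partial>lborel) \<longlonglongrightarrow> (\<integral>\<^sup>+x. 0 \<partial>(lborel :: (real^'n) measure))"
      by (rule nn_integral_dominated_convergence[where w="\<lambda>x. ennreal ((u x)\<^sup>2)"])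
         (use sq_fin mult_le lim in \<open>auto simp: sq_int_def\<close>)
    then show ?thesis by (simp add: sq_int_def)
  qed
  define g where "g k h = (\<integral>\<^sup>+x. ennreal ((c k x * (u x - u (x - h)))\<^sup>2) \<partial>lborel)" for k h
  have [measurable]: "g k \<in> borel_measurable borel" for k unfolding g_def[abs_def] by measurable
  have g_le: "g k h \<le> diff_sq u h" for k h
    unfolding g_def diff_sq_def by (intro nn_integral_mono mult_le)
  have diff_fin: "diff_sq u h < \<infinity>" for h
    using diff_sq_le_sq_int[OF u, of h] sq_fin by (auto simp: ennreal_mult_less_top intro: le_less_trans)
  have g0: "(\<lambda>k. g k h) \<longlonglongrightarrow> 0" for h
  proof -
    have "(\<lambda>k. \<integral>\<^sup>+x. ennreal ((c k x * (u x - u (x - h)))\<^sup>2) \<partial>lborel) \<longlonglongrightarrow> (\<integral>\<^sup>+x. 0 \<partial>(lborel :: (real^'n) measure))"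
      by (rule nn_integral_dominated_convergence[where w="\<lambda>x. ennreal ((u x - u (x - h))\<^sup>2)"])
         (use diff_fin[of h] mult_le lim in \<open>auto simp: diff_sq_def\<close>)
    then show ?thesis by (simp add: g_def)
  qed
  have 2: "(\<lambda>k. \<integral>\<^sup>+h. g k h * ennreal (norm h powr - (?n + 2 * s)) \<partial>lborel) \<longlonglongrightarrow> 0"
  proof -
    have "(\<lambda>k. \<integral>\<^sup>+h. g k h * ennreal (norm h powr - (?n + 2 * s)) \<partial>lborel) \<longlonglongrightarrow> (\<integral>\<^sup>+h. 0 \<partial>(lborel :: (real^'n) measure))"
    proof (rule nn_integral_dominated_convergence[where w="\<lambda>h. diff_sq u h * ennreal (norm h powr - (?n + 2 * s))"])
      show "AE h in lborel. g k h * ennreal (norm h powr - (?n + 2 * s)) \<le> diff_sq u h * ennreal (norm h powr - (?n + 2 * s))" for k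
        by (intro AE_I2 mult_right_mono g_le) simp
      show "(\<integral>\<^sup>+h. diff_sq u h * ennreal (norm h powr - (?n + 2 * s)) \<partial>lborel) < \<infinity>"
        using gag_fin by (simp add: gag_def)
      show "AE h in lborel. (\<lambda>k. g k h * ennreal (norm h powr - (?n + 2 * s))) \<longlonglongrightarrow> 0"
      proof (rule AE_I2)
        fix h :: "real^'n"
        have "(\<lambda>k. ennreal (norm h powr - (?n + 2 * s)) * g k h) \<longlonglongrightarrow> ennreal (norm h powr - (?n + 2 * s)) * 0"
          by (intro ennreal_tendsto_cmult g0) simp
        then show "(\<lambda>k. g k h * ennreal (norm h powr - (?n + 2 * s))) \<longlonglongrightarrow> 0" by (simp add: mult.commute)
      qed
    qed measurable
    then show ?thesis by simp
  qed
  \<comment> \<open>What the increment of the cutoff leaves. The radius \<open>Suc k\<close> is at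
    least 1, so the integrand of \<open>nn_integral_min_norm_finite\<close> dominates all k at
    once.\<close>
  define m where "m k h = ennreal ((min 1 (norm h / real (Suc k)))\<^sup>2 * norm h powr - (?n + 2 * s))" for k and h :: "real^'n"
  have [measurable]: "m k \<in> borel_measurable borel" for k unfolding m_def[abs_def] by measurable
  have 3: "(\<lambda>k. \<integral>\<^sup>+h. m k h \<partial>lborel) \<longlonglongrightarrow> 0"
  proof -
    have "(\<lambda>k. \<integral>\<^sup>+h. m k h \<partial>lborel) \<longlonglongrightarrow> (\<integral>\<^sup>+h. 0 \<partial>(lborel :: (real^'n) measure))"
    proof (rule nn_integral_dominated_convergence[where w="\<lambda>h. ennreal ((min 1 (norm h))\<^sup>2 * norm h powr - (?n + 2 * s))"])
      show "AE h in lborel. m k h \<le> ennreal ((min 1 (norm h))\<^sup>2 * norm h powr - (?n + 2 * s))" for k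
      proof (rule AE_I2)
        fix h :: "real^'n"
        have "norm h / real (Suc k) \<le> norm h / 1" by (intro divide_left_mono) auto
        then have "(min 1 (norm h / real (Suc k)))\<^sup>2 \<le> (min 1 (norm h))\<^sup>2" by (intro power_mono) auto
        then show "m k h \<le> ennreal ((min 1 (norm h))\<^sup>2 * norm h powr - (?n + 2 * s))"
          unfolding m_def by (intro ennreal_leI mult_right_mono) auto
      qed
      show "AE h in lborel. (\<lambda>k. m k h) \<longlonglongrightarrow> 0"
      proof (rule AE_I2)
        fix h :: "real^'n"
        have "(\<lambda>k. norm h / real (Suc k)) \<longlonglongrightarrow> 0"
          by (rule LIMSEQ_Suc[OF lim_const_over_n])
        then have "(\<lambda>k. m k h) \<longlonglongrightarrow> ennreal ((min 1 0)\<^sup>2 * norm h powr - (?n + 2 * s))"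
          unfolding m_def by (intro tendsto_ennrealI tendsto_mult tendsto_power tendsto_min tendsto_const)
        then show "(\<lambda>k. m k h) \<longlonglongrightarrow> 0" by simp
      qed
    qed (use nn_integral_min_norm_finite[OF s, where 'n='n] in auto)
    then show ?thesis by simp
  qed
  have gag_le: "gag s (\<lambda>x. c k x * u x) \<le> 2 * (\<integral>\<^sup>+h. g k h * ennreal (norm h powr - (?n + 2 * s)) \<partial>lborel)
     + 2 * sq_int u * (\<integral>\<^sup>+h. m k h \<partial>lborel)" for k
  proof -
    have "diff_sq (\<lambda>x. c k x * u x) h \<le> 2 * g k h + 2 * sq_int u * ennreal ((min 1 (norm h / real (Suc k)))\<^sup>2)" for h
    proof -
      have "diff_sq (\<lambda>x. c k x * u x) h \<le> (\<integral>\<^sup>+x. (2 * ennreal ((c k x * (u x - u (x - h)))\<^sup>2)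
           + 2 * (ennreal ((u (x - h))\<^sup>2) * ennreal ((min 1 (norm h / real (Suc k)))\<^sup>2))) \<partial>lborel)"
        unfolding diff_sq_def
      proof (rule nn_integral_mono)
        fix x
        have "c k x * u x - c k (x - h) * u (x - h) = c k x * (u x - u (x - h)) + (c k x - c k (x - h)) * u (x - h)"
          by (simp add: algebra_simps)
        then have "ennreal ((c k x * u x - c k (x - h) * u (x - h))\<^sup>2)
          \<le> 2 * ennreal ((c k x * (u x - u (x - h)))\<^sup>2) + 2 * ennreal (((c k x - c k (x - h)) * u (x - h))\<^sup>2)"
          by (simp only: ennreal_square_add_le)
        moreover have "ennreal (((c k x - c k (x - h)) * u (x - h))\<^sup>2) \<le> ennreal ((u (x - h))\<^sup>2) * ennreal ((min 1 (norm h / real (Suc k)))\<^sup>2)"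
        proof -
          have "\<bar>c k x - c k (x - h)\<bar> \<le> \<bar>min 1 (norm h / real (Suc k))\<bar>"
            using cutoff_diff[of "real (Suc k)" x "x - h"] by (simp add: c_def abs_minus_commute)
          then have "(c k x - c k (x - h))\<^sup>2 \<le> (min 1 (norm h / real (Suc k)))\<^sup>2" by (simp only: abs_le_square_iff)
          then have "(c k x - c k (x - h))\<^sup>2 * (u (x - h))\<^sup>2 \<le> (min 1 (norm h / real (Suc k)))\<^sup>2 * (u (x - h))\<^sup>2"
            by (rule mult_right_mono) simp
          then show ?thesis by (simp add: power_mult_distrib ennreal_mult[symmetric] mult.commute ennreal_leI)
        qed
        ultimately show "ennreal ((c k x * u x - c k (x - h) * u (x - h))\<^sup>2)
          \<le> 2 * ennreal ((c k x * (u x - u (x - h)))\<^sup>2) + 2 * (ennreal ((u (x - h))\<^sup>2) * ennreal ((min 1 (norm h / real (Suc k)))\<^sup>2))"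
          by (meson add_left_mono mult_left_mono order_trans zero_le)
      qed
      also have "\<dots> = 2 * g k h + 2 * (sq_int (\<lambda>x. u (x - h)) * ennreal ((min 1 (norm h / real (Suc k)))\<^sup>2))"
        unfolding g_def sq_int_def by (subst nn_integral_add) (simp_all add: nn_integral_cmult nn_integral_multc)
      finally show ?thesis by (simp add: sq_int_shift mult.assoc)
    qed
    from mult_right_mono[OF this]
    have "gag s (\<lambda>x. c k x * u x) \<le> (\<integral>\<^sup>+h. (2 * g k h + 2 * sq_int u * ennreal ((min 1 (norm h / real (Suc k)))\<^sup>2)) * ennreal (norm h powr - (?n + 2 * s)) \<partial>lborel)"
      unfolding gag_def by (intro nn_integral_mono) simp
    also have "\<dots> = (\<integral>\<^sup>+h. (2 * (g k h * ennreal (norm h powr - (?n + 2 * s))) + 2 * sq_int u * m k h) \<partial>lborel)"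
      by (intro nn_integral_cong) (simp add: m_def ennreal_mult distrib_right mult.assoc)
    also have "\<dots> = 2 * (\<integral>\<^sup>+h. g k h * ennreal (norm h powr - (?n + 2 * s)) \<partial>lborel) + 2 * sq_int u * (\<integral>\<^sup>+h. m k h \<partial>lborel)"
      by (subst nn_integral_add) (simp_all add: nn_integral_cmult)
    finally show ?thesis .
  qed
  have "(\<lambda>k. sq_int (\<lambda>x. c k x * u x) + (2 * (\<integral>\<^sup>+h. g k h * ennreal (norm h powr - (?n + 2 * s)) \<partial>lborel)
     + 2 * sq_int u * (\<integral>\<^sup>+h. m k h \<partial>lborel))) \<longlonglongrightarrow> 0 + (2 * 0 + 2 * sq_int u * 0)"
    using sq_fin by (intro tendsto_add ennreal_tendsto_cmult 1 2 3) (auto simp: ennreal_mult_less_top)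
  then have L: "(\<lambda>k. sq_int (\<lambda>x. c k x * u x) + (2 * (\<integral>\<^sup>+h. g k h * ennreal (norm h powr - (?n + 2 * s)) \<partial>lborel)
     + 2 * sq_int u * (\<integral>\<^sup>+h. m k h \<partial>lborel))) \<longlonglongrightarrow> 0" by simp
  have "(\<lambda>k. sob s (\<lambda>x. c k x * u x)) \<longlonglongrightarrow> 0"
    by (rule tendsto_sandwich[OF _ _ tendsto_const L])
       (simp, rule always_eventually, unfold sob_def, intro allI add_left_mono gag_le)
  then show ?thesis by (simp add: c_def)
qed

subsection \<open>Mollification\<close>

text \<open>The second difference is symmetric in h and z, so either increment may be estimated
  trivially. The minimum serves twice: one entry gives the integrable majorant in h, the other the
  smallness in z.\<close>

lemma diff_sq_diff_le:
  assumes [measurable]: "f \<in> borel_measurable borel"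
  shows "diff_sq (\<lambda>x. f x - f (x - h)) z \<le> 4 * min (diff_sq f h) (diff_sq f z)"
proof -
  have 1: "diff_sq (\<lambda>x. f x - f (x - h)) z \<le> 4 * diff_sq f h" for h z
    using diff_sq_le_sq_int[of "\<lambda>x. f x - f (x - h)" z] by (simp add: diff_sq_eq_sq_int)
  have "diff_sq (\<lambda>x. f x - f (x - h)) z = diff_sq (\<lambda>x. f x - f (x - z)) h"
    unfolding diff_sq_def by (intro nn_integral_cong) (simp add: algebra_simps)
  with 1[of h z] 1[of z h] show ?thesis by (simp add: min_def)
qed

text \<open>Jensen's inequality for the probability density \<eta>, then Tonelli: the error is an
  average of \<open>diff_sq g\<close> over the support of \<eta>.\<close>

lemma mollify_sq_int_le:
  fixes g :: "real^'n \<Rightarrow> real"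
  assumes g: "integrable lborel g" and \<eta>: "\<eta> \<in> test_functions" "\<And>x. 0 \<le> \<eta> x" "(\<integral>\<^sup>+x. ennreal (\<eta> x) \<partial>lborel) = 1"
  shows "integrable lborel (\<lambda>z. \<eta> z * g (x - z))"
    and "sq_int (\<lambda>x. (LINT z|lborel. \<eta> z * g (x - z)) - g x) \<le> (\<integral>\<^sup>+z. ennreal (\<eta> z) * diff_sq g z \<partial>lborel)"
proof -
  have [measurable]: "\<eta> \<in> borel_measurable borel" using \<eta>(1) by (rule test_function_measurable)
  have gm[measurable]: "g \<in> borel_measurable borel" using g by auto
  have \<eta>i: "integrable lborel \<eta>" using \<eta> by (simp add: integrable_iff_bounded)
  have \<eta>1: "(LINT z|lborel. \<eta> z) = 1" using \<eta> by (simp add: integral_eq_nn_integral)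
  have int: "integrable lborel (\<lambda>z. \<eta> z * g (x - z))" for x
  proof -
    obtain B where B: "0 \<le> B" "\<And>x. \<bar>\<eta> x\<bar> \<le> B" using test_function_bounded[OF \<eta>(1)] by blast
    have "(\<integral>\<^sup>+z. ennreal (norm (g (x - z))) \<partial>lborel) = (\<integral>\<^sup>+z. ennreal (norm (g z)) \<partial>lborel)"
      by (rule nn_integral_reflect[of "\<lambda>z. ennreal (norm (g z))"]) measurable
    then have i: "integrable lborel (\<lambda>z. g (x - z))" using g by (simp add: integrable_iff_bounded)
    have "AE z in lborel. norm (\<eta> z * g (x - z)) \<le> norm (B * g (x - z))"
      using B by (auto simp: abs_mult intro!: mult_right_mono)
    from Bochner_Integration.integrable_bound[OF _ _ this] show ?thesis using i by simp
  qed
  then show "integrable lborel (\<lambda>z. \<eta> z * g (x - z))" .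
  have "sq_int (\<lambda>x. (LINT z|lborel. \<eta> z * g (x - z)) - g x)
    \<le> (\<integral>\<^sup>+x. (\<integral>\<^sup>+z. ennreal (\<eta> z * (g (x - z) - g x)\<^sup>2) \<partial>lborel) \<partial>lborel)"
    unfolding sq_int_def
  proof (rule nn_integral_mono)
    fix x
    have "(LINT z|lborel. \<eta> z * g (x - z)) - g x = (LINT z|lborel. \<eta> z * g (x - z)) - (LINT z|lborel. \<eta> z * g x)"
      using \<eta>1 by simp
    also have "\<dots> = (LINT z|lborel. \<eta> z * (g (x - z) - g x))"
      by (subst Bochner_Integration.integral_diff[symmetric]) (use int \<eta>i in \<open>auto simp: algebra_simps\<close>)
    finally have "ennreal (((LINT z|lborel. \<eta> z * g (x - z)) - g x)\<^sup>2) = ennreal ((LINT z|lborel. \<eta> z * (g (x - z) - g x))\<^sup>2)" by simp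
    also have "\<dots> \<le> (\<integral>\<^sup>+z. ennreal (\<eta> z) \<partial>lborel) * (\<integral>\<^sup>+z. ennreal (\<eta> z * (g (x - z) - g x)\<^sup>2) \<partial>lborel)"
      by (rule integral_weighted_Cauchy_Schwarz) (use \<eta> in auto)
    finally show "ennreal (((LINT z|lborel. \<eta> z * g (x - z)) - g x)\<^sup>2) \<le> (\<integral>\<^sup>+z. ennreal (\<eta> z * (g (x - z) - g x)\<^sup>2) \<partial>lborel)"
      using \<eta>(3) by simp
  qed
  also have "\<dots> = (\<integral>\<^sup>+z. (\<integral>\<^sup>+x. ennreal (\<eta> z * (g (x - z) - g x)\<^sup>2) \<partial>lborel) \<partial>lborel)"
    by (rule lborel_pair.Fubini') measurable
  also have "\<dots> = (\<integral>\<^sup>+z. ennreal (\<eta> z) * diff_sq g z \<partial>lborel)"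
    unfolding diff_sq_def using \<eta>(2)
    by (intro nn_integral_cong) (simp add: ennreal_mult nn_integral_cmult power2_commute)
  finally show "sq_int (\<lambda>x. (LINT z|lborel. \<eta> z * g (x - z)) - g x) \<le> (\<integral>\<^sup>+z. ennreal (\<eta> z) * diff_sq g z \<partial>lborel)" .
qed

text \<open>Mollification commutes with differences. So the L^2 estimate is used once for f and once
  for every f(x) - f(x-h), where it yields 4 min (A(h), a) if A \<le> a on the support of the
  mollifier. Integrated against the singular weight this is \<open>W a\<close>, which tends to 0
  with a by dominated convergence.\<close>

lemma sob_mollify:
  fixes f :: "real^'n \<Rightarrow> real"
  assumes f[measurable]: "f \<in> borel_measurable borel" and fin: "sob s f < \<infinity>" and s: "0 < s" "s < 1"
    and R: "\<And>x. R \<le> norm x \<Longrightarrow> f x = 0" and e: "0 < e"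
  shows "\<exists>\<phi>\<in>test_functions. sob s (\<lambda>x. \<phi> x - f x) \<le> ennreal e"
proof -
  let ?n = "real CARD('n)" and ?C = "line_const TYPE('n)"
  have sq_fin: "sq_int f < \<infinity>" and gag_fin: "gag s f < \<infinity>"
    using fin by (auto simp: sob_def ennreal_add_less_top)
  have fi: "integrable lborel f"
    unfolding integrable_iff_bounded
  proof
    have "(\<integral>\<^sup>+x. ennreal (norm (f x)) \<partial>lborel) \<le> (\<integral>\<^sup>+x. (indicator (cball 0 R) x + ennreal ((f x)\<^sup>2)) \<partial>lborel)"
    proof (rule nn_integral_mono)
      fix x
      have "\<bar>f x\<bar> \<le> 1 + (f x)\<^sup>2"
        using sum_squares_bound[of 1 "\<bar>f x\<bar>"] abs_ge_zero[of "f x"] by simp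
      then have "ennreal \<bar>f x\<bar> \<le> 1 + ennreal ((f x)\<^sup>2)"
        by (metis ennreal_1 ennreal_leI ennreal_plus zero_le_one zero_le_power2)
      then show "ennreal (norm (f x)) \<le> indicator (cball 0 R) x + ennreal ((f x)\<^sup>2)"
        using R[of x] by (cases "R \<le> norm x") (auto simp: indicator_def)
    qed
    also have "\<dots> = emeasure lborel (cball (0 :: real^'n) R) + sq_int f"
      unfolding sq_int_def
      by (subst nn_integral_add) (simp_all add: borel_measurable_indicator)
    also have "\<dots> < \<infinity>"
      using sq_fin emeasure_lborel_cball_finite[of "0 :: real^'n" R] by (simp add: ennreal_add_less_top)
    finally show "(\<integral>\<^sup>+x. ennreal (norm (f x)) \<partial>lborel) < \<infinity>" .
  qed simp
  define W where "W a = (\<integral>\<^sup>+h. 4 * min (diff_sq f h) (ennreal a) * ennreal (norm h powr - (?n + 2 * s)) \<partial>lborel)" for a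
  have "(\<lambda>k. W (inverse (real (Suc k)))) \<longlonglongrightarrow> (\<integral>\<^sup>+h. 0 \<partial>(lborel :: (real^'n) measure))"
    unfolding W_def
  proof (rule nn_integral_dominated_convergence[where w="\<lambda>h. 4 * (diff_sq f h * ennreal (norm h powr - (?n + 2 * s)))"])
    show "(\<integral>\<^sup>+h. 4 * (diff_sq f h * ennreal (norm h powr - (?n + 2 * s))) \<partial>lborel) < \<infinity>"
      using gag_fin by (simp add: nn_integral_cmult gag_def ennreal_mult_less_top)
    show "AE h in lborel. 4 * min (diff_sq f h) (ennreal (inverse (real (Suc k)))) * ennreal (norm h powr - (?n + 2 * s))
       \<le> 4 * (diff_sq f h * ennreal (norm h powr - (?n + 2 * s)))" for k
      by (intro AE_I2) (simp add: mult.assoc mult_left_mono mult_right_mono)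
    show "AE h in lborel. (\<lambda>k. 4 * min (diff_sq f h) (ennreal (inverse (real (Suc k)))) * ennreal (norm h powr - (?n + 2 * s))) \<longlonglongrightarrow> 0"
    proof (rule AE_I2)
      fix h :: "real^'n"
      have "(\<lambda>k. ennreal (inverse (real (Suc k)))) \<longlonglongrightarrow> ennreal 0"
        by (intro tendsto_ennrealI LIMSEQ_inverse_real_of_nat)
      then have "(\<lambda>k. min (diff_sq f h) (ennreal (inverse (real (Suc k))))) \<longlonglongrightarrow> min (diff_sq f h) (ennreal 0)"
        by (intro tendsto_min tendsto_const)
      then have "(\<lambda>k. (4 * ennreal (norm h powr - (?n + 2 * s))) * min (diff_sq f h) (ennreal (inverse (real (Suc k))))) \<longlonglongrightarrow> (4 * ennreal (norm h powr - (?n + 2 * s))) * min (diff_sq f h) (ennreal 0)"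
        by (intro ennreal_tendsto_cmult) (auto simp: ennreal_mult_less_top)
      then show "(\<lambda>k. 4 * min (diff_sq f h) (ennreal (inverse (real (Suc k)))) * ennreal (norm h powr - (?n + 2 * s))) \<longlonglongrightarrow> 0"
        by (simp add: mult_ac)
    qed
  qed measurable
  then have W0: "(\<lambda>k. W (inverse (real (Suc k)))) \<longlonglongrightarrow> 0" by simp
  have inv0: "(\<lambda>k. inverse (real (Suc k))) \<longlonglongrightarrow> 0" by (rule LIMSEQ_inverse_real_of_nat)
  \<comment> \<open>One half of \<open>e\<close> pays for the L^2 part, the other for the Gagliardo
    part.\<close>
  have "eventually (\<lambda>k. W (inverse (real (Suc k))) < ennreal (e / 2) \<and> inverse (real (Suc k)) < e / 2) sequentially"
    using order_tendstoD(2)[OF W0, of "ennreal (e / 2)"] order_tendstoD(2)[OF inv0, of "e / 2"] e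
    by (intro eventually_conj) simp_all
  then obtain k where k: "W (inverse (real (Suc k))) < ennreal (e / 2)" "inverse (real (Suc k)) < e / 2"
    by (auto simp: eventually_sequentially)
  define a where "a = inverse (real (Suc k))"
  have a: "0 < a" "W a < ennreal (e / 2)" "a < e / 2" using k by (simp_all add: a_def)
  obtain G where G: "gag s f = ennreal G" "0 \<le> G" using gag_fin by (cases "gag s f") auto
  \<comment> \<open>\<open>b\<close> is the value prescribed for \<delta>^(2s):
    \<open>diff_sq_le_gag\<close> then bounds A by C b G \<le> a within distance \<delta>. The
    summand 1 covers a vanishing seminorm.\<close>
  define b where "b = a / (?C * G + 1)"
  have CG: "0 \<le> ?C * G" using G line_const_nonneg[where 'n='n] by simp
  have b: "0 < b" "?C * b * G \<le> a" using a(1) CG by (auto simp: b_def field_simps add_pos_nonneg)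
  define \<delta> where "\<delta> = b powr (1 / (2 * s))"
  have \<delta>: "0 < \<delta>" using b by (simp add: \<delta>_def)
  have small: "diff_sq f z \<le> ennreal a" if "norm z < \<delta>" for z
  proof -
    have "norm z powr (2 * s) \<le> \<delta> powr (2 * s)" using that s by (intro powr_mono2) auto
    also have "\<delta> powr (2 * s) = b" using s b by (simp add: \<delta>_def powr_powr)
    finally have "?C * norm z powr (2 * s) * G \<le> ?C * b * G"
      using G(2) line_const_nonneg[where 'n='n] by (intro mult_right_mono mult_left_mono) auto
    then have "ennreal (?C * norm z powr (2 * s) * G) \<le> ennreal a" using b(2) by (intro ennreal_leI) simp
    moreover have "diff_sq f z \<le> ennreal (?C * norm z powr (2 * s)) * ennreal G"
      using diff_sq_le_gag[OF f s(1), of z] G(1) by simp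
    ultimately show ?thesis using G(2) line_const_nonneg[where 'n='n] by (simp add: ennreal_mult'')
  qed
  obtain \<eta> :: "real^'n \<Rightarrow> real" where \<eta>: "\<eta> \<in> test_functions" "\<And>x. 0 \<le> \<eta> x"
    "\<And>x. \<delta> \<le> norm x \<Longrightarrow> \<eta> x = 0" "(\<integral>\<^sup>+x. ennreal (\<eta> x) \<partial>lborel) = 1"
    using mollifier_exists[OF \<delta>] by blast
  have [measurable]: "\<eta> \<in> borel_measurable borel" using \<eta>(1) by (rule test_function_measurable)
  define \<phi> where "\<phi> x = (LINT z|lborel. \<eta> z * f (x - z))" for x
  have "\<phi> = (\<lambda>x. LINT y|lborel. f y * \<eta> (x - y))"
  proof
    fix x show "\<phi> x = (LINT y|lborel. f y * \<eta> (x - y))"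
      unfolding \<phi>_def using integral_shift(3)[of "\<lambda>y. f y * \<eta> (x - y)" x] by (simp add: mult.commute)
  qed
  then have \<phi>: "\<phi> \<in> test_functions" using convolution_test_function[OF fi R \<eta>(1)] by simp
  have weighted: "(\<integral>\<^sup>+z. ennreal (\<eta> z) * F z \<partial>lborel) \<le> c" if "\<And>z. norm z < \<delta> \<Longrightarrow> F z \<le> c" for F c
  proof -
    have "(\<integral>\<^sup>+z. ennreal (\<eta> z) * F z \<partial>lborel) \<le> (\<integral>\<^sup>+z. ennreal (\<eta> z) * c \<partial>lborel)"
    proof (rule nn_integral_mono)
      fix z show "ennreal (\<eta> z) * F z \<le> ennreal (\<eta> z) * c"
        using \<eta>(3)[of z] that[of z] by (cases "norm z < \<delta>") (auto intro: mult_left_mono)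
    qed
    also have "\<dots> = c" by (simp add: nn_integral_multc \<eta>(4))
    finally show ?thesis .
  qed
  have 1: "sq_int (\<lambda>x. \<phi> x - f x) \<le> ennreal a"
    unfolding \<phi>_def using mollify_sq_int_le(2)[OF fi \<eta>(1,2,4)] weighted[OF small] by (rule order_trans)
  have 2: "diff_sq (\<lambda>x. \<phi> x - f x) h \<le> 4 * min (diff_sq f h) (ennreal a)" for h
  proof -
    have fh: "integrable lborel (\<lambda>x. f x - f (x - h))"
    proof -
      have "(\<integral>\<^sup>+x. ennreal (norm (f (x - h))) \<partial>lborel) = (\<integral>\<^sup>+x. ennreal (norm (f x)) \<partial>lborel)"
        by (rule nn_integral_shift(3)[of "\<lambda>x. ennreal (norm (f x))"]) measurable
      then have "integrable lborel (\<lambda>x. f (x - h))" using fi by (simp add: integrable_iff_bounded)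
      with fi show ?thesis by simp
    qed
    have "\<phi> x - f x - (\<phi> (x - h) - f (x - h)) = (LINT z|lborel. \<eta> z * (f (x - z) - f (x - z - h))) - (f x - f (x - h))" for x
    proof -
      have "\<phi> x - \<phi> (x - h) = (LINT z|lborel. \<eta> z * f (x - z) - \<eta> z * f (x - h - z))"
        unfolding \<phi>_def by (rule Bochner_Integration.integral_diff[symmetric]) (rule mollify_sq_int_le(1)[OF fi \<eta>(1,2,4)])+
      also have "\<dots> = (LINT z|lborel. \<eta> z * (f (x - z) - f (x - z - h)))"
        by (intro Bochner_Integration.integral_cong) (auto simp: algebra_simps)
      finally show ?thesis by simp
    qed
    then have "diff_sq (\<lambda>x. \<phi> x - f x) h = sq_int (\<lambda>x. (LINT z|lborel. \<eta> z * (f (x - z) - f (x - z - h))) - (f x - f (x - h)))"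
      unfolding diff_sq_eq_sq_int by (intro arg_cong[where f=sq_int] ext)
    also have "\<dots> \<le> (\<integral>\<^sup>+z. ennreal (\<eta> z) * diff_sq (\<lambda>x. f x - f (x - h)) z \<partial>lborel)"
      by (rule mollify_sq_int_le(2)[OF fh \<eta>(1,2,4)])
    also have "\<dots> \<le> 4 * min (diff_sq f h) (ennreal a)"
    proof (rule weighted)
      fix z :: "real^'n" assume "norm z < \<delta>"
      then have "min (diff_sq f h) (diff_sq f z) \<le> min (diff_sq f h) (ennreal a)"
        using small[of z] by (auto simp: min_le_iff_disj)
      then show "diff_sq (\<lambda>x. f x - f (x - h)) z \<le> 4 * min (diff_sq f h) (ennreal a)"
        using diff_sq_diff_le[OF f, of h z] by (meson mult_left_mono order_trans zero_le)
    qed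
    finally show ?thesis .
  qed
  have "gag s (\<lambda>x. \<phi> x - f x) \<le> W a"
    unfolding gag_def W_def by (intro nn_integral_mono mult_right_mono 2) simp
  with a 1 have "sob s (\<lambda>x. \<phi> x - f x) \<le> ennreal a + ennreal (e / 2)"
    unfolding sob_def by (intro add_mono) auto
  also have "\<dots> = ennreal (a + e / 2)" using a e by (subst ennreal_plus) auto
  also have "\<dots> \<le> ennreal e" using a(3) by (intro ennreal_leI) simp
  finally show ?thesis using \<phi> by blast
qed

text \<open>Cut off, then mollify. Each of the two errors is at most e / 4, and
  \<open>sob_add\<close> doubles both.\<close>

theorem test_functions_dense:
  fixes u :: "real^'n \<Rightarrow> real"
  assumes u[measurable]: "u \<in> borel_measurable borel" and fin: "sob s u < \<infinity>" and s: "0 < s" "s < 1"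
    and e: "0 < e"
  shows "\<exists>\<phi>\<in>test_functions. sob s (\<lambda>x. \<phi> x - u x) \<le> ennreal e"
proof -
  have "eventually (\<lambda>k. sob s (\<lambda>x. (1 - cutoff (real (Suc k)) x) * u x) < ennreal (e / 4)) sequentially"
    using order_tendstoD(2)[OF sob_cutoff_tendsto[OF u fin s], of "ennreal (e / 4)"] e by simp
  then obtain k where k: "sob s (\<lambda>x. (1 - cutoff (real (Suc k)) x) * u x) < ennreal (e / 4)"
    by (auto simp: eventually_sequentially)
  define f where "f x = cutoff (real (Suc k)) x * u x" for x
  have [measurable]: "f \<in> borel_measurable borel" unfolding f_def[abs_def] by measurable
  have eq: "(\<lambda>x. (1 - cutoff (real (Suc k)) x) * u x) = (\<lambda>x. u x - f x)"
    by (simp add: f_def algebra_simps)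
  have k': "sob s (\<lambda>x. f x - u x) < ennreal (e / 4)"
    using k unfolding eq by (subst sob_minus_commute)
  have "sob s (\<lambda>x. (f x - u x) + u x) \<le> 2 * sob s (\<lambda>x. f x - u x) + 2 * sob s u"
    by (rule sob_add) measurable
  also have "\<dots> < \<infinity>" using fin k' by (auto simp: ennreal_add_less_top ennreal_mult_less_top intro: less_trans)
  finally have "sob s f < \<infinity>" by simp
  moreover have "f x = 0" if "2 * real (Suc k) \<le> norm x" for x
    using cutoff_eq_0[OF that] by (simp add: f_def)
  ultimately obtain \<phi> where \<phi>: "\<phi> \<in> test_functions" "sob s (\<lambda>x. \<phi> x - f x) \<le> ennreal (e / 4)"
    using sob_mollify[of f s "2 * real (Suc k)" "e / 4"] s e by auto
  have [measurable]: "\<phi> \<in> borel_measurable borel" using \<phi>(1) by (rule test_function_measurable)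
  have "sob s (\<lambda>x. (\<phi> x - f x) + (f x - u x)) \<le> 2 * sob s (\<lambda>x. \<phi> x - f x) + 2 * sob s (\<lambda>x. f x - u x)"
    by (rule sob_add) measurable
  also have "\<dots> \<le> 2 * ennreal (e / 4) + 2 * ennreal (e / 4)"
    using \<phi>(2) k' by (intro add_mono mult_left_mono) auto
  also have "\<dots> = ennreal e" using e
    by (simp add: distrib_right[symmetric] ennreal_mult'[symmetric] ennreal_plus[symmetric] del: ennreal_plus flip: ennreal_numeral)
  finally show ?thesis using \<phi>(1) by (intro bexI[of _ \<phi>]) simp_all
qed

subsection \<open>The Marchaud derivative\<close>

text \<open>Marchaud's form of the fractional derivative without its factor s / \<Gamma>(1 - s). For
  test functions the integral converges absolutely, and no derivative stands in front of it.\<close>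

definition marchaud :: "real \<Rightarrow> real^'n \<Rightarrow> (real^'n \<Rightarrow> real) \<Rightarrow> real^'n \<Rightarrow> real" where
  "marchaud s \<theta> \<phi> x = (LINT t:{0<..}|lborel. (\<phi> x - \<phi> (x - t *\<^sub>R \<theta>)) * t powr (- 1 - s))"

lemma set_integrable_powr_head:
  fixes b c :: real
  assumes "- 1 < b" "0 \<le> c"
  shows "integrable lborel (\<lambda>t. indicator {0..c} t * t powr b)"
  unfolding integrable_iff_bounded
proof
  have "(\<integral>\<^sup>+t. ennreal (norm (indicator {0..c} t * t powr b)) \<partial>lborel) = (\<integral>\<^sup>+t. ennreal (t powr b) * indicator {0..c} t \<partial>lborel)"
    by (intro nn_integral_cong) (auto simp: indicator_def)
  then show "(\<integral>\<^sup>+t. ennreal (norm (indicator {0..c} t * t powr b)) \<partial>lborel) < \<infinity>"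
    using nn_integral_powr_head[OF assms] by simp
qed simp

lemma set_integrable_powr_tail:
  fixes a c :: real
  assumes "0 < a" "0 < c"
  shows "integrable lborel (\<lambda>t. indicator {c..} t * t powr (- 1 - a))"
  unfolding integrable_iff_bounded
proof
  have "(\<integral>\<^sup>+t. ennreal (norm (indicator {c..} t * t powr (- 1 - a))) \<partial>lborel) = (\<integral>\<^sup>+t. ennreal (t powr (- 1 - a)) * indicator {c..} t \<partial>lborel)"
    by (intro nn_integral_cong) (auto simp: indicator_def)
  then show "(\<integral>\<^sup>+t. ennreal (norm (indicator {c..} t * t powr (- 1 - a))) \<partial>lborel) < \<infinity>"
    using nn_integral_powr_tail[OF assms] by simp
qed simp

text \<open>The Lipschitz bound is used for t \<le> 1, where t^(-s) is integrable since s < 1, and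
  the sup bound for t \<ge> 1, where t^(-1-s) is integrable since s > 0.\<close>

lemma integrable_marchaud_majorant:
  fixes s L B :: real
  assumes s: "0 < s" "s < 1"
  shows "integrable lborel (\<lambda>t. L * (indicator {0..1} t * t powr (- s)) + B * (indicator {1..} t * t powr (- 1 - s)))"
  using set_integrable_powr_head[of "- s" 1] set_integrable_powr_tail[of s 1] s
  by (intro Bochner_Integration.integrable_add integrable_mult_right) auto

lemma marchaud_kernel_le:
  fixes t s L B a :: real
  assumes "\<bar>a\<bar> \<le> L * t" "\<bar>a\<bar> \<le> B" "0 < t"
  shows "\<bar>a * t powr (- 1 - s)\<bar> \<le> L * (indicator {0..1} t * t powr (- s)) + B * (indicator {1..} t * t powr (- 1 - s))"
proof -
  have L: "0 \<le> L"
    using assms by (smt (verit) mult_neg_pos)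
  have B: "0 \<le> B" using assms by linarith
  show ?thesis
  proof (cases "t \<le> 1")
    case True
    have "\<bar>a * t powr (- 1 - s)\<bar> \<le> L * t * t powr (- 1 - s)"
      using assms by (simp add: abs_mult mult_right_mono)
    also have "\<dots> = L * t powr (- s)" using assms(3) by (simp add: mult.assoc powr_mult_base)
    also have "\<dots> \<le> L * (indicator {0..1} t * t powr (- s)) + B * (indicator {1..} t * t powr (- 1 - s))"
      using True assms(3) B by simp
    finally show ?thesis .
  next
    case False
    have "\<bar>a * t powr (- 1 - s)\<bar> \<le> B * t powr (- 1 - s)"
      using assms by (simp add: abs_mult mult_right_mono)
    then show ?thesis using False L by simp
  qed
qed

lemma marchaud_integrable:
  assumes \<phi>: "\<phi> \<in> test_functions" and s: "0 < s" "s < 1"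
  shows "set_integrable lborel {0<..} (\<lambda>t. (\<phi> x - \<phi> (x - t *\<^sub>R \<theta>)) * t powr (- 1 - s))"
proof -
  obtain L where L: "0 \<le> L" "\<And>x y. \<bar>\<phi> x - \<phi> y\<bar> \<le> L * norm (x - y)" using test_function_Lipschitz[OF \<phi>] by blast
  obtain B where B: "0 \<le> B" "\<And>x. \<bar>\<phi> x\<bar> \<le> B" using test_function_bounded[OF \<phi>] by blast
  have [measurable]: "\<phi> \<in> borel_measurable borel" using \<phi> by (rule test_function_measurable)
  have bnd: "norm (indicator {0<..} t *\<^sub>R ((\<phi> x - \<phi> (x - t *\<^sub>R \<theta>)) * t powr (- 1 - s)))
     \<le> (L * norm \<theta>) * (indicator {0..1} t * t powr (- s)) + (2 * B) * (indicator {1..} t * t powr (- 1 - s))" for t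
  proof (cases "0 < t")
    case True
    have "\<bar>\<phi> x - \<phi> (x - t *\<^sub>R \<theta>)\<bar> \<le> (L * norm \<theta>) * t"
      using L(2)[of x "x - t *\<^sub>R \<theta>"] True by (simp add: mult_ac)
    moreover have "\<bar>\<phi> x - \<phi> (x - t *\<^sub>R \<theta>)\<bar> \<le> 2 * B"
      using B(2)[of x] B(2)[of "x - t *\<^sub>R \<theta>"] by linarith
    ultimately show ?thesis using marchaud_kernel_le[of "\<phi> x - \<phi> (x - t *\<^sub>R \<theta>)" "L * norm \<theta>" t "2 * B" s] True by simp
  next
    case False
    then show ?thesis using L B by simp
  qed
  have "AE t in lborel. norm (indicator {0<..} t *\<^sub>R ((\<phi> x - \<phi> (x - t *\<^sub>R \<theta>)) * t powr (- 1 - s)))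
     \<le> norm ((L * norm \<theta>) * (indicator {0..1} t * t powr (- s)) + (2 * B) * (indicator {1..} t * t powr (- 1 - s)))"
  proof (rule AE_I2)
    fix t show "norm (indicator {0<..} t *\<^sub>R ((\<phi> x - \<phi> (x - t *\<^sub>R \<theta>)) * t powr (- 1 - s)))
     \<le> norm ((L * norm \<theta>) * (indicator {0..1} t * t powr (- s)) + (2 * B) * (indicator {1..} t * t powr (- 1 - s)))"
      using bnd[of t] unfolding real_norm_def by linarith
  qed
  from Bochner_Integration.integrable_bound[OF integrable_marchaud_majorant[OF s] _ this]
  show ?thesis unfolding set_integrable_def by simp
qed

lemma marchaud_diff:
  assumes "\<phi> \<in> test_functions" "\<psi> \<in> test_functions" and s: "0 < s" "s < 1"
  shows "marchaud s \<theta> (\<lambda>x. \<phi> x - \<psi> x) x = marchaud s \<theta> \<phi> x - marchaud s \<theta> \<psi> x"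
  unfolding marchaud_def
    set_integral_diff(2)[OF marchaud_integrable[OF assms(1) s] marchaud_integrable[OF assms(2) s], symmetric]
  by (intro set_lebesgue_integral_cong) (auto simp: algebra_simps)

text \<open>Joint measurability in direction and point is inherited by the limit
  \<open>dir_deriv\<close> and makes Tonelli over the sphere available.\<close>

lemma measurable_marchaud [measurable]:
  assumes [measurable]: "\<phi> \<in> borel_measurable borel"
  shows "(\<lambda>(\<theta>, x). marchaud s \<theta> \<phi> x) \<in> borel_measurable (borel \<Otimes>\<^sub>M borel)"
  unfolding marchaud_def set_lebesgue_integral_def by measurable

lemma marchaud_eq_lim:
  assumes \<phi>: "\<phi> \<in> test_functions" and s: "0 < s" "s < 1"
  shows "(\<lambda>k. LINT t|tail_measure s (inverse (real (Suc k))). \<phi> x - \<phi> (x - t *\<^sub>R \<theta>)) \<longlonglongrightarrow> marchaud s \<theta> \<phi> x"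
proof -
  let ?e = "\<lambda>k. inverse (real (Suc k))"
  have [measurable]: "\<phi> \<in> borel_measurable borel" using \<phi> by (rule test_function_measurable)
  have eq: "(LINT t|tail_measure s (?e k). \<phi> x - \<phi> (x - t *\<^sub>R \<theta>))
    = (LINT t|lborel. indicator {?e k..} t * ((\<phi> x - \<phi> (x - t *\<^sub>R \<theta>)) * t powr (- 1 - s)))" for k
  proof -
    have "tail_measure s (?e k) = density lborel (\<lambda>t. ennreal (indicator {?e k..} t * t powr (- 1 - s)))"
      unfolding tail_measure_def by (intro density_cong) (auto simp: indicator_def)
    then show ?thesis by (simp add: integral_density mult_ac)
  qed
  show ?thesis unfolding eq marchaud_def set_lebesgue_integral_def
  proof (rule integral_dominated_convergence)
    show "integrable lborel (\<lambda>t. \<bar>indicator {0<..} t *\<^sub>R ((\<phi> x - \<phi> (x - t *\<^sub>R \<theta>)) * t powr (- 1 - s))\<bar>)"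
      using marchaud_integrable[OF \<phi> s] unfolding set_integrable_def by (rule integrable_abs)
    show "AE t in lborel. (\<lambda>k. indicator {?e k..} t * ((\<phi> x - \<phi> (x - t *\<^sub>R \<theta>)) * t powr (- 1 - s)))
       \<longlonglongrightarrow> indicator {0<..} t *\<^sub>R ((\<phi> x - \<phi> (x - t *\<^sub>R \<theta>)) * t powr (- 1 - s))"
    proof (rule AE_I2)
      fix t :: real
      have "eventually (\<lambda>k. indicator {?e k..} t = (indicator {0<..} t :: real)) sequentially"
      proof (cases "0 < t")
        case True
        have "eventually (\<lambda>k. ?e k < t) sequentially"
          using order_tendstoD(2)[OF LIMSEQ_inverse_real_of_nat True] .
        then show ?thesis by eventually_elim (use True in auto)
      next
        case False
        have "\<not> ?e k \<le> t" for k using False by (smt (verit) inverse_positive_iff_positive of_nat_0_less_iff zero_less_Suc)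
        then show ?thesis using False by simp
      qed
      then have "eventually (\<lambda>k. indicator {?e k..} t * ((\<phi> x - \<phi> (x - t *\<^sub>R \<theta>)) * t powr (- 1 - s))
        = indicator {0<..} t *\<^sub>R ((\<phi> x - \<phi> (x - t *\<^sub>R \<theta>)) * t powr (- 1 - s))) sequentially"
        by eventually_elim simp
      then show "(\<lambda>k. indicator {?e k..} t * ((\<phi> x - \<phi> (x - t *\<^sub>R \<theta>)) * t powr (- 1 - s)))
       \<longlonglongrightarrow> indicator {0<..} t *\<^sub>R ((\<phi> x - \<phi> (x - t *\<^sub>R \<theta>)) * t powr (- 1 - s))"
        by (rule tendsto_eventually)
    qed
    show "AE t in lborel. norm (indicator {?e k..} t * ((\<phi> x - \<phi> (x - t *\<^sub>R \<theta>)) * t powr (- 1 - s)))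
       \<le> \<bar>indicator {0<..} t *\<^sub>R ((\<phi> x - \<phi> (x - t *\<^sub>R \<theta>)) * t powr (- 1 - s))\<bar>" for k
    proof (rule AE_I2)
      fix t :: real
      have "0 < t" if "?e k \<le> t" using that by (smt (verit) inverse_positive_iff_positive of_nat_0_less_iff zero_less_Suc)
      then show "norm (indicator {?e k..} t * ((\<phi> x - \<phi> (x - t *\<^sub>R \<theta>)) * t powr (- 1 - s)))
       \<le> \<bar>indicator {0<..} t *\<^sub>R ((\<phi> x - \<phi> (x - t *\<^sub>R \<theta>)) * t powr (- 1 - s))\<bar>"
        by (auto simp: indicator_def)
    qed
  qed simp_all
qed

text \<open>Fatou's lemma. The bound is asked only from index N on, so that a fixed k-th approximant
  can be compared with all later ones.\<close>

lemma nn_integral_bounded_limit: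
  fixes f :: "nat \<Rightarrow> 'a \<Rightarrow> real"
  assumes [measurable]: "\<And>k. f k \<in> borel_measurable M"
    and lim: "AE x in M. (\<lambda>k. f k x) \<longlonglongrightarrow> g x"
    and le: "\<And>k. N \<le> k \<Longrightarrow> (\<integral>\<^sup>+x. ennreal ((f k x)\<^sup>2) \<partial>M) \<le> C"
  shows "(\<integral>\<^sup>+x. ennreal ((g x)\<^sup>2) \<partial>M) \<le> C"
proof -
  have "(\<integral>\<^sup>+x. ennreal ((g x)\<^sup>2) \<partial>M) = (\<integral>\<^sup>+x. liminf (\<lambda>k. ennreal ((f k x)\<^sup>2)) \<partial>M)"
  proof (rule nn_integral_cong_AE)
    show "AE x in M. ennreal ((g x)\<^sup>2) = liminf (\<lambda>k. ennreal ((f k x)\<^sup>2))"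
      using lim
    proof eventually_elim
      fix x assume "(\<lambda>k. f k x) \<longlonglongrightarrow> g x"
      then have "(\<lambda>k. ennreal ((f k x)\<^sup>2)) \<longlonglongrightarrow> ennreal ((g x)\<^sup>2)"
        by (intro tendsto_ennrealI tendsto_power)
      then show "ennreal ((g x)\<^sup>2) = liminf (\<lambda>k. ennreal ((f k x)\<^sup>2))"
        by (intro lim_imp_Liminf[symmetric]) simp_all
    qed
  qed
  also have "\<dots> \<le> liminf (\<lambda>k. \<integral>\<^sup>+x. ennreal ((f k x)\<^sup>2) \<partial>M)"
    by (rule nn_integral_liminf) measurable
  also have "\<dots> \<le> C"
  proof -
    have "liminf (\<lambda>k. \<integral>\<^sup>+x. ennreal ((f k x)\<^sup>2) \<partial>M) \<le> limsup (\<lambda>k. \<integral>\<^sup>+x. ennreal ((f k x)\<^sup>2) \<partial>M)"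
      by (rule Liminf_le_Limsup) simp
    also have "\<dots> \<le> C"
      by (rule Limsup_bounded) (use le in \<open>auto simp: eventually_sequentially\<close>)
    finally show ?thesis .
  qed
  finally show ?thesis .
qed

lemma sq_int_test_finite:
  fixes \<phi> :: "real^'n \<Rightarrow> real"
  assumes \<phi>: "\<phi> \<in> test_functions"
  shows "sq_int \<phi> < \<infinity>"
proof -
  obtain B where B: "0 \<le> B" "\<And>x. \<bar>\<phi> x\<bar> \<le> B" using test_function_bounded[OF \<phi>] by blast
  obtain R where R: "\<And>x. R \<le> norm x \<Longrightarrow> \<phi> x = 0" using test_function_support[OF \<phi>] by blast
  have "sq_int \<phi> \<le> (\<integral>\<^sup>+x. ennreal (B\<^sup>2) * indicator (cball (0 :: real^'n) R) x \<partial>lborel)"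
    unfolding sq_int_def
  proof (rule nn_integral_mono)
    fix x
    have "(\<phi> x)\<^sup>2 \<le> B\<^sup>2" using B by (metis abs_ge_zero power2_abs power_mono)
    then show "ennreal ((\<phi> x)\<^sup>2) \<le> ennreal (B\<^sup>2) * indicator (cball 0 R) x"
      using R[of x] by (cases "R \<le> norm x") (auto simp: indicator_def intro: ennreal_leI)
  qed
  also have "\<dots> = ennreal (B\<^sup>2) * emeasure lborel (cball (0 :: real^'n) R)"
    by (simp add: nn_integral_cmult_indicator)
  also have "\<dots> < \<infinity>"
    using emeasure_lborel_cball_finite[of "0 :: real^'n" R] by (simp add: ennreal_mult_less_top)
  finally show ?thesis .
qed

text \<open>Product of the constants of \<open>truncated_Marchaud_bound\<close> and
  \<open>diff_sq_line\<close>; free of the direction.\<close>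

definition dir_const :: "real \<Rightarrow> 'n::finite itself \<Rightarrow> real" where
  "dir_const s _ = marchaud_const s * (line_const TYPE('n) / (real CARD('n) + 2 * s))"

lemma dir_const_nonneg: "0 < s \<Longrightarrow> s < 1 \<Longrightarrow> 0 \<le> dir_const s TYPE('n::finite)"
  using line_const_nonneg[where 'n='n]
  by (auto simp: dir_const_def marchaud_const_def intro!: mult_nonneg_nonneg add_nonneg_nonneg divide_nonneg_nonneg)

text \<open>The bound for the truncated integrals does not involve \<epsilon>, so Fatou passes it on
  to \<epsilon> \<rightarrow> 0.\<close>

theorem marchaud_bound:
  fixes \<phi> :: "real^'n \<Rightarrow> real"
  assumes \<phi>: "\<phi> \<in> test_functions" and s: "0 < s" "s < 1" and \<theta>: "norm \<theta> = 1"
  shows "sq_int (marchaud s \<theta> \<phi>) \<le> ennreal (dir_const s TYPE('n)) * gag s \<phi>"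
proof -
  have m[measurable]: "\<phi> \<in> borel_measurable borel" using \<phi> by (rule test_function_measurable)
  obtain B where B: "\<And>x. \<bar>\<phi> x\<bar> \<le> B" using test_function_bounded[OF \<phi>] by blast
  obtain D where D: "4 * sq_int \<phi> = ennreal D"
    using sq_int_test_finite[OF \<phi>] by (cases "4 * sq_int \<phi>") (auto simp: ennreal_mult_eq_top_iff)
  have D': "diff_sq \<phi> h \<le> ennreal D" for h using diff_sq_le_sq_int[OF m, of h] D by simp
  have bnd: "(\<integral>\<^sup>+x. ennreal ((LINT t|tail_measure s (inverse (real (Suc k))). \<phi> x - \<phi> (x - t *\<^sub>R \<theta>))\<^sup>2) \<partial>lborel)
      \<le> ennreal (dir_const s TYPE('n)) * gag s \<phi>" for k
  proof -
    have "(\<integral>\<^sup>+x. ennreal ((LINT t|tail_measure s (inverse (real (Suc k))). \<phi> x - \<phi> (x - t *\<^sub>R \<theta>))\<^sup>2) \<partial>lborel)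
      \<le> ennreal (marchaud_const s) * (ennreal (line_const TYPE('n) / (real CARD('n) + 2 * s)) * gag s \<phi>)"
      using truncated_Marchaud_bound[OF m B D' s, of "inverse (real (Suc k))" \<theta>] diff_sq_line[OF m s(1) \<theta>]
      by (meson mult_left_mono order_trans zero_le inverse_positive_iff_positive of_nat_0_less_iff zero_less_Suc)
    moreover have "0 \<le> marchaud_const s" using s by (simp add: marchaud_const_def)
    ultimately show ?thesis by (simp add: dir_const_def ennreal_mult' mult.assoc del: times_divide_eq_right)
  qed
  have sf: "sigma_finite_measure (tail_measure s (inverse (real (Suc k))))" for k
    using finite_tail_measure[OF s(1), of "inverse (real (Suc k))"] by (simp add: finite_measure.axioms(1))
  have "(\<lambda>x. LINT t|tail_measure s (inverse (real (Suc k))). \<phi> x - \<phi> (x - t *\<^sub>R \<theta>)) \<in> borel_measurable lborel" for k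
    by (intro sigma_finite_measure.borel_measurable_lebesgue_integral[OF sf]) measurable
  from nn_integral_bounded_limit[OF this AE_I2[OF marchaud_eq_lim[OF \<phi> s]] bnd]
  show ?thesis by (simp add: sq_int_def)
qed

subsection \<open>The Riemann--Liouville derivative of a test function\<close>

text \<open>The primitive (w(0) - w(-t)) t^(-s) has no boundary terms: near 0 it is at most L
  t^(1-s) with s < 1, and for large t it equals w(0) t^(-s) with s > 0. Subtracting the constant
  w(0) is what tames the origin, and differentiating t^(-s) produces the factor s.\<close>

lemma marchaud_by_parts:
  fixes w d :: "real \<Rightarrow> real"
  assumes D: "\<And>t. (w has_real_derivative d t) (at t)" and dc: "continuous_on UNIV d"
    and L: "0 \<le> L" "\<And>x y. \<bar>w x - w y\<bar> \<le> L * \<bar>x - y\<bar>" and B: "0 \<le> B" "\<And>t. \<bar>w t\<bar> \<le> B" "\<And>t. \<bar>d t\<bar> \<le> L"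
    and M: "0 < M" "\<And>t. M \<le> \<bar>t\<bar> \<Longrightarrow> w t = 0" "\<And>t. M \<le> \<bar>t\<bar> \<Longrightarrow> d t = 0"
    and s: "0 < s" "s < 1"
  shows "(LINT t:{0<..}|lborel. d (- t) * t powr (- s)) = s * (LINT t:{0<..}|lborel. (w 0 - w (- t)) * t powr (- 1 - s))"
proof -
  have [measurable]: "d \<in> borel_measurable borel" using dc by (rule borel_measurable_continuous_onI)
  have wc: "continuous_on UNIV w" using D by (intro continuous_at_imp_continuous_on) (auto intro: DERIV_isCont)
  have [measurable]: "w \<in> borel_measurable borel" using wc by (rule borel_measurable_continuous_onI)
  have i1: "set_integrable lborel {0<..} (\<lambda>t. d (- t) * t powr (- s))"
  proof -
    have maj: "integrable lborel (\<lambda>t. L * (indicator {0..M} t * t powr (- s)))"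
      using set_integrable_powr_head[of "- s" M] s M by auto
    have "AE t in lborel. norm (indicator {0<..} t *\<^sub>R (d (- t) * t powr (- s))) \<le> norm (L * (indicator {0..M} t * t powr (- s)))"
    proof (rule AE_I2)
      fix t
      show "norm (indicator {0<..} t *\<^sub>R (d (- t) * t powr (- s))) \<le> norm (L * (indicator {0..M} t * t powr (- s)))"
        using B(3)[of "- t"] M(3)[of "- t"] L(1) by (cases "t \<le> M") (auto simp: indicator_def abs_mult intro!: mult_right_mono)
    qed
    from Bochner_Integration.integrable_bound[OF maj _ this] show ?thesis
      unfolding set_integrable_def by simp
  qed
  have i2: "set_integrable lborel {0<..} (\<lambda>t. (w 0 - w (- t)) * t powr (- 1 - s))"
  proof -
    have bnd: "norm (indicator {0<..} t *\<^sub>R ((w 0 - w (- t)) * t powr (- 1 - s)))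
       \<le> L * (indicator {0..1} t * t powr (- s)) + (2 * B) * (indicator {1..} t * t powr (- 1 - s))" for t
    proof (cases "0 < t")
      case True
      have "\<bar>w 0 - w (- t)\<bar> \<le> 2 * B" using B(2)[of 0] B(2)[of "- t"] by linarith
      then show ?thesis using marchaud_kernel_le[of "w 0 - w (- t)" L t "2 * B" s] L(2)[of 0 "- t"] True by simp
    qed (use L B in simp)
    have "AE t in lborel. norm (indicator {0<..} t *\<^sub>R ((w 0 - w (- t)) * t powr (- 1 - s)))
       \<le> norm (L * (indicator {0..1} t * t powr (- s)) + (2 * B) * (indicator {1..} t * t powr (- 1 - s)))"
    proof (rule AE_I2)
      fix t show "norm (indicator {0<..} t *\<^sub>R ((w 0 - w (- t)) * t powr (- 1 - s)))
         \<le> norm (L * (indicator {0..1} t * t powr (- s)) + (2 * B) * (indicator {1..} t * t powr (- 1 - s)))"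
        using bnd[of t] unfolding real_norm_def by linarith
    qed
    from Bochner_Integration.integrable_bound[OF integrable_marchaud_majorant[OF s] _ this]
    show ?thesis unfolding set_integrable_def by simp
  qed
  define F where "F t = (w 0 - w (- t)) * t powr (- s)" for t
  define f where "f t = d (- t) * t powr (- s) - s * ((w 0 - w (- t)) * t powr (- 1 - s))" for t
  have exponent: "- 1 - s = - s - 1" by simp
  have "(LBINT t=0..\<infinity>. f t) = 0 - 0"
  proof (rule interval_integral_FTC_integrable[where F=F])
    fix t :: real assume "0 < ereal t" "ereal t < \<infinity>"
    then have t: "0 < t" by simp
    have "(uminus has_real_derivative - 1) (at t)" by (auto intro!: derivative_eq_intros)
    from DERIV_chain2[OF D this]
    have Dm: "((\<lambda>t. w (- t)) has_real_derivative - d (- t)) (at t)" by simp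
    have "(F has_real_derivative f t) (at t)"
      unfolding F_def f_def exponent
      by (rule DERIV_cong[OF DERIV_mult[OF DERIV_diff[OF DERIV_const Dm] has_real_derivative_powr[OF t]]])
         (simp add: algebra_simps)
    then show "(F has_vector_derivative f t) (at t)" by (simp add: has_real_derivative_iff_has_vector_derivative)
    have "isCont (\<lambda>t. d (- t)) t"
      using dc by (intro continuous_on_interior[of UNIV]) (auto intro!: continuous_on_compose2[OF dc] continuous_intros)
    moreover have "isCont (\<lambda>t. w (- t)) t"
      using wc by (intro continuous_on_interior[of UNIV]) (auto intro!: continuous_on_compose2[OF wc] continuous_intros)
    ultimately show "isCont f t"
      unfolding f_def using t by (intro continuous_intros) auto
  next
    have "einterval 0 \<infinity> = {0<..}" by (auto simp: einterval_def)
    then show "set_integrable lborel (einterval 0 \<infinity>) f"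
      unfolding f_def by (simp add: i1 i2)
  next
    have "(F \<longlongrightarrow> 0) (at_right 0)"
    proof (rule Lim_null_comparison)
      show "eventually (\<lambda>t. norm (F t) \<le> L * t powr (1 - s)) (at_right 0)"
        using eventually_at_right_less[of 0]
      proof eventually_elim
        case (elim t)
        have "\<bar>w 0 - w (- t)\<bar> * t powr (- s) \<le> (L * t) * t powr (- s)"
          using L(2)[of 0 "- t"] elim by (intro mult_right_mono) auto
        then show ?case using elim by (simp add: F_def abs_mult mult.assoc powr_mult_base)
      qed
      have "((\<lambda>t. t powr (1 - s)) \<longlongrightarrow> 0) (at_right 0)"
      proof -
        have "((\<lambda>t. t powr (1 - s)) \<longlongrightarrow> 0 powr (1 - s)) (at_right 0)"
        proof (rule tendsto_powr'[OF tendsto_ident_at tendsto_const])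
          have "eventually (\<lambda>t. 0 \<le> t) (at_right (0 :: real))"
            using eventually_at_right_less[of "0 :: real"] by eventually_elim simp
          with s show "(0 :: real) \<noteq> 0 \<or> (0 < 1 - s \<and> (\<forall>\<^sub>F t in at_right (0 :: real). 0 \<le> t))" by simp
        qed
        then show ?thesis by simp
      qed
      from tendsto_mult_right_zero[OF this] show "((\<lambda>t. L * t powr (1 - s)) \<longlongrightarrow> 0) (at_right 0)" .
    qed
    then show "((F \<circ> real_of_ereal) \<longlongrightarrow> 0) (at_right 0)"
      by (simp add: zero_ereal_def ereal_tendsto_simps)
    have "(F \<longlongrightarrow> 0) at_top"
    proof (rule tendsto_cong[THEN iffD2])
      show "eventually (\<lambda>t. F t = w 0 * t powr (- s)) at_top"
        using eventually_ge_at_top[of M] by eventually_elim (use M in \<open>simp add: F_def\<close>)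
      show "((\<lambda>t. w 0 * t powr (- s)) \<longlongrightarrow> 0) at_top"
        using s by (intro tendsto_mult_right_zero tendsto_neg_powr filterlim_ident) auto
    qed
    then show "((F \<circ> real_of_ereal) \<longlongrightarrow> 0) (at_left \<infinity>)"
      by (simp add: ereal_tendsto_simps)
  qed simp
  then have "(LINT t:{0<..}|lborel. f t) = 0" by (simp add: interval_lebesgue_integral_0_infty)
  moreover have "(LINT t:{0<..}|lborel. f t) = (LINT t:{0<..}|lborel. d (- t) * t powr (- s))
     - s * (LINT t:{0<..}|lborel. (w 0 - w (- t)) * t powr (- 1 - s))"
    unfolding f_def by (subst set_integral_diff(2)) (simp_all add: i1 i2)
  ultimately show ?thesis by simp
qed

text \<open>Differentiation under the integral sign. Increments are restricted to |h| < 1, so that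
  all difference quotients vanish beyond M + 1 and share the majorant L \<tau>^(-s) on
  [0, M + 1].\<close>

lemma Riemann_Liouville_integral_derivative:
  fixes w d :: "real \<Rightarrow> real"
  assumes D: "\<And>t. (w has_real_derivative d t) (at t)" and dc: "continuous_on UNIV d"
    and L: "0 \<le> L" "\<And>x y. \<bar>w x - w y\<bar> \<le> L * \<bar>x - y\<bar>" and B: "0 \<le> B" "\<And>t. \<bar>w t\<bar> \<le> B"
    and M: "0 < M" "\<And>t. M \<le> \<bar>t\<bar> \<Longrightarrow> w t = 0"
    and s: "0 < s" "s < 1"
  shows "((\<lambda>t. LINT \<tau>:{0<..}|lborel. w (t - \<tau>) * \<tau> powr (- s)) has_real_derivative
     (LINT \<tau>:{0<..}|lborel. d (- \<tau>) * \<tau> powr (- s))) (at 0)"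
proof -
  have [measurable]: "d \<in> borel_measurable borel" using dc by (rule borel_measurable_continuous_onI)
  have wc: "continuous_on UNIV w" using D by (intro continuous_at_imp_continuous_on) (auto intro: DERIV_isCont)
  have [measurable]: "w \<in> borel_measurable borel" using wc by (rule borel_measurable_continuous_onI)
  have maj: "integrable lborel (\<lambda>\<tau>. c * (indicator {0..M + 1} \<tau> * \<tau> powr (- s)))" for c
    using set_integrable_powr_head[of "- s" "M + 1"] s M by auto
  have int: "integrable lborel (\<lambda>\<tau>. indicator {0<..} \<tau> *\<^sub>R (w (t - \<tau>) * \<tau> powr (- s)))" if "\<bar>t\<bar> \<le> 1" for t
  proof -
    have "AE \<tau> in lborel. norm (indicator {0<..} \<tau> *\<^sub>R (w (t - \<tau>) * \<tau> powr (- s))) \<le> norm (B * (indicator {0..M + 1} \<tau> * \<tau> powr (- s)))"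
    proof (rule AE_I2)
      fix \<tau>
      show "norm (indicator {0<..} \<tau> *\<^sub>R (w (t - \<tau>) * \<tau> powr (- s))) \<le> norm (B * (indicator {0..M + 1} \<tau> * \<tau> powr (- s)))"
        using B(2)[of "t - \<tau>"] B(1) M(2)[of "t - \<tau>"] that
        by (cases "\<tau> \<le> M + 1") (auto simp: indicator_def abs_mult intro!: mult_right_mono)
    qed
    from Bochner_Integration.integrable_bound[OF maj _ this] show ?thesis by simp
  qed
  define q where "q h \<tau> = (w (h - \<tau>) - w (- \<tau>)) / h" for h \<tau>
  have "((\<lambda>h. ((LINT \<tau>:{0<..}|lborel. w (0 + h - \<tau>) * \<tau> powr (- s)) - (LINT \<tau>:{0<..}|lborel. w (0 - \<tau>) * \<tau> powr (- s))) / h)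
     \<longlongrightarrow> (LINT \<tau>:{0<..}|lborel. d (- \<tau>) * \<tau> powr (- s))) (at 0 within {-1<..<1})"
    unfolding tendsto_at_iff_sequentially
  proof (intro allI impI)
    fix X :: "nat \<Rightarrow> real" assume X: "\<forall>i. X i \<in> {-1<..<1} - {0}" "X \<longlonglongrightarrow> 0"
    have eq: "((LINT \<tau>:{0<..}|lborel. w (0 + X k - \<tau>) * \<tau> powr (- s)) - (LINT \<tau>:{0<..}|lborel. w (0 - \<tau>) * \<tau> powr (- s))) / X k
      = (LINT \<tau>|lborel. indicator {0<..} \<tau> *\<^sub>R (q (X k) \<tau> * \<tau> powr (- s)))" for k
    proof -
      have "\<bar>X k\<bar> \<le> 1" using X(1)[rule_format, of k] by auto
      then have e1: "(LINT \<tau>:{0<..}|lborel. w (0 + X k - \<tau>) * \<tau> powr (- s)) - (LINT \<tau>:{0<..}|lborel. w (0 - \<tau>) * \<tau> powr (- s))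
        = (LINT \<tau>|lborel. indicator {0<..} \<tau> *\<^sub>R (w (X k - \<tau>) * \<tau> powr (- s)) - indicator {0<..} \<tau> *\<^sub>R (w (0 - \<tau>) * \<tau> powr (- s)))"
        unfolding set_lebesgue_integral_def using int[of "X k"] int[of 0]
        by (subst Bochner_Integration.integral_diff) simp_all
      show ?thesis unfolding e1
      proof -
      have "(LINT \<tau>|lborel. indicator {0<..} \<tau> *\<^sub>R (w (X k - \<tau>) * \<tau> powr (- s)) - indicator {0<..} \<tau> *\<^sub>R (w (0 - \<tau>) * \<tau> powr (- s))) / X k = (LINT \<tau>|lborel. (indicator {0<..} \<tau> *\<^sub>R (w (X k - \<tau>) * \<tau> powr (- s)) - indicator {0<..} \<tau> *\<^sub>R (w (0 - \<tau>) * \<tau> powr (- s))) / X k)"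
        by simp
      also have "\<dots> = (LINT \<tau>|lborel. indicator {0<..} \<tau> *\<^sub>R (q (X k) \<tau> * \<tau> powr (- s)))"
        by (intro Bochner_Integration.integral_cong refl) (simp add: q_def field_simps diff_divide_distrib)
      finally show "(LINT \<tau>|lborel. indicator {0<..} \<tau> *\<^sub>R (w (X k - \<tau>) * \<tau> powr (- s)) - indicator {0<..} \<tau> *\<^sub>R (w (0 - \<tau>) * \<tau> powr (- s))) / X k
        = (LINT \<tau>|lborel. indicator {0<..} \<tau> *\<^sub>R (q (X k) \<tau> * \<tau> powr (- s)))" .
      qed
    qed
    have "(\<lambda>k. LINT \<tau>|lborel. indicator {0<..} \<tau> *\<^sub>R (q (X k) \<tau> * \<tau> powr (- s))) \<longlonglongrightarrow> (LINT \<tau>|lborel. indicator {0<..} \<tau> *\<^sub>R (d (- \<tau>) * \<tau> powr (- s)))"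
    proof (rule integral_dominated_convergence)
      show "integrable lborel (\<lambda>\<tau>. L * (indicator {0..M + 1} \<tau> * \<tau> powr (- s)))" by (rule maj)
      show "AE \<tau> in lborel. (\<lambda>k. indicator {0<..} \<tau> *\<^sub>R (q (X k) \<tau> * \<tau> powr (- s))) \<longlonglongrightarrow> indicator {0<..} \<tau> *\<^sub>R (d (- \<tau>) * \<tau> powr (- s))"
      proof (rule AE_I2)
        fix \<tau>
        have "((\<lambda>h. (w (- \<tau> + h) - w (- \<tau>)) / h) \<longlongrightarrow> d (- \<tau>)) (at 0)"
          using D[of "- \<tau>"] by (simp add: DERIV_def)
        then have "(\<lambda>k. q (X k) \<tau>) \<longlonglongrightarrow> d (- \<tau>)"
          using X unfolding tendsto_at_iff_sequentially by (auto simp: comp_def q_def algebra_simps)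
        then show "(\<lambda>k. indicator {0<..} \<tau> *\<^sub>R (q (X k) \<tau> * \<tau> powr (- s))) \<longlonglongrightarrow> indicator {0<..} \<tau> *\<^sub>R (d (- \<tau>) * \<tau> powr (- s))"
          by (intro tendsto_scaleR tendsto_mult tendsto_const)
      qed
      show "AE \<tau> in lborel. norm (indicator {0<..} \<tau> *\<^sub>R (q (X k) \<tau> * \<tau> powr (- s))) \<le> L * (indicator {0..M + 1} \<tau> * \<tau> powr (- s))" for k
      proof (rule AE_I2)
        fix \<tau>
        have X1: "X k \<noteq> 0" "\<bar>X k\<bar> \<le> 1" using X(1)[rule_format, of k] by auto
        have "\<bar>q (X k) \<tau>\<bar> \<le> L" using L(2)[of "X k - \<tau>" "- \<tau>"] X1 by (simp add: q_def field_simps)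
        moreover have "q (X k) \<tau> = 0" if "M + 1 < \<tau>" using that X1 M by (simp add: q_def)
        ultimately show "norm (indicator {0<..} \<tau> *\<^sub>R (q (X k) \<tau> * \<tau> powr (- s))) \<le> L * (indicator {0..M + 1} \<tau> * \<tau> powr (- s))"
          by (cases "\<tau> \<le> M + 1") (auto simp: indicator_def abs_mult intro!: mult_right_mono)
      qed
    qed (simp_all add: q_def)
    then show "((\<lambda>h. ((LINT \<tau>:{0<..}|lborel. w (0 + h - \<tau>) * \<tau> powr (- s)) - (LINT \<tau>:{0<..}|lborel. w (0 - \<tau>) * \<tau> powr (- s))) / h) \<circ> X)
      \<longlonglongrightarrow> (LINT \<tau>:{0<..}|lborel. d (- \<tau>) * \<tau> powr (- s))"
      unfolding comp_def eq unfolding set_lebesgue_integral_def .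
  qed
  moreover have "at (0 :: real) within {-1<..<1} = at 0" by (rule at_within_open) auto
  ultimately show ?thesis by (simp add: DERIV_def)
qed

text \<open>This is where the constant of the theorem arises: 1 / \<Gamma>(1 - s) stands in
  \<open>RL_deriv\<close>, and s comes out of \<open>marchaud_by_parts\<close>.\<close>

theorem RL_dir_deriv_test_function:
  assumes \<phi>: "\<phi> \<in> test_functions" and s: "0 < s" "s < 1" and \<theta>: "norm \<theta> = 1"
  shows "RL_dir_deriv s \<theta> \<phi> x = s / Gamma (1 - s) * marchaud s \<theta> \<phi> x"
proof -
  define w where "w t = \<phi> (x + t *\<^sub>R \<theta>)" for t
  define d where "d t = (\<Sum>i\<in>UNIV. \<theta> $ i * partial_deriv i \<phi> (x + t *\<^sub>R \<theta>))" for t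
  have D: "(w has_real_derivative d t) (at t)" for t
    unfolding w_def d_def by (rule test_function_line_derivative[OF \<phi>])
  have dc: "continuous_on UNIV d"
    unfolding d_def
    by (intro continuous_intros continuous_on_compose2[OF test_function_continuous[OF test_function_partial_deriv[OF \<phi>]]]) auto
  obtain L1 where L1: "0 \<le> L1" "\<And>x y. \<bar>\<phi> x - \<phi> y\<bar> \<le> L1 * norm (x - y)" using test_function_Lipschitz[OF \<phi>] by blast
  obtain L2 where L2: "0 \<le> L2" "\<And>x h. \<bar>\<Sum>i\<in>UNIV. h $ i * partial_deriv i \<phi> x\<bar> \<le> L2 * norm h"
    using test_function_deriv_bounded[OF \<phi>] by blast
  define L where "L = L1 + L2"
  have L: "0 \<le> L" using L1 L2 by (simp add: L_def)
  have wL: "\<bar>w a - w b\<bar> \<le> L * \<bar>a - b\<bar>" for a b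
  proof -
    have "\<bar>w a - w b\<bar> \<le> L1 * norm ((a - b) *\<^sub>R \<theta>)" using L1(2)[of "x + a *\<^sub>R \<theta>" "x + b *\<^sub>R \<theta>"] by (simp add: w_def algebra_simps)
    also have "\<dots> = L1 * \<bar>a - b\<bar>" using \<theta> by simp
    also have "\<dots> \<le> L * \<bar>a - b\<bar>" using L2 by (intro mult_right_mono) (auto simp: L_def)
    finally show ?thesis .
  qed
  have dL: "\<bar>d t\<bar> \<le> L" for t using L2(2)[of \<theta> "x + t *\<^sub>R \<theta>"] \<theta> L1 by (simp add: d_def L_def)
  obtain B where B: "0 \<le> B" "\<And>x. \<bar>\<phi> x\<bar> \<le> B" using test_function_bounded[OF \<phi>] by blast
  have wB: "\<bar>w t\<bar> \<le> B" for t using B by (simp add: w_def)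
  obtain R where R: "0 < R" "\<And>x. R \<le> norm x \<Longrightarrow> \<phi> x = 0" using test_function_support[OF \<phi>] by blast
  \<comment> \<open>Beyond this parameter the line is at distance at least R + 1 from the origin.
    The extra 1 puts the point inside the open set where \<phi> vanishes, so that its derivative is
    zero as well.\<close>
  define M where "M = R + norm x + 1"
  have M: "0 < M" using R by (simp add: M_def add_pos_nonneg)
  have far: "R < norm (x + t *\<^sub>R \<theta>)" if "M \<le> \<bar>t\<bar>" for t
  proof -
    have "\<bar>t\<bar> \<le> norm (x + t *\<^sub>R \<theta>) + norm x"
      using norm_triangle_ineq4[of "x + t *\<^sub>R \<theta>" x] \<theta> by simp
    then show ?thesis using that by (simp add: M_def)
  qed
  have wM: "w t = 0" if "M \<le> \<bar>t\<bar>" for t using far[OF that] R(2) by (simp add: w_def)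
  have dM: "d t = 0" if "M \<le> \<bar>t\<bar>" for t
  proof -
    have "(\<phi> has_derivative (\<lambda>_. 0)) (at (x + t *\<^sub>R \<theta>))"
    proof (rule has_derivative_transform_within_open)
      show "((\<lambda>_. 0) has_derivative (\<lambda>_. 0)) (at (x + t *\<^sub>R \<theta>))" by simp
      show "open {y :: real^'a. R < norm y}" by (intro open_Collect_less continuous_intros)
      show "x + t *\<^sub>R \<theta> \<in> {y. R < norm y}" using far[OF that] by simp
    qed (use R(2) in auto)
    then have "frechet_derivative \<phi> (at (x + t *\<^sub>R \<theta>)) = (\<lambda>_. 0)" by (rule frechet_derivative_at[symmetric])
    then show ?thesis by (simp add: d_def partial_deriv_def)
  qed
  have wc: "continuous_on UNIV w" using D by (intro continuous_at_imp_continuous_on) (auto intro: DERIV_isCont)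
  have [measurable]: "w \<in> borel_measurable borel" using wc by (rule borel_measurable_continuous_onI)
  have leb: "(LINT t':{0<..}|lebesgue. w (t - t') * t' powr (- s)) = (LINT t':{0<..}|lborel. w (t - t') * t' powr (- s))" for t
    unfolding set_lebesgue_integral_def by (rule integral_completion) measurable
  have "deriv (\<lambda>t. LINT t':{0<..}|lebesgue. w (t - t') * t' powr (- s)) 0 = (LINT \<tau>:{0<..}|lborel. d (- \<tau>) * \<tau> powr (- s))"
    unfolding leb
    by (rule DERIV_imp_deriv, rule Riemann_Liouville_integral_derivative[OF D dc L wL B(1) wB M wM s])
  also have "\<dots> = s * (LINT t:{0<..}|lborel. (w 0 - w (- t)) * t powr (- 1 - s))"
    by (rule marchaud_by_parts[OF D dc L wL B(1) wB dL M wM dM s])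
  also have "(LINT t:{0<..}|lborel. (w 0 - w (- t)) * t powr (- 1 - s)) = marchaud s \<theta> \<phi> x"
    by (simp add: w_def marchaud_def)
  finally show ?thesis unfolding RL_dir_deriv_def RL_deriv_def w_def by simp
qed

subsection \<open>The Cartesian gradient of a test function\<close>

text \<open>The kernel of the Cartesian operators in the variable h = x - y. Scaling h instead of h
  / |h| makes it zero at the origin and visibly odd.\<close>

definition riesz :: "real \<Rightarrow> real^'n \<Rightarrow> real^'n" where
  "riesz s h = norm h powr (- (real CARD('n) + s + 1)) *\<^sub>R h"

lemma measurable_riesz [measurable]: "riesz s \<in> borel_measurable borel"
  unfolding riesz_def[abs_def] by measurable

lemma riesz_uminus: "riesz s (- h) = - riesz s h"
  by (simp add: riesz_def)

lemma norm_riesz: "h \<noteq> 0 \<Longrightarrow> norm (riesz s (h :: real^'n)) = norm h powr (- real CARD('n) - s)"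
proof -
  assume "h \<noteq> 0"
  then have "norm (riesz s h) = norm h * norm h powr (- (real CARD('n) + s + 1))" by (simp add: riesz_def)
  also have "\<dots> = norm h powr (1 + - (real CARD('n) + s + 1))" using \<open>h \<noteq> 0\<close> by (subst powr_mult_base) auto
  also have "1 + - (real CARD('n) + s + 1) = - real CARD('n) - s" by simp
  finally show ?thesis .
qed

lemma nn_integral_riesz_tail:
  assumes "0 < s" "0 < r"
  shows "(\<integral>\<^sup>+h. ennreal (norm (riesz s (h :: real^'n))) * indicator (- ball 0 r) h \<partial>lborel) = ennreal (sphere_area TYPE('n) * (r powr (- s) / s))"
  unfolding nn_integral_norm_powr_tail[OF assms, symmetric]
proof (rule nn_integral_cong)
  fix h :: "real^'n"
  show "ennreal (norm (riesz s h)) * indicator (- ball 0 r) h = ennreal (norm h powr (- real CARD('n) - s)) * indicator (- ball 0 r) h"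
    using assms by (cases "h = 0") (auto simp: indicator_def norm_riesz)
qed

lemma nn_integral_riesz_head:
  assumes "s < 1" "0 \<le> r"
  shows "(\<integral>\<^sup>+h. ennreal (norm h * norm (riesz s (h :: real^'n))) * indicator (cball 0 r) h \<partial>lborel) = ennreal (sphere_area TYPE('n) * (r powr (1 - s) / (1 - s)))"
proof -
  have "norm h * norm (riesz s h) = norm h powr ((1 - s) - real CARD('n))" for h :: "real^'n"
  proof (cases "h = 0")
    case False
    have "norm h * norm (riesz s h) = norm h powr (1 + (- real CARD('n) - s))"
      unfolding norm_riesz[OF False] by (rule powr_mult_base) simp
    then show ?thesis by (simp add: algebra_simps)
  qed simp
  then show ?thesis
    using assms nn_integral_norm_powr_head[of "1 - s" r, where 'n='n] by simp
qed

lemma riesz_tail_integrable: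
  assumes "0 < s" "0 < r"
  shows "integrable lborel (\<lambda>h :: real^'n. indicator (- ball 0 r) h * norm (riesz s h))"
    and "integrable lborel (\<lambda>h :: real^'n. indicator (- ball 0 r) h *\<^sub>R riesz s h)"
proof -
  have [measurable]: "- ball (0 :: real^'n) r \<in> sets borel" by auto
  have "(\<integral>\<^sup>+h. ennreal (norm (indicator (- ball 0 r) h *\<^sub>R riesz s (h :: real^'n))) \<partial>lborel)
     = (\<integral>\<^sup>+h. ennreal (norm (riesz s (h :: real^'n))) * indicator (- ball 0 r) h \<partial>lborel)"
    by (intro nn_integral_cong) (auto simp: indicator_def)
  then show "integrable lborel (\<lambda>h :: real^'n. indicator (- ball 0 r) h *\<^sub>R riesz s h)"
    unfolding integrable_iff_bounded nn_integral_riesz_tail[OF assms] by simp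
  from integrable_norm[OF this]
  show "integrable lborel (\<lambda>h :: real^'n. indicator (- ball 0 r) h * norm (riesz s h))"
    by simp
qed

lemma riesz_head_integrable:
  assumes "s < 1" "0 \<le> r"
  shows "integrable lborel (\<lambda>h :: real^'n. indicator (cball 0 r) h * (norm h * norm (riesz s h)))"
proof -
  have [measurable]: "cball (0 :: real^'n) r \<in> sets borel" by auto
  have "(\<integral>\<^sup>+h. ennreal (norm (indicator (cball 0 r) h * (norm h * norm (riesz s (h :: real^'n))))) \<partial>lborel)
     = (\<integral>\<^sup>+h. ennreal (norm h * norm (riesz s (h :: real^'n))) * indicator (cball 0 r) h \<partial>lborel)"
    by (intro nn_integral_cong) (auto simp: indicator_def)
  then show ?thesis
    unfolding integrable_iff_bounded nn_integral_riesz_head[OF assms] by simp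
qed

lemma integral_odd_eq_0:
  fixes f :: "'a::euclidean_space \<Rightarrow> 'b::{banach, second_countable_topology}"
  assumes [measurable]: "f \<in> borel_measurable borel" and "\<And>x. f (- x) = - f x"
  shows "(LINT x|lborel. f x) = 0"
proof -
  have "(LINT x|lborel. f x) = (LINT x|lborel. - f x)"
    using integral_shift(3)[of f 0] assms by simp
  then have "(LINT x|lborel. f x) = - (LINT x|lborel. f x)" by simp
  then have "(LINT x|lborel. f x) + (LINT x|lborel. f x) = 0" by (metis ab_left_minus)
  then have "2 *\<^sub>R (LINT x|lborel. f x) = 0" by (simp only: scaleR_2)
  then show ?thesis by simp
qed

definition cart_majorant :: "real \<Rightarrow> real \<Rightarrow> real \<Rightarrow> real^'n \<Rightarrow> real" where
  "cart_majorant s L B h = L * (indicator (cball 0 1) h * (norm h * norm (riesz s h))) + B * (indicator (- ball 0 1) h * norm (riesz s h))"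

lemma cart_majorant_integrable:
  "0 < s \<Longrightarrow> s < 1 \<Longrightarrow> integrable lborel (cart_majorant s L B :: real^'n \<Rightarrow> real)"
  unfolding cart_majorant_def[abs_def]
  by (intro Bochner_Integration.integrable_add integrable_mult_right riesz_head_integrable riesz_tail_integrable) auto

lemma cart_majorant_le:
  assumes "\<bar>a\<bar> \<le> L * norm h" "\<bar>a\<bar> \<le> B" "0 \<le> L"
  shows "norm (a *\<^sub>R riesz s h) \<le> cart_majorant s L B h"
proof (cases "norm h \<le> 1")
  case True
  have "norm (a *\<^sub>R riesz s h) \<le> L * norm h * norm (riesz s h)"
    using assms by (simp add: mult_right_mono)
  also have "\<dots> \<le> cart_majorant s L B h"
    using True assms by (auto simp: cart_majorant_def indicator_def)
  finally show ?thesis .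
next
  case False
  have "norm (a *\<^sub>R riesz s h) \<le> B * norm (riesz s h)"
    using assms by (simp add: mult_right_mono)
  also have "\<dots> \<le> cart_majorant s L B h"
    using False assms by (auto simp: cart_majorant_def indicator_def)
  finally show ?thesis .
qed

lemma test_function_cart_majorant:
  fixes \<phi> :: "real^'n \<Rightarrow> real"
  assumes \<phi>: "\<phi> \<in> test_functions"
  obtains L B where "0 \<le> L" "0 \<le> B" "\<And>s x h. norm ((\<phi> x - \<phi> (x - h)) *\<^sub>R riesz s h) \<le> cart_majorant s L B h"
    "\<And>x. \<bar>\<phi> x\<bar> \<le> B" "\<And>x y. \<bar>\<phi> x - \<phi> y\<bar> \<le> L * norm (x - y)"
proof -
  obtain L where L: "0 \<le> L" "\<And>x y. \<bar>\<phi> x - \<phi> y\<bar> \<le> L * norm (x - y)" using test_function_Lipschitz[OF \<phi>] by blast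
  obtain B where B: "0 \<le> B" "\<And>x. \<bar>\<phi> x\<bar> \<le> B" using test_function_bounded[OF \<phi>] by blast
  show thesis
  proof (rule that[of L "2 * B"])
    fix s x and h :: "real^'n"
    have "\<bar>\<phi> x - \<phi> (x - h)\<bar> \<le> 2 * B" using B(2)[of x] B(2)[of "x - h"] by linarith
    then show "norm ((\<phi> x - \<phi> (x - h)) *\<^sub>R riesz s h) \<le> cart_majorant s L (2 * B) h"
      using L(2)[of x "x - h"] L(1) by (intro cart_majorant_le) auto
  qed (use L B order_trans[OF B(2)] in auto)
qed

text \<open>The Cartesian gradient of a test function: by the Lipschitz bound the integral converges
  absolutely, and no principal value is taken.\<close>

definition cart :: "real \<Rightarrow> (real^'n \<Rightarrow> real) \<Rightarrow> real^'n \<Rightarrow> real^'n" where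
  "cart s \<phi> x = (LINT h|lborel. (\<phi> x - \<phi> (x - h)) *\<^sub>R riesz s h)"

definition trunc :: "real \<Rightarrow> real \<Rightarrow> (real^'n \<Rightarrow> real) \<Rightarrow> real^'n \<Rightarrow> real^'n" where
  "trunc s r \<phi> x = (LINT h|lborel. indicator (- ball 0 r) h *\<^sub>R ((\<phi> x - \<phi> (x - h)) *\<^sub>R riesz s h))"

lemma cart_integrable:
  fixes \<phi> :: "real^'n \<Rightarrow> real"
  assumes \<phi>: "\<phi> \<in> test_functions" and s: "0 < s" "s < 1"
  shows "integrable lborel (\<lambda>h. (\<phi> x - \<phi> (x - h)) *\<^sub>R riesz s h)"
proof -
  have [measurable]: "\<phi> \<in> borel_measurable borel" using \<phi> by (rule test_function_measurable)
  obtain L B where LB: "\<And>s x h. norm ((\<phi> x - \<phi> (x - h)) *\<^sub>R riesz s h) \<le> cart_majorant s L B h"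
    using test_function_cart_majorant[OF \<phi>] by metis
  have "AE h in lborel. norm ((\<phi> x - \<phi> (x - h)) *\<^sub>R riesz s h) \<le> norm (cart_majorant s L B h)"
    by (intro AE_I2 order_trans[OF LB]) simp
  from Bochner_Integration.integrable_bound[OF cart_majorant_integrable[OF s] _ this] show ?thesis by simp
qed

text \<open>In polar coordinates r^(n-1) times the kernel at r \<theta> is r^(-1-s) \<theta>, so the
  radial integral is exactly the Marchaud integral in direction \<theta>.\<close>

theorem cart_eq_sphere_integral:
  fixes \<phi> :: "real^'n \<Rightarrow> real"
  assumes \<phi>: "\<phi> \<in> test_functions" and s: "0 < s" "s < 1"
  shows "cart s \<phi> x = (LINT \<theta>|surface_measure. marchaud s \<theta> \<phi> x *\<^sub>R \<theta>)"
    and "integrable surface_measure (\<lambda>\<theta>. marchaud s \<theta> \<phi> x *\<^sub>R \<theta>)"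
proof -
  have eq: "(LINT r:{0<..}|lborel. r ^ (CARD('n) - 1) *\<^sub>R ((\<phi> x - \<phi> (x - r *\<^sub>R \<theta>)) *\<^sub>R riesz s (r *\<^sub>R \<theta>))) = marchaud s \<theta> \<phi> x *\<^sub>R \<theta>"
    if \<theta>: "norm \<theta> = 1" for \<theta>
  proof -
    have "(LINT r:{0<..}|lborel. r ^ (CARD('n) - 1) *\<^sub>R ((\<phi> x - \<phi> (x - r *\<^sub>R \<theta>)) *\<^sub>R riesz s (r *\<^sub>R \<theta>)))
      = (LINT r:{0<..}|lborel. ((\<phi> x - \<phi> (x - r *\<^sub>R \<theta>)) * r powr (- 1 - s)) *\<^sub>R \<theta>)"
    proof (intro set_lebesgue_integral_cong allI impI)
      fix r :: real assume "r \<in> {0<..}"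
      then have r: "0 < r" by simp
      have "r ^ (CARD('n) - 1) * (r powr (- (real CARD('n) + s + 1)) * r) = (r powr (- (real CARD('n) + s + 1)) * r ^ (CARD('n) - 1)) * r"
        by simp
      also have "\<dots> = r * r powr (- (real CARD('n) + s + 1) + real CARD('n) - 1)"
        unfolding powr_times_radius[OF r] by simp
      also have "\<dots> = r powr (1 + (- (real CARD('n) + s + 1) + real CARD('n) - 1))"
        using r by (intro powr_mult_base) simp
      also have "1 + (- (real CARD('n) + s + 1) + real CARD('n) - 1) = - 1 - s" by simp
      finally show "r ^ (CARD('n) - 1) *\<^sub>R ((\<phi> x - \<phi> (x - r *\<^sub>R \<theta>)) *\<^sub>R riesz s (r *\<^sub>R \<theta>))
         = ((\<phi> x - \<phi> (x - r *\<^sub>R \<theta>)) * r powr (- 1 - s)) *\<^sub>R \<theta>"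
        using r \<theta> by (simp add: riesz_def mult_ac)
    qed simp
    also have "\<dots> = marchaud s \<theta> \<phi> x *\<^sub>R \<theta>"
      unfolding marchaud_def set_lebesgue_integral_def
      using marchaud_integrable[OF \<phi> s, of x \<theta>] unfolding set_integrable_def
      by (subst integral_scaleR_left[symmetric]) simp_all
    finally show ?thesis .
  qed
  have cong: "(LINT r:{0<..}|lborel. r ^ (CARD('n) - 1) *\<^sub>R ((\<phi> x - \<phi> (x - r *\<^sub>R \<theta>)) *\<^sub>R riesz s (r *\<^sub>R \<theta>))) = marchaud s \<theta> \<phi> x *\<^sub>R \<theta>"
    if "\<theta> \<in> space surface_measure" for \<theta> using eq[of \<theta>] that by simp
  show "cart s \<phi> x = (LINT \<theta>|surface_measure. marchaud s \<theta> \<phi> x *\<^sub>R \<theta>)"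
    unfolding cart_def integral_polar(1)[OF cart_integrable[OF \<phi> s]]
    by (intro Bochner_Integration.integral_cong refl cong)
  show "integrable surface_measure (\<lambda>\<theta>. marchaud s \<theta> \<phi> x *\<^sub>R \<theta>)"
    using integral_polar(2)[OF cart_integrable[OF \<phi> s, of x]] cong
    by (subst (asm) Bochner_Integration.integrable_cong[OF refl cong]) auto
qed

text \<open>The majorant does not depend on the point, so dominated convergence applies. Continuity
  makes these gradients the approximants in the Lebesgue point argument of
  \<open>rho_tendsto_AE\<close>.\<close>

lemma cart_continuous:
  fixes \<phi> :: "real^'n \<Rightarrow> real"
  assumes \<phi>: "\<phi> \<in> test_functions" and s: "0 < s" "s < 1"
  shows "continuous_on UNIV (cart s \<phi>)"
proof -
  have [measurable]: "\<phi> \<in> borel_measurable borel" using \<phi> by (rule test_function_measurable)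
  obtain L B where LB: "\<And>s x h. norm ((\<phi> x - \<phi> (x - h)) *\<^sub>R riesz s h) \<le> cart_majorant s L B h"
    using test_function_cart_majorant[OF \<phi>] by metis
  have c: "isCont \<phi> x" for x using test_function_continuous[OF \<phi>] by (simp add: continuous_on_eq_continuous_at)
  have "isCont (cart s \<phi>) x" for x
    unfolding continuous_at_sequentially
  proof (intro allI impI)
    fix X assume X: "X \<longlonglongrightarrow> x"
    show "(cart s \<phi> \<circ> X) \<longlonglongrightarrow> cart s \<phi> x"
      unfolding comp_def cart_def
    proof (rule integral_dominated_convergence)
      show "integrable lborel (cart_majorant s L B :: real^'n \<Rightarrow> real)" by (rule cart_majorant_integrable[OF s])
      show "AE h in lborel. (\<lambda>k. (\<phi> (X k) - \<phi> (X k - h)) *\<^sub>R riesz s h) \<longlonglongrightarrow> (\<phi> x - \<phi> (x - h)) *\<^sub>R riesz s h"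
        by (intro AE_I2 tendsto_scaleR tendsto_diff tendsto_const isCont_tendsto_compose[OF c] X)
      show "AE h in lborel. norm ((\<phi> (X k) - \<phi> (X k - h)) *\<^sub>R riesz s h) \<le> cart_majorant s L B h" for k
        by (intro AE_I2 LB)
    qed simp_all
  qed
  then show ?thesis by (simp add: continuous_at_imp_continuous_on)
qed

lemma trunc_tendsto_cart:
  fixes \<phi> :: "real^'n \<Rightarrow> real"
  assumes \<phi>: "\<phi> \<in> test_functions" and s: "0 < s" "s < 1" and e: "e \<longlonglongrightarrow> 0"
  shows "(\<lambda>k. trunc s (e k) \<phi> x) \<longlonglongrightarrow> cart s \<phi> x"
proof -
  have [measurable]: "\<phi> \<in> borel_measurable borel" using \<phi> by (rule test_function_measurable)
  have [measurable]: "- ball (0 :: real^'n) r \<in> sets borel" for r by auto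
  show ?thesis
    unfolding trunc_def cart_def
  proof (rule integral_dominated_convergence)
    show "integrable lborel (\<lambda>h. norm ((\<phi> x - \<phi> (x - h)) *\<^sub>R riesz s h))"
      using cart_integrable[OF \<phi> s] by (rule integrable_norm)
    show "AE h in lborel. (\<lambda>k. indicator (- ball 0 (e k)) h *\<^sub>R ((\<phi> x - \<phi> (x - h)) *\<^sub>R riesz s h)) \<longlonglongrightarrow> (\<phi> x - \<phi> (x - h)) *\<^sub>R riesz s h"
    proof (rule AE_I2)
      fix h :: "real^'n"
      show "(\<lambda>k. indicator (- ball 0 (e k)) h *\<^sub>R ((\<phi> x - \<phi> (x - h)) *\<^sub>R riesz s h)) \<longlonglongrightarrow> (\<phi> x - \<phi> (x - h)) *\<^sub>R riesz s h"
      proof (cases "h = 0")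
        case False
        have "eventually (\<lambda>k. e k < norm h) sequentially" using order_tendstoD(2)[OF e] False by simp
        then have "eventually (\<lambda>k. indicator (- ball 0 (e k)) h *\<^sub>R ((\<phi> x - \<phi> (x - h)) *\<^sub>R riesz s h) = (\<phi> x - \<phi> (x - h)) *\<^sub>R riesz s h) sequentially"
          by eventually_elim (auto simp: indicator_def)
        then show ?thesis by (rule tendsto_eventually)
      qed (simp add: riesz_def)
    qed
    show "AE h in lborel. norm (indicator (- ball 0 (e k)) h *\<^sub>R ((\<phi> x - \<phi> (x - h)) *\<^sub>R riesz s h)) \<le> norm ((\<phi> x - \<phi> (x - h)) *\<^sub>R riesz s h)" for k
      by (intro AE_I2) (auto simp: indicator_def)
  qed measurable
qed

text \<open>The difference is |p|^(-a) (p - q) + (|p|^(-a) - |q|^(-a)) q. Since |p| \<ge> |q| / 2,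
  both the power and its derivative are bounded by their values at |q| / 2, which is where the
  powers of 2 in the constant come from.\<close>

lemma riesz_diff_le:
  fixes p q :: "real^'n"
  assumes s: "0 < s" and q: "q \<noteq> 0" "norm (p - q) \<le> norm q / 2"
  defines "a \<equiv> real CARD('n) + s + 1"
  shows "norm (riesz s p - riesz s q) \<le> (2 powr a + a * 2 powr (a + 1)) * norm (p - q) * norm q powr (- a)"
proof -
  have a: "0 < a" using s by (simp add: a_def add_pos_pos)
  let ?m = "norm q / 2"
  have m: "0 < ?m" using q by simp
  have p: "?m \<le> norm p" using q(2) norm_triangle_ineq2[of q p] by (simp add: norm_minus_commute)
  have pw: "?m powr (- b) = 2 powr b * norm q powr (- b)" for b
  proof -
    have "?m powr (- b) = norm q powr (- b) / 2 powr (- b)" by (rule powr_divide)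
    also have "(2 :: real) powr (- b) = inverse (2 powr b)" by (rule powr_minus)
    finally show ?thesis by (simp only: divide_inverse inverse_inverse_eq mult.commute)
  qed
  have 1: "norm p powr (- a) \<le> 2 powr a * norm q powr (- a)"
    unfolding pw[symmetric] using p m a by (intro powr_mono2') auto
  have 2: "\<bar>norm p powr (- a) - norm q powr (- a)\<bar> \<le> (a * ?m powr (- a - 1)) * \<bar>norm p - norm q\<bar>"
  proof -
    have "norm (norm p powr (- a) - norm q powr (- a)) \<le> (a * ?m powr (- a - 1)) * norm (norm p - norm q)"
    proof (rule field_differentiable_bound[where S = "{?m..}"])
      fix z :: real assume "z \<in> {?m..}"
      then have "?m \<le> z" by simp
      then have z: "0 < z" "?m \<le> z" using m by linarith+
      show "((\<lambda>z. z powr (- a)) has_field_derivative (- a * z powr (- a - 1))) (at z within {?m..})"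
        using has_real_derivative_powr[OF z(1), of "- a"] by (rule has_field_derivative_at_within)
      have "z powr (- a - 1) \<le> ?m powr (- a - 1)" using z m a by (intro powr_mono2') auto
      then show "norm (- a * z powr (- a - 1)) \<le> a * ?m powr (- a - 1)"
        using a by (simp add: abs_mult)
    qed (use p q in auto)
    then show ?thesis by simp
  qed
  have "riesz s p - riesz s q = norm p powr (- a) *\<^sub>R (p - q) + (norm p powr (- a) - norm q powr (- a)) *\<^sub>R q"
    by (simp add: riesz_def a_def algebra_simps)
  then have "norm (riesz s p - riesz s q) \<le> norm p powr (- a) * norm (p - q) + \<bar>norm p powr (- a) - norm q powr (- a)\<bar> * norm q"
    using norm_triangle_ineq[of "norm p powr (- a) *\<^sub>R (p - q)" "(norm p powr (- a) - norm q powr (- a)) *\<^sub>R q"] by simp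
  also have "\<dots> \<le> (2 powr a * norm q powr (- a)) * norm (p - q) + ((a * ?m powr (- a - 1)) * norm (p - q)) * norm q"
  proof (intro add_mono mult_right_mono 1 order_trans[OF 2])
    show "a * ?m powr (- a - 1) * \<bar>norm p - norm q\<bar> \<le> a * ?m powr (- a - 1) * norm (p - q)"
      using a norm_triangle_ineq3[of p q] by (intro mult_left_mono) auto
  qed auto
  also have "?m powr (- a - 1) = 2 powr (a + 1) * (norm q powr (- a) / norm q)"
  proof -
    have "?m powr (- a - 1) = ?m powr (- (a + 1))" by simp
    also have "\<dots> = 2 powr (a + 1) * norm q powr (- a - 1)" unfolding pw by simp
    also have "norm q powr (- a - 1) = norm q powr (- a) / norm q" using q by (simp add: powr_diff)
    finally show ?thesis .
  qed
  also have "(2 powr a * norm q powr (- a)) * norm (p - q) + ((a * (2 powr (a + 1) * (norm q powr (- a) / norm q))) * norm (p - q)) * norm q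
     = (2 powr a + a * 2 powr (a + 1)) * norm (p - q) * norm q powr (- a)"
    using q by (simp add: algebra_simps)
  finally show ?thesis .
qed

text \<open>Outside the ball the kernel is integrable and odd, so its integral is 0 and any constant
  \<open>c\<close> may take the place of \<open>w x\<close>. This allows a truncated integral
  centred at x - z to be written with the increment from the fixed point x.\<close>

lemma trunc_shift:
  fixes w :: "real^'n \<Rightarrow> real"
  assumes [measurable]: "w \<in> borel_measurable borel" and i: "integrable lborel (\<lambda>h. indicator (- ball 0 r) h *\<^sub>R (w (x - h) *\<^sub>R riesz s h))"
    and s: "0 < s" "0 < r"
  shows "integrable lborel (\<lambda>h. indicator (- ball 0 r) h *\<^sub>R ((c - w (x - h)) *\<^sub>R riesz s h))"
    and "(LINT h|lborel. indicator (- ball 0 r) h *\<^sub>R ((c - w (x - h)) *\<^sub>R riesz s h)) = trunc s r w x"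
proof -
  have [measurable]: "- ball (0 :: real^'n) r \<in> sets borel" by auto
  have eq: "indicator (- ball 0 r) h *\<^sub>R ((c - w (x - h)) *\<^sub>R riesz s h)
    = c *\<^sub>R (indicator (- ball 0 r) h *\<^sub>R riesz s h) - indicator (- ball 0 r) h *\<^sub>R (w (x - h) *\<^sub>R riesz s h)" for c h
    by (simp add: algebra_simps)
  have ic: "integrable lborel (\<lambda>h. c *\<^sub>R (indicator (- ball 0 r) h *\<^sub>R riesz s (h :: real^'n)))" for c
    by (intro integrable_scaleR_right riesz_tail_integrable(2) s)
  then show "integrable lborel (\<lambda>h. indicator (- ball 0 r) h *\<^sub>R ((c - w (x - h)) *\<^sub>R riesz s h))"
    unfolding eq using i by (rule Bochner_Integration.integrable_diff)
  have "(LINT h|lborel. indicator (- ball 0 r) h *\<^sub>R riesz s (h :: real^'n)) = 0"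
    by (rule integral_odd_eq_0) (simp_all add: riesz_uminus indicator_def)
  then have z: "(LINT h|lborel. c *\<^sub>R (indicator (- ball 0 r) h *\<^sub>R riesz s (h :: real^'n))) = 0" for c
    by (simp only: integral_scaleR_right scaleR_zero_right)
  have "(LINT h|lborel. indicator (- ball 0 r) h *\<^sub>R ((c - w (x - h)) *\<^sub>R riesz s h))
    = - (LINT h|lborel. indicator (- ball 0 r) h *\<^sub>R (w (x - h) *\<^sub>R riesz s h))" for c
    unfolding eq Bochner_Integration.integral_diff[OF ic i] z by (rule diff_0)
  then show "(LINT h|lborel. indicator (- ball 0 r) h *\<^sub>R ((c - w (x - h)) *\<^sub>R riesz s h)) = trunc s r w x"
    unfolding trunc_def by simp
qed

subsection \<open>The mollified Riesz kernel\<close>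

definition rho :: "(real^'n \<Rightarrow> real) \<Rightarrow> real \<Rightarrow> real^'n \<Rightarrow> real" where
  "rho \<eta> r z = \<eta> (z /\<^sub>R r) / r ^ CARD('n)"

text \<open>Size of the difference between the Riesz kernel truncated at radius \<open>r\<close> and its mollification at scale \<open>r\<close>.\<close>

definition error_kernel :: "real \<Rightarrow> real \<Rightarrow> real^'n \<Rightarrow> real" where
  "error_kernel s r y = (if norm y < 2 * r then r powr (- real CARD('n) - s) else r * norm y powr (- (real CARD('n) + s + 1)))"

lemma measurable_kap [measurable]: "error_kernel s r \<in> borel_measurable borel"
  unfolding error_kernel_def[abs_def] by measurable

lemma error_kernel_nonneg: "0 < r \<Longrightarrow> 0 \<le> error_kernel s r y"
  by (simp add: error_kernel_def)

locale mollifier =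
  fixes \<eta> :: "real^'n \<Rightarrow> real" and L B :: real
  assumes \<eta>: "\<eta> \<in> test_functions" "\<And>x. 0 \<le> \<eta> x" "\<And>x. 1 \<le> norm x \<Longrightarrow> \<eta> x = 0" "(\<integral>\<^sup>+x. ennreal (\<eta> x) \<partial>lborel) = 1"
    and L: "0 \<le> L" "\<And>x y. \<bar>\<eta> x - \<eta> y\<bar> \<le> L * norm (x - y)" and B: "0 \<le> B" "\<And>x. \<eta> x \<le> B"
begin

lemma measurable_eta [measurable]: "\<eta> \<in> borel_measurable borel"
  using \<eta>(1) by (rule test_function_measurable)

lemma measurable_rho [measurable]: "rho \<eta> r \<in> borel_measurable borel"
  unfolding rho_def[abs_def] by measurable

lemma rho_nonneg: "0 < r \<Longrightarrow> 0 \<le> rho \<eta> r z"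
  using \<eta>(2) by (simp add: rho_def)

lemma rho_eq_0: "0 < r \<Longrightarrow> r \<le> norm z \<Longrightarrow> rho \<eta> r z = 0"
  using \<eta>(3)[of "z /\<^sub>R r"] by (simp add: rho_def field_simps)

lemma rho_le: "0 < r \<Longrightarrow> rho \<eta> r z \<le> B / r ^ CARD('n)"
  using B by (simp add: rho_def divide_right_mono)

lemma rho_Lipschitz:
  assumes "0 < r"
  shows "\<bar>rho \<eta> r z - rho \<eta> r y\<bar> \<le> L / r ^ (CARD('n) + 1) * norm (z - y)"
proof -
  have "\<bar>rho \<eta> r z - rho \<eta> r y\<bar> = \<bar>\<eta> (z /\<^sub>R r) - \<eta> (y /\<^sub>R r)\<bar> / r ^ CARD('n)"
    using assms by (simp add: rho_def diff_divide_distrib[symmetric])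
  also have "\<dots> \<le> (L * norm (z /\<^sub>R r - y /\<^sub>R r)) / r ^ CARD('n)"
    using L(2) assms by (intro divide_right_mono) auto
  also have "z /\<^sub>R r - y /\<^sub>R r = (z - y) /\<^sub>R r" by (simp add: scaleR_diff_right)
  finally show ?thesis using assms by (simp add: divide_inverse mult_ac)
qed

lemma nn_integral_rho: "0 < r \<Longrightarrow> (\<integral>\<^sup>+z. ennreal (rho \<eta> r z) \<partial>lborel) = 1"
proof -
  assume r: "0 < r"
  have "(\<integral>\<^sup>+z. ennreal (rho \<eta> r z) \<partial>lborel) = ennreal (r ^ CARD('n)) * (\<integral>\<^sup>+z. ennreal (rho \<eta> r (r *\<^sub>R z)) \<partial>lborel)"
    using nn_integral_scale[of "\<lambda>z. ennreal (rho \<eta> r z)" r] r by simp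
  also have "\<dots> = (\<integral>\<^sup>+z. ennreal (r ^ CARD('n)) * ennreal (rho \<eta> r (r *\<^sub>R z)) \<partial>lborel)"
    by (subst nn_integral_cmult) simp_all
  also have "\<dots> = (\<integral>\<^sup>+z. ennreal (\<eta> z) \<partial>lborel)"
    using r \<eta>(2) by (intro nn_integral_cong) (simp add: rho_def ennreal_mult[symmetric])
  finally show ?thesis using \<eta>(4) by simp
qed

lemma integrable_rho: "0 < r \<Longrightarrow> integrable lborel (rho \<eta> r)"
  using nn_integral_rho[of r] rho_nonneg[of r] by (simp add: integrable_iff_bounded)

lemma integral_rho: "0 < r \<Longrightarrow> (LINT z|lborel. rho \<eta> r z) = 1"
  using nn_integral_rho[of r] rho_nonneg[of r] by (simp add: integral_eq_nn_integral)

text \<open>The convolution of \<open>rho \<eta> r\<close> with the kernel truncated at the smaller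
  radius \<epsilon>. The inner truncation makes Fubini absolutely convergent; the bounds below are
  uniform in \<epsilon> \<le> r.\<close>

definition mollified_kernel :: "real \<Rightarrow> real \<Rightarrow> real \<Rightarrow> real^'n \<Rightarrow> real^'n" where
  "mollified_kernel s r \<epsilon> y = (LINT z|lborel. rho \<eta> r z *\<^sub>R (indicator (- ball 0 \<epsilon>) (y - z) *\<^sub>R riesz s (y - z)))"

definition far_const :: "real \<Rightarrow> real" where
  "far_const s = 2 powr (real CARD('n) + s + 1) + (real CARD('n) + s + 1) * 2 powr ((real CARD('n) + s + 1) + 1)"

text \<open>The 1 bounds the truncated kernel itself; the other term is the integral of |h| times
  the kernel over the ball of radius 3 r, with the power of r split off.\<close>

definition near_const :: "real \<Rightarrow> real" where
  "near_const s = 1 + L * (sphere_area TYPE('n) * (3 powr (1 - s) / (1 - s)))"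

lemma riesz_tail_norm_le:
  assumes "0 < s" "0 < \<epsilon>" "\<epsilon> \<le> norm (h :: real^'n)"
  shows "norm (riesz s h) \<le> \<epsilon> powr (- real CARD('n) - s)"
proof -
  have "h \<noteq> 0" using assms by auto
  then show ?thesis using assms by (auto simp: norm_riesz intro!: powr_mono2')
qed

text \<open>For |z| < r the point y - z stays outside the ball of radius \<epsilon>, so the
  truncation is inactive and the difference is an average of differences of the kernel over
  distances below r.\<close>

lemma far_bound:
  assumes s: "0 < s" "s < 1" and e: "0 < \<epsilon>" "\<epsilon> \<le> r" and y: "2 * r \<le> norm y"
  shows "norm (mollified_kernel s r \<epsilon> y - riesz s y) \<le> far_const s * (r * norm y powr (- (real CARD('n) + s + 1)))"
proof -
  have r: "0 < r" using e by simp
  have [measurable]: "- ball (0 :: real^'n) \<epsilon> \<in> sets borel" by auto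
  let ?K = "far_const s * (r * norm y powr (- (real CARD('n) + s + 1)))"
  have K: "0 \<le> ?K" using r s by (simp add: far_const_def)
  have pt: "norm (rho \<eta> r z *\<^sub>R (indicator (- ball 0 \<epsilon>) (y - z) *\<^sub>R riesz s (y - z)) - rho \<eta> r z *\<^sub>R riesz s y) \<le> rho \<eta> r z * ?K" for z
  proof (cases "norm z < r")
    case True
    have "norm y \<le> norm (y - z) + norm z" using norm_triangle_sub[of y z] by (simp add: add.commute)
    then have "\<epsilon> \<le> norm (y - z)" using True e y by simp
    then have ind: "indicator (- ball 0 \<epsilon>) (y - z) = (1 :: real)" by simp
    have "norm (riesz s (y - z) - riesz s y) \<le> far_const s * norm (y - z - y) * norm y powr (- (real CARD('n) + s + 1))"
      unfolding far_const_def using y r True by (intro riesz_diff_le s) auto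
    also have "\<dots> \<le> far_const s * r * norm y powr (- (real CARD('n) + s + 1))"
      using True s by (intro mult_right_mono mult_left_mono) (auto simp: far_const_def)
    finally have "norm (riesz s (y - z) - riesz s y) \<le> ?K" by (simp add: mult.assoc)
    then have "rho \<eta> r z * norm (riesz s (y - z) - riesz s y) \<le> rho \<eta> r z * ?K"
      by (rule mult_left_mono) (rule rho_nonneg[OF r])
    then show ?thesis using rho_nonneg[OF r, of z] by (simp add: ind scaleR_diff_right[symmetric])
  next
    case False
    then show ?thesis using rho_eq_0[OF r, of z] by simp
  qed
  have i2: "integrable lborel (\<lambda>z. rho \<eta> r z *\<^sub>R riesz s y)" using integrable_rho[OF r] by simp
  have i0: "integrable lborel (\<lambda>z. rho \<eta> r z *\<^sub>R (indicator (- ball 0 \<epsilon>) (y - z) *\<^sub>R riesz s (y - z)) - rho \<eta> r z *\<^sub>R riesz s y)"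
    by (rule Bochner_Integration.integrable_bound[where f="\<lambda>z. rho \<eta> r z * ?K"])
       (use integrable_rho[OF r] pt K rho_nonneg[OF r] in \<open>auto intro!: order_trans[OF pt]\<close>)
  have i1: "integrable lborel (\<lambda>z. rho \<eta> r z *\<^sub>R (indicator (- ball 0 \<epsilon>) (y - z) *\<^sub>R riesz s (y - z)))"
    using Bochner_Integration.integrable_add[OF i0 i2] by simp
  have "mollified_kernel s r \<epsilon> y - riesz s y
    = (LINT z|lborel. rho \<eta> r z *\<^sub>R (indicator (- ball 0 \<epsilon>) (y - z) *\<^sub>R riesz s (y - z)) - rho \<eta> r z *\<^sub>R riesz s y)"
    unfolding mollified_kernel_def using i1 i2 integral_rho[OF r] integrable_rho[OF r]
    by (subst Bochner_Integration.integral_diff) simp_all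
  also have "norm \<dots> \<le> (LINT z|lborel. rho \<eta> r z * ?K)"
    by (rule Bochner_Integration.integral_norm_bound_integral) (use i0 integrable_rho[OF r] pt in auto)
  also have "\<dots> = ?K" using integral_rho[OF r] by simp
  finally show ?thesis .
qed

text \<open>A bound uniform in \<epsilon> needs cancellation. The kernel cut to \<epsilon> \<le> |h|
  < 3 r is odd, so rho(y) times it can be subtracted at no cost; the Lipschitz bound of rho then
  supplies a factor |h|, which makes the singularity integrable because s < 1.\<close>

lemma near_bound:
  assumes s: "0 < s" "s < 1" and e: "0 < \<epsilon>" "\<epsilon> \<le> r" and y: "norm y < 2 * r"
  shows "norm (mollified_kernel s r \<epsilon> y - indicator (- ball 0 r) y *\<^sub>R riesz s y) \<le> near_const s * r powr (- real CARD('n) - s)"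
proof -
  have r: "0 < r" using e by simp
  have [measurable]: "- ball (0 :: real^'n) \<epsilon> \<in> sets borel" "ball (0 :: real^'n) (3 * r) \<in> sets borel" by auto
  define g where "g h = rho \<eta> r (y - h) *\<^sub>R (indicator (- ball 0 \<epsilon>) h *\<^sub>R riesz s h)" for h
  \<comment> \<open>Radius 3 r suffices: rho(y - h) vanishes unless |y - h| < r, and |y| < 2
    r.\<close>
  define k where "k h = indicator (ball 0 (3 * r)) h *\<^sub>R (indicator (- ball 0 \<epsilon>) h *\<^sub>R riesz s (h :: real^'n))" for h
  have [measurable]: "g \<in> borel_measurable borel" unfolding g_def[abs_def] by measurable
  have [measurable]: "k \<in> borel_measurable borel" unfolding k_def[abs_def] by measurable
  have k_int: "integrable lborel k"
    by (rule Bochner_Integration.integrable_bound[OF riesz_tail_integrable(2)[OF s(1) e(1)]])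
       (auto simp: k_def indicator_def)
  have k0: "(LINT h|lborel. k h) = 0"
    by (rule integral_odd_eq_0) (simp_all add: k_def riesz_uminus indicator_def)
  let ?c = "L / r ^ (CARD('n) + 1)"
  have c: "0 \<le> ?c" using L r by simp
  define M where "M h = ?c * (indicator (cball 0 (3 * r)) h * (norm h * norm (riesz s (h :: real^'n))))" for h
  have M_int: "integrable lborel M"
    unfolding M_def[abs_def] using r s by (intro integrable_mult_right riesz_head_integrable) auto
  have M_nonneg: "0 \<le> M h" for h unfolding M_def using c by (intro mult_nonneg_nonneg) auto
  have pt: "norm (g h - rho \<eta> r y *\<^sub>R k h) \<le> M h" for h
  proof (cases "norm h < 3 * r")
    case True
    have "g h - rho \<eta> r y *\<^sub>R k h = (rho \<eta> r (y - h) - rho \<eta> r y) *\<^sub>R (indicator (- ball 0 \<epsilon>) h *\<^sub>R riesz s h)"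
      using True by (simp add: g_def k_def scaleR_diff_left left_diff_distrib)
    also have "norm \<dots> \<le> \<bar>rho \<eta> r (y - h) - rho \<eta> r y\<bar> * norm (riesz s h)"
      by (auto simp: indicator_def)
    also have "\<dots> \<le> (?c * norm h) * norm (riesz s h)"
      using rho_Lipschitz[OF r, of "y - h" y] by (intro mult_right_mono) auto
    also have "\<dots> = M h" using True by (simp add: M_def)
    finally show ?thesis .
  next
    case False
    have "r \<le> norm (y - h)" using False y norm_triangle_ineq2[of h y] by (simp add: norm_minus_commute)
    then have "g h = 0" using rho_eq_0[OF r] by (simp add: g_def)
    moreover have "k h = 0" using False by (simp add: k_def)
    ultimately show ?thesis using M_nonneg by simp
  qed
  have i0: "integrable lborel (\<lambda>h. g h - rho \<eta> r y *\<^sub>R k h)"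
    by (rule Bochner_Integration.integrable_bound[OF M_int]) (use order_trans[OF pt abs_ge_self] in auto)
  have i1: "integrable lborel g"
    using Bochner_Integration.integrable_add[OF i0 integrable_scaleR_right[of "rho \<eta> r y" lborel k]] k_int by simp
  have "mollified_kernel s r \<epsilon> y = (LINT h|lborel. g h)"
    unfolding mollified_kernel_def using integral_shift(3)[of g y] by (simp add: g_def)
  also have "\<dots> = (LINT h|lborel. g h - rho \<eta> r y *\<^sub>R k h)"
    using i1 k_int k0 by (subst Bochner_Integration.integral_diff) auto
  finally have "norm (mollified_kernel s r \<epsilon> y) \<le> (LINT h|lborel. M h)"
    using Bochner_Integration.integral_norm_bound_integral[OF i0 M_int] pt by simp
  also have "(LINT h|lborel. M h) = L * (sphere_area TYPE('n) * (3 powr (1 - s) / (1 - s))) * r powr (- real CARD('n) - s)"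
  proof -
    have "(\<integral>\<^sup>+h. ennreal (indicator (cball 0 (3 * r)) h * (norm h * norm (riesz s (h :: real^'n)))) \<partial>lborel)
       = (\<integral>\<^sup>+h. ennreal (norm h * norm (riesz s (h :: real^'n))) * indicator (cball 0 (3 * r)) h \<partial>lborel)"
      by (intro nn_integral_cong) (auto simp: indicator_def)
    also have "\<dots> = ennreal (sphere_area TYPE('n) * ((3 * r) powr (1 - s) / (1 - s)))"
      using r s by (intro nn_integral_riesz_head) auto
    finally have "(LINT h|lborel. indicator (cball 0 (3 * r)) h * (norm h * norm (riesz s (h :: real^'n)))) = sphere_area TYPE('n) * ((3 * r) powr (1 - s) / (1 - s))"
      using s borel_measurable_integrable[OF riesz_head_integrable[of s "3 * r", where 'n='n]] r
      by (subst integral_eq_nn_integral) auto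
    then have "(LINT h|lborel. M h) = ?c * (sphere_area TYPE('n) * ((3 * r) powr (1 - s) / (1 - s)))"
      unfolding M_def by simp
    also have "(3 * r) powr (1 - s) = 3 powr (1 - s) * r powr (1 - s)" using r by (simp add: powr_mult)
    also have "?c * (sphere_area TYPE('n) * (3 powr (1 - s) * r powr (1 - s) / (1 - s)))
      = L * (sphere_area TYPE('n) * (3 powr (1 - s) / (1 - s))) * (r powr (1 - s) / r ^ (CARD('n) + 1))"
      by (simp add: mult_ac)
    also have "r powr (1 - s) / r ^ (CARD('n) + 1) = r powr ((1 - s) - real (CARD('n) + 1))"
      unfolding powr_diff using r by (subst powr_realpow) auto
    also have "(1 - s) - real (CARD('n) + 1) = - real CARD('n) - s" by simp
    finally show ?thesis .
  qed
  finally have 1: "norm (mollified_kernel s r \<epsilon> y) \<le> L * (sphere_area TYPE('n) * (3 powr (1 - s) / (1 - s))) * r powr (- real CARD('n) - s)" .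
  have 2: "norm (indicator (- ball 0 r) y *\<^sub>R riesz s y) \<le> r powr (- real CARD('n) - s)"
    using riesz_tail_norm_le[OF s(1) r, of y] by (auto simp: indicator_def)
  have "norm (mollified_kernel s r \<epsilon> y - indicator (- ball 0 r) y *\<^sub>R riesz s y)
     \<le> norm (mollified_kernel s r \<epsilon> y) + norm (indicator (- ball 0 r) y *\<^sub>R riesz s y)"
    by (rule norm_triangle_ineq4)
  also have "\<dots> \<le> near_const s * r powr (- real CARD('n) - s)"
    using add_mono[OF 1 2] by (simp add: near_const_def algebra_simps)
  finally show ?thesis .
qed

definition kernel_const :: "real \<Rightarrow> real" where
  "kernel_const s = far_const s + near_const s"

lemma kernel_const_nonneg:
  assumes "0 < s" "s < 1" shows "0 \<le> far_const s" "0 \<le> near_const s" "0 \<le> kernel_const s"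
  using assms L by (auto simp: kernel_const_def far_const_def near_const_def intro!: add_nonneg_nonneg mult_nonneg_nonneg)

lemma mollified_kernel_bound:
  assumes s: "0 < s" "s < 1" and e: "0 < \<epsilon>" "\<epsilon> \<le> r"
  shows "norm (mollified_kernel s r \<epsilon> y - indicator (- ball 0 r) y *\<^sub>R riesz s y) \<le> kernel_const s * error_kernel s r y"
proof (cases "norm y < 2 * r")
  case True
  have "norm (mollified_kernel s r \<epsilon> y - indicator (- ball 0 r) y *\<^sub>R riesz s y) \<le> near_const s * r powr (- real CARD('n) - s)"
    using near_bound[OF s e True] .
  also have "\<dots> \<le> kernel_const s * r powr (- real CARD('n) - s)"
    using kernel_const_nonneg[OF s] by (intro mult_right_mono) (auto simp: kernel_const_def)
  finally show ?thesis using True by (simp add: error_kernel_def)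
next
  case False
  then have "indicator (- ball 0 r) y = (1 :: real)" using e by simp
  then have "norm (mollified_kernel s r \<epsilon> y - indicator (- ball 0 r) y *\<^sub>R riesz s y) \<le> far_const s * (r * norm y powr (- (real CARD('n) + s + 1)))"
    using far_bound[OF s e, of y] False by simp
  also have "\<dots> \<le> kernel_const s * (r * norm y powr (- (real CARD('n) + s + 1)))"
    using kernel_const_nonneg[OF s] e by (intro mult_right_mono) (auto simp: kernel_const_def)
  finally show ?thesis using False by (simp add: error_kernel_def)
qed

text \<open>Convolving the truncated gradient with rho and centring all increments at x, Fubini
  moves rho onto the kernel. Subtracting the integral truncated at r leaves the increments of w
  against a kernel bounded by \<open>error_kernel\<close>. The estimate is uniform in the inner
  radius \<epsilon>, which then tends to 0.\<close>

lemma rho_cart_bound: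
  assumes w: "w \<in> test_functions" and s: "0 < s" "s < 1" and r: "0 < r"
  shows "ennreal (norm ((LINT z|lborel. rho \<eta> r z *\<^sub>R cart s w (x - z)) - trunc s r w x))
    \<le> ennreal (kernel_const s) * (\<integral>\<^sup>+y. ennreal (\<bar>w x - w (x - y)\<bar> * error_kernel s r y) \<partial>lborel)"
proof -
  have wm[measurable]: "w \<in> borel_measurable borel" using w by (rule test_function_measurable)
  have [measurable]: "- ball (0 :: real^'n) \<epsilon> \<in> sets borel" for \<epsilon> by auto
  obtain L' B' where LB: "\<And>s x h. norm ((w x - w (x - h)) *\<^sub>R riesz s h) \<le> cart_majorant s L' B' h"
    and B': "0 \<le> B'" "\<And>x. \<bar>w x\<bar> \<le> B'"
    using test_function_cart_majorant[OF w] by metis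
  let ?bound = "ennreal (kernel_const s) * (\<integral>\<^sup>+y. ennreal (\<bar>w x - w (x - y)\<bar> * error_kernel s r y) \<partial>lborel)"
  have wi: "integrable lborel (\<lambda>h. indicator (- ball 0 \<epsilon>) h *\<^sub>R (w (x - h) *\<^sub>R riesz s h))" if "0 < \<epsilon>" for \<epsilon> x
  proof -
    have "AE h in lborel. norm (indicator (- ball 0 \<epsilon>) h *\<^sub>R (w (x - h) *\<^sub>R riesz s h)) \<le> norm (B' * (indicator (- ball 0 \<epsilon>) h * norm (riesz s h)))"
      using B' by (intro AE_I2) (auto simp: indicator_def abs_mult intro!: mult_right_mono)
    from Bochner_Integration.integrable_bound[OF integrable_mult_right[OF riesz_tail_integrable(1)[OF s(1) that]] _ this]
    show ?thesis by simp
  qed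
  have P: "ennreal (norm ((LINT z|lborel. rho \<eta> r z *\<^sub>R trunc s \<epsilon> w (x - z)) - trunc s r w x)) \<le> ?bound"
    if e: "0 < \<epsilon>" "\<epsilon> \<le> r" for \<epsilon>
  proof -
    define f where "f z y = rho \<eta> r z *\<^sub>R (indicator (- ball 0 \<epsilon>) (y - z) *\<^sub>R ((w x - w (x - y)) *\<^sub>R riesz s (y - z)))" for z y
    have [measurable]: "case_prod f \<in> borel_measurable (borel \<Otimes>\<^sub>M borel)" unfolding f_def by measurable
    have inner: "rho \<eta> r z *\<^sub>R trunc s \<epsilon> w (x - z) = (LINT y|lborel. f z y)" for z
    proof -
      \<comment> \<open>Here \<open>w x\<close> replaces \<open>w (x - z)\<close>; after y = z + h
        the increment no longer depends on z and comes out of the z-integral.\<close>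
      have "trunc s \<epsilon> w (x - z) = (LINT h|lborel. indicator (- ball 0 \<epsilon>) h *\<^sub>R ((w x - w (x - z - h)) *\<^sub>R riesz s h))"
        using trunc_shift(2)[OF wm wi[OF e(1), of "x - z"] s(1) e(1)] by simp
      also have "\<dots> = (LINT y|lborel. indicator (- ball 0 \<epsilon>) (y - z) *\<^sub>R ((w x - w (x - y)) *\<^sub>R riesz s (y - z)))"
        using integral_shift(2)[of "\<lambda>h. indicator (- ball 0 \<epsilon>) h *\<^sub>R ((w x - w (x - z - h)) *\<^sub>R riesz s h)" z] by simp
      finally show ?thesis unfolding f_def by (simp only: integral_scaleR_right)
    qed
    let ?T = "\<integral>\<^sup>+h. ennreal (norm (riesz s (h :: real^'n))) * indicator (- ball 0 \<epsilon>) h \<partial>lborel"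
    have fi: "integrable (lborel \<Otimes>\<^sub>M lborel) (case_prod f)"
      unfolding integrable_iff_bounded
    proof
      have "(\<integral>\<^sup>+p. ennreal (norm (case_prod f p)) \<partial>(lborel \<Otimes>\<^sub>M lborel)) = (\<integral>\<^sup>+z. (\<integral>\<^sup>+y. ennreal (norm (f z y)) \<partial>lborel) \<partial>lborel)"
        by (subst lborel.nn_integral_fst[symmetric]) simp_all
      also have "\<dots> \<le> (\<integral>\<^sup>+z. ennreal (rho \<eta> r z) * (ennreal (2 * B') * ?T) \<partial>lborel)"
      proof (rule nn_integral_mono)
        fix z :: "real^'n"
        have "(\<integral>\<^sup>+y. ennreal (norm (f z y)) \<partial>lborel)
          \<le> (\<integral>\<^sup>+y. ennreal (rho \<eta> r z * (2 * B')) * (ennreal (norm (riesz s (y - z))) * indicator (- ball 0 \<epsilon>) (y - z)) \<partial>lborel)"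
        proof (rule nn_integral_mono)
          fix y
          have "\<bar>w x - w (x - y)\<bar> \<le> 2 * B'" using B'(2)[of x] B'(2)[of "x - y"] by linarith
          then have "rho \<eta> r z * (\<bar>w x - w (x - y)\<bar> * norm (riesz s (y - z))) \<le> rho \<eta> r z * ((2 * B') * norm (riesz s (y - z)))"
            by (intro mult_left_mono mult_right_mono rho_nonneg[OF r]) auto
          then show "ennreal (norm (f z y)) \<le> ennreal (rho \<eta> r z * (2 * B')) * (ennreal (norm (riesz s (y - z))) * indicator (- ball 0 \<epsilon>) (y - z))"
            using rho_nonneg[OF r, of z] B'(1)
            by (auto simp: f_def indicator_def ennreal_mult[symmetric] mult.assoc abs_mult intro!: ennreal_leI)
        qed
        also have "\<dots> = ennreal (rho \<eta> r z * (2 * B')) * (\<integral>\<^sup>+y. ennreal (norm (riesz s (y - z))) * indicator (- ball 0 \<epsilon>) (y - z) \<partial>lborel)"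
          by (rule nn_integral_cmult) measurable
        also have "(\<integral>\<^sup>+y. ennreal (norm (riesz s (y - z))) * indicator (- ball 0 \<epsilon>) (y - z) \<partial>lborel) = ?T"
          by (rule nn_integral_shift(3)[of "\<lambda>h. ennreal (norm (riesz s h)) * indicator (- ball 0 \<epsilon>) h"]) measurable
        finally show "(\<integral>\<^sup>+y. ennreal (norm (f z y)) \<partial>lborel) \<le> ennreal (rho \<eta> r z) * (ennreal (2 * B') * ?T)"
          using rho_nonneg[OF r, of z] B'(1) by (simp add: ennreal_mult mult.assoc)
      qed
      also have "\<dots> = ennreal (2 * B') * ?T"
        by (subst nn_integral_multc) (simp_all add: nn_integral_rho[OF r])
      also have "\<dots> < \<infinity>" unfolding nn_integral_riesz_tail[OF s(1) e(1)] by (simp add: ennreal_mult_less_top)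
      finally show "(\<integral>\<^sup>+p. ennreal (norm (case_prod f p)) \<partial>(lborel \<Otimes>\<^sub>M lborel)) < \<infinity>" .
    qed simp
    have outer: "(LINT z|lborel. f z y) = (w x - w (x - y)) *\<^sub>R mollified_kernel s r \<epsilon> y" for y
    proof -
      have "f z y = (w x - w (x - y)) *\<^sub>R (rho \<eta> r z *\<^sub>R (indicator (- ball 0 \<epsilon>) (y - z) *\<^sub>R riesz s (y - z)))" for z
        by (simp add: f_def mult_ac)
      then show ?thesis unfolding mollified_kernel_def by (simp only: integral_scaleR_right)
    qed
    have i1: "integrable lborel (\<lambda>y. (w x - w (x - y)) *\<^sub>R mollified_kernel s r \<epsilon> y)"
      using lborel_pair.integrable_snd[OF fi] unfolding outer .
    have i2: "integrable lborel (\<lambda>y. indicator (- ball 0 r) y *\<^sub>R ((w x - w (x - y)) *\<^sub>R riesz s y))"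
      by (rule trunc_shift(1)[OF wm wi[OF r] s(1) r])
    have "(LINT z|lborel. rho \<eta> r z *\<^sub>R trunc s \<epsilon> w (x - z)) = (LINT y|lborel. (LINT z|lborel. f z y))"
      unfolding inner by (rule lborel_pair.Fubini_integral[OF fi, symmetric])
    then have "(LINT z|lborel. rho \<eta> r z *\<^sub>R trunc s \<epsilon> w (x - z)) - trunc s r w x
      = (LINT y|lborel. (w x - w (x - y)) *\<^sub>R mollified_kernel s r \<epsilon> y - indicator (- ball 0 r) y *\<^sub>R ((w x - w (x - y)) *\<^sub>R riesz s y))"
      unfolding outer trunc_def using Bochner_Integration.integral_diff[OF i1 i2] by simp
    then have "ennreal (norm ((LINT z|lborel. rho \<eta> r z *\<^sub>R trunc s \<epsilon> w (x - z)) - trunc s r w x))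
      \<le> (\<integral>\<^sup>+y. ennreal (norm ((w x - w (x - y)) *\<^sub>R mollified_kernel s r \<epsilon> y - indicator (- ball 0 r) y *\<^sub>R ((w x - w (x - y)) *\<^sub>R riesz s y))) \<partial>lborel)"
      using integral_norm_bound_ennreal[OF Bochner_Integration.integrable_diff[OF i1 i2]] by simp
    also have "\<dots> \<le> (\<integral>\<^sup>+y. ennreal (kernel_const s) * ennreal (\<bar>w x - w (x - y)\<bar> * error_kernel s r y) \<partial>lborel)"
    proof (rule nn_integral_mono)
      fix y
      have "(w x - w (x - y)) *\<^sub>R mollified_kernel s r \<epsilon> y - indicator (- ball 0 r) y *\<^sub>R ((w x - w (x - y)) *\<^sub>R riesz s y)
        = (w x - w (x - y)) *\<^sub>R (mollified_kernel s r \<epsilon> y - indicator (- ball 0 r) y *\<^sub>R riesz s y)"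
        by (simp add: scaleR_diff_right mult.commute)
      also have "norm \<dots> \<le> \<bar>w x - w (x - y)\<bar> * (kernel_const s * error_kernel s r y)"
        unfolding norm_scaleR by (intro mult_left_mono mollified_kernel_bound[OF s e]) auto
      finally show "ennreal (norm ((w x - w (x - y)) *\<^sub>R mollified_kernel s r \<epsilon> y - indicator (- ball 0 r) y *\<^sub>R ((w x - w (x - y)) *\<^sub>R riesz s y)))
        \<le> ennreal (kernel_const s) * ennreal (\<bar>w x - w (x - y)\<bar> * error_kernel s r y)"
        using kernel_const_nonneg[OF s] error_kernel_nonneg[OF r, of s y] by (simp add: ennreal_mult[symmetric] ennreal_leI mult_ac)
    qed
    also have "\<dots> = ?bound" by (rule nn_integral_cmult) measurable
    finally show ?thesis .
  qed
  define e where "e k = r * inverse (real (Suc k))" for k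
  have e0: "e \<longlonglongrightarrow> 0"
    unfolding e_def using tendsto_mult_right_zero[OF LIMSEQ_inverse_real_of_nat, of r] by simp
  have e_pos: "0 < e k" "e k \<le> r" for k using r by (auto simp: e_def field_simps)
  have tm: "(\<lambda>z. trunc s (e k) w (x - z)) \<in> borel_measurable borel" for k
    unfolding trunc_def by measurable
  have cm: "(\<lambda>z. cart s w (x - z)) \<in> borel_measurable borel" unfolding cart_def by measurable
  have "(\<lambda>k. LINT z|lborel. rho \<eta> r z *\<^sub>R trunc s (e k) w (x - z)) \<longlonglongrightarrow> (LINT z|lborel. rho \<eta> r z *\<^sub>R cart s w (x - z))"
  proof (rule integral_dominated_convergence)
    show "integrable lborel (\<lambda>z. rho \<eta> r z * (LINT h|lborel. cart_majorant s L' B' (h :: real^'n)))"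
      using integrable_rho[OF r] by simp
    show "AE z in lborel. (\<lambda>k. rho \<eta> r z *\<^sub>R trunc s (e k) w (x - z)) \<longlonglongrightarrow> rho \<eta> r z *\<^sub>R cart s w (x - z)"
      by (intro AE_I2 tendsto_scaleR tendsto_const trunc_tendsto_cart[OF w s e0])
    show "AE z in lborel. norm (rho \<eta> r z *\<^sub>R trunc s (e k) w (x - z)) \<le> rho \<eta> r z * (LINT h|lborel. cart_majorant s L' B' (h :: real^'n))" for k
    proof (rule AE_I2)
      fix z
      have "norm (trunc s (e k) w (x - z)) \<le> (LINT h|lborel. cart_majorant s L' B' (h :: real^'n))"
        unfolding trunc_def
      proof (rule Bochner_Integration.integral_norm_bound_integral)
        show "integrable lborel (\<lambda>h. indicator (- ball 0 (e k)) h *\<^sub>R ((w (x - z) - w (x - z - h)) *\<^sub>R riesz s h))"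
          by (rule trunc_shift(1)[OF wm wi[OF e_pos(1)] s(1) e_pos(1)])
        fix h :: "real^'n"
        have "0 \<le> cart_majorant s L' B' h" using LB[of x h s] norm_ge_zero order_trans by blast
        then show "norm (indicator (- ball 0 (e k)) h *\<^sub>R ((w (x - z) - w (x - z - h)) *\<^sub>R riesz s h)) \<le> cart_majorant s L' B' h"
          using LB[of "x - z" h s] by (auto simp: indicator_def)
      qed (rule cart_majorant_integrable[OF s])
      then show "norm (rho \<eta> r z *\<^sub>R trunc s (e k) w (x - z)) \<le> rho \<eta> r z * (LINT h|lborel. cart_majorant s L' B' (h :: real^'n))"
        using rho_nonneg[OF r, of z] by (simp add: mult_left_mono)
    qed
  qed (use tm cm in measurable)
  then have "(\<lambda>k. ennreal (norm ((LINT z|lborel. rho \<eta> r z *\<^sub>R trunc s (e k) w (x - z)) - trunc s r w x)))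
     \<longlonglongrightarrow> ennreal (norm ((LINT z|lborel. rho \<eta> r z *\<^sub>R cart s w (x - z)) - trunc s r w x))"
    by (intro tendsto_ennrealI tendsto_norm tendsto_diff tendsto_const)
  then show ?thesis by (rule LIMSEQ_le_const2) (use P e_pos in auto)
qed

end

subsection \<open>Lebesgue points\<close>

text \<open>Vitali covering: disjoint balls are selected whose fivefold enlargements cover the
  exceptional set, which explains 5^n; each has volume at most a multiple of its f-mass divided by
  \<kappa>, and disjointness adds these masses up. Radii are kept below 1 to be bounded, and a Borel
  superset is returned in place of measurability of the exceptional set.\<close>

lemma weak_maximal_inequality:
  fixes f :: "real^'n \<Rightarrow> ennreal"
  assumes [measurable]: "f \<in> borel_measurable borel" and \<kappa>: "0 < \<kappa>"
  shows "\<exists>E\<in>sets borel. {x. \<exists>r. 0 < r \<and> r \<le> 1 \<and> ennreal (\<kappa> * r ^ CARD('n)) < (\<integral>\<^sup>+y\<in>cball x r. f y \<partial>lborel)} \<subseteq> E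
     \<and> emeasure lborel E \<le> ennreal (5 ^ CARD('n) * unit_ball_vol (real CARD('n)) / \<kappa>) * (\<integral>\<^sup>+y. f y \<partial>lborel)"
proof -
  let ?v = "unit_ball_vol (real CARD('n))"
  define K where "K = {(x, r). 0 < r \<and> r \<le> 1 \<and> ennreal (\<kappa> * r ^ CARD('n)) < (\<integral>\<^sup>+y\<in>cball x r. f y \<partial>lborel)}"
  define S where "S = {x. \<exists>r. 0 < r \<and> r \<le> 1 \<and> ennreal (\<kappa> * r ^ CARD('n)) < (\<integral>\<^sup>+y\<in>cball x r. f y \<partial>lborel)}"
  have "S \<subseteq> (\<Union>i\<in>K. cball (fst i) (snd i))"
  proof
    fix x assume "x \<in> S"
    then obtain r where "(x, r) \<in> K" "0 < r" by (auto simp: S_def K_def)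
    then show "x \<in> (\<Union>i\<in>K. cball (fst i) (snd i))" by (intro UN_I[of "(x, r)"]) auto
  qed
  moreover have "0 < snd i \<and> snd i \<le> 1" if "i \<in> K" for i using that by (auto simp: K_def)
  ultimately obtain C where C: "countable C" "C \<subseteq> K"
     "pairwise (\<lambda>i j. disjnt (cball (fst i) (snd i)) (cball (fst j) (snd j))) C"
     "S \<subseteq> (\<Union>i\<in>C. cball (fst i) (5 * snd i))"
    by (rule Vitali_covering_lemma_cballs)
  define E where "E = (\<Union>i\<in>C. cball (fst i) (5 * snd i))"
  have [measurable]: "E \<in> sets borel" unfolding E_def using C(1) by (intro sets.countable_UN') auto
  have inC: "0 < snd i" "ennreal (\<kappa> * snd i ^ CARD('n)) < (\<integral>\<^sup>+y\<in>cball (fst i) (snd i). f y \<partial>lborel)" if "i \<in> C" for i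
    using that C(2) by (auto simp: K_def)
  have "emeasure lborel E \<le> (\<integral>\<^sup>+i. emeasure lborel (cball (fst i) (5 * snd i)) \<partial>count_space C)"
  proof -
    have "emeasure lborel E = (\<integral>\<^sup>+x. indicator E x \<partial>lborel)" by simp
    also have "\<dots> \<le> (\<integral>\<^sup>+x. (\<integral>\<^sup>+i. indicator (cball (fst i) (5 * snd i)) x \<partial>count_space C) \<partial>lborel)"
    proof (rule nn_integral_mono)
      fix x
      show "indicator E x \<le> (\<integral>\<^sup>+i. indicator (cball (fst i) (5 * snd i)) x \<partial>count_space C)"
      proof (cases "x \<in> E")
        case True
        then obtain j where j: "j \<in> C" "x \<in> cball (fst j) (5 * snd j)" by (auto simp: E_def)
        have "(\<lambda>i. indicator (cball (fst i) (5 * snd i)) x :: ennreal) j \<le> (\<integral>\<^sup>+i. indicator (cball (fst i) (5 * snd i)) x \<partial>count_space C)"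
          by (rule nn_integral_ge_point) (rule j(1))
        then show ?thesis using j True by simp
      qed simp
    qed
    also have "\<dots> = (\<integral>\<^sup>+i. (\<integral>\<^sup>+x. indicator (cball (fst i) (5 * snd i)) x \<partial>lborel) \<partial>count_space C)"
      using C(1) by (intro nn_integral_count_space_nn_integral) (auto intro: borel_measurable_indicator)
    finally show ?thesis by simp
  qed
  also have "\<dots> \<le> (\<integral>\<^sup>+i. ennreal (5 ^ CARD('n) * ?v / \<kappa>) * emeasure (density lborel f) (cball (fst i) (snd i)) \<partial>count_space C)"
  proof (rule nn_integral_mono)
    fix i assume "i \<in> space (count_space C)"
    then have i: "0 < snd i" "ennreal (\<kappa> * snd i ^ CARD('n)) < (\<integral>\<^sup>+y\<in>cball (fst i) (snd i). f y \<partial>lborel)"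
      using inC by auto
    have "emeasure lborel (cball (fst i) (5 * snd i)) = ennreal (?v * (5 * snd i) ^ CARD('n))"
      using i by (subst emeasure_cball) auto
    also have "?v * (5 * snd i) ^ CARD('n) = (5 ^ CARD('n) * ?v / \<kappa>) * (\<kappa> * snd i ^ CARD('n))"
      using \<kappa> by (simp add: power_mult_distrib)
    also have "ennreal \<dots> = ennreal (5 ^ CARD('n) * ?v / \<kappa>) * ennreal (\<kappa> * snd i ^ CARD('n))"
      using \<kappa> i by (intro ennreal_mult) auto
    also have "\<dots> \<le> ennreal (5 ^ CARD('n) * ?v / \<kappa>) * (\<integral>\<^sup>+y\<in>cball (fst i) (snd i). f y \<partial>lborel)"
      using i(2) by (intro mult_left_mono) auto
    finally show "emeasure lborel (cball (fst i) (5 * snd i)) \<le> ennreal (5 ^ CARD('n) * ?v / \<kappa>) * emeasure (density lborel f) (cball (fst i) (snd i))"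
      by (simp add: emeasure_density)
  qed
  also have "\<dots> = ennreal (5 ^ CARD('n) * ?v / \<kappa>) * (\<integral>\<^sup>+i. emeasure (density lborel f) (cball (fst i) (snd i)) \<partial>count_space C)"
    by (rule nn_integral_cmult) simp
  also have "(\<integral>\<^sup>+i. emeasure (density lborel f) (cball (fst i) (snd i)) \<partial>count_space C) = emeasure (density lborel f) (\<Union>i\<in>C. cball (fst i) (snd i))"
    using C(1,3) by (intro emeasure_UN_countable[symmetric]) (auto simp: disjoint_family_on_def pairwise_def disjnt_def)
  also have "\<dots> \<le> emeasure (density lborel f) (space (density lborel f))"
    by (rule emeasure_space)
  also have "\<dots> = (\<integral>\<^sup>+y. f y \<partial>lborel)" by (simp add: emeasure_density)
  finally have "emeasure lborel E \<le> ennreal (5 ^ CARD('n) * ?v / \<kappa>) * (\<integral>\<^sup>+y. f y \<partial>lborel)"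
    by (simp add: mult_left_mono)
  moreover have "S \<subseteq> E" using C(4) by (simp add: E_def)
  ultimately show ?thesis unfolding S_def[symmetric] by (intro bexI[of _ E]) auto
qed

text \<open>The sum of the \<open>f k\<close> has finite integral, so the series converges almost
  everywhere and its terms tend to 0. For indicators this is the Borel--Cantelli lemma.\<close>

lemma AE_tendsto_0_geometric:
  fixes f :: "nat \<Rightarrow> 'a \<Rightarrow> ennreal"
  assumes [measurable]: "\<And>k. f k \<in> borel_measurable M" and le: "\<And>k. (\<integral>\<^sup>+x. f k x \<partial>M) \<le> ennreal (c * (1 / 2) ^ k)"
    and c: "0 \<le> c"
  shows "AE x in M. (\<lambda>k. f k x) \<longlonglongrightarrow> 0"
proof -
  have sm: "summable (\<lambda>k. c * (1 / 2) ^ k :: real)" by (intro summable_mult summable_geometric) simp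
  have "(\<integral>\<^sup>+x. (\<Sum>k. f k x) \<partial>M) = (\<Sum>k. \<integral>\<^sup>+x. f k x \<partial>M)" by (rule nn_integral_suminf) simp
  also have "\<dots> \<le> (\<Sum>k. ennreal (c * (1 / 2) ^ k))" by (intro suminf_le le) auto
  also have "\<dots> = ennreal (\<Sum>k. c * (1 / 2) ^ k)" using c by (intro suminf_ennreal2 sm) simp
  also have "\<dots> < \<infinity>" by simp
  finally have "(\<integral>\<^sup>+x. (\<Sum>k. f k x) \<partial>M) \<noteq> \<infinity>" by simp
  then have "AE x in M. (\<Sum>k. f k x) \<noteq> \<infinity>" by (intro nn_integral_noteq_infinite) simp_all
  then show ?thesis
  proof eventually_elim
    fix x assume fin: "(\<Sum>k. f k x) \<noteq> \<infinity>"
    have fk: "f k x < top" for k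
    proof -
      have "f k x \<le> (\<Sum>k. f k x)" using sum_le_suminf[of "\<lambda>k. f k x" "{k}"] by simp
      with fin show ?thesis by (simp add: less_top le_less_trans)
    qed
    define g where "g k = enn2real (f k x)" for k
    have g: "f k x = ennreal (g k)" "0 \<le> g k" for k using fk[of k] by (auto simp: g_def)
    have "summable g" using fin g by (intro summable_suminf_not_top) auto
    then have "g \<longlonglongrightarrow> 0" by (rule summable_LIMSEQ_zero)
    then have "(\<lambda>k. ennreal (g k)) \<longlonglongrightarrow> ennreal 0" by (intro tendsto_ennrealI)
    then show "(\<lambda>k. f k x) \<longlonglongrightarrow> 0" using g by simp
  qed
qed

text \<open>Mass 4^(-k) tested at level 2^(-k) leaves exceptional sets of measure of order 2^(-k),
  which is summable. The index from which the bound holds depends on x but not on r.\<close>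

lemma AE_maximal_small:
  fixes W :: "nat \<Rightarrow> real^'n \<Rightarrow> ennreal"
  assumes [measurable]: "\<And>k. W k \<in> borel_measurable borel" and le: "\<And>k. (\<integral>\<^sup>+x. W k x \<partial>lborel) \<le> ennreal (c * (1 / 4) ^ k)"
    and c: "0 \<le> c"
  shows "AE x in lborel. eventually (\<lambda>k. \<forall>r. 0 < r \<and> r \<le> 1 \<longrightarrow> (\<integral>\<^sup>+y\<in>cball x r. W k y \<partial>lborel) \<le> ennreal ((1 / 2) ^ k * r ^ CARD('n))) sequentially"
proof -
  let ?v = "5 ^ CARD('n) * unit_ball_vol (real CARD('n))"
  have "\<forall>k. \<exists>E. E \<in> sets borel \<and> {x. \<exists>r. 0 < r \<and> r \<le> 1 \<and> ennreal ((1 / 2) ^ k * r ^ CARD('n)) < (\<integral>\<^sup>+y\<in>cball x r. W k y \<partial>lborel)} \<subseteq> E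
     \<and> emeasure lborel E \<le> ennreal (?v / (1 / 2) ^ k) * (\<integral>\<^sup>+y. W k y \<partial>lborel)"
    by (intro allI weak_maximal_inequality[unfolded Bex_def]) auto
  from choice[OF this] obtain E where E': "\<forall>k. E k \<in> sets borel \<and> {x. \<exists>r. 0 < r \<and> r \<le> 1 \<and> ennreal ((1 / 2) ^ k * r ^ CARD('n)) < (\<integral>\<^sup>+y\<in>cball x r. W k y \<partial>lborel)} \<subseteq> E k
     \<and> emeasure lborel (E k) \<le> ennreal (?v / (1 / 2) ^ k) * (\<integral>\<^sup>+y. W k y \<partial>lborel)"
    by (rule exE)
  have E: "\<And>k. E k \<in> sets borel"
    "\<And>k. {x. \<exists>r. 0 < r \<and> r \<le> 1 \<and> ennreal ((1 / 2) ^ k * r ^ CARD('n)) < (\<integral>\<^sup>+y\<in>cball x r. W k y \<partial>lborel)} \<subseteq> E k"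
    "\<And>k. emeasure lborel (E k) \<le> ennreal (?v / (1 / 2) ^ k) * (\<integral>\<^sup>+y. W k y \<partial>lborel)"
    using E' by simp_all
  have Ek: "emeasure lborel (E k) \<le> ennreal ((?v * c) * (1 / 2) ^ k)" for k
  proof -
    have "emeasure lborel (E k) \<le> ennreal (?v / (1 / 2) ^ k) * ennreal (c * (1 / 4) ^ k)"
      using E(3)[of k] le[of k] by (meson mult_left_mono order_trans zero_le)
    also have "\<dots> = ennreal (?v / (1 / 2) ^ k * (c * (1 / 4) ^ k))" using c by (intro ennreal_mult[symmetric]) auto
    also have "?v / (1 / 2) ^ k * (c * (1 / 4) ^ k) = (?v * c) * ((1 / 4) ^ k / (1 / 2) ^ k)" by simp
    also have "((1 / 4) ^ k / (1 / 2) ^ k :: real) = (1 / 2) ^ k" unfolding power_divide[symmetric] by simp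
    finally show ?thesis .
  qed
  have "AE x in lborel. (\<lambda>k. indicator (E k) x :: ennreal) \<longlonglongrightarrow> 0"
  proof (rule AE_tendsto_0_geometric)
    show "(\<integral>\<^sup>+x. indicator (E k) x \<partial>lborel) \<le> ennreal ((?v * c) * (1 / 2) ^ k)" for k
      using Ek[of k] E(1)[of k] by simp
  qed (use E(1) c in auto)
  then show ?thesis
  proof eventually_elim
    fix x assume "(\<lambda>k. indicator (E k) x :: ennreal) \<longlonglongrightarrow> 0"
    then have "eventually (\<lambda>k. indicator (E k) x < (1 :: ennreal)) sequentially"
      by (rule order_tendstoD) simp
    then show "eventually (\<lambda>k. \<forall>r. 0 < r \<and> r \<le> 1 \<longrightarrow> (\<integral>\<^sup>+y\<in>cball x r. W k y \<partial>lborel) \<le> ennreal ((1 / 2) ^ k * r ^ CARD('n))) sequentially"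
    proof eventually_elim
      case (elim k)
      then have "x \<notin> E k" by (auto simp: indicator_def)
      then show ?case using E(2)[of k] by (auto simp: not_le[symmetric])
    qed
  qed
qed

lemma ennreal_le_of_square_le:
  fixes X :: ennreal
  assumes "X\<^sup>2 \<le> ennreal (e\<^sup>2)" "0 \<le> e"
  shows "X \<le> ennreal e"
proof (cases X)
  case (real a)
  with assms have "a\<^sup>2 \<le> e\<^sup>2" by (simp add: ennreal_power)
  then have "a \<le> e" using assms(2) by (rule power2_le_imp_le)
  with real show ?thesis by (simp add: ennreal_leI)
next
  case top
  with assms show ?thesis by (simp add: power2_eq_square ennreal_top_mult top_unique)
qed

section \<open>Almost everywhere convergence of mollifications\<close>

context mollifier
begin

lemma rho_integrable_sq:
  fixes V :: "real^'n \<Rightarrow> real^'n"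
  assumes [measurable]: "V \<in> borel_measurable borel" and fin: "(\<integral>\<^sup>+x. ennreal ((norm (V x))\<^sup>2) \<partial>lborel) < \<infinity>" and r: "0 < r"
  shows "integrable lborel (\<lambda>z. rho \<eta> r z *\<^sub>R V (x - z))"
proof -
  have "(\<integral>\<^sup>+z. ennreal ((norm (V (x - z)))\<^sup>2) \<partial>lborel) = (\<integral>\<^sup>+z. ennreal ((norm (V z))\<^sup>2) \<partial>lborel)"
    by (rule nn_integral_reflect[of "\<lambda>z. ennreal ((norm (V z))\<^sup>2)"]) measurable
  then have i: "integrable lborel (\<lambda>z. (norm (V (x - z)))\<^sup>2)"
    using fin by (simp add: integrable_iff_bounded)
  have pt: "norm (rho \<eta> r z *\<^sub>R V (x - z)) \<le> rho \<eta> r z + B / r ^ CARD('n) * (norm (V (x - z)))\<^sup>2" for z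
  proof -
    have "norm (V (x - z)) \<le> 1 + (norm (V (x - z)))\<^sup>2"
      using sum_squares_bound[of 1 "norm (V (x - z))"] norm_ge_zero[of "V (x - z)"]
      unfolding one_power2 mult_1_right by linarith
    then have "rho \<eta> r z * norm (V (x - z)) \<le> rho \<eta> r z * (1 + (norm (V (x - z)))\<^sup>2)"
      by (rule mult_left_mono) (rule rho_nonneg[OF r])
    also have "\<dots> \<le> rho \<eta> r z + B / r ^ CARD('n) * (norm (V (x - z)))\<^sup>2"
      using mult_right_mono[OF rho_le[OF r, of z], of "(norm (V (x - z)))\<^sup>2"] by (simp add: distrib_left)
    finally show ?thesis using rho_nonneg[OF r, of z] by simp
  qed
  have "integrable lborel (\<lambda>z. rho \<eta> r z + B / r ^ CARD('n) * (norm (V (x - z)))\<^sup>2)"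
    using i integrable_rho[OF r] by (intro Bochner_Integration.integrable_add integrable_mult_right)
  then show ?thesis
    by (rule Bochner_Integration.integrable_bound) (use order_trans[OF pt abs_ge_self] in auto)
qed

text \<open>Jensen for the probability density rho, then rho \<le> B r^(-n) on a support within
  radius r. The factor r^(-n) is matched by the r^n of \<open>AE_maximal_small\<close>.\<close>

lemma rho_average_le:
  fixes g :: "real^'n \<Rightarrow> real"
  assumes [measurable]: "g \<in> borel_measurable borel" and r: "0 < r"
  shows "(\<integral>\<^sup>+z. ennreal (rho \<eta> r z * \<bar>g (x - z)\<bar>) \<partial>lborel)\<^sup>2 \<le> ennreal (B / r ^ CARD('n)) * (\<integral>\<^sup>+y\<in>cball x r. ennreal ((g y)\<^sup>2) \<partial>lborel)"
proof -
  have [measurable]: "cball x r \<in> sets borel" by simp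
  have "(\<integral>\<^sup>+z. ennreal (rho \<eta> r z * \<bar>g (x - z)\<bar>) \<partial>lborel)\<^sup>2
    \<le> (\<integral>\<^sup>+z. ennreal (rho \<eta> r z) \<partial>lborel) * (\<integral>\<^sup>+z. ennreal (rho \<eta> r z * (g (x - z))\<^sup>2) \<partial>lborel)"
    by (rule nn_integral_weighted_Cauchy_Schwarz) (use rho_nonneg[OF r] in auto)
  also have "\<dots> = (\<integral>\<^sup>+z. ennreal (rho \<eta> r z * (g (x - z))\<^sup>2) \<partial>lborel)" by (simp add: nn_integral_rho[OF r])
  also have "\<dots> \<le> (\<integral>\<^sup>+z. ennreal (B / r ^ CARD('n)) * (ennreal ((g (x - z))\<^sup>2) * indicator (cball x r) (x - z)) \<partial>lborel)"
  proof (rule nn_integral_mono)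
    fix z
    show "ennreal (rho \<eta> r z * (g (x - z))\<^sup>2) \<le> ennreal (B / r ^ CARD('n)) * (ennreal ((g (x - z))\<^sup>2) * indicator (cball x r) (x - z))"
    proof (cases "norm z < r")
      case True
      then have "x - z \<in> cball x r" by (simp add: dist_norm)
      then show ?thesis
        using mult_right_mono[OF rho_le[OF r, of z], of "(g (x - z))\<^sup>2"] B(1) r
        by (simp add: ennreal_mult[symmetric] ennreal_leI)
    next
      case False
      then show ?thesis using rho_eq_0[OF r, of z] by simp
    qed
  qed
  also have "\<dots> = ennreal (B / r ^ CARD('n)) * (\<integral>\<^sup>+z. ennreal ((g (x - z))\<^sup>2) * indicator (cball x r) (x - z) \<partial>lborel)"
    by (rule nn_integral_cmult) measurable
  also have "(\<integral>\<^sup>+z. ennreal ((g (x - z))\<^sup>2) * indicator (cball x r) (x - z) \<partial>lborel) = (\<integral>\<^sup>+y\<in>cball x r. ennreal ((g y)\<^sup>2) \<partial>lborel)"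
    by (rule nn_integral_reflect[of "\<lambda>y. ennreal ((g y)\<^sup>2) * indicator (cball x r) y"]) measurable
  finally show ?thesis .
qed

text \<open>Between V and its average stand three errors: the average of V - c_k, bounded through
  the maximal inequality uniformly in the radius; the oscillation of the continuous c_k near x; and
  V(x) - c_k(x).\<close>

theorem rho_tendsto_AE:
  fixes V :: "real^'n \<Rightarrow> real^'n"
  assumes V[measurable]: "V \<in> borel_measurable borel" and fin: "(\<integral>\<^sup>+x. ennreal ((norm (V x))\<^sup>2) \<partial>lborel) < \<infinity>"
    and cont: "\<And>k. continuous_on UNIV (c k)"
    and close: "\<And>k. (\<integral>\<^sup>+x. ennreal ((norm (V x - c k x))\<^sup>2) \<partial>lborel) \<le> ennreal (C * (1 / 4) ^ k)" and C: "0 \<le> C"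
  shows "AE x in lborel. ((\<lambda>r. LINT z|lborel. rho \<eta> r z *\<^sub>R V (x - z)) \<longlongrightarrow> V x) (at_right 0)"
proof -
  have [measurable]: "c k \<in> borel_measurable borel" for k using cont by (rule borel_measurable_continuous_onI)
  define W where "W k x = ennreal ((norm (V x - c k x))\<^sup>2)" for k x
  have [measurable]: "W k \<in> borel_measurable borel" for k unfolding W_def[abs_def] by measurable
  have "AE x in lborel. eventually (\<lambda>k. \<forall>r. 0 < r \<and> r \<le> 1 \<longrightarrow> (\<integral>\<^sup>+y\<in>cball x r. W k y \<partial>lborel) \<le> ennreal ((1 / 2) ^ k * r ^ CARD('n))) sequentially"
    by (rule AE_maximal_small[OF _ _ C]) (use close in \<open>auto simp: W_def\<close>)
  moreover have "AE x in lborel. (\<lambda>k. W k x) \<longlonglongrightarrow> 0"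
  proof (rule AE_tendsto_0_geometric[OF _ _ C])
    fix k
    have "C * (1 / 4) ^ k \<le> C * (1 / 2) ^ k" using C by (intro mult_left_mono power_mono) auto
    with close[of k] show "(\<integral>\<^sup>+x. W k x \<partial>lborel) \<le> ennreal (C * (1 / 2) ^ k)"
      unfolding W_def by (meson ennreal_leI order_trans)
  qed simp
  ultimately show ?thesis
  proof eventually_elim
    fix x
    assume ev: "eventually (\<lambda>k. \<forall>r. 0 < r \<and> r \<le> 1 \<longrightarrow> (\<integral>\<^sup>+y\<in>cball x r. W k y \<partial>lborel) \<le> ennreal ((1 / 2) ^ k * r ^ CARD('n))) sequentially"
      and W0: "(\<lambda>k. W k x) \<longlonglongrightarrow> 0"
    show "((\<lambda>r. LINT z|lborel. rho \<eta> r z *\<^sub>R V (x - z)) \<longlongrightarrow> V x) (at_right 0)"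
    proof (rule tendstoI)
      fix e' :: real assume e': "0 < e'"
      \<comment> \<open>Three errors of size \<open>e\<close> add up to strictly less than
        \<open>e'\<close>.\<close>
      define e where "e = e' / 4"
      have e: "0 < e" using e' by (simp add: e_def)
      have "(\<lambda>k. B * (1 / 2) ^ k) \<longlonglongrightarrow> 0" by (intro tendsto_mult_right_zero LIMSEQ_realpow_zero) auto
      then have "eventually (\<lambda>k. B * (1 / 2) ^ k < e\<^sup>2) sequentially" using e by (intro order_tendstoD(2)) auto
      moreover have "eventually (\<lambda>k. W k x < ennreal (e\<^sup>2)) sequentially" using e W0 by (intro order_tendstoD(2)) auto
      ultimately have "eventually (\<lambda>k. (\<forall>r. 0 < r \<and> r \<le> 1 \<longrightarrow> (\<integral>\<^sup>+y\<in>cball x r. W k y \<partial>lborel) \<le> ennreal ((1 / 2) ^ k * r ^ CARD('n)))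
         \<and> B * (1 / 2) ^ k < e\<^sup>2 \<and> W k x < ennreal (e\<^sup>2)) sequentially"
        using ev by (intro eventually_conj)
      \<comment> \<open>The index is fixed before the radius; the radius is then chosen by
        continuity of this one \<open>c k\<close>.\<close>
      then obtain k where k: "\<And>r. 0 < r \<Longrightarrow> r \<le> 1 \<Longrightarrow> (\<integral>\<^sup>+y\<in>cball x r. W k y \<partial>lborel) \<le> ennreal ((1 / 2) ^ k * r ^ CARD('n))"
        "B * (1 / 2) ^ k < e\<^sup>2" "W k x < ennreal (e\<^sup>2)"
        by (auto simp: eventually_sequentially)
      have "(norm (V x - c k x))\<^sup>2 < e\<^sup>2" using k(3) by (simp add: W_def ennreal_less_iff)
      then have "norm (V x - c k x) < e" by (rule power2_less_imp_less) (use e in simp)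
      then have Vx: "norm (V x - c k x) \<le> e" by simp
      obtain d where d: "0 < d" "\<And>y. dist y x < d \<Longrightarrow> dist (c k y) (c k x) < e"
        using cont[of k, unfolded continuous_on_iff, rule_format, OF UNIV_I e, of x] by auto
      have "dist (LINT z|lborel. rho \<eta> r z *\<^sub>R V (x - z)) (V x) < e'" if r: "0 < r" "r < min 1 d" for r
      proof -
        have i: "integrable lborel (\<lambda>z. rho \<eta> r z *\<^sub>R V (x - z))" by (rule rho_integrable_sq[OF V fin r(1)])
        have i': "integrable lborel (\<lambda>z. rho \<eta> r z *\<^sub>R V x)" using integrable_rho[OF r(1)] by simp
        have "(LINT z|lborel. rho \<eta> r z *\<^sub>R V (x - z)) - V x = (LINT z|lborel. rho \<eta> r z *\<^sub>R V (x - z) - rho \<eta> r z *\<^sub>R V x)"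
          using Bochner_Integration.integral_diff[OF i i'] integrable_rho[OF r(1)] integral_rho[OF r(1)] by simp
        then have "ennreal (norm ((LINT z|lborel. rho \<eta> r z *\<^sub>R V (x - z)) - V x))
          \<le> (\<integral>\<^sup>+z. ennreal (norm (rho \<eta> r z *\<^sub>R V (x - z) - rho \<eta> r z *\<^sub>R V x)) \<partial>lborel)"
          using integral_norm_bound_ennreal[OF Bochner_Integration.integrable_diff[OF i i']] by simp
        also have "\<dots> \<le> (\<integral>\<^sup>+z. (ennreal (rho \<eta> r z * \<bar>norm (V (x - z) - c k (x - z))\<bar>) + ennreal (rho \<eta> r z) * ennreal (2 * e)) \<partial>lborel)"
        proof (rule nn_integral_mono)
          fix z
          show "ennreal (norm (rho \<eta> r z *\<^sub>R V (x - z) - rho \<eta> r z *\<^sub>R V x))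
             \<le> ennreal (rho \<eta> r z * \<bar>norm (V (x - z) - c k (x - z))\<bar>) + ennreal (rho \<eta> r z) * ennreal (2 * e)"
          proof (cases "norm z < r")
            case True
            then have "norm (c k (x - z) - c k x) \<le> e" using d(2)[of "x - z"] r by (simp add: dist_norm)
            moreover have "norm (V (x - z) - V x) \<le> norm (V (x - z) - c k (x - z)) + norm (c k (x - z) - c k x) + norm (V x - c k x)"
              by norm
            ultimately have "norm (V (x - z) - V x) \<le> norm (V (x - z) - c k (x - z)) + 2 * e" using Vx by linarith
            then have "rho \<eta> r z * norm (V (x - z) - V x) \<le> rho \<eta> r z * (norm (V (x - z) - c k (x - z)) + 2 * e)"
              by (rule mult_left_mono) (rule rho_nonneg[OF r(1)])
            then have "ennreal (rho \<eta> r z * norm (V (x - z) - V x)) \<le> ennreal (rho \<eta> r z * norm (V (x - z) - c k (x - z)) + rho \<eta> r z * (2 * e))"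
              by (intro ennreal_leI) (simp add: distrib_left)
            then show ?thesis
              using rho_nonneg[OF r(1), of z] e by (simp add: scaleR_diff_right[symmetric] ennreal_mult)
          next
            case False
            then show ?thesis using rho_eq_0[OF r(1), of z] by simp
          qed
        qed
        also have "\<dots> = (\<integral>\<^sup>+z. ennreal (rho \<eta> r z * \<bar>norm (V (x - z) - c k (x - z))\<bar>) \<partial>lborel) + ennreal (2 * e)"
          by (subst nn_integral_add) (simp_all add: nn_integral_multc nn_integral_rho[OF r(1)])
        also have "\<dots> \<le> ennreal e + ennreal (2 * e)"
        proof (rule add_mono[OF ennreal_le_of_square_le order_refl])
          have "(\<integral>\<^sup>+z. ennreal (rho \<eta> r z * \<bar>norm (V (x - z) - c k (x - z))\<bar>) \<partial>lborel)\<^sup>2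
             \<le> ennreal (B / r ^ CARD('n)) * (\<integral>\<^sup>+y\<in>cball x r. ennreal ((norm (V y - c k y))\<^sup>2) \<partial>lborel)"
            by (rule rho_average_le[of "\<lambda>y. norm (V y - c k y)"]) (use r in auto)
          also have "\<dots> \<le> ennreal (B / r ^ CARD('n)) * ennreal ((1 / 2) ^ k * r ^ CARD('n))"
            using k(1)[of r] r by (intro mult_left_mono) (auto simp: W_def)
          also have "\<dots> = ennreal (B / r ^ CARD('n) * ((1 / 2) ^ k * r ^ CARD('n)))"
            using B(1) r by (intro ennreal_mult[symmetric]) auto
          also have "B / r ^ CARD('n) * ((1 / 2) ^ k * r ^ CARD('n)) = B * (1 / 2) ^ k" using r by simp
          also have "ennreal \<dots> \<le> ennreal (e\<^sup>2)" using k(2) by (intro ennreal_leI) simp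
          finally show "(\<integral>\<^sup>+z. ennreal (rho \<eta> r z * \<bar>norm (V (x - z) - c k (x - z))\<bar>) \<partial>lborel)\<^sup>2 \<le> ennreal (e\<^sup>2)" .
        qed (use e in auto)
        also have "\<dots> = ennreal (3 * e)" using e by (subst ennreal_plus[symmetric]) auto
        finally have "norm ((LINT z|lborel. rho \<eta> r z *\<^sub>R V (x - z)) - V x) \<le> 3 * e"
          using e by (subst (asm) ennreal_le_iff) auto
        then show ?thesis using e' by (simp add: dist_norm e_def)
      qed
      then show "eventually (\<lambda>r. dist (LINT z|lborel. rho \<eta> r z *\<^sub>R V (x - z)) (V x) < e') (at_right 0)"
        using d(1) unfolding eventually_at_right_field by (intro exI[of _ "min 1 d"]) auto
    qed
  qed
qed

end

subsection \<open>Averages against bounded integrable kernels\<close>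

text \<open>Even multiplied by 4^k the squared increments have summable integrals, so almost
  everywhere the increments are eventually below 2^(-k) and the telescoping series converges
  absolutely.\<close>

lemma AE_convergent_geometric:
  fixes g :: "nat \<Rightarrow> 'a \<Rightarrow> real"
  assumes [measurable]: "\<And>k. g k \<in> borel_measurable M"
    and le: "\<And>k. (\<integral>\<^sup>+x. ennreal ((g (Suc k) x - g k x)\<^sup>2) \<partial>M) \<le> ennreal (c * (1 / 16) ^ k)" and c: "0 \<le> c"
  shows "AE x in M. convergent (\<lambda>k. g k x)"
proof -
  have "AE x in M. (\<lambda>k. ennreal (4 ^ k * (g (Suc k) x - g k x)\<^sup>2)) \<longlonglongrightarrow> 0"
  proof (rule AE_tendsto_0_geometric[OF _ _ c])
    fix k
    have "(\<integral>\<^sup>+x. ennreal (4 ^ k * (g (Suc k) x - g k x)\<^sup>2) \<partial>M) = ennreal (4 ^ k) * (\<integral>\<^sup>+x. ennreal ((g (Suc k) x - g k x)\<^sup>2) \<partial>M)"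
      by (simp add: ennreal_mult nn_integral_cmult)
    also have "\<dots> \<le> ennreal (4 ^ k) * ennreal (c * (1 / 16) ^ k)" by (intro mult_left_mono le) simp
    also have "\<dots> = ennreal (4 ^ k * (c * (1 / 16) ^ k))" using c by (intro ennreal_mult[symmetric]) auto
    also have "4 ^ k * (c * (1 / 16) ^ k) = c * (1 / 4) ^ k"
    proof -
      have "(4 :: real) ^ k * (1 / 16) ^ k = (1 / 4) ^ k" by (simp flip: power_mult_distrib)
      then show ?thesis by (simp only: mult.left_commute[of "4 ^ k" c])
    qed
    also have "ennreal (c * (1 / 4) ^ k) \<le> ennreal (c * (1 / 2) ^ k)"
      using c by (intro ennreal_leI mult_left_mono power_mono) auto
    finally show "(\<integral>\<^sup>+x. ennreal (4 ^ k * (g (Suc k) x - g k x)\<^sup>2) \<partial>M) \<le> ennreal (c * (1 / 2) ^ k)" .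
  qed simp
  then show ?thesis
  proof eventually_elim
    fix x assume "(\<lambda>k. ennreal (4 ^ k * (g (Suc k) x - g k x)\<^sup>2)) \<longlonglongrightarrow> 0"
    then have "eventually (\<lambda>k. ennreal (4 ^ k * (g (Suc k) x - g k x)\<^sup>2) < 1) sequentially"
      by (rule order_tendstoD) simp
    then have "eventually (\<lambda>k. norm (g (Suc k) x - g k x) \<le> (1 / 2) ^ k) sequentially"
    proof eventually_elim
      case (elim k)
      then have "4 ^ k * (g (Suc k) x - g k x)\<^sup>2 < 1" by (simp add: ennreal_less_iff flip: ennreal_1)
      moreover have "4 ^ k * (g (Suc k) x - g k x)\<^sup>2 = (2 ^ k * \<bar>g (Suc k) x - g k x\<bar>)\<^sup>2"
      proof -
        have "(4 :: real) ^ k = (2 ^ k)\<^sup>2" by (simp add: power2_eq_square flip: power_mult_distrib)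
        then show ?thesis by (simp add: power_mult_distrib)
      qed
      ultimately have "(2 ^ k * \<bar>g (Suc k) x - g k x\<bar>)\<^sup>2 < 1\<^sup>2" by simp
      then have "2 ^ k * \<bar>g (Suc k) x - g k x\<bar> < 1" by (rule power2_less_imp_less) simp
      then show ?case by (simp add: power_divide field_simps)
    qed
    then have "summable (\<lambda>k. g (Suc k) x - g k x)"
      by (rule summable_comparison_test_ev) (simp add: summable_geometric)
    then have "convergent (\<lambda>n. \<Sum>k<n. g (Suc k) x - g k x)" by (simp add: summable_iff_convergent)
    then have "convergent (\<lambda>n. (g n x - g 0 x) + g 0 x)" 
      by (intro convergent_add convergent_const) (simp only: sum_lessThan_telescope[of "\<lambda>k. g k x"])
    then show "convergent (\<lambda>k. g k x)" by simp
  qed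
qed

lemma bounded_kernel_average:
  fixes g k :: "real^'n \<Rightarrow> real"
  assumes [measurable]: "g \<in> borel_measurable borel" "k \<in> borel_measurable borel"
    and k: "\<And>y. 0 \<le> k y" "\<And>y. k y \<le> M" "(\<integral>\<^sup>+y. ennreal (k y) \<partial>lborel) \<le> ennreal I"
  shows "(\<integral>\<^sup>+y. ennreal (k y * \<bar>g (x - y)\<bar>) \<partial>lborel)\<^sup>2 \<le> ennreal I * (ennreal M * sq_int g)"
proof -
  have M: "0 \<le> M" using k(1,2) order_trans by blast
  have "(\<integral>\<^sup>+y. ennreal (k y * \<bar>g (x - y)\<bar>) \<partial>lborel)\<^sup>2 \<le> (\<integral>\<^sup>+y. ennreal (k y) \<partial>lborel) * (\<integral>\<^sup>+y. ennreal (k y * (g (x - y))\<^sup>2) \<partial>lborel)"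
    by (rule nn_integral_weighted_Cauchy_Schwarz) (use k in auto)
  also have "\<dots> \<le> ennreal I * (\<integral>\<^sup>+y. ennreal M * ennreal ((g (x - y))\<^sup>2) \<partial>lborel)"
    using k M by (intro mult_mono nn_integral_mono) (auto simp: ennreal_mult[symmetric] intro!: ennreal_leI mult_right_mono)
  also have "(\<integral>\<^sup>+y. ennreal M * ennreal ((g (x - y))\<^sup>2) \<partial>lborel) = ennreal M * (\<integral>\<^sup>+y. ennreal ((g (x - y))\<^sup>2) \<partial>lborel)"
    by (rule nn_integral_cmult) measurable
  also have "(\<integral>\<^sup>+y. ennreal ((g (x - y))\<^sup>2) \<partial>lborel) = sq_int g"
    unfolding sq_int_def by (rule nn_integral_reflect[of "\<lambda>y. ennreal ((g y)\<^sup>2)"]) measurable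
  finally show ?thesis .
qed

text \<open>For a fixed bounded integrable kernel, L^2 smallness of g gives smallness of the average
  at every x, with a bound that does not depend on x.\<close>

lemma bounded_kernel_average_tendsto:
  fixes g :: "nat \<Rightarrow> real^'n \<Rightarrow> real" and k :: "real^'n \<Rightarrow> real"
  assumes [measurable]: "\<And>j. g j \<in> borel_measurable borel" "k \<in> borel_measurable borel"
    and k: "\<And>y. 0 \<le> k y" "\<And>y. k y \<le> M" "(\<integral>\<^sup>+y. ennreal (k y) \<partial>lborel) \<le> ennreal I" "0 \<le> I"
    and g: "\<And>j. sq_int (g j) \<le> ennreal (c * (1 / 16) ^ j)" "0 \<le> c"
  shows "(\<lambda>j. \<integral>\<^sup>+y. ennreal (k y * \<bar>g j (x - y)\<bar>) \<partial>lborel) \<longlonglongrightarrow> 0"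
proof -
  have M: "0 \<le> M" using k(1,2) order_trans by blast
  have le: "(\<integral>\<^sup>+y. ennreal (k y * \<bar>g j (x - y)\<bar>) \<partial>lborel) \<le> ennreal (sqrt (I * M * c) * (1 / 4) ^ j)" for j
  proof (rule ennreal_le_of_square_le)
    have "(\<integral>\<^sup>+y. ennreal (k y * \<bar>g j (x - y)\<bar>) \<partial>lborel)\<^sup>2 \<le> ennreal I * (ennreal M * sq_int (g j))"
      by (rule bounded_kernel_average) (use k in auto)
    also have "\<dots> \<le> ennreal I * (ennreal M * ennreal (c * (1 / 16) ^ j))" by (intro mult_left_mono g) auto
    also have "\<dots> = ennreal (I * (M * (c * (1 / 16) ^ j)))" using M k(4) g(2) by (simp add: ennreal_mult)
    also have "I * (M * (c * (1 / 16) ^ j)) = (sqrt (I * M * c) * (1 / 4) ^ j)\<^sup>2"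
    proof -
      have "((1 / 4) ^ j)\<^sup>2 = ((1 / 16) ^ j :: real)" by (simp add: power2_eq_square flip: power_mult_distrib)
      then show ?thesis using M k(4) g(2) by (simp add: power_mult_distrib)
    qed
    finally show "(\<integral>\<^sup>+y. ennreal (k y * \<bar>g j (x - y)\<bar>) \<partial>lborel)\<^sup>2 \<le> ennreal ((sqrt (I * M * c) * (1 / 4) ^ j)\<^sup>2)" .
  qed (use M k(4) g(2) in auto)
  have "(\<lambda>j. ennreal (sqrt (I * M * c) * (1 / 4) ^ j)) \<longlonglongrightarrow> ennreal 0"
    by (intro tendsto_ennrealI tendsto_mult_right_zero LIMSEQ_realpow_zero) auto
  then have L: "(\<lambda>j. ennreal (sqrt (I * M * c) * (1 / 4) ^ j)) \<longlonglongrightarrow> 0" by simp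
  show ?thesis
    by (rule tendsto_sandwich[OF _ _ tendsto_const L]) (simp, rule always_eventually, rule allI, rule le)
qed

lemma error_kernel_le: "0 < s \<Longrightarrow> 0 < r \<Longrightarrow> error_kernel s r (y :: real^'n) \<le> r powr (- real CARD('n) - s)"
proof -
  assume s: "0 < s" and r: "0 < r"
  have "r * norm y powr (- (real CARD('n) + s + 1)) \<le> r powr (- real CARD('n) - s)" if "2 * r \<le> norm y"
  proof -
    have "norm y powr (- (real CARD('n) + s + 1)) \<le> r powr (- (real CARD('n) + s + 1))"
      using that r s by (intro powr_mono2') auto
    then have "r * norm y powr (- (real CARD('n) + s + 1)) \<le> r * r powr (- (real CARD('n) + s + 1))"
      using r by (intro mult_left_mono) auto
    also have "\<dots> = r powr (1 + - (real CARD('n) + s + 1))" using r by (intro powr_mult_base) simp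
    also have "1 + - (real CARD('n) + s + 1) = - real CARD('n) - s" by simp
    finally show ?thesis .
  qed
  then show ?thesis by (simp add: error_kernel_def)
qed

definition error_kernel_const :: "real \<Rightarrow> 'n::finite itself \<Rightarrow> real" where
  "error_kernel_const s _ = unit_ball_vol (real CARD('n)) * 2 ^ CARD('n) + sphere_area TYPE('n) * (2 powr (- (s + 1)) / (s + 1))"

lemma error_kernel_const_nonneg: "0 < s \<Longrightarrow> 0 \<le> error_kernel_const s TYPE('n::finite)"
  by (simp add: error_kernel_const_def)

lemma nn_integral_kap_le:
  assumes s: "0 < s" and r: "0 < r"
  shows "(\<integral>\<^sup>+y. ennreal (error_kernel s r (y :: real^'n)) \<partial>lborel) \<le> ennreal (error_kernel_const s TYPE('n) * r powr (- s))"
proof -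
  let ?n = "real CARD('n)"
  have [measurable]: "ball (0 :: real^'n) (2 * r) \<in> sets borel" "- ball (0 :: real^'n) (2 * r) \<in> sets borel" by auto
  have "(\<integral>\<^sup>+y. ennreal (error_kernel s r (y :: real^'n)) \<partial>lborel)
    = (\<integral>\<^sup>+y. (ennreal (r powr (- ?n - s)) * indicator (ball 0 (2 * r)) y + ennreal r * (ennreal (norm (y :: real^'n) powr (- ?n - (s + 1))) * indicator (- ball 0 (2 * r)) y)) \<partial>lborel)"
  proof (rule nn_integral_cong)
    fix y :: "real^'n"
    have exponent: "- (?n + s + 1) = - ?n - (s + 1)" by simp
    show "ennreal (error_kernel s r y) = ennreal (r powr (- ?n - s)) * indicator (ball 0 (2 * r)) y + ennreal r * (ennreal (norm y powr (- ?n - (s + 1))) * indicator (- ball 0 (2 * r)) y)"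
      unfolding error_kernel_def exponent using r by (auto simp: indicator_def ennreal_mult)
  qed
  also have "\<dots> = ennreal (r powr (- ?n - s)) * emeasure lborel (ball (0 :: real^'n) (2 * r)) + ennreal r * ennreal (sphere_area TYPE('n) * ((2 * r) powr (- (s + 1)) / (s + 1)))"
    using s r by (subst nn_integral_add) (simp_all add: nn_integral_cmult nn_integral_cmult_indicator nn_integral_norm_powr_tail)
  also have "emeasure lborel (ball (0 :: real^'n) (2 * r)) = ennreal (unit_ball_vol ?n * (2 * r) ^ CARD('n))"
    using r by (subst emeasure_ball) auto
  also have "ennreal (r powr (- ?n - s)) * ennreal (unit_ball_vol ?n * (2 * r) ^ CARD('n)) = ennreal (r powr (- ?n - s) * (unit_ball_vol ?n * (2 * r) ^ CARD('n)))"
    using r by (intro ennreal_mult[symmetric]) auto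
  also have "r powr (- ?n - s) * (unit_ball_vol ?n * (2 * r) ^ CARD('n)) = unit_ball_vol ?n * 2 ^ CARD('n) * r powr (- s)"
  proof -
    have "r powr (- ?n - s) * r ^ CARD('n) = r powr (- ?n - s + ?n)" using r by (simp only: powr_add powr_realpow)
    then show ?thesis by (simp add: power_mult_distrib mult_ac)
  qed
  also have "ennreal r * ennreal (sphere_area TYPE('n) * ((2 * r) powr (- (s + 1)) / (s + 1))) = ennreal (r * (sphere_area TYPE('n) * ((2 * r) powr (- (s + 1)) / (s + 1))))"
    using r s by (intro ennreal_mult[symmetric]) auto
  also have "r * (sphere_area TYPE('n) * ((2 * r) powr (- (s + 1)) / (s + 1))) = sphere_area TYPE('n) * (2 powr (- (s + 1)) / (s + 1)) * r powr (- s)"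
  proof -
    have "(2 * r) powr (- (s + 1)) = 2 powr (- (s + 1)) * r powr (- (s + 1))" by (rule powr_mult; use r in simp)
    moreover have "r * r powr (- (s + 1)) = r powr (1 + - (s + 1))" using r by (intro powr_mult_base) auto
    then have "r * r powr (- (s + 1)) = r powr (- s)" by simp
    ultimately show ?thesis by (simp add: mult_ac)
  qed
  also have "ennreal (unit_ball_vol ?n * 2 ^ CARD('n) * r powr (- s)) + ennreal (sphere_area TYPE('n) * (2 powr (- (s + 1)) / (s + 1)) * r powr (- s)) = ennreal (error_kernel_const s TYPE('n) * r powr (- s))"
    using s by (subst ennreal_plus[symmetric]) (auto simp: error_kernel_const_def distrib_right)
  finally show ?thesis by simp
qed

text \<open>Cauchy--Schwarz with the error kernel as weight: its mass is of order r^(-s), and this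
  factor is absorbed into the other integral \<open>Q\<close>. The kernel r^(-s)
  \<open>error_kernel\<close> is at most a multiple of |y|^(-n-2s), so the local Gagliardo energy
  dominates, and for fixed y \<noteq> 0 it is eventually of order r^(1-s), which tends to 0.\<close>

lemma error_kernel_average_tendsto_0:
  fixes u :: "real^'n \<Rightarrow> real"
  assumes [measurable]: "u \<in> borel_measurable borel" and s: "0 < s" "s < 1"
    and fin: "(\<integral>\<^sup>+y. ennreal ((u x - u (x - y))\<^sup>2 * norm y powr - (real CARD('n) + 2 * s)) \<partial>lborel) < \<infinity>"
    and X: "\<And>j. 0 < X j" "X \<longlonglongrightarrow> 0"
  shows "(\<lambda>j. \<integral>\<^sup>+y. ennreal (\<bar>u x - u (x - y)\<bar> * error_kernel s (X j) y) \<partial>lborel) \<longlonglongrightarrow> 0"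
proof -
  let ?n = "real CARD('n)"
  define R where "R j = (\<integral>\<^sup>+y. ennreal (\<bar>u x - u (x - y)\<bar> * error_kernel s (X j) y) \<partial>lborel)" for j
  define Q where "Q j = (\<integral>\<^sup>+y. ennreal (X j powr (- s) * error_kernel s (X j) y * (u x - u (x - y))\<^sup>2) \<partial>lborel)" for j
  have sqR: "(R j)\<^sup>2 \<le> ennreal (error_kernel_const s TYPE('n)) * Q j" for j
  proof -
    have "(R j)\<^sup>2 \<le> (\<integral>\<^sup>+y. ennreal (error_kernel s (X j) (y :: real^'n)) \<partial>lborel) * (\<integral>\<^sup>+y. ennreal (error_kernel s (X j) y * (u x - u (x - y))\<^sup>2) \<partial>lborel)"
      unfolding R_def mult.commute[of "\<bar>_\<bar>"]
      by (rule nn_integral_weighted_Cauchy_Schwarz) (use error_kernel_nonneg[OF X(1)] in auto)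
    also have "\<dots> \<le> ennreal (error_kernel_const s TYPE('n) * X j powr (- s)) * (\<integral>\<^sup>+y. ennreal (error_kernel s (X j) y * (u x - u (x - y))\<^sup>2) \<partial>lborel)"
      by (intro mult_right_mono nn_integral_kap_le s X) simp
    also have "\<dots> = ennreal (error_kernel_const s TYPE('n)) * (ennreal (X j powr (- s)) * (\<integral>\<^sup>+y. ennreal (error_kernel s (X j) y * (u x - u (x - y))\<^sup>2) \<partial>lborel))"
      using error_kernel_const_nonneg[OF s(1), where 'n='n] by (simp add: ennreal_mult mult.assoc)
    also have "ennreal (X j powr (- s)) * (\<integral>\<^sup>+y. ennreal (error_kernel s (X j) y * (u x - u (x - y))\<^sup>2) \<partial>lborel) = Q j"
      unfolding Q_def using error_kernel_nonneg[OF X(1)]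
      by (subst nn_integral_cmult[symmetric]) (simp_all add: ennreal_mult'[symmetric] mult.assoc)
    finally show ?thesis .
  qed
  have "Q \<longlonglongrightarrow> (\<integral>\<^sup>+y. 0 \<partial>(lborel :: (real^'n) measure))"
    unfolding Q_def
  proof (rule nn_integral_dominated_convergence[where w="\<lambda>y. ennreal (2 powr (?n + 2 * s)) * ennreal ((u x - u (x - y))\<^sup>2 * norm y powr - (?n + 2 * s))"])
    show "(\<integral>\<^sup>+y. ennreal (2 powr (?n + 2 * s)) * ennreal ((u x - u (x - y))\<^sup>2 * norm y powr - (?n + 2 * s)) \<partial>lborel) < \<infinity>"
      using fin by (subst nn_integral_cmult) (auto simp: ennreal_mult_less_top)
    show "AE y in lborel. ennreal (X j powr (- s) * error_kernel s (X j) y * (u x - u (x - y))\<^sup>2)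
        \<le> ennreal (2 powr (?n + 2 * s)) * ennreal ((u x - u (x - y))\<^sup>2 * norm y powr - (?n + 2 * s))" for j
    proof (rule AE_I2)
      fix y :: "real^'n"
      let ?r = "X j"
      have r: "0 < ?r" by (rule X)
      have "?r powr (- s) * error_kernel s ?r y \<le> 2 powr (?n + 2 * s) * norm y powr - (?n + 2 * s)" if "y \<noteq> 0"
      proof (cases "norm y < 2 * ?r")
        case True
        have "?r powr (- s) * error_kernel s ?r y = ?r powr (- (?n + 2 * s))"
          using True by (simp add: error_kernel_def powr_add[symmetric] algebra_simps)
        also have "\<dots> = 2 powr (?n + 2 * s) * (2 * ?r) powr (- (?n + 2 * s))"
          using r by (subst powr_mult) (auto simp: powr_add[symmetric] simp flip: mult.assoc)
        also have "\<dots> \<le> 2 powr (?n + 2 * s) * norm y powr (- (?n + 2 * s))"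
          using True that s by (intro mult_left_mono powr_mono2') auto
        finally show ?thesis .
      next
        case False
        have "?r powr (- s) * error_kernel s ?r y = ?r powr (- s) * ?r * norm y powr (- (?n + s + 1))"
          using False by (simp add: error_kernel_def)
        also have "?r powr (- s) * ?r = ?r powr (1 + - s)" using r by (subst powr_mult_base[symmetric]) auto
        also have "?r powr (1 + - s) \<le> norm y powr (1 + - s)" using False r s by (intro powr_mono2) auto
        also have "norm y powr (1 + - s) * norm y powr (- (?n + s + 1)) = norm y powr - (?n + 2 * s)"
          by (simp add: powr_add[symmetric] algebra_simps)
        also have "1 * norm y powr - (?n + 2 * s) \<le> 2 powr (?n + 2 * s) * norm y powr - (?n + 2 * s)"
          using s by (intro mult_right_mono ge_one_powr_ge_zero) auto
        finally show ?thesis by (simp add: mult_right_mono)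
      qed
      then have "?r powr (- s) * error_kernel s ?r y * (u x - u (x - y))\<^sup>2 \<le> 2 powr (?n + 2 * s) * norm y powr - (?n + 2 * s) * (u x - u (x - y))\<^sup>2"
        by (cases "y = 0") (simp_all add: mult_right_mono)
      then show "ennreal (?r powr (- s) * error_kernel s ?r y * (u x - u (x - y))\<^sup>2)
        \<le> ennreal (2 powr (?n + 2 * s)) * ennreal ((u x - u (x - y))\<^sup>2 * norm y powr - (?n + 2 * s))"
        by (simp add: ennreal_mult[symmetric] ennreal_leI mult_ac)
    qed
    show "AE y in lborel. (\<lambda>j. ennreal (X j powr (- s) * error_kernel s (X j) y * (u x - u (x - y))\<^sup>2)) \<longlonglongrightarrow> 0"
    proof (rule AE_I2)
      fix y :: "real^'n"
      show "(\<lambda>j. ennreal (X j powr (- s) * error_kernel s (X j) y * (u x - u (x - y))\<^sup>2)) \<longlonglongrightarrow> 0"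
      proof (cases "y = 0")
        case False
        have "eventually (\<lambda>j. X j < norm y / 2) sequentially" using order_tendstoD(2)[OF X(2), of "norm y / 2"] False by simp
        then have "eventually (\<lambda>j. X j powr (1 - s) * (norm y powr (- (?n + s + 1)) * (u x - u (x - y))\<^sup>2) = X j powr (- s) * error_kernel s (X j) y * (u x - u (x - y))\<^sup>2) sequentially"
        proof eventually_elim
          case (elim j)
          have "X j powr (1 + - s) = X j * X j powr (- s)" using X(1)[of j] by (intro powr_mult_base[symmetric]) simp
          then show ?case using elim by (simp add: error_kernel_def mult_ac)
        qed
        moreover have "(\<lambda>j. X j powr (1 - s) * (norm y powr (- (?n + s + 1)) * (u x - u (x - y))\<^sup>2)) \<longlonglongrightarrow> 0"
        proof (rule tendsto_mult_left_zero)
          have "(\<lambda>j. X j powr (1 - s)) \<longlonglongrightarrow> 0 powr (1 - s)"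
            by (rule tendsto_powr'[OF X(2) tendsto_const]) (use s X(1) in \<open>auto intro!: always_eventually less_imp_le\<close>)
          then show "(\<lambda>j. X j powr (1 - s)) \<longlonglongrightarrow> 0" by simp
        qed
        ultimately have "(\<lambda>j. X j powr (- s) * error_kernel s (X j) y * (u x - u (x - y))\<^sup>2) \<longlonglongrightarrow> 0"
          by (rule Lim_transform_eventually[rotated])
        then have "(\<lambda>j. ennreal (X j powr (- s) * error_kernel s (X j) y * (u x - u (x - y))\<^sup>2)) \<longlonglongrightarrow> ennreal 0"
          by (rule tendsto_ennrealI)
        then show ?thesis by simp
      qed simp
    qed
  qed measurable
  then have "Q \<longlonglongrightarrow> 0" by simp
  then have "(\<lambda>j. ennreal (error_kernel_const s TYPE('n)) * Q j) \<longlonglongrightarrow> ennreal (error_kernel_const s TYPE('n)) * 0"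
    by (intro ennreal_tendsto_cmult) auto
  then have KQ: "(\<lambda>j. ennreal (error_kernel_const s TYPE('n)) * Q j) \<longlonglongrightarrow> 0" by simp
  have "R \<longlonglongrightarrow> 0"
  proof (rule order_tendstoI)
    fix a :: ennreal assume a: "0 < a"
    obtain b where b: "0 < b" "b < a" using dense[OF a] by blast
    obtain e where e: "0 < e" "ennreal e < a"
    proof (cases b)
      case (real e)
      with b show thesis by (intro that[of e]) auto
    next
      case top
      with b show thesis by simp
    qed
    have "eventually (\<lambda>j. ennreal (error_kernel_const s TYPE('n)) * Q j < ennreal (e\<^sup>2)) sequentially"
      using order_tendstoD(2)[OF KQ, of "ennreal (e\<^sup>2)"] e by simp
    then show "eventually (\<lambda>j. R j < a) sequentially"
    proof eventually_elim
      case (elim j)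
      have "R j \<le> ennreal e" 
        by (rule ennreal_le_of_square_le[OF order_trans[OF sqR[of j] less_imp_le[OF elim]]]) (use e in simp)
      with e show ?case by simp
    qed
  qed simp
  then show ?thesis by (simp add: R_def[abs_def])
qed

subsection \<open>The directional derivatives and their spherical average\<close>

text \<open>The rate 16^(-k) for squared norms leaves room for the weights 4^k in the almost
  everywhere arguments. The sequence depends on u alone and is shared by all directions.\<close>

locale sobolev_approximation =
  fixes s K :: real and u :: "real^'n \<Rightarrow> real" and \<phi> :: "nat \<Rightarrow> real^'n \<Rightarrow> real"
  assumes K_eq: "K = dir_const s TYPE('n)" and s: "0 < s" "s < 1"
    and u [measurable]: "u \<in> borel_measurable borel" and u_fin: "sob s u < \<infinity>"
    and \<phi>: "\<And>k. \<phi> k \<in> test_functions"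
    and approx: "\<And>k. sob s (\<lambda>x. \<phi> k x - u x) \<le> ennreal ((1 / 16) ^ k)"
begin

lemma measurable_phi [measurable]: "\<phi> k \<in> borel_measurable borel"
  using \<phi> by (rule test_function_measurable)

lemma K_nonneg: "0 \<le> K" unfolding K_eq using s by (rule dir_const_nonneg)

lemma phi_diff:
  assumes "k \<le> m"
  shows "sob s (\<lambda>x. \<phi> k x - \<phi> m x) \<le> ennreal (4 * (1 / 16) ^ k)"
proof -
  have "sob s (\<lambda>x. (\<phi> k x - u x) + (u x - \<phi> m x)) \<le> 2 * sob s (\<lambda>x. \<phi> k x - u x) + 2 * sob s (\<lambda>x. u x - \<phi> m x)"
    by (rule sob_add) measurable
  also have "sob s (\<lambda>x. u x - \<phi> m x) = sob s (\<lambda>x. \<phi> m x - u x)" by (rule sob_minus_commute)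
  also have "2 * sob s (\<lambda>x. \<phi> k x - u x) + 2 * sob s (\<lambda>x. \<phi> m x - u x) \<le> 2 * ennreal ((1 / 16) ^ k) + 2 * ennreal ((1 / 16) ^ k)"
  proof (intro add_mono mult_left_mono approx)
    have "(1 / 16) ^ m \<le> ((1 / 16) ^ k :: real)" using assms by (intro power_decreasing) auto
    then show "sob s (\<lambda>x. \<phi> m x - u x) \<le> ennreal ((1 / 16) ^ k)" using approx[of m] by (meson ennreal_leI order_trans)
  qed auto
  also have "\<dots> = ennreal (4 * (1 / 16) ^ k)" by (simp add: ennreal_mult distrib_right[symmetric])
  finally show ?thesis by simp
qed

lemma marchaud_phi_diff:
  assumes "k \<le> m" "norm \<theta> = 1"
  shows "sq_int (\<lambda>x. marchaud s \<theta> (\<phi> k) x - marchaud s \<theta> (\<phi> m) x) \<le> ennreal (4 * K * (1 / 16) ^ k)"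
proof -
  have "sq_int (\<lambda>x. marchaud s \<theta> (\<phi> k) x - marchaud s \<theta> (\<phi> m) x) = sq_int (marchaud s \<theta> (\<lambda>x. \<phi> k x - \<phi> m x))"
    by (simp add: marchaud_diff[OF \<phi> \<phi> s, abs_def, symmetric])
  also have "\<dots> \<le> ennreal K * gag s (\<lambda>x. \<phi> k x - \<phi> m x)"
    unfolding K_eq by (intro marchaud_bound test_function_diff \<phi> s assms)
  also have "\<dots> \<le> ennreal K * ennreal (4 * (1 / 16) ^ k)"
  proof (rule mult_left_mono)
    have "gag s (\<lambda>x. \<phi> k x - \<phi> m x) \<le> sob s (\<lambda>x. \<phi> k x - \<phi> m x)" by (simp add: sob_def)
    then show "gag s (\<lambda>x. \<phi> k x - \<phi> m x) \<le> ennreal (4 * (1 / 16) ^ k)" using phi_diff[OF assms(1)] by (rule order_trans)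
  qed simp
  also have "\<dots> = ennreal (4 * K * (1 / 16) ^ k)" using K_nonneg by (subst ennreal_mult[symmetric]) (auto simp: mult_ac)
  finally show ?thesis .
qed

text \<open>A pointwise \<open>lim\<close>, meaningful at every direction and point at once and thus
  jointly measurable. For each unit vector the points of divergence form a null set, where the
  default value does no harm.\<close>

definition dir_deriv :: "real^'n \<Rightarrow> real^'n \<Rightarrow> real" where
  "dir_deriv \<theta> x = lim (\<lambda>k. marchaud s \<theta> (\<phi> k) x)"

lemma measurable_D0 [measurable]: "(\<lambda>(\<theta>, x). dir_deriv \<theta> x) \<in> borel_measurable (borel \<Otimes>\<^sub>M borel)"
proof -
  have "(\<lambda>p. lim (\<lambda>k. (\<lambda>(\<theta>, x). marchaud s \<theta> (\<phi> k) x) p)) \<in> borel_measurable (borel \<Otimes>\<^sub>M borel)"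
    by (rule borel_measurable_lim_metric) measurable
  then show ?thesis by (simp add: dir_deriv_def case_prod_beta)
qed

lemma dir_deriv_tendsto:
  assumes "norm \<theta> = 1"
  shows "AE x in lborel. (\<lambda>k. marchaud s \<theta> (\<phi> k) x) \<longlonglongrightarrow> dir_deriv \<theta> x"
proof -
  have "AE x in lborel. convergent (\<lambda>k. marchaud s \<theta> (\<phi> k) x)"
  proof (rule AE_convergent_geometric[where c="4 * K"])
    fix k
    have "(\<integral>\<^sup>+x. ennreal ((marchaud s \<theta> (\<phi> (Suc k)) x - marchaud s \<theta> (\<phi> k) x)\<^sup>2) \<partial>lborel)
      = sq_int (\<lambda>x. marchaud s \<theta> (\<phi> k) x - marchaud s \<theta> (\<phi> (Suc k)) x)"
      by (simp add: sq_int_def power2_commute)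
    also have "\<dots> \<le> ennreal (4 * K * (1 / 16) ^ k)" by (rule marchaud_phi_diff) (use assms in auto)
    finally show "(\<integral>\<^sup>+x. ennreal ((marchaud s \<theta> (\<phi> (Suc k)) x - marchaud s \<theta> (\<phi> k) x)\<^sup>2) \<partial>lborel) \<le> ennreal (4 * K * (1 / 16) ^ k)" .
  qed (use K_nonneg in auto)
  then show ?thesis by eventually_elim (simp add: dir_deriv_def convergent_LIMSEQ_iff)
qed

lemma dir_deriv_close:
  assumes "norm \<theta> = 1"
  shows "sq_int (\<lambda>x. marchaud s \<theta> (\<phi> k) x - dir_deriv \<theta> x) \<le> ennreal (4 * K * (1 / 16) ^ k)"
  unfolding sq_int_def
proof (rule nn_integral_bounded_limit[where N=k])
  show "AE x in lborel. (\<lambda>m. marchaud s \<theta> (\<phi> k) x - marchaud s \<theta> (\<phi> m) x) \<longlonglongrightarrow> marchaud s \<theta> (\<phi> k) x - dir_deriv \<theta> x"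
    using dir_deriv_tendsto[OF assms] by eventually_elim (intro tendsto_diff tendsto_const)
  show "(\<integral>\<^sup>+x. ennreal ((marchaud s \<theta> (\<phi> k) x - marchaud s \<theta> (\<phi> m) x)\<^sup>2) \<partial>lborel) \<le> ennreal (4 * K * (1 / 16) ^ k)" if "k \<le> m" for m
    using marchaud_phi_diff[OF that assms] by (simp add: sq_int_def)
qed measurable

lemma gag_phi_finite: "gag s (\<phi> k) < \<infinity>"
proof -
  have "sob s (\<lambda>x. (\<phi> k x - u x) + u x) \<le> 2 * sob s (\<lambda>x. \<phi> k x - u x) + 2 * sob s u"
    by (rule sob_add) measurable
  also have "\<dots> < \<infinity>" using u_fin approx[of k] by (auto simp: ennreal_add_less_top ennreal_mult_less_top intro: le_less_trans)
  finally show ?thesis by (simp add: sob_def ennreal_add_less_top)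
qed

lemma marchaud_phi_finite: "norm \<theta> = 1 \<Longrightarrow> sq_int (marchaud s \<theta> (\<phi> k)) < \<infinity>"
  using marchaud_bound[OF \<phi> s, of \<theta> k] gag_phi_finite[of k]
  by (auto simp: ennreal_mult_less_top intro: le_less_trans)

lemma dir_deriv_finite:
  assumes "norm \<theta> = 1"
  shows "sq_int (dir_deriv \<theta>) < \<infinity>"
proof -
  have "sq_int (\<lambda>x. - (marchaud s \<theta> (\<phi> 0) x - dir_deriv \<theta> x) + marchaud s \<theta> (\<phi> 0) x)
     \<le> 2 * sq_int (\<lambda>x. - (marchaud s \<theta> (\<phi> 0) x - dir_deriv \<theta> x)) + 2 * sq_int (marchaud s \<theta> (\<phi> 0))"
    by (rule sq_int_add) measurable
  also have "\<dots> < \<infinity>"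
    using dir_deriv_close[OF assms, of 0] marchaud_phi_finite[OF assms, of 0]
    unfolding sq_int_uminus by (auto simp: ennreal_add_less_top ennreal_mult_less_top intro: le_less_trans)
  finally show ?thesis by simp
qed

text \<open>Spherical average without the factor s / \<Gamma>(1 - s): the candidate for the
  Cartesian gradient.\<close>

definition V :: "real^'n \<Rightarrow> real^'n" where
  "V x = (LINT \<theta>|surface_measure. dir_deriv \<theta> x *\<^sub>R \<theta>)"

lemma measurable_surface_pair:
  assumes "(\<lambda>(\<theta>, x). f \<theta> x) \<in> borel_measurable (borel \<Otimes>\<^sub>M borel)"
  shows "(\<lambda>(x :: real^'n, \<theta> :: real^'n). f \<theta> x) \<in> borel_measurable (borel \<Otimes>\<^sub>M surface_measure)"
proof -
  have "(\<lambda>\<theta>. \<theta>) \<in> surface_measure \<rightarrow>\<^sub>M (borel :: (real^'n) measure)" by (rule measurable_surface_measure) simp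
  then have "snd \<in> borel \<Otimes>\<^sub>M surface_measure \<rightarrow>\<^sub>M (borel :: (real^'n) measure)"
    using measurable_compose[OF measurable_snd] by auto
  then have "(\<lambda>p. (snd p, fst p)) \<in> borel \<Otimes>\<^sub>M surface_measure \<rightarrow>\<^sub>M (borel :: (real^'n) measure) \<Otimes>\<^sub>M (borel :: (real^'n) measure)"
    by (intro measurable_Pair measurable_fst)
  from measurable_compose[OF this assms] show ?thesis by (simp add: case_prod_beta)
qed

lemma measurable_V [measurable]: "V \<in> borel_measurable borel"
proof -
  have "(\<lambda>(\<theta>, x). dir_deriv \<theta> x *\<^sub>R \<theta>) \<in> borel_measurable (borel \<Otimes>\<^sub>M borel)" by measurable
  from surface.borel_measurable_lebesgue_integral[OF measurable_surface_pair[OF this]]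
  show ?thesis unfolding V_def[abs_def] .
qed

definition E :: "nat \<Rightarrow> real^'n \<Rightarrow> ennreal" where
  "E k x = (\<integral>\<^sup>+\<theta>. ennreal ((marchaud s \<theta> (\<phi> k) x - dir_deriv \<theta> x)\<^sup>2) \<partial>surface_measure)"

text \<open>Tonelli turns the bound for each direction, uniform over the sphere, into finiteness of
  the spherical L^2 error at almost every point.\<close>

lemma nn_integral_E: "(\<integral>\<^sup>+x. E k x \<partial>lborel) \<le> ennreal (sphere_area TYPE('n) * (4 * K) * (1 / 16) ^ k)"
  and measurable_E [measurable]: "E k \<in> borel_measurable borel"
proof -
  interpret S: pair_sigma_finite lborel "surface_measure :: (real^'n) measure" ..
  have "(\<lambda>(\<theta>, x). ennreal ((marchaud s \<theta> (\<phi> k) x - dir_deriv \<theta> x)\<^sup>2)) \<in> borel_measurable (borel \<Otimes>\<^sub>M borel)" by measurable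
  note m = measurable_surface_pair[OF this]
  show "E k \<in> borel_measurable borel"
    unfolding E_def[abs_def] using surface.borel_measurable_nn_integral[OF m] by simp
  have m': "(\<lambda>(x, \<theta>). ennreal ((marchaud s \<theta> (\<phi> k) x - dir_deriv \<theta> x)\<^sup>2)) \<in> borel_measurable (lborel \<Otimes>\<^sub>M surface_measure)"
    using m by (subst measurable_cong_sets[OF sets_pair_measure_cong[OF sets_lborel refl] refl])
  have "(\<integral>\<^sup>+x. E k x \<partial>lborel) = (\<integral>\<^sup>+\<theta>. (\<integral>\<^sup>+x. ennreal ((marchaud s \<theta> (\<phi> k) x - dir_deriv \<theta> x)\<^sup>2) \<partial>lborel) \<partial>surface_measure)"
    unfolding E_def by (rule S.Fubini'[OF m', symmetric])
  also have "\<dots> \<le> (\<integral>\<^sup>+\<theta>. ennreal (4 * K * (1 / 16) ^ k) \<partial>(surface_measure :: (real^'n) measure))"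
    using dir_deriv_close by (intro nn_integral_mono) (auto simp: sq_int_def)
  also have "\<dots> = ennreal (sphere_area TYPE('n)) * ennreal (4 * K * (1 / 16) ^ k)"
    by (simp add: emeasure_sphere_area mult.commute)
  also have "\<dots> = ennreal (sphere_area TYPE('n) * (4 * K) * (1 / 16) ^ k)"
    using K_nonneg by (subst ennreal_mult[symmetric]) (auto simp: mult_ac)
  finally show "(\<integral>\<^sup>+x. E k x \<partial>lborel) \<le> ennreal (sphere_area TYPE('n) * (4 * K) * (1 / 16) ^ k)" .
qed

lemma sphere_integral_Cauchy_Schwarz:
  fixes f :: "real^'n \<Rightarrow> real"
  assumes [measurable]: "f \<in> borel_measurable surface_measure"
  shows "(\<integral>\<^sup>+\<theta>. ennreal \<bar>f \<theta>\<bar> \<partial>surface_measure)\<^sup>2 \<le> ennreal (sphere_area TYPE('n)) * (\<integral>\<^sup>+\<theta>. ennreal ((f \<theta>)\<^sup>2) \<partial>surface_measure)"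
  using nn_integral_weighted_Cauchy_Schwarz[of "\<lambda>_. 1" surface_measure f] by (simp add: emeasure_sphere_area)

lemma measurable_slice:
  assumes "(\<lambda>(\<theta>, x). f \<theta> x) \<in> borel_measurable ((borel :: (real^'n) measure) \<Otimes>\<^sub>M (borel :: (real^'n) measure))"
  shows "(\<lambda>\<theta>. f \<theta> x) \<in> borel_measurable surface_measure"
  using measurable_compose[OF measurable_Pair2'[of x borel borel] assms]
  by (intro measurable_surface_measure) simp

lemma sphere_integrable_diff:
  assumes "E k x < \<infinity>"
  shows "integrable surface_measure (\<lambda>\<theta>. (marchaud s \<theta> (\<phi> k) x - dir_deriv \<theta> x) *\<^sub>R \<theta>)"
    and "ennreal ((norm (LINT \<theta>|surface_measure. (marchaud s \<theta> (\<phi> k) x - dir_deriv \<theta> x) *\<^sub>R \<theta>))\<^sup>2) \<le> ennreal (sphere_area TYPE('n)) * E k x"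
proof -
  have m: "(\<lambda>\<theta>. marchaud s \<theta> (\<phi> k) x - dir_deriv \<theta> x) \<in> borel_measurable surface_measure"
    by (rule measurable_slice[of "\<lambda>\<theta> x. marchaud s \<theta> (\<phi> k) x - dir_deriv \<theta> x"]) measurable
  have [measurable]: "(\<lambda>\<theta>. \<theta>) \<in> surface_measure \<rightarrow>\<^sub>M (borel :: (real^'n) measure)" by (rule measurable_surface_measure) simp
  have n: "(\<integral>\<^sup>+\<theta>. ennreal (norm ((marchaud s \<theta> (\<phi> k) x - dir_deriv \<theta> x) *\<^sub>R \<theta>)) \<partial>surface_measure)
    = (\<integral>\<^sup>+\<theta>. ennreal \<bar>marchaud s \<theta> (\<phi> k) x - dir_deriv \<theta> x\<bar> \<partial>surface_measure)"
    by (intro nn_integral_cong) auto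
  have cs: "(\<integral>\<^sup>+\<theta>. ennreal \<bar>marchaud s \<theta> (\<phi> k) x - dir_deriv \<theta> x\<bar> \<partial>surface_measure)\<^sup>2 \<le> ennreal (sphere_area TYPE('n)) * E k x"
    unfolding E_def by (rule sphere_integral_Cauchy_Schwarz[OF m])
  have "(\<integral>\<^sup>+\<theta>. ennreal \<bar>marchaud s \<theta> (\<phi> k) x - dir_deriv \<theta> x\<bar> \<partial>surface_measure)\<^sup>2 < \<infinity>"
    using cs assms by (auto simp: ennreal_mult_less_top intro: le_less_trans)
  then have "(\<integral>\<^sup>+\<theta>. ennreal \<bar>marchaud s \<theta> (\<phi> k) x - dir_deriv \<theta> x\<bar> \<partial>surface_measure) < \<infinity>"
    by (cases "(\<integral>\<^sup>+\<theta>. ennreal \<bar>marchaud s \<theta> (\<phi> k) x - dir_deriv \<theta> x\<bar> \<partial>surface_measure) = top") (auto simp: less_top power2_eq_square)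
  then show i: "integrable surface_measure (\<lambda>\<theta>. (marchaud s \<theta> (\<phi> k) x - dir_deriv \<theta> x) *\<^sub>R \<theta>)"
    unfolding integrable_iff_bounded n using m by (intro conjI borel_measurable_scaleR) auto
  have "ennreal (norm (LINT \<theta>|surface_measure. (marchaud s \<theta> (\<phi> k) x - dir_deriv \<theta> x) *\<^sub>R \<theta>)) \<le> (\<integral>\<^sup>+\<theta>. ennreal \<bar>marchaud s \<theta> (\<phi> k) x - dir_deriv \<theta> x\<bar> \<partial>surface_measure)"
    using integral_norm_bound_ennreal[OF i] unfolding n .
  then have "(ennreal (norm (LINT \<theta>|surface_measure. (marchaud s \<theta> (\<phi> k) x - dir_deriv \<theta> x) *\<^sub>R \<theta>)))\<^sup>2 \<le> (\<integral>\<^sup>+\<theta>. ennreal \<bar>marchaud s \<theta> (\<phi> k) x - dir_deriv \<theta> x\<bar> \<partial>surface_measure)\<^sup>2"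
    by (rule power_mono) simp
  with cs have "(ennreal (norm (LINT \<theta>|surface_measure. (marchaud s \<theta> (\<phi> k) x - dir_deriv \<theta> x) *\<^sub>R \<theta>)))\<^sup>2 \<le> ennreal (sphere_area TYPE('n)) * E k x" by simp
  then show "ennreal ((norm (LINT \<theta>|surface_measure. (marchaud s \<theta> (\<phi> k) x - dir_deriv \<theta> x) *\<^sub>R \<theta>))\<^sup>2) \<le> ennreal (sphere_area TYPE('n)) * E k x"
    by (simp add: ennreal_power)
qed

text \<open>The Marchaud derivatives of the first approximant are integrable over the sphere at
  every point, and their difference from \<open>dir_deriv\<close> is so wherever \<open>E 0\<close>
  is finite.\<close>

lemma dir_deriv_sphere_integrable: "AE x in lborel. integrable surface_measure (\<lambda>\<theta>. dir_deriv \<theta> x *\<^sub>R \<theta>)"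
proof -
  have "(\<integral>\<^sup>+x. E 0 x \<partial>lborel) \<noteq> \<infinity>" using nn_integral_E[of 0] by (auto simp: top_unique)
  then have "AE x in lborel. E 0 x \<noteq> \<infinity>" by (intro nn_integral_noteq_infinite) simp_all
  then show ?thesis
  proof eventually_elim
    fix x assume "E 0 x \<noteq> \<infinity>"
    then have "integrable surface_measure (\<lambda>\<theta>. marchaud s \<theta> (\<phi> 0) x *\<^sub>R \<theta> - (marchaud s \<theta> (\<phi> 0) x - dir_deriv \<theta> x) *\<^sub>R \<theta>)"
      by (intro Bochner_Integration.integrable_diff cart_eq_sphere_integral(2)[OF \<phi> s] sphere_integrable_diff(1)) (simp add: less_top)
    then show "integrable surface_measure (\<lambda>\<theta>. dir_deriv \<theta> x *\<^sub>R \<theta>)" by (simp add: scaleR_diff_left)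
  qed
qed

lemma V_close: "(\<integral>\<^sup>+x. ennreal ((norm (V x - cart s (\<phi> k) x))\<^sup>2) \<partial>lborel) \<le> ennreal ((sphere_area TYPE('n) * (sphere_area TYPE('n) * (4 * K))) * (1 / 16) ^ k)"
proof -
  have "(\<integral>\<^sup>+x. E k x \<partial>lborel) \<noteq> \<infinity>" using nn_integral_E[of k] by (auto simp: top_unique)
  then have "AE x in lborel. E k x \<noteq> \<infinity>" by (intro nn_integral_noteq_infinite) simp_all
  then have "AE x in lborel. ennreal ((norm (V x - cart s (\<phi> k) x))\<^sup>2) \<le> ennreal (sphere_area TYPE('n)) * E k x"
    using dir_deriv_sphere_integrable
  proof eventually_elim
    fix x assume x: "E k x \<noteq> \<infinity>" "integrable surface_measure (\<lambda>\<theta>. dir_deriv \<theta> x *\<^sub>R \<theta>)"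
    have "V x - cart s (\<phi> k) x = - (LINT \<theta>|surface_measure. (marchaud s \<theta> (\<phi> k) x - dir_deriv \<theta> x) *\<^sub>R \<theta>)"
      unfolding V_def cart_eq_sphere_integral(1)[OF \<phi> s] scaleR_diff_left
      using x(2) cart_eq_sphere_integral(2)[OF \<phi> s] by (subst Bochner_Integration.integral_diff) simp_all
    then show "ennreal ((norm (V x - cart s (\<phi> k) x))\<^sup>2) \<le> ennreal (sphere_area TYPE('n)) * E k x"
      using sphere_integrable_diff(2)[of k x] x(1) by (simp add: less_top)
  qed
  then have "(\<integral>\<^sup>+x. ennreal ((norm (V x - cart s (\<phi> k) x))\<^sup>2) \<partial>lborel) \<le> (\<integral>\<^sup>+x. ennreal (sphere_area TYPE('n)) * E k x \<partial>lborel)"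
    by (rule nn_integral_mono_AE)
  also have "\<dots> = ennreal (sphere_area TYPE('n)) * (\<integral>\<^sup>+x. E k x \<partial>lborel)" by (rule nn_integral_cmult) simp
  also have "\<dots> \<le> ennreal (sphere_area TYPE('n)) * ennreal (sphere_area TYPE('n) * (4 * K) * (1 / 16) ^ k)"
    by (intro mult_left_mono nn_integral_E) simp
  also have "\<dots> = ennreal (sphere_area TYPE('n) * (sphere_area TYPE('n) * (4 * K) * (1 / 16) ^ k))"
    using K_nonneg by (intro ennreal_mult[symmetric]) auto
  finally show ?thesis by (simp add: mult.assoc)
qed

end

text \<open>The value at the centre does not follow from the L^2 bound, so convergence at x itself
  is assumed; almost every x provides it.\<close>

lemma kernel_diff_tendsto:
  fixes w :: "nat \<Rightarrow> real^'n \<Rightarrow> real" and k :: "real^'n \<Rightarrow> real"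
  assumes [measurable]: "\<And>j. w j \<in> borel_measurable borel" "k \<in> borel_measurable borel"
    and k: "\<And>y. 0 \<le> k y" "\<And>y. k y \<le> M" "(\<integral>\<^sup>+y. ennreal (k y) \<partial>lborel) \<le> ennreal I" "0 \<le> I"
    and w: "\<And>j. sq_int (w j) \<le> ennreal (c * (1 / 16) ^ j)" "0 \<le> c" and wx: "(\<lambda>j. w j x) \<longlonglongrightarrow> 0"
  shows "(\<lambda>j. \<integral>\<^sup>+y. ennreal (k y * \<bar>w j x - w j (x - y)\<bar>) \<partial>lborel) \<longlonglongrightarrow> 0"
proof -
  have le: "(\<integral>\<^sup>+y. ennreal (k y * \<bar>w j x - w j (x - y)\<bar>) \<partial>lborel)
     \<le> ennreal I * ennreal \<bar>w j x\<bar> + (\<integral>\<^sup>+y. ennreal (k y * \<bar>w j (x - y)\<bar>) \<partial>lborel)" for j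
  proof -
    have "(\<integral>\<^sup>+y. ennreal (k y * \<bar>w j x - w j (x - y)\<bar>) \<partial>lborel) \<le> (\<integral>\<^sup>+y. (ennreal (k y) * ennreal \<bar>w j x\<bar> + ennreal (k y * \<bar>w j (x - y)\<bar>)) \<partial>lborel)"
    proof (rule nn_integral_mono)
      fix y
      have "k y * \<bar>w j x - w j (x - y)\<bar> \<le> k y * (\<bar>w j x\<bar> + \<bar>w j (x - y)\<bar>)" using k(1) by (intro mult_left_mono abs_triangle_ineq4)
      then have "ennreal (k y * \<bar>w j x - w j (x - y)\<bar>) \<le> ennreal (k y * \<bar>w j x\<bar> + k y * \<bar>w j (x - y)\<bar>)" by (intro ennreal_leI) (simp add: distrib_left)
      then show "ennreal (k y * \<bar>w j x - w j (x - y)\<bar>) \<le> ennreal (k y) * ennreal \<bar>w j x\<bar> + ennreal (k y * \<bar>w j (x - y)\<bar>)"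
        using k(1)[of y] by (simp add: ennreal_mult)
    qed
    also have "\<dots> = (\<integral>\<^sup>+y. ennreal (k y) \<partial>lborel) * ennreal \<bar>w j x\<bar> + (\<integral>\<^sup>+y. ennreal (k y * \<bar>w j (x - y)\<bar>) \<partial>lborel)"
      by (subst nn_integral_add) (simp_all add: nn_integral_multc)
    also have "\<dots> \<le> ennreal I * ennreal \<bar>w j x\<bar> + (\<integral>\<^sup>+y. ennreal (k y * \<bar>w j (x - y)\<bar>) \<partial>lborel)"
      using k(3) by (intro add_mono mult_right_mono) auto
    finally show ?thesis .
  qed
  have "(\<lambda>j. ennreal \<bar>w j x\<bar>) \<longlonglongrightarrow> ennreal \<bar>0\<bar>" by (intro tendsto_ennrealI tendsto_rabs wx)
  then have "(\<lambda>j. ennreal I * ennreal \<bar>w j x\<bar> + (\<integral>\<^sup>+y. ennreal (k y * \<bar>w j (x - y)\<bar>) \<partial>lborel)) \<longlonglongrightarrow> ennreal I * ennreal \<bar>0\<bar> + 0"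
    by (intro tendsto_add ennreal_tendsto_cmult bounded_kernel_average_tendsto[OF _ _ k w]) auto
  then have L: "(\<lambda>j. ennreal I * ennreal \<bar>w j x\<bar> + (\<integral>\<^sup>+y. ennreal (k y * \<bar>w j (x - y)\<bar>) \<partial>lborel)) \<longlonglongrightarrow> 0" by simp
  show ?thesis by (rule tendsto_sandwich[OF _ _ tendsto_const L]) (simp, rule always_eventually, rule allI, rule le)
qed

subsection \<open>Almost everywhere convergence of the principal value\<close>

definition tail_kernel :: "real \<Rightarrow> real \<Rightarrow> real^'n \<Rightarrow> real" where
  "tail_kernel s r h = indicator (- ball 0 r) h * norm (riesz s h)"

lemma measurable_tail_kernel [measurable]: "tail_kernel s r \<in> borel_measurable (borel :: (real^'n) measure)"
proof -
  have [measurable]: "- ball (0 :: real^'n) r \<in> sets borel" by auto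
  show ?thesis unfolding tail_kernel_def[abs_def] by measurable
qed

lemma tail_kernel_bounds:
  assumes "0 < s" "0 < r"
  shows "0 \<le> tail_kernel s r (h :: real^'n)" "tail_kernel s r (h :: real^'n) \<le> r powr (- real CARD('n) - s)"
    and "(\<integral>\<^sup>+h. ennreal (tail_kernel s r (h :: real^'n)) \<partial>lborel) \<le> ennreal (sphere_area TYPE('n) * (r powr (- s) / s))"
proof -
  show "0 \<le> tail_kernel s r h" by (simp add: tail_kernel_def)
  show "tail_kernel s r h \<le> r powr (- real CARD('n) - s)"
  proof (cases "r \<le> norm h")
    case True
    then have "h \<noteq> 0" using assms by auto
    then show ?thesis using True assms by (auto simp: tail_kernel_def norm_riesz intro!: powr_mono2')
  qed (simp add: tail_kernel_def)
  have "(\<integral>\<^sup>+h. ennreal (tail_kernel s r (h :: real^'n)) \<partial>lborel) = (\<integral>\<^sup>+h. ennreal (norm (riesz s (h :: real^'n))) * indicator (- ball 0 r) h \<partial>lborel)"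
    by (intro nn_integral_cong) (auto simp: tail_kernel_def indicator_def)
  then show "(\<integral>\<^sup>+h. ennreal (tail_kernel s r (h :: real^'n)) \<partial>lborel) \<le> ennreal (sphere_area TYPE('n) * (r powr (- s) / s))"
    using nn_integral_riesz_tail[OF assms, where 'n='n] by simp
qed

lemma trunc_integrable:
  fixes g :: "real^'n \<Rightarrow> real"
  assumes [measurable]: "g \<in> borel_measurable borel" and fin: "sq_int g < \<infinity>" and s: "0 < s" "0 < r"
  shows "integrable lborel (\<lambda>h. indicator (- ball 0 r) h *\<^sub>R ((c - g (x - h)) *\<^sub>R riesz s h))"
proof (rule trunc_shift(1)[OF _ _ s])
  have [measurable]: "- ball (0 :: real^'n) r \<in> sets borel" by auto
  have "(\<integral>\<^sup>+h. ennreal (tail_kernel s r h * \<bar>g (x - h)\<bar>) \<partial>lborel)\<^sup>2 \<le> ennreal (sphere_area TYPE('n) * (r powr (- s) / s)) * (ennreal (r powr (- real CARD('n) - s)) * sq_int g)"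
    by (intro bounded_kernel_average tail_kernel_bounds s) measurable
  also have "\<dots> < \<infinity>" using fin by (simp add: ennreal_mult_less_top)
  finally have "(\<integral>\<^sup>+h. ennreal (tail_kernel s r h * \<bar>g (x - h)\<bar>) \<partial>lborel) < \<infinity>"
    by (cases "(\<integral>\<^sup>+h. ennreal (tail_kernel s r h * \<bar>g (x - h)\<bar>) \<partial>lborel) = top") (auto simp: less_top power2_eq_square)
  moreover have "norm (indicator (- ball 0 r) h *\<^sub>R (g (x - h) *\<^sub>R riesz s h)) = tail_kernel s r h * \<bar>g (x - h)\<bar>" for h
    by (simp add: tail_kernel_def abs_mult)
  ultimately show "integrable lborel (\<lambda>h. indicator (- ball 0 r) h *\<^sub>R (g (x - h) *\<^sub>R riesz s h))"
    by (simp only: integrable_iff_bounded) simp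
qed measurable

lemma trunc_diff_le:
  fixes f g :: "real^'n \<Rightarrow> real"
  assumes [measurable]: "f \<in> borel_measurable borel" "g \<in> borel_measurable borel" and fin: "sq_int f < \<infinity>" "sq_int g < \<infinity>" and s: "0 < s" "0 < r"
  shows "ennreal (norm (trunc s r f x - trunc s r g x)) \<le> (\<integral>\<^sup>+h. ennreal (tail_kernel s r h * \<bar>(f x - g x) - (f (x - h) - g (x - h))\<bar>) \<partial>lborel)"
proof -
  note i = trunc_integrable[OF assms(1) fin(1) s] trunc_integrable[OF assms(2) fin(2) s]
  have "trunc s r f x - trunc s r g x = (LINT h|lborel. indicator (- ball 0 r) h *\<^sub>R ((f x - f (x - h)) *\<^sub>R riesz s h) - indicator (- ball 0 r) h *\<^sub>R ((g x - g (x - h)) *\<^sub>R riesz s h))"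
    unfolding trunc_def by (rule Bochner_Integration.integral_diff[symmetric]) (rule i)+
  then have "ennreal (norm (trunc s r f x - trunc s r g x)) \<le> (\<integral>\<^sup>+h. ennreal (norm (indicator (- ball 0 r) h *\<^sub>R ((f x - f (x - h)) *\<^sub>R riesz s h) - indicator (- ball 0 r) h *\<^sub>R ((g x - g (x - h)) *\<^sub>R riesz s h))) \<partial>lborel)"
    using integral_norm_bound_ennreal[OF Bochner_Integration.integrable_diff[OF i(1)[of "f x"] i(2)[of "g x"]]] by simp
  also have "\<dots> = (\<integral>\<^sup>+h. ennreal (tail_kernel s r h * \<bar>(f x - g x) - (f (x - h) - g (x - h))\<bar>) \<partial>lborel)"
  proof (rule nn_integral_cong)
    fix h
    have "indicator (- ball 0 r) h *\<^sub>R ((f x - f (x - h)) *\<^sub>R riesz s h) - indicator (- ball 0 r) h *\<^sub>R ((g x - g (x - h)) *\<^sub>R riesz s h)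
      = (indicator (- ball 0 r) h * ((f x - g x) - (f (x - h) - g (x - h)))) *\<^sub>R riesz s h"
      by (simp add: algebra_simps)
    then show "ennreal (norm (indicator (- ball 0 r) h *\<^sub>R ((f x - f (x - h)) *\<^sub>R riesz s h) - indicator (- ball 0 r) h *\<^sub>R ((g x - g (x - h)) *\<^sub>R riesz s h)))
      = ennreal (tail_kernel s r h * \<bar>(f x - g x) - (f (x - h) - g (x - h))\<bar>)"
      by (simp add: tail_kernel_def abs_mult)
  qed
  finally show ?thesis .
qed

section \<open>The truncated integrals of the Sobolev function\<close>

context sobolev_approximation
begin

lemma u_sq_fin: "sq_int u < \<infinity>" and u_gag_fin: "gag s u < \<infinity>"
  using u_fin by (auto simp: sob_def ennreal_add_less_top)

lemma phi_u_close: "sq_int (\<lambda>x. \<phi> k x - u x) \<le> ennreal (1 * (1 / 16) ^ k)"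
proof -
  have "sq_int (\<lambda>x. \<phi> k x - u x) \<le> sob s (\<lambda>x. \<phi> k x - u x)" by (simp add: sob_def)
  then show ?thesis using approx[of k] by simp
qed

lemma phi_tendsto_AE: "AE x in lborel. (\<lambda>k. \<phi> k x - u x) \<longlonglongrightarrow> 0"
proof -
  have "AE x in lborel. (\<lambda>k. ennreal ((\<phi> k x - u x)\<^sup>2)) \<longlonglongrightarrow> 0"
  proof (rule AE_tendsto_0_geometric[where c=1])
    fix k
    have "(1 / 16) ^ k \<le> ((1 / 2) ^ k :: real)" by (intro power_mono) auto
    then show "(\<integral>\<^sup>+x. ennreal ((\<phi> k x - u x)\<^sup>2) \<partial>lborel) \<le> ennreal (1 * (1 / 2) ^ k)"
      using phi_u_close[of k] unfolding sq_int_def by (simp add: order_trans[OF _ ennreal_leI])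
  qed auto
  then show ?thesis
  proof eventually_elim
    fix x assume "(\<lambda>k. ennreal ((\<phi> k x - u x)\<^sup>2)) \<longlonglongrightarrow> 0"
    then have "(\<lambda>k. ennreal ((\<phi> k x - u x)\<^sup>2)) \<longlonglongrightarrow> ennreal 0" by simp
    then have "(\<lambda>k. (\<phi> k x - u x)\<^sup>2) \<longlonglongrightarrow> 0"
      by (subst (asm) tendsto_ennreal_iff) auto
    then have "(\<lambda>k. sqrt ((\<phi> k x - u x)\<^sup>2)) \<longlonglongrightarrow> sqrt 0" by (rule tendsto_real_sqrt)
    then show "(\<lambda>k. \<phi> k x - u x) \<longlonglongrightarrow> 0" by (simp add: tendsto_rabs_zero_iff)
  qed
qed

lemma cart_measurable [measurable]: "cart s (\<phi> k) \<in> borel_measurable borel"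
  by (intro borel_measurable_continuous_onI cart_continuous \<phi> s)

lemma CV_nonneg: "0 \<le> sphere_area TYPE('n) * (sphere_area TYPE('n) * (4 * K))"
  using K_nonneg by simp

text \<open>No decay of the gradient at infinity is estimated: the spherical representation and the
  uniform bound \<open>marchaud_bound\<close> give square integrability directly.\<close>

lemma cart_phi_finite: "(\<integral>\<^sup>+x. ennreal ((norm (cart s (\<phi> k) x))\<^sup>2) \<partial>lborel) < \<infinity>"
proof -
  interpret S: pair_sigma_finite lborel "surface_measure :: (real^'n) measure" ..
  have m0: "(\<lambda>(\<theta>, x). ennreal ((marchaud s \<theta> (\<phi> k) x)\<^sup>2)) \<in> borel_measurable (borel \<Otimes>\<^sub>M borel)" by measurable
  have m': "(\<lambda>(x, \<theta>). ennreal ((marchaud s \<theta> (\<phi> k) x)\<^sup>2)) \<in> borel_measurable (lborel \<Otimes>\<^sub>M surface_measure)"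
    using measurable_surface_pair[OF m0] by (subst measurable_cong_sets[OF sets_pair_measure_cong[OF sets_lborel refl] refl])
  have pt: "ennreal ((norm (cart s (\<phi> k) x))\<^sup>2) \<le> ennreal (sphere_area TYPE('n)) * (\<integral>\<^sup>+\<theta>. ennreal ((marchaud s \<theta> (\<phi> k) x)\<^sup>2) \<partial>surface_measure)" for x
  proof -
    have "ennreal (norm (cart s (\<phi> k) x)) \<le> (\<integral>\<^sup>+\<theta>. ennreal (norm (marchaud s \<theta> (\<phi> k) x *\<^sub>R \<theta>)) \<partial>surface_measure)"
      unfolding cart_eq_sphere_integral(1)[OF \<phi> s] by (rule integral_norm_bound_ennreal) (rule cart_eq_sphere_integral(2)[OF \<phi> s])
    also have "\<dots> = (\<integral>\<^sup>+\<theta>. ennreal \<bar>marchaud s \<theta> (\<phi> k) x\<bar> \<partial>surface_measure)" by (intro nn_integral_cong) auto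
    finally have "(ennreal (norm (cart s (\<phi> k) x)))\<^sup>2 \<le> (\<integral>\<^sup>+\<theta>. ennreal \<bar>marchaud s \<theta> (\<phi> k) x\<bar> \<partial>surface_measure)\<^sup>2" by (rule power_mono) simp
    also have "\<dots> \<le> ennreal (sphere_area TYPE('n)) * (\<integral>\<^sup>+\<theta>. ennreal ((marchaud s \<theta> (\<phi> k) x)\<^sup>2) \<partial>surface_measure)"
      by (rule sphere_integral_Cauchy_Schwarz[OF measurable_slice[of "\<lambda>\<theta> x. marchaud s \<theta> (\<phi> k) x"]]) measurable
    finally show ?thesis by (simp add: ennreal_power)
  qed
  have "(\<integral>\<^sup>+x. (\<integral>\<^sup>+\<theta>. ennreal ((marchaud s \<theta> (\<phi> k) x)\<^sup>2) \<partial>surface_measure) \<partial>lborel) = (\<integral>\<^sup>+\<theta>. (\<integral>\<^sup>+x. ennreal ((marchaud s \<theta> (\<phi> k) x)\<^sup>2) \<partial>lborel) \<partial>surface_measure)"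
    by (rule S.Fubini'[OF m', symmetric])
  also have "\<dots> \<le> (\<integral>\<^sup>+\<theta>. ennreal K * gag s (\<phi> k) \<partial>(surface_measure :: (real^'n) measure))"
    using marchaud_bound[OF \<phi> s] by (intro nn_integral_mono) (auto simp: sq_int_def K_eq)
  also have "\<dots> < \<infinity>"
    using gag_phi_finite[of k] by (simp add: emeasure_sphere_area ennreal_mult_less_top)
  finally have fin: "(\<integral>\<^sup>+x. (\<integral>\<^sup>+\<theta>. ennreal ((marchaud s \<theta> (\<phi> k) x)\<^sup>2) \<partial>surface_measure) \<partial>lborel) < \<infinity>" .
  have "(\<integral>\<^sup>+x. ennreal ((norm (cart s (\<phi> k) x))\<^sup>2) \<partial>lborel)
    \<le> (\<integral>\<^sup>+x. ennreal (sphere_area TYPE('n)) * (\<integral>\<^sup>+\<theta>. ennreal ((marchaud s \<theta> (\<phi> k) x)\<^sup>2) \<partial>surface_measure) \<partial>lborel)"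
    by (intro nn_integral_mono pt)
  also have "\<dots> = ennreal (sphere_area TYPE('n)) * (\<integral>\<^sup>+x. (\<integral>\<^sup>+\<theta>. ennreal ((marchaud s \<theta> (\<phi> k) x)\<^sup>2) \<partial>surface_measure) \<partial>lborel)"
    using surface.borel_measurable_nn_integral[OF m'] by (intro nn_integral_cmult) simp
  also have "\<dots> < \<infinity>" using fin by (simp add: ennreal_mult_less_top)
  finally show ?thesis .
qed

lemma V_finite: "(\<integral>\<^sup>+x. ennreal ((norm (V x))\<^sup>2) \<partial>lborel) < \<infinity>"
proof -
  have "(\<integral>\<^sup>+x. ennreal ((norm (V x))\<^sup>2) \<partial>lborel) \<le> (\<integral>\<^sup>+x. (2 * ennreal ((norm (V x - cart s (\<phi> 0) x))\<^sup>2) + 2 * ennreal ((norm (cart s (\<phi> 0) x))\<^sup>2)) \<partial>lborel)"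
  proof (rule nn_integral_mono)
    fix x
    have "norm (V x) \<le> norm (V x - cart s (\<phi> 0) x) + norm (cart s (\<phi> 0) x)" by norm
    then have "(norm (V x))\<^sup>2 \<le> (norm (V x - cart s (\<phi> 0) x) + norm (cart s (\<phi> 0) x))\<^sup>2" by (rule power_mono) simp
    then show "ennreal ((norm (V x))\<^sup>2) \<le> 2 * ennreal ((norm (V x - cart s (\<phi> 0) x))\<^sup>2) + 2 * ennreal ((norm (cart s (\<phi> 0) x))\<^sup>2)"
      using ennreal_square_add_le order_trans ennreal_leI by blast
  qed
  also have "\<dots> = 2 * (\<integral>\<^sup>+x. ennreal ((norm (V x - cart s (\<phi> 0) x))\<^sup>2) \<partial>lborel) + 2 * (\<integral>\<^sup>+x. ennreal ((norm (cart s (\<phi> 0) x))\<^sup>2) \<partial>lborel)"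
    by (subst nn_integral_add) (simp_all add: nn_integral_cmult)
  also have "\<dots> < \<infinity>"
    using V_close[of 0] cart_phi_finite[of 0] by (auto simp: ennreal_add_less_top ennreal_mult_less_top intro: le_less_trans)
  finally show ?thesis .
qed

lemma u_local_energy_AE:
  "AE x in lborel. (\<integral>\<^sup>+y. ennreal ((u x - u (x - y))\<^sup>2 * norm y powr - (real CARD('n) + 2 * s)) \<partial>lborel) < \<infinity>"
proof -
  have "(\<integral>\<^sup>+x. (\<integral>\<^sup>+y. ennreal ((u x - u (x - y))\<^sup>2 * norm y powr - (real CARD('n) + 2 * s)) \<partial>lborel) \<partial>lborel)
    = (\<integral>\<^sup>+y. (\<integral>\<^sup>+x. ennreal ((u x - u (x - y))\<^sup>2 * norm y powr - (real CARD('n) + 2 * s)) \<partial>lborel) \<partial>lborel)"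
    by (rule lborel_pair.Fubini') measurable
  also have "\<dots> = gag s u"
    unfolding gag_def diff_sq_def by (intro nn_integral_cong) (simp add: ennreal_mult nn_integral_multc)
  finally have "(\<integral>\<^sup>+x. (\<integral>\<^sup>+y. ennreal ((u x - u (x - y))\<^sup>2 * norm y powr - (real CARD('n) + 2 * s)) \<partial>lborel) \<partial>lborel) \<noteq> \<infinity>"
    using u_gag_fin by simp
  then have "AE x in lborel. (\<integral>\<^sup>+y. ennreal ((u x - u (x - y))\<^sup>2 * norm y powr - (real CARD('n) + 2 * s)) \<partial>lborel) \<noteq> \<infinity>"
    by (intro nn_integral_noteq_infinite) measurable
  then show ?thesis by eventually_elim (simp add: less_top)
qed

text \<open>The error \<open>R r\<close> between the mollification of \<open>V\<close> and the truncated integral involves only \<open>u\<close>; it is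
  proved for the approximants, for which the two operators coincide, and survives the limit \<open>k \<rightarrow> \<infinity>\<close>.\<close>

theorem trunc_tendsto_AE: "AE x in lborel. ((\<lambda>r. trunc s r u x) \<longlongrightarrow> V x) (at_right 0)"
proof -
  obtain \<eta> :: "real^'n \<Rightarrow> real" where \<eta>: "\<eta> \<in> test_functions" "\<And>x. 0 \<le> \<eta> x"
    "\<And>x. 1 \<le> norm x \<Longrightarrow> \<eta> x = 0" "(\<integral>\<^sup>+x. ennreal (\<eta> x) \<partial>lborel) = 1"
    using mollifier_exists[of 1] by auto
  obtain L where L: "0 \<le> L" "\<And>x y. \<bar>\<eta> x - \<eta> y\<bar> \<le> L * norm (x - y)" using test_function_Lipschitz[OF \<eta>(1)] by blast
  obtain B where B: "0 \<le> B" "\<And>x. \<bar>\<eta> x\<bar> \<le> B" using test_function_bounded[OF \<eta>(1)] by blast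
  interpret mollifier \<eta> L B
    by unfold_locales (use \<eta> L B abs_le_D1 in auto)
  have lebesgue_points: "AE x in lborel. ((\<lambda>r. LINT z|lborel. rho \<eta> r z *\<^sub>R V (x - z)) \<longlongrightarrow> V x) (at_right 0)"
  proof (rule rho_tendsto_AE[OF measurable_V V_finite cart_continuous[OF \<phi> s] _ CV_nonneg])
    fix k
    have "(1 / 16) ^ k \<le> ((1 / 4) ^ k :: real)" by (intro power_mono) auto
    then have "ennreal ((sphere_area TYPE('n) * (sphere_area TYPE('n) * (4 * K))) * (1 / 16) ^ k) \<le> ennreal ((sphere_area TYPE('n) * (sphere_area TYPE('n) * (4 * K))) * (1 / 4) ^ k)"
      by (intro ennreal_leI mult_left_mono CV_nonneg)
    with V_close[of k] show "(\<integral>\<^sup>+x. ennreal ((norm (V x - cart s (\<phi> k) x))\<^sup>2) \<partial>lborel) \<le> ennreal ((sphere_area TYPE('n) * (sphere_area TYPE('n) * (4 * K))) * (1 / 4) ^ k)"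
      by (rule order_trans)
  qed
  have phi_sq: "sq_int (\<phi> k) < \<infinity>" for k by (rule sq_int_test_finite[OF \<phi>])
  show ?thesis
    \<comment> \<open>None of the three exceptional sets depends on the radius, so a single null set
      serves the whole limit r \<rightarrow> 0.\<close>
    using lebesgue_points phi_tendsto_AE u_local_energy_AE
  proof eventually_elim
    fix x
    assume lp: "((\<lambda>r. LINT z|lborel. rho \<eta> r z *\<^sub>R V (x - z)) \<longlongrightarrow> V x) (at_right 0)"
      and px: "(\<lambda>k. \<phi> k x - u x) \<longlonglongrightarrow> 0"
      and ex: "(\<integral>\<^sup>+y. ennreal ((u x - u (x - y))\<^sup>2 * norm y powr - (real CARD('n) + 2 * s)) \<partial>lborel) < \<infinity>"
    define R where "R r = (\<integral>\<^sup>+y. ennreal (\<bar>u x - u (x - y)\<bar> * error_kernel s r y) \<partial>lborel)" for r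
    have main: "ennreal (norm ((LINT z|lborel. rho \<eta> r z *\<^sub>R V (x - z)) - trunc s r u x)) \<le> ennreal (kernel_const s) * R r"
      if r: "0 < r" for r
    proof -
      define v where "v = (LINT z|lborel. rho \<eta> r z *\<^sub>R V (x - z))"
      define a where "a k = (LINT z|lborel. rho \<eta> r z *\<^sub>R cart s (\<phi> k) (x - z))" for k
      \<comment> \<open>Three costs of replacing \<open>u\<close> by \<open>\<phi> k\<close>: in the
        mollified gradient, in the error integral and in the truncated integral. At fixed r all
        three kernels are bounded and integrable, so each cost tends to 0.\<close>
      define e1 where "e1 k = (\<integral>\<^sup>+z. ennreal (rho \<eta> r z * \<bar>norm (V (x - z) - cart s (\<phi> k) (x - z))\<bar>) \<partial>lborel)" for k
      define e2 where "e2 k = (\<integral>\<^sup>+y. ennreal (error_kernel s r y * \<bar>(\<phi> k x - u x) - (\<phi> k (x - y) - u (x - y))\<bar>) \<partial>lborel)" for k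
      define e3 where "e3 k = (\<integral>\<^sup>+h. ennreal (tail_kernel s r h * \<bar>(\<phi> k x - u x) - (\<phi> k (x - h) - u (x - h))\<bar>) \<partial>lborel)" for k
      have 1: "ennreal (norm (v - a k)) \<le> e1 k" for k
      proof -
        note iV = rho_integrable_sq[OF measurable_V V_finite r] and ic = rho_integrable_sq[OF cart_measurable cart_phi_finite r]
        have "v - a k = (LINT z|lborel. rho \<eta> r z *\<^sub>R V (x - z) - rho \<eta> r z *\<^sub>R cart s (\<phi> k) (x - z))"
          unfolding v_def a_def by (rule Bochner_Integration.integral_diff[OF iV ic, symmetric])
        then have "ennreal (norm (v - a k)) \<le> (\<integral>\<^sup>+z. ennreal (norm (rho \<eta> r z *\<^sub>R V (x - z) - rho \<eta> r z *\<^sub>R cart s (\<phi> k) (x - z))) \<partial>lborel)"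
          using integral_norm_bound_ennreal[OF Bochner_Integration.integrable_diff[OF iV[of x] ic[of k x]]] by simp
        also have "\<dots> = e1 k"
          unfolding e1_def using rho_nonneg[OF r] by (intro nn_integral_cong) (simp add: scaleR_diff_right[symmetric])
        finally show ?thesis .
      qed
      have 2: "ennreal (norm (a k - trunc s r (\<phi> k) x)) \<le> ennreal (kernel_const s) * (R r + e2 k)" for k
      proof -
        have "(\<integral>\<^sup>+y. ennreal (\<bar>\<phi> k x - \<phi> k (x - y)\<bar> * error_kernel s r y) \<partial>lborel)
          \<le> (\<integral>\<^sup>+y. (ennreal (\<bar>u x - u (x - y)\<bar> * error_kernel s r y) + ennreal (error_kernel s r y * \<bar>(\<phi> k x - u x) - (\<phi> k (x - y) - u (x - y))\<bar>)) \<partial>lborel)"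
        proof (rule nn_integral_mono)
          fix y
          have "\<bar>\<phi> k x - \<phi> k (x - y)\<bar> \<le> \<bar>u x - u (x - y)\<bar> + \<bar>(\<phi> k x - u x) - (\<phi> k (x - y) - u (x - y))\<bar>" by linarith
          then have "\<bar>\<phi> k x - \<phi> k (x - y)\<bar> * error_kernel s r y \<le> (\<bar>u x - u (x - y)\<bar> + \<bar>(\<phi> k x - u x) - (\<phi> k (x - y) - u (x - y))\<bar>) * error_kernel s r y"
            by (rule mult_right_mono) (rule error_kernel_nonneg[OF r])
          then have "ennreal (\<bar>\<phi> k x - \<phi> k (x - y)\<bar> * error_kernel s r y) \<le> ennreal (\<bar>u x - u (x - y)\<bar> * error_kernel s r y + error_kernel s r y * \<bar>(\<phi> k x - u x) - (\<phi> k (x - y) - u (x - y))\<bar>)"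
            by (intro ennreal_leI) (simp only: distrib_right mult.commute[of "error_kernel s r y"])
          then show "ennreal (\<bar>\<phi> k x - \<phi> k (x - y)\<bar> * error_kernel s r y) \<le> ennreal (\<bar>u x - u (x - y)\<bar> * error_kernel s r y) + ennreal (error_kernel s r y * \<bar>(\<phi> k x - u x) - (\<phi> k (x - y) - u (x - y))\<bar>)"
            using error_kernel_nonneg[OF r, of s y] by simp
        qed
        also have "\<dots> = R r + e2 k" unfolding R_def e2_def by (rule nn_integral_add) measurable
        finally have "ennreal (kernel_const s) * (\<integral>\<^sup>+y. ennreal (\<bar>\<phi> k x - \<phi> k (x - y)\<bar> * error_kernel s r y) \<partial>lborel) \<le> ennreal (kernel_const s) * (R r + e2 k)"
          by (rule mult_left_mono) simp
        with rho_cart_bound[OF \<phi> s r, of k x] show ?thesis unfolding a_def by (rule order_trans)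
      qed
      have 3: "ennreal (norm (trunc s r (\<phi> k) x - trunc s r u x)) \<le> e3 k" for k
        unfolding e3_def by (intro trunc_diff_le phi_sq u_sq_fin s r) measurable
      have sum: "ennreal (norm (v - trunc s r u x)) \<le> e1 k + (ennreal (kernel_const s) * (R r + e2 k) + e3 k)" for k
      proof -
        have "norm (v - trunc s r u x) \<le> norm (v - a k) + (norm (a k - trunc s r (\<phi> k) x) + norm (trunc s r (\<phi> k) x - trunc s r u x))" by norm
        then have "ennreal (norm (v - trunc s r u x)) \<le> ennreal (norm (v - a k) + (norm (a k - trunc s r (\<phi> k) x) + norm (trunc s r (\<phi> k) x - trunc s r u x)))"
          by (rule ennreal_leI)
        also have "\<dots> = ennreal (norm (v - a k)) + (ennreal (norm (a k - trunc s r (\<phi> k) x)) + ennreal (norm (trunc s r (\<phi> k) x - trunc s r u x)))"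
          by simp
        also have "\<dots> \<le> e1 k + (ennreal (kernel_const s) * (R r + e2 k) + e3 k)" by (intro add_mono 1 2 3)
        finally show ?thesis .
      qed
      have "e1 \<longlonglongrightarrow> 0"
        unfolding e1_def[abs_def]
        by (rule bounded_kernel_average_tendsto[where g="\<lambda>k y. norm (V y - cart s (\<phi> k) y)" and I=1, OF _ _ rho_nonneg[OF r] rho_le[OF r] _ _ _ CV_nonneg])
           (use V_close in \<open>auto simp: sq_int_def nn_integral_rho[OF r]\<close>)
      moreover have "e2 \<longlonglongrightarrow> 0"
        unfolding e2_def[abs_def]
        by (rule kernel_diff_tendsto[where w="\<lambda>k y. \<phi> k y - u y", OF _ _ error_kernel_nonneg[OF r] error_kernel_le[OF s(1) r] nn_integral_kap_le[OF s(1) r] _ phi_u_close])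
           (use px error_kernel_const_nonneg[OF s(1), where 'n='n] in auto)
      moreover have "e3 \<longlonglongrightarrow> 0"
        unfolding e3_def[abs_def]
        by (rule kernel_diff_tendsto[where w="\<lambda>k y. \<phi> k y - u y", OF _ _ tail_kernel_bounds[OF s(1) r] _ phi_u_close])
           (use px s in auto)
      ultimately have "(\<lambda>k. e1 k + (ennreal (kernel_const s) * (R r + e2 k) + e3 k)) \<longlonglongrightarrow> 0 + (ennreal (kernel_const s) * (R r + 0) + 0)"
        by (intro tendsto_add ennreal_tendsto_cmult tendsto_const) auto
      then have "(\<lambda>k. e1 k + (ennreal (kernel_const s) * (R r + e2 k) + e3 k)) \<longlonglongrightarrow> ennreal (kernel_const s) * R r" by simp
      then show ?thesis unfolding v_def[symmetric]
        by (rule LIMSEQ_le_const) (use sum in auto)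
    qed
    show "((\<lambda>r. trunc s r u x) \<longlongrightarrow> V x) (at_right 0)"
      unfolding tendsto_at_iff_sequentially
    proof (intro allI impI)
      fix X :: "nat \<Rightarrow> real" assume X: "\<forall>i. X i \<in> {0<..} - {0}" "X \<longlonglongrightarrow> 0"
      have X0: "0 < X j" for j using X(1) by auto
      have "(\<lambda>j. R (X j)) \<longlonglongrightarrow> 0"
        unfolding R_def by (rule error_kernel_average_tendsto_0[OF u s ex X0 X(2)])
      then have "(\<lambda>j. ennreal (kernel_const s) * R (X j)) \<longlonglongrightarrow> ennreal (kernel_const s) * 0"
        by (intro ennreal_tendsto_cmult) auto
      then have L0: "(\<lambda>j. ennreal (kernel_const s) * R (X j)) \<longlonglongrightarrow> 0" by simp
      have "(\<lambda>j. ennreal (norm ((LINT z|lborel. rho \<eta> (X j) z *\<^sub>R V (x - z)) - trunc s (X j) u x))) \<longlonglongrightarrow> 0"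
        by (rule tendsto_sandwich[OF _ _ tendsto_const L0]) (simp, rule always_eventually, rule allI, rule main[OF X0])
      then have "(\<lambda>j. ennreal (norm ((LINT z|lborel. rho \<eta> (X j) z *\<^sub>R V (x - z)) - trunc s (X j) u x))) \<longlonglongrightarrow> ennreal 0" by simp
      then have "(\<lambda>j. norm ((LINT z|lborel. rho \<eta> (X j) z *\<^sub>R V (x - z)) - trunc s (X j) u x)) \<longlonglongrightarrow> 0"
        by (subst (asm) tendsto_ennreal_iff) auto
      then have d: "(\<lambda>j. (LINT z|lborel. rho \<eta> (X j) z *\<^sub>R V (x - z)) - trunc s (X j) u x) \<longlonglongrightarrow> 0"
        by (simp only: tendsto_norm_zero_iff)
      have "(\<lambda>j. LINT z|lborel. rho \<eta> (X j) z *\<^sub>R V (x - z)) \<longlonglongrightarrow> V x"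
        using lp X unfolding tendsto_at_iff_sequentially by (auto simp: comp_def)
      from tendsto_diff[OF this d] show "((\<lambda>r. trunc s r u x) \<circ> X) \<longlonglongrightarrow> V x" by (simp add: comp_def)
    qed
  qed
qed

end

subsection \<open>From Borel to Lebesgue measurable representatives\<close>

lemma borel_representative:
  fixes u :: "real^'n \<Rightarrow> real"
  assumes "u \<in> borel_measurable lebesgue"
  obtains v where "v \<in> borel_measurable borel" "AE x in lborel. u x = v x"
  using completion_ex_borel_measurable_real[OF assms] by auto

lemma L2_norm_sq_eq_sq_int: "L2_norm_sq u = sq_int u"
  by (simp add: L2_norm_sq_def sq_int_def nn_integral_completion)

lemma Sobolev_norm_sq_eq_sob: "u \<in> borel_measurable borel \<Longrightarrow> Sobolev_norm_sq s u = sob s u"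
  by (simp add: Sobolev_norm_sq_def sob_def L2_norm_sq_eq_sq_int gagliardo_sq_eq_gag)

lemma Sobolev_norm_sq_cong:
  fixes u v :: "real^'n \<Rightarrow> real"
  assumes "AE x in lborel. u x = v x"
  shows "Sobolev_norm_sq s u = Sobolev_norm_sq s v"
proof -
  have "L2_norm_sq u = L2_norm_sq v"
    unfolding L2_norm_sq_def nn_integral_completion
    using assms by (intro nn_integral_cong_AE) (auto elim!: eventually_mono)
  moreover have "gagliardo_sq s u = gagliardo_sq s v"
    unfolding gagliardo_sq_def nn_integral_completion
  proof (rule nn_integral_cong_AE)
    show "AE x in lborel. (\<integral>\<^sup>+ y. ennreal ((u x - u y)\<^sup>2 / norm (x - y) powr (real CARD('n) + 2 * s)) \<partial>lborel)
      = (\<integral>\<^sup>+ y. ennreal ((v x - v y)\<^sup>2 / norm (x - y) powr (real CARD('n) + 2 * s)) \<partial>lborel)"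
      using assms
    proof eventually_elim
      fix x assume "u x = v x"
      then show "(\<integral>\<^sup>+ y. ennreal ((u x - u y)\<^sup>2 / norm (x - y) powr (real CARD('n) + 2 * s)) \<partial>lborel)
        = (\<integral>\<^sup>+ y. ennreal ((v x - v y)\<^sup>2 / norm (x - y) powr (real CARD('n) + 2 * s)) \<partial>lborel)"
        using assms by (intro nn_integral_cong_AE) (auto elim!: eventually_mono)
    qed
  qed
  ultimately show ?thesis by (simp add: Sobolev_norm_sq_def)
qed

lemma L2_norm_sq_add:
  fixes a b :: "real^'n \<Rightarrow> real"
  assumes [measurable]: "a \<in> borel_measurable lebesgue" "b \<in> borel_measurable lebesgue"
  shows "L2_norm_sq (\<lambda>x. a x + b x) \<le> 2 * L2_norm_sq a + 2 * L2_norm_sq b"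
proof -
  have "L2_norm_sq (\<lambda>x. a x + b x) \<le> (\<integral>\<^sup>+x. (2 * ennreal ((a x)\<^sup>2) + 2 * ennreal ((b x)\<^sup>2)) \<partial>lebesgue)"
    unfolding L2_norm_sq_def by (intro nn_integral_mono ennreal_square_add_le)
  then show ?thesis by (simp add: L2_norm_sq_def nn_integral_add nn_integral_cmult)
qed

lemma L2_norm_sq_cmult: "L2_norm_sq (\<lambda>x. c * a x) = ennreal (c\<^sup>2) * sq_int a" if "a \<in> borel_measurable borel"
  using that by (simp add: L2_norm_sq_eq_sq_int sq_int_def power_mult_distrib ennreal_mult nn_integral_cmult)

lemma L2_norm_sq_minus_commute: "L2_norm_sq (\<lambda>x. a x - b x) = L2_norm_sq (\<lambda>x. b x - a x)"
  by (simp add: L2_norm_sq_def power2_commute)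

lemma borel_imp_lebesgue_measurable:
  "f \<in> borel_measurable borel \<Longrightarrow> f \<in> borel_measurable lebesgue"
  by (simp add: measurable_completion)

text \<open>The approximating sequences behind g and g' may differ, but both tend to u in the
  Sobolev norm. Their difference is a test function, so \<open>marchaud_bound\<close> makes the
  difference of the two Riemann--Liouville derivatives tend to 0 in L^2.\<close>

lemma is_dir_deriv_unique:
  fixes u g g' :: "real^'n \<Rightarrow> real"
  assumes s: "0 < s" "s < 1" and u: "u \<in> borel_measurable lebesgue" and \<theta>: "norm \<theta> = 1"
    and g: "is_dir_deriv s \<theta> u g" and g': "is_dir_deriv s \<theta> u g'"
  shows "AE x in lebesgue. g x = g' x"
proof -
  obtain v where v[measurable]: "v \<in> borel_measurable borel" and uv: "AE x in lborel. u x = v x"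
    using borel_representative[OF u] by blast
  obtain \<phi> where \<phi>: "\<And>k. \<phi> k \<in> test_functions" "(\<lambda>k. Sobolev_norm_sq s (\<lambda>x. \<phi> k x - u x)) \<longlonglongrightarrow> 0"
    "(\<lambda>k. L2_norm_sq (\<lambda>x. RL_dir_deriv s \<theta> (\<phi> k) x - g x)) \<longlonglongrightarrow> 0"
    using g unfolding is_dir_deriv_def by blast
  obtain \<psi> where \<psi>: "\<And>k. \<psi> k \<in> test_functions" "(\<lambda>k. Sobolev_norm_sq s (\<lambda>x. \<psi> k x - u x)) \<longlonglongrightarrow> 0"
    "(\<lambda>k. L2_norm_sq (\<lambda>x. RL_dir_deriv s \<theta> (\<psi> k) x - g' x)) \<longlonglongrightarrow> 0"
    using g' unfolding is_dir_deriv_def by blast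
  have gm[measurable]: "g \<in> borel_measurable lebesgue" "g' \<in> borel_measurable lebesgue"
    using g g' by (auto simp: is_dir_deriv_def L2_functions_def)
  have [measurable]: "\<phi> k \<in> borel_measurable borel" "\<psi> k \<in> borel_measurable borel" for k
    using \<phi>(1) \<psi>(1) by (auto intro: test_function_measurable)
  define G where "G = s / Gamma (1 - s)"
  have RL: "RL_dir_deriv s \<theta> f = (\<lambda>x. G * marchaud s \<theta> f x)" if "f \<in> test_functions" for f
    using RL_dir_deriv_test_function[OF that s \<theta>] by (simp add: G_def fun_eq_iff)
  have sob_eq: "Sobolev_norm_sq s (\<lambda>x. f x - u x) = sob s (\<lambda>x. f x - v x)" if [measurable]: "f \<in> borel_measurable borel" for f
  proof -
    have "Sobolev_norm_sq s (\<lambda>x. f x - u x) = Sobolev_norm_sq s (\<lambda>x. f x - v x)"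
      using uv by (intro Sobolev_norm_sq_cong) (auto elim!: eventually_mono)
    also have "\<dots> = sob s (\<lambda>x. f x - v x)" by (rule Sobolev_norm_sq_eq_sob) measurable
    finally show ?thesis .
  qed
  let ?a = "\<lambda>k. sob s (\<lambda>x. \<phi> k x - v x)" and ?b = "\<lambda>k. sob s (\<lambda>x. \<psi> k x - v x)"
  let ?c = "\<lambda>k. L2_norm_sq (\<lambda>x. RL_dir_deriv s \<theta> (\<phi> k) x - g x)" and ?d = "\<lambda>k. L2_norm_sq (\<lambda>x. RL_dir_deriv s \<theta> (\<psi> k) x - g' x)"
  let ?K = "ennreal (G\<^sup>2) * ennreal (dir_const s TYPE('n))"
  have rm: "RL_dir_deriv s \<theta> (\<phi> k) \<in> borel_measurable lebesgue" "RL_dir_deriv s \<theta> (\<psi> k) \<in> borel_measurable lebesgue" for k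
    unfolding RL[OF \<phi>(1)] RL[OF \<psi>(1)] by (rule borel_imp_lebesgue_measurable, measurable)+
  have mid: "L2_norm_sq (\<lambda>x. RL_dir_deriv s \<theta> (\<phi> k) x - RL_dir_deriv s \<theta> (\<psi> k) x) \<le> ?K * (2 * ?a k + 2 * ?b k)" for k
  proof -
    have "L2_norm_sq (\<lambda>x. RL_dir_deriv s \<theta> (\<phi> k) x - RL_dir_deriv s \<theta> (\<psi> k) x)
      = L2_norm_sq (\<lambda>x. G * marchaud s \<theta> (\<lambda>x. \<phi> k x - \<psi> k x) x)"
      unfolding RL[OF \<phi>(1)] RL[OF \<psi>(1)] marchaud_diff[OF \<phi>(1) \<psi>(1) s] by (simp add: right_diff_distrib)
    also have "\<dots> = ennreal (G\<^sup>2) * sq_int (marchaud s \<theta> (\<lambda>x. \<phi> k x - \<psi> k x))"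
      by (rule L2_norm_sq_cmult) measurable
    also have "\<dots> \<le> ennreal (G\<^sup>2) * (ennreal (dir_const s TYPE('n)) * sob s (\<lambda>x. \<phi> k x - \<psi> k x))"
    proof (intro mult_left_mono)
      have "sq_int (marchaud s \<theta> (\<lambda>x. \<phi> k x - \<psi> k x)) \<le> ennreal (dir_const s TYPE('n)) * gag s (\<lambda>x. \<phi> k x - \<psi> k x)"
        by (intro marchaud_bound test_function_diff \<phi> \<psi> s \<theta>)
      also have "\<dots> \<le> ennreal (dir_const s TYPE('n)) * sob s (\<lambda>x. \<phi> k x - \<psi> k x)"
        by (intro mult_left_mono) (auto simp: sob_def)
      finally show "sq_int (marchaud s \<theta> (\<lambda>x. \<phi> k x - \<psi> k x)) \<le> ennreal (dir_const s TYPE('n)) * sob s (\<lambda>x. \<phi> k x - \<psi> k x)" .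
    qed simp
    also have "\<dots> = ?K * sob s (\<lambda>x. (\<phi> k x - v x) + (v x - \<psi> k x))" by (simp add: mult.assoc)
    also have "\<dots> \<le> ?K * (2 * ?a k + 2 * sob s (\<lambda>x. v x - \<psi> k x))"
      by (intro mult_left_mono sob_add) measurable
    also have "sob s (\<lambda>x. v x - \<psi> k x) = ?b k" by (rule sob_minus_commute)
    finally show ?thesis .
  qed
  have le: "L2_norm_sq (\<lambda>x. g x - g' x) \<le> 2 * ?c k + 2 * (2 * (?K * (2 * ?a k + 2 * ?b k)) + 2 * ?d k)" for k
  proof -
    have "L2_norm_sq (\<lambda>x. (g x - RL_dir_deriv s \<theta> (\<phi> k) x) + (RL_dir_deriv s \<theta> (\<phi> k) x - g' x))
      \<le> 2 * L2_norm_sq (\<lambda>x. g x - RL_dir_deriv s \<theta> (\<phi> k) x) + 2 * L2_norm_sq (\<lambda>x. RL_dir_deriv s \<theta> (\<phi> k) x - g' x)"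
      using rm by (intro L2_norm_sq_add borel_measurable_diff gm)
    also have "L2_norm_sq (\<lambda>x. g x - RL_dir_deriv s \<theta> (\<phi> k) x) = ?c k" by (rule L2_norm_sq_minus_commute)
    also have "L2_norm_sq (\<lambda>x. RL_dir_deriv s \<theta> (\<phi> k) x - g' x)
      \<le> 2 * (?K * (2 * ?a k + 2 * ?b k)) + 2 * ?d k"
    proof -
      have "L2_norm_sq (\<lambda>x. (RL_dir_deriv s \<theta> (\<phi> k) x - RL_dir_deriv s \<theta> (\<psi> k) x) + (RL_dir_deriv s \<theta> (\<psi> k) x - g' x))
        \<le> 2 * L2_norm_sq (\<lambda>x. RL_dir_deriv s \<theta> (\<phi> k) x - RL_dir_deriv s \<theta> (\<psi> k) x) + 2 * ?d k"
        using rm by (intro L2_norm_sq_add borel_measurable_diff gm)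
      also have "\<dots> \<le> 2 * (?K * (2 * ?a k + 2 * ?b k)) + 2 * ?d k" by (intro add_right_mono mult_left_mono mid) simp
      finally show ?thesis by simp
    qed
    finally show ?thesis by (simp add: add_left_mono mult_left_mono)
  qed
  have "(\<lambda>k. 2 * ?c k + 2 * (2 * (?K * (2 * ?a k + 2 * ?b k)) + 2 * ?d k)) \<longlonglongrightarrow> 2 * 0 + 2 * (2 * (?K * (2 * 0 + 2 * 0)) + 2 * 0)"
    using \<phi>(2,3) \<psi>(2,3) sob_eq
    by (intro tendsto_add ennreal_tendsto_cmult) (auto simp: ennreal_mult_less_top)
  then have "(\<lambda>k. 2 * ?c k + 2 * (2 * (?K * (2 * ?a k + 2 * ?b k)) + 2 * ?d k)) \<longlonglongrightarrow> 0" by simp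
  then have "L2_norm_sq (\<lambda>x. g x - g' x) \<le> 0"
    by (rule LIMSEQ_le_const) (use le in auto)
  then have "(\<integral>\<^sup>+x. ennreal ((g x - g' x)\<^sup>2) \<partial>lebesgue) = 0" by (simp add: L2_norm_sq_def)
  then have "AE x in lebesgue. ennreal ((g x - g' x)\<^sup>2) = 0"
    by (subst (asm) nn_integral_0_iff_AE) auto
  then show ?thesis by eventually_elim (simp add: ennreal_eq_0_iff)
qed

section \<open>Principal values for Lebesgue measurable functions\<close>

lemma integrable_reflect:
  fixes f :: "real^'n \<Rightarrow> 'b::{banach, second_countable_topology}"
  assumes "integrable lborel f"
  shows "integrable lborel (\<lambda>y. f (x - y))"
proof -
  have [measurable]: "f \<in> borel_measurable borel" using assms by auto
  have "(\<integral>\<^sup>+y. ennreal (norm (f (x - y))) \<partial>lborel) = (\<integral>\<^sup>+y. ennreal (norm (f y)) \<partial>lborel)"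
    by (rule nn_integral_reflect[of "\<lambda>y. ennreal (norm (f y))"]) measurable
  then show ?thesis using assms by (simp add: integrable_iff_bounded)
qed

lemma pv_integrand_eq_riesz:
  "(c / norm h powr (real CARD('n) + s)) *\<^sub>R (h /\<^sub>R norm h) = c *\<^sub>R riesz s (h :: real^'n)"
proof (cases "h = 0")
  case False
  have "norm h powr (- (real CARD('n) + s + 1)) = inverse (norm h powr ((real CARD('n) + s) + 1))"
    by (rule powr_minus)
  also have "norm h powr ((real CARD('n) + s) + 1) = norm h powr (real CARD('n) + s) * norm h"
    using False by (simp add: powr_add)
  finally show ?thesis by (simp add: riesz_def divide_inverse mult.assoc)
qed (simp add: riesz_def)

text \<open>Equality almost everywhere handles the integration variable, but \<open>u x\<close> at
  the centre enters the whole integral; hence u and v must also agree at x, which costs one more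
  null set in the end.\<close>

lemma truncated_pv_integral:
  fixes u v :: "real^'n \<Rightarrow> real"
  assumes u: "u \<in> borel_measurable lebesgue" and v[measurable]: "v \<in> borel_measurable borel"
    and uv: "AE x in lborel. u x = v x" "u x = v x" and fin: "sq_int v < \<infinity>" and s: "0 < s" "0 < r"
  shows "set_integrable lebesgue (- ball x r) (\<lambda>y. ((u x - u y) / norm (x - y) powr (real CARD('n) + s)) *\<^sub>R ((x - y) /\<^sub>R norm (x - y)))"
    and "(LINT y:- ball x r|lebesgue. ((u x - u y) / norm (x - y) powr (real CARD('n) + s)) *\<^sub>R ((x - y) /\<^sub>R norm (x - y))) = trunc s r v x"
proof -
  define F where "F h = indicator (- ball 0 r) h *\<^sub>R ((v x - v (x - h)) *\<^sub>R riesz s h)" for h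
  have F: "integrable lborel F" unfolding F_def[abs_def] by (rule trunc_integrable[OF v fin s])
  then have Fm: "F \<in> borel_measurable borel" by auto
  have i: "integrable lborel (\<lambda>y. F (x - y))" by (rule integrable_reflect[OF F])
  have fm: "(\<lambda>y. F (x - y)) \<in> borel_measurable borel" using i by auto
  have [measurable]: "u \<in> borel_measurable lebesgue" by (rule u)
  have [measurable]: "- ball x r \<in> sets lebesgue" by auto
  have [measurable]: "(\<lambda>y. riesz s (x - y)) \<in> borel_measurable lebesgue" by (rule borel_imp_lebesgue_measurable) measurable
  have um: "(\<lambda>y. indicator (- ball x r) y *\<^sub>R ((u x - u y) *\<^sub>R riesz s (x - y))) \<in> borel_measurable lebesgue"
    by measurable
  have "AE y in lborel. indicator (- ball x r) y *\<^sub>R ((u x - u y) *\<^sub>R riesz s (x - y)) = F (x - y)"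
    using uv(1)
  proof eventually_elim
    fix y assume "u y = v y"
    moreover have "indicator (- ball x r) y = (indicator (- ball 0 r) (x - y) :: real)"
      by (simp add: indicator_def dist_norm norm_minus_commute)
    ultimately show "indicator (- ball x r) y *\<^sub>R ((u x - u y) *\<^sub>R riesz s (x - y)) = F (x - y)"
      using uv(2) by (simp add: F_def)
  qed
  then have ae: "AE y in lebesgue. indicator (- ball x r) y *\<^sub>R ((u x - u y) *\<^sub>R riesz s (x - y)) = F (x - y)"
    by (rule AE_completion)
  show "set_integrable lebesgue (- ball x r) (\<lambda>y. ((u x - u y) / norm (x - y) powr (real CARD('n) + s)) *\<^sub>R ((x - y) /\<^sub>R norm (x - y)))"
    unfolding pv_integrand_eq_riesz set_integrable_def
    using integrable_cong_AE[OF um borel_imp_lebesgue_measurable[OF fm] ae] i fm by (simp add: integrable_completion)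
  have "(LINT y:- ball x r|lebesgue. (u x - u y) *\<^sub>R riesz s (x - y)) = (LINT y|lebesgue. F (x - y))"
    unfolding set_lebesgue_integral_def by (rule integral_cong_AE[OF um borel_imp_lebesgue_measurable[OF fm] ae])
  also have "\<dots> = (LINT y|lborel. F (x - y))" using fm by (intro integral_completion) simp
  also have "\<dots> = (LINT y|lborel. F y)" by (rule integral_shift(3)[OF Fm])
  also have "\<dots> = trunc s r v x" by (simp add: F_def trunc_def)
  finally show "(LINT y:- ball x r|lebesgue. ((u x - u y) / norm (x - y) powr (real CARD('n) + s)) *\<^sub>R ((x - y) /\<^sub>R norm (x - y))) = trunc s r v x"
    unfolding pv_integrand_eq_riesz .
qed

text \<open>Both operators are produced from one \<open>V\<close>: the same approximating sequence
  witnesses every directional derivative, and the normalising factor appears only on the directional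
  side.\<close>

theorem fractional_gradients_scalar:
  fixes u :: "real^'n \<Rightarrow> real"
  assumes s: "0 < s" "s < 1" and u: "u \<in> Sobolev s"
  obtains D :: "real^'n \<Rightarrow> real^'n \<Rightarrow> real" and V :: "real^'n \<Rightarrow> real^'n"
  where "(\<lambda>(\<theta>, x). D \<theta> x) \<in> borel_measurable (surface_measure \<Otimes>\<^sub>M lebesgue)"
    and "\<And>\<theta>. \<theta> \<in> sphere 0 1 \<Longrightarrow> is_dir_deriv s \<theta> u (D \<theta>)"
    and "AE x in lebesgue. has_bochner_integral surface_measure (\<lambda>\<theta>. D \<theta> x *\<^sub>R \<theta>) ((s / Gamma (1 - s)) *\<^sub>R V x)"
    and "is_grad s u V"
proof -
  have um: "u \<in> borel_measurable lebesgue" and ufin: "Sobolev_norm_sq s u < \<infinity>" using u by (auto simp: Sobolev_def)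
  obtain v where v[measurable]: "v \<in> borel_measurable borel" and uv: "AE x in lborel. u x = v x"
    using borel_representative[OF um] by blast
  have vfin: "sob s v < \<infinity>"
    using ufin Sobolev_norm_sq_cong[OF uv, of s] Sobolev_norm_sq_eq_sob[OF v] by simp
  have "\<exists>\<phi>. \<phi> \<in> test_functions \<and> sob s (\<lambda>x. \<phi> x - v x) \<le> ennreal ((1 / 16) ^ k)" for k
    using test_functions_dense[OF v vfin s, of "(1 / 16) ^ k"] by auto
  then obtain \<phi> where test: "\<And>k. \<phi> k \<in> test_functions" and close: "\<And>k. sob s (\<lambda>x. \<phi> k x - v x) \<le> ennreal ((1 / 16) ^ k)"
    by metis
  interpret sobolev_approximation s "dir_const s TYPE('n)" v \<phi>
    by unfold_locales (use s v vfin test close in auto)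
  define G where "G = s / Gamma (1 - s)"
  show thesis
  proof (rule that[of "\<lambda>\<theta> x. G * dir_deriv \<theta> x" V])
    have "(\<lambda>\<theta>. \<theta>) \<in> surface_measure \<rightarrow>\<^sub>M (borel :: (real^'n) measure)" by (rule measurable_surface_measure) simp
    then have 1: "fst \<in> surface_measure \<Otimes>\<^sub>M lebesgue \<rightarrow>\<^sub>M (borel :: (real^'n) measure)"
      using measurable_compose[OF measurable_fst] by auto
    have "(\<lambda>x. x) \<in> lebesgue \<rightarrow>\<^sub>M (borel :: (real^'n) measure)" by (rule measurable_completion) simp
    then have 2: "snd \<in> surface_measure \<Otimes>\<^sub>M lebesgue \<rightarrow>\<^sub>M (borel :: (real^'n) measure)"
      using measurable_compose[OF measurable_snd] by auto
    have "(\<lambda>p. (fst p, snd p)) \<in> surface_measure \<Otimes>\<^sub>M lebesgue \<rightarrow>\<^sub>M (borel :: (real^'n) measure) \<Otimes>\<^sub>M (borel :: (real^'n) measure)"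
      using 1 2 by (rule measurable_Pair)
    from measurable_compose[OF this measurable_D0]
    show "(\<lambda>(\<theta>, x). G * dir_deriv \<theta> x) \<in> borel_measurable (surface_measure \<Otimes>\<^sub>M lebesgue)"
      by (simp add: case_prod_beta)
  next
    fix \<theta> :: "real^'n" assume "\<theta> \<in> sphere 0 1"
    then have \<theta>: "norm \<theta> = 1" by simp
    have m: "(\<lambda>x. G * dir_deriv \<theta> x) \<in> borel_measurable lebesgue" by (rule borel_imp_lebesgue_measurable) measurable
    have "L2_norm_sq (\<lambda>x. G * dir_deriv \<theta> x) < \<infinity>"
      using dir_deriv_finite[OF \<theta>] by (simp add: L2_norm_sq_cmult ennreal_mult_less_top)
    moreover have "(\<lambda>k. Sobolev_norm_sq s (\<lambda>x. \<phi> k x - u x)) \<longlonglongrightarrow> 0"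
    proof -
      have le: "Sobolev_norm_sq s (\<lambda>x. \<phi> k x - u x) \<le> ennreal ((1 / 16) ^ k)" for k
      proof -
        have "Sobolev_norm_sq s (\<lambda>x. \<phi> k x - u x) = Sobolev_norm_sq s (\<lambda>x. \<phi> k x - v x)"
          using uv by (intro Sobolev_norm_sq_cong) (auto elim!: eventually_mono)
        also have "\<dots> = sob s (\<lambda>x. \<phi> k x - v x)" by (rule Sobolev_norm_sq_eq_sob) measurable
        finally show ?thesis using close[of k] by simp
      qed
      have "(\<lambda>k. ennreal ((1 / 16) ^ k)) \<longlonglongrightarrow> ennreal 0" by (intro tendsto_ennrealI LIMSEQ_realpow_zero) auto
      then have L: "(\<lambda>k. ennreal ((1 / 16) ^ k)) \<longlonglongrightarrow> 0" by simp
      show ?thesis by (rule tendsto_sandwich[OF _ _ tendsto_const L]) (simp, rule always_eventually, rule allI, rule le)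
    qed
    moreover have "(\<lambda>k. L2_norm_sq (\<lambda>x. RL_dir_deriv s \<theta> (\<phi> k) x - G * dir_deriv \<theta> x)) \<longlonglongrightarrow> 0"
    proof -
      let ?b = "\<lambda>k. ennreal (G\<^sup>2) * ennreal (4 * dir_const s TYPE('n) * (1 / 16) ^ k)"
      have le: "L2_norm_sq (\<lambda>x. RL_dir_deriv s \<theta> (\<phi> k) x - G * dir_deriv \<theta> x) \<le> ?b k" for k
      proof -
        have "L2_norm_sq (\<lambda>x. RL_dir_deriv s \<theta> (\<phi> k) x - G * dir_deriv \<theta> x) = L2_norm_sq (\<lambda>x. G * (marchaud s \<theta> (\<phi> k) x - dir_deriv \<theta> x))"
          unfolding RL_dir_deriv_test_function[OF test s \<theta>] G_def by (simp only: right_diff_distrib)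
        also have "\<dots> = ennreal (G\<^sup>2) * sq_int (\<lambda>x. marchaud s \<theta> (\<phi> k) x - dir_deriv \<theta> x)" by (rule L2_norm_sq_cmult) measurable
        also have "\<dots> \<le> ?b k" by (intro mult_left_mono dir_deriv_close \<theta>) simp
        finally show ?thesis .
      qed
      have "?b \<longlonglongrightarrow> ennreal (G\<^sup>2) * ennreal 0"
        by (intro ennreal_tendsto_cmult tendsto_ennrealI tendsto_mult_right_zero LIMSEQ_realpow_zero) auto
      then have L: "?b \<longlonglongrightarrow> 0" by simp
      show ?thesis by (rule tendsto_sandwich[OF _ _ tendsto_const L]) (simp, rule always_eventually, rule allI, rule le)
    qed
    ultimately show "is_dir_deriv s \<theta> u (\<lambda>x. G * dir_deriv \<theta> x)"
      unfolding is_dir_deriv_def L2_functions_def using m test by blast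
  next
    have "AE x in lborel. has_bochner_integral surface_measure (\<lambda>\<theta>. (G * dir_deriv \<theta> x) *\<^sub>R \<theta>) ((s / Gamma (1 - s)) *\<^sub>R V x)"
      using dir_deriv_sphere_integrable
    proof eventually_elim
      fix x assume "integrable surface_measure (\<lambda>\<theta>. dir_deriv \<theta> x *\<^sub>R \<theta>)"
      then have "has_bochner_integral surface_measure (\<lambda>\<theta>. dir_deriv \<theta> x *\<^sub>R \<theta>) (V x)"
        unfolding V_def by (rule has_bochner_integral_integrable)
      then have "has_bochner_integral surface_measure (\<lambda>\<theta>. G *\<^sub>R (dir_deriv \<theta> x *\<^sub>R \<theta>)) (G *\<^sub>R V x)"
        by (intro has_bochner_integral_scaleR_right)
      then show "has_bochner_integral surface_measure (\<lambda>\<theta>. (G * dir_deriv \<theta> x) *\<^sub>R \<theta>) ((s / Gamma (1 - s)) *\<^sub>R V x)"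
        by (simp add: G_def)
    qed
    then show "AE x in lebesgue. has_bochner_integral surface_measure (\<lambda>\<theta>. (G * dir_deriv \<theta> x) *\<^sub>R \<theta>) ((s / Gamma (1 - s)) *\<^sub>R V x)"
      by (rule AE_completion)
  next
    have "AE x in lborel. has_pv_integral (\<lambda>y. ((u x - u y) / norm (x - y) powr (real CARD('n) + s)) *\<^sub>R ((x - y) /\<^sub>R norm (x - y))) x (V x)"
      using uv trunc_tendsto_AE
    proof eventually_elim
      fix x assume x: "u x = v x" and lim: "((\<lambda>r. trunc s r v x) \<longlongrightarrow> V x) (at_right 0)"
      note pv = truncated_pv_integral[OF um v uv x u_sq_fin s(1)]
      have "eventually (\<lambda>r. trunc s r v x = (LINT y:- ball x r|lebesgue. ((u x - u y) / norm (x - y) powr (real CARD('n) + s)) *\<^sub>R ((x - y) /\<^sub>R norm (x - y)))) (at_right 0)"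
        using eventually_at_right_less[of 0] by eventually_elim (simp only: pv(2))
      from Lim_transform_eventually[OF lim this]
      show "has_pv_integral (\<lambda>y. ((u x - u y) / norm (x - y) powr (real CARD('n) + s)) *\<^sub>R ((x - y) /\<^sub>R norm (x - y))) x (V x)"
        unfolding has_pv_integral_def using pv(1) by blast
    qed
    then show "is_grad s u V" unfolding is_grad_def by (rule AE_completion)
  qed
qed

section \<open>Uniqueness and the passage to vector fields\<close>

lemma measurable_vec_lambda:
  fixes f :: "'n::finite \<Rightarrow> 'a \<Rightarrow> real"
  assumes "\<And>i. f i \<in> borel_measurable M"
  shows "(\<lambda>x. \<chi> i. f i x) \<in> borel_measurable M"
  by (subst borel_measurable_euclidean_space) (auto simp: Basis_vec_def inner_axis assms)

text \<open>Wanted for \<open>lebesgue\<close>, the completion of \<open>lborel\<close>, as a factor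
  of the product with the surface measure.\<close>

lemma sigma_finite_completion:
  assumes "sigma_finite_measure M"
  shows "sigma_finite_measure (completion M)"
proof -
  interpret sigma_finite_measure M by fact
  obtain A where A: "countable A" "A \<subseteq> sets M" "\<Union>A = space M" "\<forall>a\<in>A. emeasure M a \<noteq> \<infinity>"
    using sigma_finite_countable by blast
  show ?thesis
    by (rule sigma_finite_measure.intro, rule exI[of _ A]) (use A in \<open>auto simp: emeasure_completion main_part_sets subset_eq\<close>)
qed

lemma has_pv_integral_unique: "has_pv_integral f x I \<Longrightarrow> has_pv_integral f x J \<Longrightarrow> I = J"
  unfolding has_pv_integral_def using tendsto_unique[OF trivial_limit_at_right_real] by blast

text \<open>Two choices of representatives agree for each direction off a null set of points that
  varies with the direction. The set of agreement is measurable in the product, so Fubini gives, for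
  almost every x, agreement in almost every direction, which is all that the spherical integral
  sees.\<close>

lemma AE_sphere_eq:
  fixes f g :: "real^'n \<Rightarrow> real^'n \<Rightarrow> real"
  assumes [measurable]: "(\<lambda>(\<theta>, x). f \<theta> x) \<in> borel_measurable (surface_measure \<Otimes>\<^sub>M lebesgue)"
    "(\<lambda>(\<theta>, x). g \<theta> x) \<in> borel_measurable (surface_measure \<Otimes>\<^sub>M lebesgue)"
    and eq: "\<And>\<theta>. \<theta> \<in> sphere 0 1 \<Longrightarrow> AE x in lebesgue. f \<theta> x = g \<theta> x"
  shows "AE x in lebesgue. AE \<theta> in surface_measure. f \<theta> x = g \<theta> x"
proof -
  interpret lebesgue: sigma_finite_measure "lebesgue :: (real^'n) measure" by (intro sigma_finite_completion sigma_finite_lborel)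
  interpret pair_sigma_finite "surface_measure :: (real^'n) measure" "lebesgue :: (real^'n) measure" ..
  have "{p \<in> space (surface_measure \<Otimes>\<^sub>M lebesgue). (\<lambda>(\<theta>, x). f \<theta> x) p = (\<lambda>(\<theta>, x). g \<theta> x) p} \<in> sets (surface_measure \<Otimes>\<^sub>M lebesgue)"
    by (rule borel_measurable_eq) measurable
  then have m: "{p \<in> space (surface_measure \<Otimes>\<^sub>M lebesgue). f (fst p) (snd p) = g (fst p) (snd p)} \<in> sets (surface_measure \<Otimes>\<^sub>M lebesgue)"
    by (simp add: case_prod_beta)
  show ?thesis by (rule iffD1[OF AE_commute[OF m]], rule AE_I2) (use eq in simp)
qed

text \<open>All components are truncated at the same radius, so a finite sum passes through the
  integral and through the limit.\<close>

lemma has_pv_integral_trace: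
  fixes f :: "'n \<Rightarrow> real^'n \<Rightarrow> real^'n"
  assumes "\<And>i. has_pv_integral (f i) x (I i)"
  shows "has_pv_integral (\<lambda>y. \<Sum>i\<in>UNIV. f i y $ i) x (\<Sum>i\<in>UNIV. I i $ i)"
  unfolding has_pv_integral_def
proof (intro conjI allI impI)
  have int: "integrable lebesgue (\<lambda>y. indicator (- ball x e) y *\<^sub>R f i y)" if "0 < e" for e i
    using assms[of i] that by (auto simp: has_pv_integral_def set_integrable_def)
  have int': "integrable lebesgue (\<lambda>y. (indicator (- ball x e) y *\<^sub>R f i y) $ i)" if "0 < e" for e i
    using int[OF that] by (rule integrable_bounded_linear[OF bounded_linear_vec_nth])
  have eq: "indicator (- ball x e) y *\<^sub>R (\<Sum>i\<in>UNIV. f i y $ i) = (\<Sum>i\<in>UNIV. (indicator (- ball x e) y *\<^sub>R f i y) $ i)" for e y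
    by (simp add: sum_distrib_left)
  show "set_integrable lebesgue (- ball x e) (\<lambda>y. \<Sum>i\<in>UNIV. f i y $ i)" if "0 < e" for e
    unfolding set_integrable_def eq by (intro Bochner_Integration.integrable_sum int' that)
  have LINT: "(LINT y:- ball x e|lebesgue. \<Sum>i\<in>UNIV. f i y $ i) = (\<Sum>i\<in>UNIV. (LINT y:- ball x e|lebesgue. f i y) $ i)" if "0 < e" for e
  proof -
    have "(LINT y:- ball x e|lebesgue. \<Sum>i\<in>UNIV. f i y $ i) = (\<Sum>i\<in>UNIV. (LINT y|lebesgue. (indicator (- ball x e) y *\<^sub>R f i y) $ i))"
      unfolding set_lebesgue_integral_def eq by (rule Bochner_Integration.integral_sum) (rule int'[OF that])
    also have "\<dots> = (\<Sum>i\<in>UNIV. (LINT y:- ball x e|lebesgue. f i y) $ i)"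
      unfolding set_lebesgue_integral_def
      by (intro sum.cong refl integral_bounded_linear[OF bounded_linear_vec_nth] int that)
    finally show ?thesis .
  qed
  have "((\<lambda>e. \<Sum>i\<in>UNIV. (LINT y:- ball x e|lebesgue. f i y) $ i) \<longlongrightarrow> (\<Sum>i\<in>UNIV. I i $ i)) (at_right 0)"
    using assms by (intro tendsto_sum tendsto_vec_nth) (auto simp: has_pv_integral_def)
  then show "((\<lambda>e. LINT y:- ball x e|lebesgue. \<Sum>i\<in>UNIV. f i y $ i) \<longlongrightarrow> (\<Sum>i\<in>UNIV. I i $ i)) (at_right 0)"
  proof (rule Lim_transform_eventually)
    show "eventually (\<lambda>e. (\<Sum>i\<in>UNIV. (LINT y:- ball x e|lebesgue. f i y) $ i) = (LINT y:- ball x e|lebesgue. \<Sum>i\<in>UNIV. f i y $ i)) (at_right 0)"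
      using eventually_at_right_less[of "0 :: real"] by eventually_elim (simp only: LINT)
  qed
qed

text \<open>The operators are relations, so the identity is accompanied by existence on both sides;
  it could hold vacuously otherwise.\<close>

theorem theorem3p1:
  fixes s :: real and u :: "real^'n \<Rightarrow> real" and v :: "real^'n \<Rightarrow> real^'n"
  assumes "0 < s" "s < 1"
    and "v \<in> Sobolev_vec s" and "u \<in> Sobolev s"
  shows "((\<exists>G. is_Grad s u G) \<and> (\<exists>g. is_grad s u g) \<and>
          (\<forall>G g. is_Grad s u G \<longrightarrow> is_grad s u g \<longrightarrow>
             (AE x in lebesgue. G x = (s / Gamma (1 - s)) *\<^sub>R g x))) \<and>
         ((\<exists>D. is_Div s v D) \<and> (\<exists>d. is_div s v d) \<and>
          (\<forall>D d. is_Div s v D \<longrightarrow> is_div s v d \<longrightarrow>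
             (AE x in lebesgue. D x = (s / Gamma (1 - s)) * d x)))"
proof (rule conjI)
  note s = assms(1,2)
  obtain D :: "real^'n \<Rightarrow> real^'n \<Rightarrow> real" and V :: "real^'n \<Rightarrow> real^'n"
    where D_meas: "(\<lambda>(\<theta>, x). D \<theta> x) \<in> borel_measurable (surface_measure \<Otimes>\<^sub>M lebesgue)"
      and D_dir: "\<And>\<theta>. \<theta> \<in> sphere 0 1 \<Longrightarrow> is_dir_deriv s \<theta> u (D \<theta>)"
      and D_int: "AE x in lebesgue. has_bochner_integral surface_measure (\<lambda>\<theta>. D \<theta> x *\<^sub>R \<theta>) ((s / Gamma (1 - s)) *\<^sub>R V x)"
      and V: "is_grad s u V"
    by (rule fractional_gradients_scalar[OF s assms(4)], rule that)
  have um: "u \<in> borel_measurable lebesgue" using assms(4) by (simp add: Sobolev_def)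
  have "is_Grad s u (\<lambda>x. (s / Gamma (1 - s)) *\<^sub>R V x)"
    unfolding is_Grad_def using D_meas D_dir D_int by blast
  moreover have "AE x in lebesgue. G x = (s / Gamma (1 - s)) *\<^sub>R g x" if G: "is_Grad s u G" and g: "is_grad s u g" for G g
  proof -
    obtain D' where D'_meas: "(\<lambda>(\<theta>, x). D' \<theta> x) \<in> borel_measurable (surface_measure \<Otimes>\<^sub>M lebesgue)"
      and D'_dir: "\<And>\<theta>. \<theta> \<in> sphere 0 1 \<Longrightarrow> is_dir_deriv s \<theta> u (D' \<theta>)"
      and D'_int: "AE x in lebesgue. has_bochner_integral surface_measure (\<lambda>\<theta>. D' \<theta> x *\<^sub>R \<theta>) (G x)"
      using G unfolding is_Grad_def by blast
    have "AE x in lebesgue. AE \<theta> in surface_measure. D' \<theta> x = D \<theta> x"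
    proof (rule AE_sphere_eq[OF D'_meas D_meas])
      fix \<theta> :: "real^'n" assume \<theta>: "\<theta> \<in> sphere 0 1"
      then have "norm \<theta> = 1" by simp
      from is_dir_deriv_unique[OF s um this D'_dir[OF \<theta>] D_dir[OF \<theta>]]
      show "AE x in lebesgue. D' \<theta> x = D \<theta> x" .
    qed
    then show ?thesis
      using D_int D'_int V[unfolded is_grad_def] g[unfolded is_grad_def]
    proof eventually_elim
      fix x
      assume eq: "AE \<theta> in surface_measure. D' \<theta> x = D \<theta> x"
        and i: "has_bochner_integral surface_measure (\<lambda>\<theta>. D \<theta> x *\<^sub>R \<theta>) ((s / Gamma (1 - s)) *\<^sub>R V x)"
        and i': "has_bochner_integral surface_measure (\<lambda>\<theta>. D' \<theta> x *\<^sub>R \<theta>) (G x)"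
        and p: "has_pv_integral (\<lambda>y. ((u x - u y) / norm (x - y) powr (real CARD('n) + s)) *\<^sub>R ((x - y) /\<^sub>R norm (x - y))) x (V x)"
        and p': "has_pv_integral (\<lambda>y. ((u x - u y) / norm (x - y) powr (real CARD('n) + s)) *\<^sub>R ((x - y) /\<^sub>R norm (x - y))) x (g x)"
      \<comment> \<open>An arbitrary choice of representatives gives the same spherical integral as
        the constructed one; the Cartesian side is unique because limits are.\<close>
      have "(LINT \<theta>|surface_measure. D' \<theta> x *\<^sub>R \<theta>) = (LINT \<theta>|surface_measure. D \<theta> x *\<^sub>R \<theta>)"
        using eq i i' by (intro integral_cong_AE) (auto simp: has_bochner_integral_iff elim!: eventually_mono)
      then have "G x = (s / Gamma (1 - s)) *\<^sub>R V x" using i i' by (simp add: has_bochner_integral_iff)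
      then show "G x = (s / Gamma (1 - s)) *\<^sub>R g x" using has_pv_integral_unique[OF p p'] by simp
    qed
  qed
  ultimately show "(\<exists>G. is_Grad s u G) \<and> (\<exists>g. is_grad s u g) \<and>
    (\<forall>G g. is_Grad s u G \<longrightarrow> is_grad s u g \<longrightarrow> (AE x in lebesgue. G x = (s / Gamma (1 - s)) *\<^sub>R g x))"
    using V by blast
next
  note s = assms(1,2)
  have vi: "(\<lambda>x. v x $ i) \<in> Sobolev s" for i using assms(3) by (simp add: Sobolev_vec_def)
  \<comment> \<open>The four properties are bundled so that one application of choice selects, for
    each component, derivatives and gradient belonging together.\<close>
  define Q where "Q i D V \<longleftrightarrow> (\<lambda>(\<theta>, x). D \<theta> x) \<in> borel_measurable (surface_measure \<Otimes>\<^sub>M lebesgue)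
      \<and> (\<forall>\<theta>\<in>sphere 0 1. is_dir_deriv s \<theta> (\<lambda>x. v x $ i) (D \<theta>))
      \<and> (AE x in lebesgue. has_bochner_integral surface_measure (\<lambda>\<theta>. D \<theta> x *\<^sub>R \<theta>) ((s / Gamma (1 - s)) *\<^sub>R V x))
      \<and> is_grad s (\<lambda>x. v x $ i) V" for i and D :: "real^'n \<Rightarrow> real^'n \<Rightarrow> real" and V :: "real^'n \<Rightarrow> real^'n"
  have "\<forall>i. \<exists>F. Q i (fst F) (snd F)"
  proof
    fix i
    obtain D :: "real^'n \<Rightarrow> real^'n \<Rightarrow> real" and V :: "real^'n \<Rightarrow> real^'n"
      where "(\<lambda>(\<theta>, x). D \<theta> x) \<in> borel_measurable (surface_measure \<Otimes>\<^sub>M lebesgue)"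
        and "\<And>\<theta>. \<theta> \<in> sphere 0 1 \<Longrightarrow> is_dir_deriv s \<theta> (\<lambda>x. v x $ i) (D \<theta>)"
        and "AE x in lebesgue. has_bochner_integral surface_measure (\<lambda>\<theta>. D \<theta> x *\<^sub>R \<theta>) ((s / Gamma (1 - s)) *\<^sub>R V x)"
        and "is_grad s (\<lambda>x. v x $ i) V"
      by (rule fractional_gradients_scalar[OF s vi[of i]], rule that)
    then have "Q i (fst (D, V)) (snd (D, V))" unfolding Q_def fst_conv snd_conv by (intro conjI ballI)
    then show "\<exists>F. Q i (fst F) (snd F)" by (rule exI)
  qed
  from choice[OF this] obtain F where F: "\<And>i. Q i (fst (F i)) (snd (F i))" by auto
  define D where "D i = fst (F i)" for i
  define V where "V i = snd (F i)" for i
  have Q: "Q i (D i) (V i)" for i unfolding D_def V_def by (rule F)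
  have D_meas: "\<And>i. (\<lambda>(\<theta>, x). D i \<theta> x) \<in> borel_measurable (surface_measure \<Otimes>\<^sub>M lebesgue)"
    and D_dir: "\<And>i \<theta>. \<theta> \<in> sphere 0 1 \<Longrightarrow> is_dir_deriv s \<theta> (\<lambda>x. v x $ i) (D i \<theta>)"
    and D_int: "\<And>i. AE x in lebesgue. has_bochner_integral surface_measure (\<lambda>\<theta>. D i \<theta> x *\<^sub>R \<theta>) ((s / Gamma (1 - s)) *\<^sub>R V i x)"
    and V: "\<And>i. is_grad s (\<lambda>x. v x $ i) (V i)"
    using Q unfolding Q_def by simp_all
  define W where "W x = (\<Sum>i\<in>UNIV. V i x $ i)" for x
  have D_int': "AE x in lebesgue. has_bochner_integral surface_measure (\<lambda>\<theta>. \<theta> \<bullet> (\<chi> i. D i \<theta> x)) ((s / Gamma (1 - s)) * W x)"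
  proof -
    have "AE x in lebesgue. \<forall>i\<in>UNIV. has_bochner_integral surface_measure (\<lambda>\<theta>. D i \<theta> x *\<^sub>R \<theta>) ((s / Gamma (1 - s)) *\<^sub>R V i x)"
      by (intro AE_finite_allI D_int) auto
    then show ?thesis
    proof eventually_elim
      fix x assume h: "\<forall>i\<in>UNIV. has_bochner_integral surface_measure (\<lambda>\<theta>. D i \<theta> x *\<^sub>R \<theta>) ((s / Gamma (1 - s)) *\<^sub>R V i x)"
      have "has_bochner_integral surface_measure (\<lambda>\<theta>. (D i \<theta> x *\<^sub>R \<theta>) $ i) (((s / Gamma (1 - s)) *\<^sub>R V i x) $ i)" for i
        using h by (intro has_bochner_integral_bounded_linear[OF bounded_linear_vec_nth]) auto
      then have "has_bochner_integral surface_measure (\<lambda>\<theta>. \<Sum>i\<in>UNIV. (D i \<theta> x *\<^sub>R \<theta>) $ i) (\<Sum>i\<in>UNIV. ((s / Gamma (1 - s)) *\<^sub>R V i x) $ i)"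
        by (intro has_bochner_integral_sum)
      then show "has_bochner_integral surface_measure (\<lambda>\<theta>. \<theta> \<bullet> (\<chi> i. D i \<theta> x)) ((s / Gamma (1 - s)) * W x)"
        by (simp add: inner_vec_def W_def sum_distrib_left mult.commute)
    qed
  qed
  have "(\<lambda>p. \<chi> i. (\<lambda>(\<theta>, x). D i \<theta> x) p) \<in> borel_measurable (surface_measure \<Otimes>\<^sub>M lebesgue)"
    by (rule measurable_vec_lambda) (rule D_meas)
  then have vec_meas: "(\<lambda>(\<theta>, x). \<chi> i. D i \<theta> x) \<in> borel_measurable (surface_measure \<Otimes>\<^sub>M lebesgue)"
    by (simp add: case_prod_beta)
  \<comment> \<open>The representatives of the components are stacked into a vector; its inner
    product with \<theta> is the trace of the integrands of the component gradients.\<close>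
  have "is_Div s v (\<lambda>x. (s / Gamma (1 - s)) * W x)"
    unfolding is_Div_def using vec_meas D_dir D_int' by (intro exI[of _ "\<lambda>\<theta> x. \<chi> i. D i \<theta> x"]) auto
  moreover have W: "is_div s v W"
  proof -
    have "AE x in lebesgue. \<forall>i\<in>UNIV. has_pv_integral (\<lambda>y. ((v x $ i - v y $ i) / norm (x - y) powr (real CARD('n) + s)) *\<^sub>R ((x - y) /\<^sub>R norm (x - y))) x (V i x)"
      using V unfolding is_grad_def by (intro AE_finite_allI) auto
    then show ?thesis unfolding is_div_def
    proof eventually_elim
      fix x
      let ?f = "\<lambda>i y. ((v x $ i - v y $ i) / norm (x - y) powr (real CARD('n) + s)) *\<^sub>R ((x - y) /\<^sub>R norm (x - y))"
      assume "\<forall>i\<in>UNIV. has_pv_integral (?f i) x (V i x)"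
      then have h: "has_pv_integral (?f i) x (V i x)" for i by blast
      have eq: "((v x - v y) \<bullet> ((x - y) /\<^sub>R norm (x - y))) / norm (x - y) powr (real CARD('n) + s) = (\<Sum>i\<in>UNIV. ?f i y $ i)" for y
        by (simp add: inner_vec_def sum_divide_distrib mult.assoc)
      show "has_pv_integral (\<lambda>y. ((v x - v y) \<bullet> ((x - y) /\<^sub>R norm (x - y))) / norm (x - y) powr (real CARD('n) + s)) x (W x)"
        unfolding eq W_def by (rule has_pv_integral_trace) (rule h)
    qed
  qed
  moreover have "AE x in lebesgue. E x = (s / Gamma (1 - s)) * d x" if E: "is_Div s v E" and d: "is_div s v d" for E d
  proof -
    obtain D' :: "real^'n \<Rightarrow> real^'n \<Rightarrow> real^'n" where D'_meas: "(\<lambda>(\<theta>, x). D' \<theta> x) \<in> borel_measurable (surface_measure \<Otimes>\<^sub>M lebesgue)"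
      and D'_dir: "\<And>\<theta> i. \<theta> \<in> sphere 0 1 \<Longrightarrow> is_dir_deriv s \<theta> (\<lambda>x. v x $ i) (\<lambda>x. D' \<theta> x $ i)"
      and D'_int: "AE x in lebesgue. has_bochner_integral surface_measure (\<lambda>\<theta>. \<theta> \<bullet> D' \<theta> x) (E x)"
      using E unfolding is_Div_def by blast
    have D'i_meas: "(\<lambda>(\<theta>, x). D' \<theta> x $ i) \<in> borel_measurable (surface_measure \<Otimes>\<^sub>M lebesgue)" for i
    proof -
      have "(\<lambda>w :: real^'n. w $ i) \<in> borel_measurable borel"
        by (intro borel_measurable_continuous_onI continuous_intros)
      from measurable_compose[OF D'_meas this] show ?thesis by (simp add: case_prod_beta)
    qed
    have "AE x in lebesgue. \<forall>i\<in>UNIV. AE \<theta> in surface_measure. D' \<theta> x $ i = D i \<theta> x"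
    proof (intro AE_finite_allI)
      fix i
      have "(\<lambda>x. v x $ i) \<in> borel_measurable lebesgue" using vi[of i] by (simp add: Sobolev_def)
      note vim = this
      show "AE x in lebesgue. AE \<theta> in surface_measure. D' \<theta> x $ i = D i \<theta> x"
      proof (rule AE_sphere_eq[OF D'i_meas D_meas])
        fix \<theta> :: "real^'n" assume \<theta>: "\<theta> \<in> sphere 0 1"
        then have "norm \<theta> = 1" by simp
        from is_dir_deriv_unique[OF s vim this D'_dir[OF \<theta>] D_dir[OF \<theta>]]
        show "AE x in lebesgue. D' \<theta> x $ i = D i \<theta> x" .
      qed
    qed auto
    then show ?thesis
      using D_int' D'_int W[unfolded is_div_def] d[unfolded is_div_def]
    proof eventually_elim
      fix x
      assume "\<forall>i\<in>UNIV. AE \<theta> in surface_measure. D' \<theta> x $ i = D i \<theta> x"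
        and i: "has_bochner_integral surface_measure (\<lambda>\<theta>. \<theta> \<bullet> (\<chi> i. D i \<theta> x)) ((s / Gamma (1 - s)) * W x)"
        and i': "has_bochner_integral surface_measure (\<lambda>\<theta>. \<theta> \<bullet> D' \<theta> x) (E x)"
        and p: "has_pv_integral (\<lambda>y. ((v x - v y) \<bullet> ((x - y) /\<^sub>R norm (x - y))) / norm (x - y) powr (real CARD('n) + s)) x (W x)"
        and p': "has_pv_integral (\<lambda>y. ((v x - v y) \<bullet> ((x - y) /\<^sub>R norm (x - y))) / norm (x - y) powr (real CARD('n) + s)) x (d x)"
      \<comment> \<open>There are finitely many components, so their exceptional sets of directions
        unite to a null set.\<close>
      then have "AE \<theta> in surface_measure. \<forall>i\<in>UNIV. D' \<theta> x $ i = D i \<theta> x" by (intro AE_finite_allI) auto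
      then have "AE \<theta> in surface_measure. \<theta> \<bullet> D' \<theta> x = \<theta> \<bullet> (\<chi> i. D i \<theta> x)"
        by eventually_elim (simp add: inner_vec_def)
      then have "(LINT \<theta>|surface_measure. \<theta> \<bullet> D' \<theta> x) = (LINT \<theta>|surface_measure. \<theta> \<bullet> (\<chi> i. D i \<theta> x))"
        using i i' by (intro integral_cong_AE) (auto simp: has_bochner_integral_iff)
      then have "E x = (s / Gamma (1 - s)) * W x" using i i' by (simp add: has_bochner_integral_iff)
      then show "E x = (s / Gamma (1 - s)) * d x" using has_pv_integral_unique[OF p p'] by simp
    qed
  qed
  ultimately show "(\<exists>D. is_Div s v D) \<and> (\<exists>d. is_div s v d) \<and>
    (\<forall>D d. is_Div s v D \<longrightarrow> is_div s v d \<longrightarrow> (AE x in lebesgue. D x = (s / Gamma (1 - s)) * d x))"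
    by blast
qed

end
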